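(* Let $L$ and $\{a,b,c,d\}$ be disjoint subsets of $[n]$, with $a,b,c,d$ distinct and cyclically ordered. (1) $\dim\operatorname{ext}^1(M_{Lac},M_{Lbd})=1$. (2) There are short exact sequences $$0\to M_{Lac}\to M_{Lad}\oplus M_{Lbc}\to M_{Lbd}\to0,\qquad 0\to M_{Lbd}\to M_{Lab}\oplus M_{Lcd}\to M_{Lac}\to0.$$ (3) Let $\mathsf J\subseteq[n-1]$ be an interval. For any cluster tilting object $T_{\mathcal S}$ in $\mathcal F_\Delta(\mathsf J)$ that has $M_{Lab},M_{Lbc},M_{Lcd},M_{Lad}$ and one of $M_{Lac},M_{Lbd}$ as summands, the sequences in (2) are the mutation sequences for the pair $M_{Lac}$ and $M_{Lbd}$.
   Context: Fix an integer $n>1$; $[m]=\{1,\dots,m\}$. $Lxy=L\cup\{x,y\}$. All modules are finite dimensional left modules. $D$ is the Auslander algebra of $\mathbb C[t]/(t^n)$: the path algebra over $\mathbb C$ of the quiver with vertices $0,\dots,n-1$ and arrows $b_i\colon i-1\to i$, $a_i\colon i\to i-1$ ($1\le i\le n-1$), with relations $b_{n-1}a_{n-1}=0$ (first $a_{n-1}$, then $b_{n-1}$) and $a_ib_i=b_{i-1}a_{i-1}$ for $2\le i\le n-1$. $e_i$ is the trivial path at $i$, $D_i=De_i$. The standard module $\Delta_i$ ($1\le i\le n$) is one-dimensional at vertices $0,\dots,i-1$ and zero elsewhere, with $a_1,\dots,a_{i-1}$ acting as isomorphisms and all $b_j$ as zero. $\mathcal F_\Delta\subseteq\operatorname{mod}D$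 is the full subcategory of modules with a filtration by standard modules; the $\Delta$-support of such a module is the set of $i$ with $\Delta_i$ occurring in the filtration. For $I\subseteq[n]$, $M_I$ is the unique submodule of $D_0$ with $\Delta$-support $I$. $\mathbb T_i=M_{[i]}$; $\eta M=De_0M$ for $M\in\mathcal F_\Delta$ (the trace of $\bigoplus_{i=1}^n\mathbb T_i$). $\mathcal E$ denotes the exact structure of short exact sequences of good modules (objects of $\mathcal F_\Delta$) that stay exact under $\eta$, and $\operatorname{ext}^1$ the corresponding extension groups. For $\mathsf J\subseteq[n-1]$, $\mathcal F_\Delta(\mathsf J)$ is the full subcategory of $M\in\mathcal F_\Delta$ with $\eta M\in\operatorname{add}\bigoplus_{j\in\mathsf J}\mathbb T_j$, with exact structure $\mathcal E$; it is Frobenius stably 2-Calabi–Yau with a cluster structure. A basic object $T\in\mathcal F_\Delta(\mathsf J)$ is cluster tilting if it is rigid and $\operatorname{ext}^1(T,M)=0$ implies $M\in\operatorname{add}T$. For a non-projective indecomposable summand $T_k$, the mutation sequences for the pair $T_k,T_k^*$ are the sequences $0\to T_k^*\to E_k\xrightarrow{f}T_k\to0$ and $0\to T_k\xrightarrow{g}F_k\to T_k^*\to0$ in $\mathcal E$ with $f,g$ minimal $\operatorname{add}(T\setminus T_k)$-approximations and $T_k^*$ indecomposable. For a maximal weakly separated collection $\mathcal S$ of $\mathsf J$-sets (subsets $I\subseteq[n]$ with $|I|\in\mathsf J$), $T_{\mathcal S}=\bigoplus_{I\in\mathcal S}M_I$. Here $I,J$ are weakly separated if (i) $|I|\ge|J|$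 and $J\setminus I$ is a disjoint union $J'\cup J''$ with $J'<(I\setminus J)<J''$ or (ii) $|J|\ge|I|$ and $I\setminus J$ is a disjoint union $I'\cup I''$ with $I'<(J\setminus I)<I''$, where $A<B$ means $a<b$ for all $a\in A,b\in B$. *)

theory Defs
  imports
    Complex_Main
    "HOL-Library.Function_Algebras"
    "HOL-Library.Product_Plus"
    "Jordan_Normal_Form.VS_Connect"
begin

section \<open>Complex vector spaces\<close>

class complex_vector = ab_group_add +
  fixes scaleC :: "complex \<Rightarrow> 'a \<Rightarrow> 'a"  (infixr "*\<^sub>C" 75)
  assumes scaleC_add_right: "c *\<^sub>C (x + y) = c *\<^sub>C x + c *\<^sub>C y"
    and scaleC_add_left: "(c + d) *\<^sub>C x = c *\<^sub>C x + d *\<^sub>C x"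
    and scaleC_scaleC: "c *\<^sub>C d *\<^sub>C x = (c * d) *\<^sub>C x"
    and scaleC_one: "1 *\<^sub>C x = x"

global_interpretation cvec: vector_space "scaleC :: complex \<Rightarrow> 'a \<Rightarrow> 'a::complex_vector"
  by unfold_locales (rule scaleC_add_right scaleC_add_left scaleC_scaleC scaleC_one)+

instantiation complex :: complex_vector
begin
definition scaleC_complex_def: "c *\<^sub>C (x::complex) = c * x"
instance by standard (simp_all add: scaleC_complex_def algebra_simps)
end

instantiation "fun" :: (type, complex_vector) complex_vector
begin
definition scaleC_fun_def: "c *\<^sub>C f = (\<lambda>x. c *\<^sub>C f x)"
instance
  by standard (simp_all add: scaleC_fun_def fun_eq_iff scaleC_add_right scaleC_add_left
      scaleC_scaleC scaleC_one)
end

instantiation prod :: (complex_vector, complex_vector) complex_vector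
begin
definition scaleC_prod_def: "c *\<^sub>C p = (c *\<^sub>C fst p, c *\<^sub>C snd p)"
instance
  by standard (simp_all add: scaleC_prod_def prod_eq_iff scaleC_add_right scaleC_add_left
      scaleC_scaleC scaleC_one)
end

definition fin_dim_subspace :: "'v::complex_vector set \<Rightarrow> bool" where
  "fin_dim_subspace V \<longleftrightarrow> (\<exists>B. finite B \<and> V = cvec.span B)"

definition linear_between ::
  "'v::complex_vector set \<Rightarrow> 'w::complex_vector set \<Rightarrow> ('v \<Rightarrow> 'w) \<Rightarrow> bool" where
  "linear_between V W f \<longleftrightarrow> (\<forall>x\<in>V. f x \<in> W) \<and> (\<forall>x\<in>V. \<forall>y\<in>V. f (x + y) = f x + f y) \<and>
     (\<forall>c. \<forall>x\<in>V. f (c *\<^sub>C x) = c *\<^sub>C f x)"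


section \<open>Modules over the Auslander algebra\<close>

text \<open>
  A finite-dimensional left module \<open>M\<close> over \<open>D\<close> is given as a representation of the quiver
  satisfying the relations: \<open>vsp M i\<close> is \<open>e\<^sub>i M\<close>, a finite-dimensional subspace of the ambient
  space \<open>'v\<close>, and \<open>bmap M i\<close>, \<open>amap M i\<close> are the actions of the arrows \<open>b\<^sub>i : i-1 \<rightarrow> i\<close> and
  \<open>a\<^sub>i : i \<rightarrow> i-1\<close>.  What these maps do outside the relevant subspaces is irrelevant.
\<close>

record 'v rep =
  vsp :: "nat \<Rightarrow> 'v set"
  bmap :: "nat \<Rightarrow> 'v \<Rightarrow> 'v"
  amap :: "nat \<Rightarrow> 'v \<Rightarrow> 'v"

definition dmod :: "nat \<Rightarrow> 'v::complex_vector rep \<Rightarrow> bool" where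
  "dmod n M \<longleftrightarrow>
     (\<forall>i. fin_dim_subspace (vsp M i)) \<and> (\<forall>i\<ge>n. vsp M i = {0}) \<and>
     (\<forall>i\<in>{1..n-1}. linear_between (vsp M (i-1)) (vsp M i) (bmap M i) \<and>
                    linear_between (vsp M i) (vsp M (i-1)) (amap M i)) \<and>
     (\<forall>x\<in>vsp M (n-1). bmap M (n-1) (amap M (n-1) x) = 0) \<and>
     (\<forall>i\<in>{2..n-1}. \<forall>x\<in>vsp M (i-1). amap M i (bmap M i x) = bmap M (i-1) (amap M (i-1) x))"

text \<open>
  Quantification over all modules is quantification over the modules carried by subspaces of the
  infinite-dimensional space \<open>univ\<close>; every finite-dimensional module is isomorphic to such a one.
\<close>

type_synonym univ = "nat \<Rightarrow> complex"

text \<open>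
  Homomorphisms are normalised to vanish outside the carriers, so that equality of homomorphisms is
  equality of functions and composition is pointwise composition.
\<close>

definition Hom ::
  "nat \<Rightarrow> 'v::complex_vector rep \<Rightarrow> 'w::complex_vector rep \<Rightarrow> (nat \<Rightarrow> 'v \<Rightarrow> 'w) set" where
  "Hom n M N = {f. (\<forall>i. linear_between (vsp M i) (vsp N i) (f i) \<and> (\<forall>x. x \<notin> vsp M i \<longrightarrow> f i x = 0)) \<and>
     (\<forall>i\<in>{1..n-1}. (\<forall>x\<in>vsp M (i-1). f i (bmap M i x) = bmap N i (f (i-1) x)) \<and>
                    (\<forall>x\<in>vsp M i. f (i-1) (amap M i x) = amap N i (f i x)))}"

definition hid :: "'v::complex_vector rep \<Rightarrow> nat \<Rightarrow> 'v \<Rightarrow> 'v" where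
  "hid M = (\<lambda>i x. if x \<in> vsp M i then x else 0)"

definition hcomp :: "(nat \<Rightarrow> 'v \<Rightarrow> 'w) \<Rightarrow> (nat \<Rightarrow> 'u \<Rightarrow> 'v) \<Rightarrow> nat \<Rightarrow> 'u \<Rightarrow> 'w"  (infixl "\<circ>\<^sub>h" 55) where
  "g \<circ>\<^sub>h f = (\<lambda>i. g i \<circ> f i)"

definition is_iso ::
  "nat \<Rightarrow> 'v::complex_vector rep \<Rightarrow> 'w::complex_vector rep \<Rightarrow> (nat \<Rightarrow> 'v \<Rightarrow> 'w) \<Rightarrow> bool" where
  "is_iso n M N f \<longleftrightarrow> f \<in> Hom n M N \<and> (\<exists>g\<in>Hom n N M. g \<circ>\<^sub>h f = hid M \<and> f \<circ>\<^sub>h g = hid N)"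

definition isomorphic :: "nat \<Rightarrow> 'v::complex_vector rep \<Rightarrow> 'w::complex_vector rep \<Rightarrow> bool" where
  "isomorphic n M N \<longleftrightarrow> (\<exists>f. is_iso n M N f)"

definition ses ::
  "nat \<Rightarrow> 'x::complex_vector rep \<Rightarrow> 'y::complex_vector rep \<Rightarrow> 'z::complex_vector rep \<Rightarrow>
   (nat \<Rightarrow> 'x \<Rightarrow> 'y) \<Rightarrow> (nat \<Rightarrow> 'y \<Rightarrow> 'z) \<Rightarrow> bool" where
  "ses n X Y Z f g \<longleftrightarrow> dmod n X \<and> dmod n Y \<and> dmod n Z \<and> f \<in> Hom n X Y \<and> g \<in> Hom n Y Z \<and>
     (\<forall>i. inj_on (f i) (vsp X i) \<and> f i ` vsp X i = {y \<in> vsp Y i. g i y = 0} \<and>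
          g i ` vsp Y i = vsp Z i)"

definition is_zero :: "'v::complex_vector rep \<Rightarrow> bool" where
  "is_zero M \<longleftrightarrow> (\<forall>i. vsp M i = {0})"

definition dsum :: "'v::complex_vector rep \<Rightarrow> 'w::complex_vector rep \<Rightarrow> ('v \<times> 'w) rep" (infixr "\<oplus>\<^sub>r" 65) where
  "M \<oplus>\<^sub>r N = \<lparr>vsp = (\<lambda>i. vsp M i \<times> vsp N i), bmap = (\<lambda>i. map_prod (bmap M i) (bmap N i)),
             amap = (\<lambda>i. map_prod (amap M i) (amap N i))\<rparr>"

definition big_dsum :: "'k set \<Rightarrow> ('k \<Rightarrow> 'v::complex_vector rep) \<Rightarrow> ('k \<Rightarrow> 'v) rep" where
  "big_dsum K M =
     \<lparr>vsp = (\<lambda>i. {f. (\<forall>k\<in>K. f k \<in> vsp (M k) i) \<and> (\<forall>k. k \<notin> K \<longrightarrow> f k = 0)}),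
      bmap = (\<lambda>i f k. if k \<in> K then bmap (M k) i (f k) else 0),
      amap = (\<lambda>i f k. if k \<in> K then amap (M k) i (f k) else 0)\<rparr>"

definition summand :: "nat \<Rightarrow> 'v::complex_vector rep \<Rightarrow> 'w::complex_vector rep \<Rightarrow> bool" where
  "summand n M X \<longleftrightarrow> dmod n M \<and> (\<exists>N :: univ rep. dmod n N \<and> isomorphic n X (M \<oplus>\<^sub>r N))"

definition in_add :: "nat \<Rightarrow> 'w::complex_vector rep \<Rightarrow> 'v::complex_vector rep \<Rightarrow> bool" where
  "in_add n X M \<longleftrightarrow> (\<exists>m. summand n M (big_dsum {..<m::nat} (\<lambda>_. X)))"

definition indecomposable :: "nat \<Rightarrow> 'v::complex_vector rep \<Rightarrow> bool" where
  "indecomposable n M \<longleftrightarrow> dmod n M \<and> \<not> is_zero M \<and>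
     (\<forall>(X :: univ rep) (Y :: univ rep). dmod n X \<and> dmod n Y \<and> isomorphic n M (X \<oplus>\<^sub>r Y) \<longrightarrow> is_zero X \<or> is_zero Y)"

definition basic :: "nat \<Rightarrow> 'v::complex_vector rep \<Rightarrow> bool" where
  "basic n M \<longleftrightarrow> \<not> (\<exists>X :: univ rep. indecomposable n X \<and> summand n (X \<oplus>\<^sub>r X) M)"


section \<open>Submodules, good modules and the modules \<open>M\<^sub>I\<close>\<close>

definition subrep :: "'v rep \<Rightarrow> (nat \<Rightarrow> 'v set) \<Rightarrow> 'v rep" where
  "subrep M U = M\<lparr>vsp := U\<rparr>"

definition submodule :: "nat \<Rightarrow> 'v::complex_vector rep \<Rightarrow> (nat \<Rightarrow> 'v set) \<Rightarrow> bool" where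
  "submodule n M U \<longleftrightarrow> dmod n (subrep M U) \<and> (\<forall>i. U i \<subseteq> vsp M i)"

definition hrestrict :: "(nat \<Rightarrow> 'v set) \<Rightarrow> (nat \<Rightarrow> 'v \<Rightarrow> 'w::zero) \<Rightarrow> nat \<Rightarrow> 'v \<Rightarrow> 'w" where
  "hrestrict U f = (\<lambda>i x. if x \<in> U i then f i x else 0)"

definition Delta :: "nat \<Rightarrow> complex rep" where
  "Delta i = \<lparr>vsp = (\<lambda>j. if j < i then UNIV else {0}), bmap = (\<lambda>_ _. 0), amap = (\<lambda>_ x. x)\<rparr>"

text \<open>
  The factors are \<open>Delta (ls ! 0), Delta (ls ! 1), ...\<close> from bottom to top; the isomorphism of
  \<open>U (k+1) / U k\<close> with a standard module is expressed by a short exact sequence.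
\<close>

definition delta_filtration :: "nat \<Rightarrow> 'v::complex_vector rep \<Rightarrow> nat list \<Rightarrow> bool" where
  "delta_filtration n M ls \<longleftrightarrow> set ls \<subseteq> {1..n} \<and>
     (\<exists>U. (\<forall>k\<le>length ls. submodule n M (U k)) \<and> U 0 = (\<lambda>_. {0}) \<and> U (length ls) = vsp M \<and>
       (\<forall>k<length ls. (\<forall>i. U k i \<subseteq> U (Suc k) i) \<and>
          (\<exists>p. ses n (subrep M (U k)) (subrep M (U (Suc k))) (Delta (ls ! k))
                 (hid (subrep M (U k))) p)))"

definition good :: "nat \<Rightarrow> 'v::complex_vector rep \<Rightarrow> bool" where
  "good n M \<longleftrightarrow> dmod n M \<and> (\<exists>ls. delta_filtration n M ls)"

definition delta_support :: "nat \<Rightarrow> 'v::complex_vector rep \<Rightarrow> nat set" where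
  "delta_support n M = \<Union>{set ls | ls. delta_filtration n M ls}"

text \<open>
  The projective module \<open>D\<^sub>0 = D e\<^sub>0\<close>.  Modulo the relations, every path from \<open>0\<close> to \<open>j\<close> is zero or
  equal to exactly one of the paths \<open>b\<^sub>j \<dots> b\<^sub>1 (a\<^sub>1 b\<^sub>1)\<^sup>k\<close> with \<open>0 \<le> k < n - j\<close>; in \<open>e\<^sub>j D e\<^sub>0\<close> this
  path is the \<open>k\<close>-th unit vector.  The facts \<open>dmod_D0\<close> and \<open>D0_universal\<close> below confirm that this is
  \<open>D e\<^sub>0\<close>: it is a \<open>D\<close>-module, and \<open>f \<mapsto> f(e\<^sub>0)\<close> is a bijection from \<open>Hom(D\<^sub>0, M)\<close> to \<open>e\<^sub>0 M\<close> for
  every \<open>D\<close>-module \<open>M\<close>.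
\<close>

definition D0 :: "nat \<Rightarrow> univ rep" where
  "D0 n = \<lparr>vsp = (\<lambda>j. {f. \<forall>k\<ge>n - j. f k = 0}),
           bmap = (\<lambda>j f k. if k < n - j then f k else 0),
           amap = (\<lambda>j f k. if k = 0 then 0 else f (k - 1))\<rparr>"

definition unit_vec0 :: "nat \<Rightarrow> univ" where
  "unit_vec0 k = (\<lambda>m. if m = k then 1 else 0)"

definition MI :: "nat \<Rightarrow> nat set \<Rightarrow> univ rep" where
  "MI n I = subrep (D0 n) (THE U. submodule n (D0 n) U \<and> good n (subrep (D0 n) U) \<and>
                                  delta_support n (subrep (D0 n) U) = I)"

definition TT :: "nat \<Rightarrow> nat \<Rightarrow> univ rep" where
  "TT n i = MI n {1..i}"


section \<open>The exact structure and its extension groups\<close>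

text \<open>\<open>D e\<^sub>0 M\<close>, the submodule generated by \<open>e\<^sub>0 M\<close>.\<close>

definition eta_sub :: "nat \<Rightarrow> 'v::complex_vector rep \<Rightarrow> nat \<Rightarrow> 'v set" where
  "eta_sub n M = (\<lambda>i. \<Inter>{U i | U. submodule n M U \<and> vsp M 0 \<subseteq> U 0})"

definition eta :: "nat \<Rightarrow> 'v::complex_vector rep \<Rightarrow> 'v rep" where
  "eta n M = subrep M (eta_sub n M)"

definition E_ses ::
  "nat \<Rightarrow> 'x::complex_vector rep \<Rightarrow> 'y::complex_vector rep \<Rightarrow> 'z::complex_vector rep \<Rightarrow>
   (nat \<Rightarrow> 'x \<Rightarrow> 'y) \<Rightarrow> (nat \<Rightarrow> 'y \<Rightarrow> 'z) \<Rightarrow> bool" where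
  "E_ses n X Y Z f g \<longleftrightarrow> good n X \<and> good n Y \<and> good n Z \<and> ses n X Y Z f g \<and>
     ses n (eta n X) (eta n Y) (eta n Z) (hrestrict (eta_sub n X) f) (hrestrict (eta_sub n Y) g)"

text \<open>
  \<open>ext\<^sup>1(Z, X)\<close> is the Yoneda group of equivalence classes of sequences \<open>0 \<rightarrow> X \<rightarrow> Y \<rightarrow> Z \<rightarrow> 0\<close>
  in the exact structure, with Baer sum as addition.  An extension is a triple \<open>(Y, f, g)\<close>.
\<close>

type_synonym ('x, 'z) extn = "univ rep \<times> (nat \<Rightarrow> 'x \<Rightarrow> univ) \<times> (nat \<Rightarrow> univ \<Rightarrow> 'z)"

definition extensions ::
  "nat \<Rightarrow> 'z::complex_vector rep \<Rightarrow> 'x::complex_vector rep \<Rightarrow> ('x, 'z) extn set" where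
  "extensions n Z X = {(Y, f, g). E_ses n X Y Z f g}"

definition ext_equiv ::
  "nat \<Rightarrow> 'z::complex_vector rep \<Rightarrow> 'x::complex_vector rep \<Rightarrow> (('x, 'z) extn \<times> ('x, 'z) extn) set" where
  "ext_equiv n Z X = {((Y, f, g), (Y', f', g')).
     (Y, f, g) \<in> extensions n Z X \<and> (Y', f', g') \<in> extensions n Z X \<and>
     (\<exists>h. is_iso n Y Y' h \<and> h \<circ>\<^sub>h f = f' \<and> g' \<circ>\<^sub>h h = g)}"

text \<open>
  The Baer sum of \<open>(Y1, f1, g1)\<close> and \<open>(Y2, f2, g2)\<close> is the extension \<open>(Y3, f3, g3)\<close> with \<open>Y3\<close> the
  quotient of the fibre product \<open>P = Y1 \<times>\<^sub>Z Y2\<close> by \<open>{(f1 x, - f2 x)}\<close>.  Up to equivalence it is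
  determined by a morphism \<open>h : P \<rightarrow> Y3\<close> that is compatible with addition \<open>X \<oplus> X \<rightarrow> X\<close> and the
  identity of \<open>Z\<close>.
\<close>

definition fibre_product ::
  "'v::complex_vector rep \<Rightarrow> (nat \<Rightarrow> 'v \<Rightarrow> 'z) \<Rightarrow> 'w::complex_vector rep \<Rightarrow> (nat \<Rightarrow> 'w \<Rightarrow> 'z) \<Rightarrow>
   ('v \<times> 'w) rep" where
  "fibre_product Y1 g1 Y2 g2 =
     subrep (Y1 \<oplus>\<^sub>r Y2) (\<lambda>i. {(y1, y2). y1 \<in> vsp Y1 i \<and> y2 \<in> vsp Y2 i \<and> g1 i y1 = g2 i y2})"

definition is_baer_sum ::
  "nat \<Rightarrow> 'x::complex_vector rep \<Rightarrow> ('x, 'z::complex_vector) extn \<Rightarrow> ('x, 'z) extn \<Rightarrow>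
   ('x, 'z) extn \<Rightarrow> bool" where
  "is_baer_sum n X = (\<lambda>(Y1, f1, g1) (Y2, f2, g2) (Y3, f3, g3).
     \<exists>h \<in> Hom n (fibre_product Y1 g1 Y2 g2) Y3.
       (\<forall>i. \<forall>x1\<in>vsp X i. \<forall>x2\<in>vsp X i. h i (f1 i x1, f2 i x2) = f3 i (x1 + x2)) \<and>
       (\<forall>i. \<forall>(y1, y2)\<in>vsp (fibre_product Y1 g1 Y2 g2) i. g3 i (h i (y1, y2)) = g1 i y1))"

text \<open>The scalar multiple is the pushout along multiplication by \<open>c\<close> on \<open>X\<close>.\<close>

definition is_scaled ::
  "nat \<Rightarrow> 'x::complex_vector rep \<Rightarrow> complex \<Rightarrow> ('x, 'z::complex_vector) extn \<Rightarrow> ('x, 'z) extn \<Rightarrow> bool" where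
  "is_scaled n X c = (\<lambda>(Y1, f1, g1) (Y2, f2, g2).
     \<exists>h \<in> Hom n Y1 Y2. (\<forall>i. \<forall>x\<in>vsp X i. h i (f1 i x) = f2 i (c *\<^sub>C x)) \<and> g2 \<circ>\<^sub>h h = g1)"

definition splits :: "nat \<Rightarrow> 'z::complex_vector rep \<Rightarrow> ('x, 'z) extn \<Rightarrow> bool" where
  "splits n Z = (\<lambda>(Y, f, g). \<exists>s \<in> Hom n Z Y. g \<circ>\<^sub>h s = hid Z)"

definition ext1 ::
  "nat \<Rightarrow> 'z::complex_vector rep \<Rightarrow> 'x::complex_vector rep \<Rightarrow> (complex, ('x, 'z) extn set) module" where
  "ext1 n Z X =
     \<lparr>carrier = extensions n Z X // ext_equiv n Z X,
      mult = undefined, one = undefined,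
      zero = {e \<in> extensions n Z X. splits n Z e},
      add = (\<lambda>A B. {e \<in> extensions n Z X. \<exists>e1\<in>A. \<exists>e2\<in>B. is_baer_sum n X e1 e2 e}),
      smult = (\<lambda>c A. {e \<in> extensions n Z X. \<exists>e1\<in>A. is_scaled n X c e1 e})\<rparr>"

definition ext1_vanishes :: "nat \<Rightarrow> 'z::complex_vector rep \<Rightarrow> 'x::complex_vector rep \<Rightarrow> bool" where
  "ext1_vanishes n Z X \<longleftrightarrow> carrier (ext1 n Z X) = {\<zero>\<^bsub>ext1 n Z X\<^esub>}"


section \<open>Cluster tilting objects and mutation sequences\<close>

definition in_FJ :: "nat \<Rightarrow> nat set \<Rightarrow> 'v::complex_vector rep \<Rightarrow> bool" where
  "in_FJ n J M \<longleftrightarrow> good n M \<and> in_add n (big_dsum J (TT n)) (eta n M)"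

definition cluster_tilting :: "nat \<Rightarrow> nat set \<Rightarrow> 'v::complex_vector rep \<Rightarrow> bool" where
  "cluster_tilting n J T \<longleftrightarrow> in_FJ n J T \<and> basic n T \<and> ext1_vanishes n T T \<and>
     (\<forall>M :: univ rep. in_FJ n J M \<and> ext1_vanishes n T M \<longrightarrow> in_add n T M)"

definition projective_in_FJ :: "nat \<Rightarrow> nat set \<Rightarrow> 'v::complex_vector rep \<Rightarrow> bool" where
  "projective_in_FJ n J P \<longleftrightarrow> in_FJ n J P \<and>
     (\<forall>(X :: univ rep) (Y :: univ rep) (Z :: univ rep) f g.
        in_FJ n J X \<and> in_FJ n J Y \<and> in_FJ n J Z \<and> E_ses n X Y Z f g \<longrightarrow>
        (\<forall>h \<in> Hom n P Z. \<exists>h' \<in> Hom n P Y. g \<circ>\<^sub>h h' = h))"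

definition minimal_right_approx ::
  "nat \<Rightarrow> 'r::complex_vector rep \<Rightarrow> 'e::complex_vector rep \<Rightarrow> 'v::complex_vector rep \<Rightarrow>
   (nat \<Rightarrow> 'e \<Rightarrow> 'v) \<Rightarrow> bool" where
  "minimal_right_approx n R E M f \<longleftrightarrow> in_add n R E \<and> f \<in> Hom n E M \<and>
     (\<forall>X :: univ rep. in_add n R X \<longrightarrow> (\<forall>h \<in> Hom n X M. \<exists>h' \<in> Hom n X E. f \<circ>\<^sub>h h' = h)) \<and>
     (\<forall>\<phi> \<in> Hom n E E. f \<circ>\<^sub>h \<phi> = f \<longrightarrow> is_iso n E E \<phi>)"

definition minimal_left_approx ::
  "nat \<Rightarrow> 'r::complex_vector rep \<Rightarrow> 'v::complex_vector rep \<Rightarrow> 'e::complex_vector rep \<Rightarrow>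
   (nat \<Rightarrow> 'v \<Rightarrow> 'e) \<Rightarrow> bool" where
  "minimal_left_approx n R M F g \<longleftrightarrow> in_add n R F \<and> g \<in> Hom n M F \<and>
     (\<forall>X :: univ rep. in_add n R X \<longrightarrow> (\<forall>h \<in> Hom n M X. \<exists>h' \<in> Hom n F X. h' \<circ>\<^sub>h g = h)) \<and>
     (\<forall>\<phi> \<in> Hom n F F. \<phi> \<circ>\<^sub>h g = g \<longrightarrow> is_iso n F F \<phi>)"

text \<open>
  \<open>0 \<rightarrow> Tk' \<rightarrow>\<^sup>i E \<rightarrow>\<^sup>f Tk \<rightarrow> 0\<close> and \<open>0 \<rightarrow> Tk \<rightarrow>\<^sup>g F \<rightarrow>\<^sup>p Tk' \<rightarrow> 0\<close> are the mutation sequences at the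
  summand \<open>Tk\<close> of \<open>T\<close>; \<open>R\<close> is the complement of \<open>Tk\<close> in \<open>T\<close>.
\<close>

definition mutation_sequences ::
  "nat \<Rightarrow> nat set \<Rightarrow> 't::complex_vector rep \<Rightarrow> 'v::complex_vector rep \<Rightarrow> 'w::complex_vector rep \<Rightarrow>
   'e::complex_vector rep \<Rightarrow> (nat \<Rightarrow> 'w \<Rightarrow> 'e) \<Rightarrow> (nat \<Rightarrow> 'e \<Rightarrow> 'v) \<Rightarrow>
   'f::complex_vector rep \<Rightarrow> (nat \<Rightarrow> 'v \<Rightarrow> 'f) \<Rightarrow> (nat \<Rightarrow> 'f \<Rightarrow> 'w) \<Rightarrow> bool" where
  "mutation_sequences n J T Tk Tk' E i f F g p \<longleftrightarrow>
     indecomposable n Tk \<and> \<not> projective_in_FJ n J Tk \<and>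
     indecomposable n Tk' \<and> in_FJ n J Tk' \<and>
     E_ses n Tk' E Tk i f \<and> E_ses n Tk F Tk' g p \<and>
     (\<exists>R :: univ rep. dmod n R \<and> isomorphic n T (Tk \<oplus>\<^sub>r R) \<and>
        minimal_right_approx n R E Tk f \<and> minimal_left_approx n R Tk F g)"


section \<open>Weakly separated collections\<close>

definition set_less :: "nat set \<Rightarrow> nat set \<Rightarrow> bool" where
  "set_less A B \<longleftrightarrow> (\<forall>a\<in>A. \<forall>b\<in>B. a < b)"

definition weakly_separated :: "nat set \<Rightarrow> nat set \<Rightarrow> bool" where
  "weakly_separated I J \<longleftrightarrow>
     (card I \<ge> card J \<and>
       (\<exists>J' J''. J - I = J' \<union> J'' \<and> J' \<inter> J'' = {} \<and> set_less J' (I - J) \<and> set_less (I - J) J'')) \<or>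
     (card J \<ge> card I \<and>
       (\<exists>I' I''. I - J = I' \<union> I'' \<and> I' \<inter> I'' = {} \<and> set_less I' (J - I) \<and> set_less (J - I) I''))"

definition ws_collection :: "nat \<Rightarrow> nat set \<Rightarrow> nat set set \<Rightarrow> bool" where
  "ws_collection n J S \<longleftrightarrow> (\<forall>I\<in>S. I \<subseteq> {1..n} \<and> card I \<in> J) \<and> (\<forall>I\<in>S. \<forall>I'\<in>S. weakly_separated I I')"

definition maximal_ws_collection :: "nat \<Rightarrow> nat set \<Rightarrow> nat set set \<Rightarrow> bool" where
  "maximal_ws_collection n J S \<longleftrightarrow> ws_collection n J S \<and> (\<forall>S'. ws_collection n J S' \<and> S \<subseteq> S' \<longrightarrow> S' = S)"

definition TS :: "nat \<Rightarrow> nat set set \<Rightarrow> (nat set \<Rightarrow> univ) rep" where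
  "TS n S = big_dsum S (MI n)"

definition cyclically_ordered :: "nat \<Rightarrow> nat \<Rightarrow> nat \<Rightarrow> nat \<Rightarrow> bool" where
  "cyclically_ordered a b c d \<longleftrightarrow>
     (a < b \<and> b < c \<and> c < d) \<or> (b < c \<and> c < d \<and> d < a) \<or>
     (c < d \<and> d < a \<and> a < b) \<or> (d < a \<and> a < b \<and> b < c)"


section \<open>\<open>D0\<close> is the module \<open>D e\<^sub>0\<close>\<close>

lemma sum_fun_apply: "(\<Sum>k\<in>A. g k) x = (\<Sum>k\<in>A. (g k x :: 'a::comm_monoid_add))"
  by (induction A rule: infinite_finite_induct) auto

lemma unit_vec0_expansion:
  assumes "\<forall>k\<ge>m. f k = 0"
  shows "f = (\<Sum>k<m. f k *\<^sub>C unit_vec0 k)"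
proof
  fix x
  have "(\<Sum>k<m. f k *\<^sub>C unit_vec0 k) x = (\<Sum>k<m. if k = x then f k else 0)"
    unfolding sum_fun_apply
    by (intro sum.cong) (auto simp: scaleC_fun_def scaleC_complex_def unit_vec0_def)
  also have "\<dots> = f x"
    using assms by (auto simp: not_less)
  finally show "f x = (\<Sum>k<m. f k *\<^sub>C unit_vec0 k) x" by simp
qed

lemma span_unit_vec0: "cvec.span (unit_vec0 ` {..<m}) = {f :: univ. \<forall>k\<ge>m. f k = 0}"
    (is "?L = ?R")
proof
  have "cvec.subspace ?R"
    by (auto simp: cvec.subspace_def scaleC_fun_def scaleC_complex_def)
  then show "?L \<subseteq> ?R"
    by (intro cvec.span_minimal) (auto simp: unit_vec0_def)
next
  show "?R \<subseteq> ?L"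
  proof
    fix f :: univ assume "f \<in> ?R"
    then have "f = (\<Sum>k<m. f k *\<^sub>C unit_vec0 k)"
      by (intro unit_vec0_expansion) simp
    also have "\<dots> \<in> ?L"
      by (intro cvec.span_sum cvec.span_scale cvec.span_base) auto
    finally show "f \<in> ?L" .
  qed
qed

lemma dmod_D0:
  assumes "n > 1"
  shows "dmod n (D0 n)"
proof -
  have fd: "fin_dim_subspace (vsp (D0 n) i)" for i
    unfolding fin_dim_subspace_def
    by (rule exI[of _ "unit_vec0 ` {..<n - i}"]) (simp add: span_unit_vec0 D0_def)
  have z: "vsp (D0 n) i = {0}" if "i \<ge> n" for i
    using that by (simp add: D0_def set_eq_iff fun_eq_iff)
  have lb: "linear_between (vsp (D0 n) (i-1)) (vsp (D0 n) i) (bmap (D0 n) i)" for i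
    unfolding linear_between_def D0_def
    by (simp add: fun_eq_iff scaleC_fun_def scaleC_complex_def)
  have la: "linear_between (vsp (D0 n) i) (vsp (D0 n) (i-1)) (amap (D0 n) i)"
    if i: "i \<in> {1..n-1}" for i
  proof -
    have "amap (D0 n) i f \<in> vsp (D0 n) (i-1)" if "f \<in> vsp (D0 n) i" for f
    proof -
      have "amap (D0 n) i f k = 0" if k: "k \<ge> n - (i-1)" for k
      proof -
        have "k - 1 \<ge> n - i" "k \<noteq> 0" using i k by auto
        then show ?thesis using \<open>f \<in> vsp (D0 n) i\<close> by (simp add: D0_def)
      qed
      then show ?thesis by (simp add: D0_def)
    qed
    then show ?thesis
      unfolding linear_between_def
      by (simp add: D0_def fun_eq_iff scaleC_fun_def scaleC_complex_def)
  qed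
  have r1: "bmap (D0 n) (n-1) (amap (D0 n) (n-1) x) = 0" for x
    using assms by (simp add: D0_def fun_eq_iff)
  have r2: "amap (D0 n) i (bmap (D0 n) i x) = bmap (D0 n) (i-1) (amap (D0 n) (i-1) x)"
    if i: "i \<in> {2..n-1}" for i x
  proof
    fix k
    have "k - 1 < n - i \<longleftrightarrow> k < n - (i - 1)" if "k \<noteq> 0" using i that by auto
    then show "amap (D0 n) i (bmap (D0 n) i x) k = bmap (D0 n) (i-1) (amap (D0 n) (i-1) x) k"
      by (simp add: D0_def)
  qed
  show ?thesis
    unfolding dmod_def by (intro conjI allI impI ballI fd z lb la r1 r2)
qed

fun bpath :: "'v rep \<Rightarrow> nat \<Rightarrow> 'v \<Rightarrow> 'v" where
  "bpath M 0 x = x"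
| "bpath M (Suc j) x = bmap M (Suc j) (bpath M j x)"

definition loop :: "'v rep \<Rightarrow> 'v \<Rightarrow> 'v" where
  "loop M x = amap M 1 (bmap M 1 x)"

context
  fixes n :: nat and M :: "'v::complex_vector rep"
  assumes n: "n > 1" and M: "dmod n M"
begin

lemma subspace_vsp: "cvec.subspace (vsp M i)"
  using M unfolding dmod_def fin_dim_subspace_def by (metis cvec.subspace_span)

lemma bmap_in: "1 \<le> i \<Longrightarrow> i < n \<Longrightarrow> x \<in> vsp M (i-1) \<Longrightarrow> bmap M i x \<in> vsp M i"
  using M unfolding dmod_def linear_between_def by auto

lemma amap_in: "1 \<le> i \<Longrightarrow> i < n \<Longrightarrow> x \<in> vsp M i \<Longrightarrow> amap M i x \<in> vsp M (i-1)"
  using M unfolding dmod_def linear_between_def by auto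

lemma bpath_in: "j < n \<Longrightarrow> x \<in> vsp M 0 \<Longrightarrow> bpath M j x \<in> vsp M j"
proof (induction j)
  case (Suc j)
  then show ?case using bmap_in[of "Suc j" "bpath M j x"] by simp
qed simp

lemma loop_in: "x \<in> vsp M 0 \<Longrightarrow> loop M x \<in> vsp M 0"
  unfolding loop_def using n amap_in[of 1 "bmap M 1 x"] bmap_in[of 1 x] by simp

lemma loop_pow_in: "x \<in> vsp M 0 \<Longrightarrow> (loop M ^^ k) x \<in> vsp M 0"
  by (induction k) (auto intro: loop_in)

lemma amap_bpath:
  "1 \<le> j \<Longrightarrow> j < n \<Longrightarrow> x \<in> vsp M 0 \<Longrightarrow> amap M j (bpath M j x) = bpath M (j-1) (loop M x)"
proof (induction j)
  case (Suc j)
  show ?case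
  proof (cases j)
    case 0
    then show ?thesis by (simp add: loop_def)
  next
    case (Suc i)
    have "amap M (Suc j) (bmap M (Suc j) (bpath M j x)) = bmap M j (amap M j (bpath M j x))"
    proof -
      have "Suc j \<in> {2..n-1}" using Suc Suc.prems by auto
      moreover have "bpath M j x \<in> vsp M (Suc j - 1)"
        using bpath_in[of j x] Suc.prems by simp
      ultimately have "amap M (Suc j) (bmap M (Suc j) (bpath M j x)) =
          bmap M (Suc j - 1) (amap M (Suc j - 1) (bpath M j x))"
        using M unfolding dmod_def by blast
      then show ?thesis by simp
    qed
    also have "amap M j (bpath M j x) = bpath M (j-1) (loop M x)"
      using Suc.IH Suc.prems Suc by simp
    finally show ?thesis using Suc by simp
  qed
qed simp

lemma linear_bmap: "1 \<le> i \<Longrightarrow> i < n \<Longrightarrow> linear_between (vsp M (i-1)) (vsp M i) (bmap M i)"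
  and linear_amap: "1 \<le> i \<Longrightarrow> i < n \<Longrightarrow> linear_between (vsp M i) (vsp M (i-1)) (amap M i)"
  using M unfolding dmod_def by auto

end

lemma linear_between_0:
  assumes "linear_between V W f" "cvec.subspace V"
  shows "f 0 = 0"
proof -
  have "f (0 *\<^sub>C 0) = 0 *\<^sub>C f 0"
    using assms cvec.subspace_0 unfolding linear_between_def by blast
  then show ?thesis by simp
qed

lemma linear_between_sum:
  assumes "linear_between V W f" "cvec.subspace V" "\<And>k. k \<in> A \<Longrightarrow> v k \<in> V"
  shows "f (\<Sum>k\<in>A. c k *\<^sub>C v k) = (\<Sum>k\<in>A. c k *\<^sub>C f (v k))"
  using assms(3)
proof (induction A rule: infinite_finite_induct)
  case (insert k A)
  have "c k *\<^sub>C v k \<in> V" "(\<Sum>k\<in>A. c k *\<^sub>C v k) \<in> V"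
    using insert assms(2) by (auto intro!: cvec.subspace_sum cvec.subspace_scale)
  then show ?case
    using insert assms(1) unfolding linear_between_def by simp
qed (use linear_between_0[OF assms(1,2)] in auto)

lemma loop_pow_bpath_zero:
  assumes n: "n > 1" and M: "dmod n M" and "j < n" "x \<in> vsp M 0"
  shows "bpath M j ((loop M ^^ (n - j)) x) = 0"
  using \<open>j < n\<close>
proof (induction "n - 1 - j" arbitrary: j)
  case 0
  then have j: "j = n - 1" by simp
  define i where "i = n - 2"
  have i: "j = Suc i" using j n by (simp add: i_def)
  have "n - j = 1" using j n by simp
  then have "bpath M j ((loop M ^^ (n - j)) x) = bmap M j (bpath M (j - 1) (loop M x))"
    using i by simp
  also have "bpath M (j - 1) (loop M x) = amap M j (bpath M j x)"
    using amap_bpath[OF n M, of j x] assms j n by simp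
  also have "bmap M j (amap M j (bpath M j x)) = 0"
    using M bpath_in[OF n M, of j x] assms j 0 unfolding dmod_def by simp
  finally show ?case .
next
  case (Suc d)
  have "bpath M (Suc j) ((loop M ^^ (n - Suc j)) x) = 0"
    using Suc(1)[of "Suc j"] Suc(2,3) by simp
  then have "amap M (Suc j) (bpath M (Suc j) ((loop M ^^ (n - Suc j)) x)) = amap M (Suc j) 0"
    by simp
  also have "\<dots> = 0"
    using Suc(2,3) by (intro linear_between_0[OF linear_amap[OF n M] subspace_vsp[OF n M]]) auto
  finally have "bpath M j (loop M ((loop M ^^ (n - Suc j)) x)) = 0"
    using amap_bpath[OF n M, of "Suc j" "(loop M ^^ (n - Suc j)) x"] Suc(2,3)
      loop_pow_in[OF n M assms(4)] by simp
  moreover have "n - j = Suc (n - Suc j)" using Suc(3) by simp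
  ultimately show ?case by simp
qed

lemma D0_bpath: "j < n \<Longrightarrow> k < n - j \<Longrightarrow> bpath (D0 n) j (unit_vec0 k) = unit_vec0 k"
  by (induction j) (auto simp: D0_def unit_vec0_def fun_eq_iff)

lemma D0_loop_pow: "k < n \<Longrightarrow> (loop (D0 n) ^^ k) (unit_vec0 0) = unit_vec0 k"
proof (induction k)
  case (Suc k)
  then have "(loop (D0 n) ^^ Suc k) (unit_vec0 0) = loop (D0 n) (unit_vec0 k)" by simp
  also have "\<dots> = unit_vec0 (Suc k)"
    using Suc(2) by (auto simp: loop_def D0_def unit_vec0_def fun_eq_iff)
  finally show ?case .
qed simp

lemma Hom_bpath:
  assumes n: "n > 1" and M: "dmod n M" and \<phi>: "\<phi> \<in> Hom n M N" and "j < n" "x \<in> vsp M 0"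
  shows "\<phi> j (bpath M j x) = bpath N j (\<phi> 0 x)"
  using \<open>j < n\<close>
proof (induction j)
  case (Suc j)
  have "bpath M j x \<in> vsp M (Suc j - 1)" using bpath_in[OF n M, of j x] Suc assms by simp
  moreover have "Suc j \<in> {1..n-1}" using Suc by auto
  ultimately have "\<phi> (Suc j) (bmap M (Suc j) (bpath M j x)) = bmap N (Suc j) (\<phi> (Suc j - 1) (bpath M j x))"
    using \<phi> unfolding Hom_def by blast
  then show ?case using Suc by simp
qed simp

lemma Hom_loop_pow:
  assumes n: "n > 1" and M: "dmod n M" and \<phi>: "\<phi> \<in> Hom n M N" and "x \<in> vsp M 0"
  shows "\<phi> 0 ((loop M ^^ k) x) = (loop N ^^ k) (\<phi> 0 x)"
proof (induction k)
  case (Suc k)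
  let ?y = "(loop M ^^ k) x"
  have y: "?y \<in> vsp M 0" using loop_pow_in[OF n M] assms by simp
  have b: "bmap M 1 ?y \<in> vsp M 1" using bmap_in[OF n M, of 1 ?y] y n by simp
  have one: "1 \<in> {1..n-1}" using n by auto
  have "\<phi> (1-1) (amap M 1 (bmap M 1 ?y)) = amap N 1 (\<phi> 1 (bmap M 1 ?y))"
    using \<phi> one b unfolding Hom_def by blast
  moreover have "\<phi> 1 (bmap M 1 ?y) = bmap N 1 (\<phi> (1-1) ?y)"
    using \<phi> one y unfolding Hom_def by simp
  ultimately have "\<phi> 0 (loop M ?y) = loop N (\<phi> 0 ?y)" by (simp add: loop_def)
  then show ?case using Suc by simp
qed simp

theorem D0_universal:
  assumes n: "n > 1" and M: "dmod n M" and x: "x \<in> vsp M 0"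
  shows "\<exists>!\<phi>. \<phi> \<in> Hom n (D0 n) M \<and> \<phi> 0 (unit_vec0 0) = x"
proof -
  define w where "w = (\<lambda>j k. bpath M j ((loop M ^^ k) x))"
  define \<phi> where "\<phi> = (\<lambda>j f. if f \<in> vsp (D0 n) j then \<Sum>k<n - j. f k *\<^sub>C w j k else 0)"
  note D = dmod_D0[OF n]
  have lp: "(loop M ^^ k) x \<in> vsp M 0" for k by (rule loop_pow_in[OF n M x])
  have w_in: "w j k \<in> vsp M j" if "j < n" for j k
    unfolding w_def using bpath_in[OF n M that lp] .
  have sub: "cvec.subspace (vsp M j)" for j by (rule subspace_vsp[OF n M])
  have subD: "cvec.subspace (vsp (D0 n) j)" for j by (rule subspace_vsp[OF n D])
  have lin: "linear_between (vsp (D0 n) j) (vsp M j) (\<phi> j)" for j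
  proof (cases "j < n")
    case True
    then show ?thesis
      using subD[of j] unfolding linear_between_def
      by (auto simp: \<phi>_def cvec.subspace_add cvec.subspace_scale scaleC_add_left sum.distrib
          scaleC_fun_def scaleC_complex_def scaleC_scaleC cvec.scale_sum_right
          intro!: cvec.subspace_sum[OF sub] cvec.subspace_scale[OF sub] w_in
          dest: cvec.subspace_scale)
  next
    case False
    then have "vsp (D0 n) j = {0}" "vsp M j = {0}" using D M unfolding dmod_def by auto
    then show ?thesis using False by (simp add: linear_between_def \<phi>_def)
  qed
  have b: "\<phi> j (bmap (D0 n) j f) = bmap M j (\<phi> (j-1) f)"
    if j: "j \<in> {1..n-1}" and f: "f \<in> vsp (D0 n) (j-1)" for j f
  proof -
    have "bmap M j (\<phi> (j-1) f) = bmap M j (\<Sum>k<n - (j-1). f k *\<^sub>C w (j-1) k)"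
      using f by (simp add: \<phi>_def)
    also have "\<dots> = (\<Sum>k<n - (j-1). f k *\<^sub>C bmap M j (w (j-1) k))"
      using j by (intro linear_between_sum[OF linear_bmap[OF n M] sub] w_in) auto
    also have "\<dots> = (\<Sum>k<n - (j-1). f k *\<^sub>C w j k)"
      using j by (intro sum.cong) (auto simp: w_def gr0_conv_Suc Suc_le_eq)
    also have "n - (j-1) = Suc (n - j)" using j by auto
    also have "(\<Sum>k<Suc (n - j). f k *\<^sub>C w j k) = (\<Sum>k<n - j. f k *\<^sub>C w j k)"
    proof -
      have "j < n" using j n by auto
      then show ?thesis using loop_pow_bpath_zero[OF n M _ x, of j] by (simp add: w_def)
    qed
    also have "\<dots> = (\<Sum>k<n - j. bmap (D0 n) j f k *\<^sub>C w j k)"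
      by (intro sum.cong) (auto simp: D0_def)
    also have "\<dots> = \<phi> j (bmap (D0 n) j f)"
    proof -
      have "1 \<le> j" "j < n" using j n by auto
      then show ?thesis using bmap_in[OF n D, of j f] f by (simp add: \<phi>_def)
    qed
    finally show ?thesis by simp
  qed
  have a: "\<phi> (j-1) (amap (D0 n) j f) = amap M j (\<phi> j f)"
    if j: "j \<in> {1..n-1}" and f: "f \<in> vsp (D0 n) j" for j f
  proof -
    have "amap M j (\<phi> j f) = amap M j (\<Sum>k<n - j. f k *\<^sub>C w j k)"
      using f by (simp add: \<phi>_def)
    also have "\<dots> = (\<Sum>k<n - j. f k *\<^sub>C amap M j (w j k))"
      using j by (intro linear_between_sum[OF linear_amap[OF n M] sub] w_in) auto
    also have "\<dots> = (\<Sum>k<n - j. f k *\<^sub>C w (j-1) (Suc k))"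
      using j lp by (intro sum.cong) (auto simp: w_def amap_bpath[OF n M])
    also have "\<dots> = (\<Sum>k<Suc (n - j). amap (D0 n) j f k *\<^sub>C w (j-1) k)"
      by (subst sum.lessThan_Suc_shift) (simp add: D0_def)
    also have "Suc (n - j) = n - (j-1)" using j by auto
    also have "(\<Sum>k<n - (j-1). amap (D0 n) j f k *\<^sub>C w (j-1) k) = \<phi> (j-1) (amap (D0 n) j f)"
    proof -
      have "1 \<le> j" "j < n" using j n by auto
      then show ?thesis using amap_in[OF n D, of j f] f by (simp add: \<phi>_def)
    qed
    finally show ?thesis by simp
  qed
  have "\<phi> \<in> Hom n (D0 n) M"
    unfolding Hom_def using lin a b by (auto simp: \<phi>_def)
  moreover have "\<phi> 0 (unit_vec0 0) = x"
  proof -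
    have "unit_vec0 0 \<in> vsp (D0 n) 0" using n by (auto simp: D0_def unit_vec0_def)
    then have "\<phi> 0 (unit_vec0 0) = (\<Sum>k<n. unit_vec0 0 k *\<^sub>C w 0 k)" by (simp add: \<phi>_def)
    also have "\<dots> = (\<Sum>k<n. if k = 0 then w 0 k else 0)"
      by (intro sum.cong) (auto simp: unit_vec0_def scaleC_one)
    also have "\<dots> = x" using n by (simp add: w_def)
    finally show ?thesis .
  qed
  moreover have "\<psi> = \<phi>" if \<psi>: "\<psi> \<in> Hom n (D0 n) M" "\<psi> 0 (unit_vec0 0) = x" for \<psi>
  proof (intro ext)
    fix j f
    show "\<psi> j f = \<phi> j f"
    proof (cases "f \<in> vsp (D0 n) j")
      case False
      then show ?thesis using \<psi> by (simp add: Hom_def \<phi>_def)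
    next
      case True
      have linp: "linear_between (vsp (D0 n) j) (vsp M j) (\<psi> j)"
        using \<psi>(1) unfolding Hom_def by blast
      have ev: "\<psi> j (unit_vec0 k) = w j k" if "k < n - j" for k
      proof -
        have e0: "unit_vec0 0 \<in> vsp (D0 n) 0" using n by (auto simp: D0_def unit_vec0_def)
        have "\<psi> j (unit_vec0 k) = \<psi> j (bpath (D0 n) j ((loop (D0 n) ^^ k) (unit_vec0 0)))"
          using that by (simp add: D0_bpath D0_loop_pow)
        also have "\<dots> = bpath M j (\<psi> 0 ((loop (D0 n) ^^ k) (unit_vec0 0)))"
          using that loop_pow_in[OF n D e0] by (intro Hom_bpath[OF n D \<psi>(1)]) auto
        also have "\<dots> = w j k"
          by (simp add: Hom_loop_pow[OF n D \<psi>(1) e0] \<psi>(2) w_def)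
        finally show ?thesis .
      qed
      have f: "f = (\<Sum>k<n - j. f k *\<^sub>C unit_vec0 k)"
        using True by (intro unit_vec0_expansion) (simp add: D0_def)
      have "\<psi> j f = \<psi> j (\<Sum>k<n - j. f k *\<^sub>C unit_vec0 k)" by (rule arg_cong[OF f])
      also have "\<dots> = (\<Sum>k<n - j. f k *\<^sub>C \<psi> j (unit_vec0 k))"
        by (intro linear_between_sum[OF linp subD]) (auto simp: D0_def unit_vec0_def)
      also have "\<dots> = \<phi> j f" using True ev by (simp add: \<phi>_def)
      finally show ?thesis .
    qed
  qed
  ultimately show ?thesis by blast
qed

end

theory Submission
  imports Defs
begin

text \<open>
  Everything is reduced to linear algebra at vertex \<open>0\<close>.  A module is good if and only if the maps
  \<open>a\<^sub>i\<close> are injective on it (\<open>good_iff_a_injective\<close>), so a good module \<open>M\<close> is the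
  \<open>\<complex>[t]/t\<^sup>n\<close>-module \<open>e\<^sub>0 M\<close>, with \<open>t = a\<^sub>1 b\<^sub>1\<close>, together with the flag of the
  images of the spaces \<open>e\<^sub>j M\<close>.  For \<open>M\<^sub>I\<close> with \<open>m = |I|\<close> one gets \<open>\<complex>[t]/t\<^sup>m\<close> whose \<open>j\<close>-th flag step is
  the submodule of dimension \<open>|{k \<in> I. k > j}|\<close> (\<open>MI_eq\<close>).  Hence \<open>Hom(M\<^sub>K, M\<^sub>I)\<close> consists of the
  power series in \<open>t\<close> supported on those \<open>t\<^sup>i\<close> that satisfy the numerical condition \<open>hle i K I\<close>
  (\<open>Hom_MI_expansion\<close>), the rings \<open>End(M\<^sub>I)\<close> are local, and for \<open>K \<noteq> I\<close> no composite
  \<open>M\<^sub>I \<rightarrow> M\<^sub>K \<rightarrow> M\<^sub>I\<close> is invertible (\<open>cst_comp_zero\<close>).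

  The short exact sequences come from squares formed by the maps \<open>t\<^sup>0\<close> and \<open>t\<^sup>1\<close> between \<open>M\<^sub>A\<close>,
  \<open>M\<^bsub>B1\<^esub> \<oplus> M\<^bsub>B2\<^esub>\<close> and \<open>M\<^sub>C\<close>; which of the four arrows are multiplication by \<open>t\<close> is dictated by
  where the cyclic order of \<open>a, b, c, d\<close> is cut (locale \<open>exchange_square\<close>, \<open>exchange_square_cyclic\<close>).
  All modules involved are annihilated by \<open>t\<^sup>m\<close> at vertex \<open>0\<close> for the common size \<open>m\<close>, so the
  sequences stay exact under \<open>\<eta>\<close> (\<open>E_sesI\<close>).

  For the extension group, let \<open>0 \<rightarrow> X \<rightarrow> Y \<rightarrow> Z \<rightarrow> 0\<close> be an arbitrary extension, \<open>X\<close> and \<open>Z\<close> being the ends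
  of such a square.  Both components of the map from the middle of the square to \<open>Z\<close> lift to \<open>Y\<close>, because
  each middle set differs from the set of \<open>X\<close> by a single exchange and \<open>ext\<^sup>1\<close> vanishes for such a pair
  (\<open>lift_flag_conditions\<close>).  The lift induces an endomorphism of \<open>X\<close>, and its radical part can be
  removed since it factors through the middle (\<open>radical_factor\<close>).  So every extension is the pushout
  of the square along a scalar.  Since the square does not split, the scalar is a coordinate that
  identifies \<open>ext\<^sup>1(Z, X)\<close> with \<open>\<complex>\<close> (\<open>ext1_dim_1\<close>).

  For the mutation sequences it has to be shown that every map \<open>M\<^sub>K \<rightarrow> M\<^sub>C\<close> with \<open>K \<noteq> C\<close> in the
  collection factors through the middle, and dually.  For \<open>t\<^sup>i\<close> a failure gives two positions, one in the
  cyclic interval from \<open>a\<close> to \<open>b\<close> and one in that from \<open>c\<close> to \<open>d\<close>, where the inequalities \<open>hle i K C\<close> are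
  equalities.  This forces a pattern that the weak separation of \<open>K\<close> from \<open>C\<close> and from two of the
  neighbouring sets excludes (\<open>exchange_obstruction\<close>, \<open>Hom_to_target_splits\<close>, \<open>Hom_from_source_splits\<close>).
  Minimality is once more the locality of the rings \<open>End(M\<^sub>I)\<close>: an endomorphism of the middle that is compatible
  with the approximation differs from the identity by a map through an end term, and the composite in
  the other order lies in the radical (\<open>right_minimal\<close>, \<open>left_minimal\<close>).
\<close>

section \<open>Calculus of homomorphisms\<close>

lemma dmod_subspace: "dmod n M \<Longrightarrow> cvec.subspace (vsp M i)"
  unfolding dmod_def fin_dim_subspace_def by (metis cvec.subspace_span)

lemma dmod_0: "dmod n M \<Longrightarrow> 0 \<in> vsp M i"
  by (rule cvec.subspace_0[OF dmod_subspace])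

lemma dmod_add: "dmod n M \<Longrightarrow> x \<in> vsp M i \<Longrightarrow> y \<in> vsp M i \<Longrightarrow> x + y \<in> vsp M i"
  by (rule cvec.subspace_add[OF dmod_subspace])

lemma dmod_scale: "dmod n M \<Longrightarrow> x \<in> vsp M i \<Longrightarrow> c *\<^sub>C x \<in> vsp M i"
  by (rule cvec.subspace_scale[OF dmod_subspace])

lemma dmod_diff: "dmod n M \<Longrightarrow> x \<in> vsp M i \<Longrightarrow> y \<in> vsp M i \<Longrightarrow> x - y \<in> vsp M i"
  by (rule cvec.subspace_diff[OF dmod_subspace])

lemma dmod_neg: "dmod n M \<Longrightarrow> x \<in> vsp M i \<Longrightarrow> - x \<in> vsp M i"
  by (rule cvec.subspace_neg[OF dmod_subspace])

lemma dmod_sum: "dmod n M \<Longrightarrow> (\<And>k. k \<in> A \<Longrightarrow> x k \<in> vsp M i) \<Longrightarrow> sum x A \<in> vsp M i"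
  by (rule cvec.subspace_sum[OF dmod_subspace])

lemma dmod_outside: "dmod n M \<Longrightarrow> n \<le> i \<Longrightarrow> vsp M i = {0}"
  unfolding dmod_def by blast

lemma
  assumes "dmod n M" "i \<in> {1..n-1}"
  shows dmod_bmap_in: "x \<in> vsp M (i-1) \<Longrightarrow> bmap M i x \<in> vsp M i"
    and dmod_bmap_add: "x \<in> vsp M (i-1) \<Longrightarrow> y \<in> vsp M (i-1) \<Longrightarrow> bmap M i (x + y) = bmap M i x + bmap M i y"
    and dmod_bmap_scale: "x \<in> vsp M (i-1) \<Longrightarrow> bmap M i (c *\<^sub>C x) = c *\<^sub>C bmap M i x"
    and dmod_amap_in: "x \<in> vsp M i \<Longrightarrow> amap M i x \<in> vsp M (i-1)"
    and dmod_amap_add: "x \<in> vsp M i \<Longrightarrow> y \<in> vsp M i \<Longrightarrow> amap M i (x + y) = amap M i x + amap M i y"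
    and dmod_amap_scale: "x \<in> vsp M i \<Longrightarrow> amap M i (c *\<^sub>C x) = c *\<^sub>C amap M i x"
  using assms unfolding dmod_def linear_between_def by blast+

lemma dmod_bmap_0: "dmod n M \<Longrightarrow> i \<in> {1..n-1} \<Longrightarrow> bmap M i 0 = 0"
  using dmod_bmap_scale[of n M i 0 0] dmod_0[of n M] by simp

lemma dmod_amap_0: "dmod n M \<Longrightarrow> i \<in> {1..n-1} \<Longrightarrow> amap M i 0 = 0"
  using dmod_amap_scale[of n M i 0 0] dmod_0[of n M] by simp

lemma HomI:
  assumes "\<And>i x. x \<in> vsp M i \<Longrightarrow> f i x \<in> vsp N i"
    and "\<And>i x y. x \<in> vsp M i \<Longrightarrow> y \<in> vsp M i \<Longrightarrow> f i (x + y) = f i x + f i y"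
    and "\<And>i c x. x \<in> vsp M i \<Longrightarrow> f i (c *\<^sub>C x) = c *\<^sub>C f i x"
    and "\<And>i x. x \<notin> vsp M i \<Longrightarrow> f i x = 0"
    and "\<And>i x. i \<in> {1..n-1} \<Longrightarrow> x \<in> vsp M (i-1) \<Longrightarrow> f i (bmap M i x) = bmap N i (f (i-1) x)"
    and "\<And>i x. i \<in> {1..n-1} \<Longrightarrow> x \<in> vsp M i \<Longrightarrow> f (i-1) (amap M i x) = amap N i (f i x)"
  shows "f \<in> Hom n M N"
  using assms unfolding Hom_def linear_between_def by blast

lemma
  assumes "f \<in> Hom n M N"
  shows Hom_in: "x \<in> vsp M i \<Longrightarrow> f i x \<in> vsp N i"
    and Hom_add: "x \<in> vsp M i \<Longrightarrow> y \<in> vsp M i \<Longrightarrow> f i (x + y) = f i x + f i y"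
    and Hom_scale: "x \<in> vsp M i \<Longrightarrow> f i (c *\<^sub>C x) = c *\<^sub>C f i x"
    and Hom_out: "x \<notin> vsp M i \<Longrightarrow> f i x = 0"
    and Hom_bmap: "i \<in> {1..n-1} \<Longrightarrow> x \<in> vsp M (i-1) \<Longrightarrow> f i (bmap M i x) = bmap N i (f (i-1) x)"
    and Hom_amap: "i \<in> {1..n-1} \<Longrightarrow> x \<in> vsp M i \<Longrightarrow> f (i-1) (amap M i x) = amap N i (f i x)"
  using assms unfolding Hom_def linear_between_def by blast+

lemma Hom_0: "f \<in> Hom n M N \<Longrightarrow> f i 0 = 0"
  by (metis Hom_out Hom_scale cvec.scale_zero_left)

lemma Hom_neg: "f \<in> Hom n M N \<Longrightarrow> x \<in> vsp M i \<Longrightarrow> f i (- x) = - f i x"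
  using Hom_scale[of f n M N x i "-1"] by simp

lemma Hom_diff:
  "dmod n M \<Longrightarrow> f \<in> Hom n M N \<Longrightarrow> x \<in> vsp M i \<Longrightarrow> y \<in> vsp M i \<Longrightarrow> f i (x - y) = f i x - f i y"
  using Hom_add[of f n M N x i "- y"] Hom_neg[of f n M N y i] dmod_neg[of n M y i] by simp

lemma Hom_sum_arg:
  assumes "dmod n M" "f \<in> Hom n M N" "\<And>k. k \<in> A \<Longrightarrow> x k \<in> vsp M i"
  shows "f i (\<Sum>k\<in>A. x k) = (\<Sum>k\<in>A. f i (x k))"
  using assms(3)
proof (induction A rule: infinite_finite_induct)
  case (insert k A)
  then have "f i (x k + sum x A) = f i (x k) + f i (sum x A)"
    by (intro Hom_add[OF assms(2)] dmod_sum[OF assms(1)]) auto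
  then show ?case using insert by simp
qed (use Hom_0[OF assms(2)] in auto)

lemma Hom_eqI:
  assumes "f \<in> Hom n M N" "g \<in> Hom n M N" "\<And>i x. x \<in> vsp M i \<Longrightarrow> f i x = g i x"
  shows "f = g"
  by (intro ext) (metis assms Hom_out)

lemma hcomp_apply: "(g \<circ>\<^sub>h f) i x = g i (f i x)"
  by (simp add: hcomp_def)

lemma hcomp_assoc: "h \<circ>\<^sub>h g \<circ>\<^sub>h f = h \<circ>\<^sub>h (g \<circ>\<^sub>h f)"
  by (simp add: hcomp_def fun_eq_iff)

lemma Hom_hcomp: "f \<in> Hom n M N \<Longrightarrow> g \<in> Hom n N P \<Longrightarrow> g \<circ>\<^sub>h f \<in> Hom n M P"
  by (rule HomI)
    (simp_all add: hcomp_apply Hom_in Hom_add Hom_scale Hom_out Hom_0 Hom_bmap Hom_amap del: One_nat_def)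

lemma Hom_hid: "dmod n M \<Longrightarrow> hid M \<in> Hom n M M"
  by (rule HomI)
    (auto simp: hid_def dmod_add dmod_scale dmod_bmap_in dmod_amap_in
       dest: dmod_bmap_in[simplified] dmod_amap_in[simplified])

lemma hid_apply: "x \<in> vsp M i \<Longrightarrow> hid M i x = x"
  by (simp add: hid_def)

lemma hcomp_hid_right: "f \<in> Hom n M N \<Longrightarrow> f \<circ>\<^sub>h hid M = f"
  by (auto simp: hcomp_def hid_def fun_eq_iff Hom_0 Hom_out)

lemma hcomp_hid_left: "f \<in> Hom n M N \<Longrightarrow> hid N \<circ>\<^sub>h f = f"
  by (auto simp: hcomp_def hid_def fun_eq_iff Hom_in) (metis Hom_in Hom_out)

lemma Hom_zero: "dmod n N \<Longrightarrow> 0 \<in> Hom n M N"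
  by (rule HomI) (auto simp: dmod_0 dmod_bmap_0 dmod_amap_0)

lemma Hom_plus:
  assumes "dmod n N" "f \<in> Hom n M N" "g \<in> Hom n M N"
  shows "f + g \<in> Hom n M N"
  by (rule HomI)
    (simp_all add: dmod_add[OF assms(1)] Hom_in[OF assms(2)] Hom_in[OF assms(3)] Hom_add[OF assms(2)]
      Hom_add[OF assms(3)] Hom_scale[OF assms(2)] Hom_scale[OF assms(3)] Hom_out[OF assms(2)]
      Hom_out[OF assms(3)] Hom_bmap[OF assms(2)] Hom_bmap[OF assms(3)] Hom_amap[OF assms(2)]
      Hom_amap[OF assms(3)] scaleC_add_right dmod_bmap_add[OF assms(1)] dmod_amap_add[OF assms(1)]
      del: One_nat_def)

lemma Hom_scaleC:
  assumes "dmod n N" "f \<in> Hom n M N"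
  shows "c *\<^sub>C f \<in> Hom n M N"
  by (rule HomI)
    (simp_all add: scaleC_fun_def dmod_scale[OF assms(1)] Hom_in[OF assms(2)] Hom_add[OF assms(2)]
      Hom_scale[OF assms(2)] Hom_out[OF assms(2)] Hom_bmap[OF assms(2)] Hom_amap[OF assms(2)]
      scaleC_add_right scaleC_scaleC mult.commute dmod_bmap_scale[OF assms(1)] dmod_amap_scale[OF assms(1)]
      del: One_nat_def)

lemma Hom_uminus: "dmod n N \<Longrightarrow> f \<in> Hom n M N \<Longrightarrow> - f \<in> Hom n M N"
  using Hom_scaleC[of n N f M "-1"] by simp

lemma Hom_minus: "dmod n N \<Longrightarrow> f \<in> Hom n M N \<Longrightarrow> g \<in> Hom n M N \<Longrightarrow> f - g \<in> Hom n M N"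
  using Hom_plus[of n N f M "- g"] Hom_uminus[of n N g M] by simp

lemma Hom_sum: "dmod n N \<Longrightarrow> (\<And>k. k \<in> A \<Longrightarrow> f k \<in> Hom n M N) \<Longrightarrow> sum f A \<in> Hom n M N"
  by (induction A rule: infinite_finite_induct) (auto simp: Hom_zero Hom_plus)

lemma sum_hom_apply: "(sum f A) i x = (\<Sum>k\<in>A. f k i x)"
  by (induction A rule: infinite_finite_induct) auto

lemma hcomp_plus_left: "(f + g) \<circ>\<^sub>h h = (f \<circ>\<^sub>h h) + (g \<circ>\<^sub>h h)"
  by (simp add: hcomp_def fun_eq_iff)

lemma hcomp_uminus_left: "(- f) \<circ>\<^sub>h h = - (f \<circ>\<^sub>h h)"
  by (simp add: hcomp_def fun_eq_iff)

lemma hcomp_minus_left: "(f - g) \<circ>\<^sub>h h = (f \<circ>\<^sub>h h) - (g \<circ>\<^sub>h h)"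
  by (simp add: hcomp_def fun_eq_iff)

lemma hcomp_scaleC_left: "(c *\<^sub>C f) \<circ>\<^sub>h h = c *\<^sub>C (f \<circ>\<^sub>h h)"
  by (simp add: hcomp_def fun_eq_iff scaleC_fun_def)

lemma hcomp_zero_left: "0 \<circ>\<^sub>h f = 0"
  by (simp add: hcomp_def fun_eq_iff)

lemma hcomp_zero_right: "f \<in> Hom n M N \<Longrightarrow> f \<circ>\<^sub>h 0 = 0"
  by (simp add: hcomp_def fun_eq_iff Hom_0)

lemma hcomp_sum_left: "sum f A \<circ>\<^sub>h h = (\<Sum>k\<in>A. f k \<circ>\<^sub>h h)"
  by (intro ext) (simp add: hcomp_apply sum_hom_apply)

lemma hcomp_plus_right:
  assumes "f \<in> Hom n M N" "g \<in> Hom n W M" "h \<in> Hom n W M"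
  shows "f \<circ>\<^sub>h (g + h) = (f \<circ>\<^sub>h g) + (f \<circ>\<^sub>h h)"
proof (intro ext)
  fix i x
  show "(f \<circ>\<^sub>h (g + h)) i x = ((f \<circ>\<^sub>h g) + (f \<circ>\<^sub>h h)) i x"
    by (cases "x \<in> vsp W i")
      (simp_all add: hcomp_apply Hom_add[OF assms(1)] Hom_in[OF assms(2)] Hom_in[OF assms(3)]
        Hom_out[OF assms(2)] Hom_out[OF assms(3)] Hom_0[OF assms(1)])
qed

lemma hcomp_scaleC_right:
  assumes "f \<in> Hom n M N" "g \<in> Hom n W M"
  shows "f \<circ>\<^sub>h (c *\<^sub>C g) = c *\<^sub>C (f \<circ>\<^sub>h g)"
proof (intro ext)
  fix i x
  show "(f \<circ>\<^sub>h (c *\<^sub>C g)) i x = (c *\<^sub>C (f \<circ>\<^sub>h g)) i x"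
    by (cases "x \<in> vsp W i")
      (simp_all add: hcomp_apply scaleC_fun_def Hom_scale[OF assms(1)] Hom_in[OF assms(2)]
        Hom_out[OF assms(2)] Hom_0[OF assms(1)])
qed

lemma hcomp_uminus_right: "f \<in> Hom n M N \<Longrightarrow> g \<in> Hom n W M \<Longrightarrow> f \<circ>\<^sub>h (- g) = - (f \<circ>\<^sub>h g)"
  using hcomp_scaleC_right[of f n M N g W "-1"] by simp

lemma hcomp_minus_right:
  "dmod n M \<Longrightarrow> f \<in> Hom n M N \<Longrightarrow> g \<in> Hom n W M \<Longrightarrow> h \<in> Hom n W M \<Longrightarrow> f \<circ>\<^sub>h (g - h) = (f \<circ>\<^sub>h g) - (f \<circ>\<^sub>h h)"
  using hcomp_plus_right[of f n M N g W "- h"] hcomp_uminus_right[of f n M N h W] Hom_uminus[of n M h W]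
  by simp

lemma hcomp_sum_right:
  assumes "dmod n M" "f \<in> Hom n M N" "\<And>k. k \<in> A \<Longrightarrow> g k \<in> Hom n W M"
  shows "f \<circ>\<^sub>h sum g A = (\<Sum>k\<in>A. f \<circ>\<^sub>h g k)"
  using assms(3)
proof (induction A rule: infinite_finite_induct)
  case (insert k A)
  have "f \<circ>\<^sub>h (g k + sum g A) = (f \<circ>\<^sub>h g k) + (f \<circ>\<^sub>h sum g A)"
    using insert by (intro hcomp_plus_right[OF assms(2)] Hom_sum[OF assms(1)]) auto
  moreover have "f \<circ>\<^sub>h sum g A = (\<Sum>k\<in>A. f \<circ>\<^sub>h g k)"
    using insert by blast
  ultimately show ?case by (simp only: sum.insert[OF insert(1,2)])
qed (use hcomp_zero_right[OF assms(2)] in auto)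

text \<open>
  Inverses, factorisations through monomorphisms and epimorphisms, and maps defined by choosing
  preimages are all given by an additive relation between the two modules; only its totality and the
  uniqueness at \<open>0\<close> need an argument.
\<close>

lemma Hom_of_relation:
  assumes P: "dmod n P" and N: "dmod n N"
    and total: "\<And>i x. x \<in> vsp P i \<Longrightarrow> \<exists>y\<in>vsp N i. R i x y"
    and single: "\<And>i y. y \<in> vsp N i \<Longrightarrow> R i 0 y \<Longrightarrow> y = 0"
    and add: "\<And>i x y x' y'. x \<in> vsp P i \<Longrightarrow> y \<in> vsp N i \<Longrightarrow> x' \<in> vsp P i \<Longrightarrow> y' \<in> vsp N i \<Longrightarrow>
        R i x y \<Longrightarrow> R i x' y' \<Longrightarrow> R i (x + x') (y + y')"
    and scale: "\<And>i c x y. x \<in> vsp P i \<Longrightarrow> y \<in> vsp N i \<Longrightarrow> R i x y \<Longrightarrow> R i (c *\<^sub>C x) (c *\<^sub>C y)"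
    and b: "\<And>i x y. i \<in> {1..n-1} \<Longrightarrow> x \<in> vsp P (i-1) \<Longrightarrow> y \<in> vsp N (i-1) \<Longrightarrow> R (i-1) x y \<Longrightarrow>
        R i (bmap P i x) (bmap N i y)"
    and a: "\<And>i x y. i \<in> {1..n-1} \<Longrightarrow> x \<in> vsp P i \<Longrightarrow> y \<in> vsp N i \<Longrightarrow> R i x y \<Longrightarrow>
        R (i-1) (amap P i x) (amap N i y)"
  obtains h where "h \<in> Hom n P N" "\<And>i x y. x \<in> vsp P i \<Longrightarrow> y \<in> vsp N i \<Longrightarrow> R i x y \<longleftrightarrow> h i x = y"
proof -
  define h where "h = (\<lambda>i x. if x \<in> vsp P i then SOME y. y \<in> vsp N i \<and> R i x y else 0)"
  have h: "h i x \<in> vsp N i \<and> R i x (h i x)" if "x \<in> vsp P i" for i x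
    using someI_ex[of "\<lambda>y. y \<in> vsp N i \<and> R i x y"] total[OF that] that by (auto simp: h_def)
  have eq: "y = h i x" if "x \<in> vsp P i" "y \<in> vsp N i" "R i x y" for i x y
  proof -
    have "R i (x + (-1) *\<^sub>C x) (y + (-1) *\<^sub>C h i x)"
      using that h[OF that(1)] by (intro add scale dmod_scale[OF P] dmod_scale[OF N]) auto
    then have "R i 0 (y - h i x)" by simp
    then have "y - h i x = 0" using single that h dmod_diff[OF N] by blast
    then show ?thesis by simp
  qed
  have "h \<in> Hom n P N"
  proof (rule HomI)
    show "h i (x + y) = h i x + h i y" if "x \<in> vsp P i" "y \<in> vsp P i" for i x y
      using eq[of "x + y" i "h i x + h i y"] h that add dmod_add[OF P] dmod_add[OF N] by metis
    show "h i (c *\<^sub>C x) = c *\<^sub>C h i x" if "x \<in> vsp P i" for i c x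
      using eq[of "c *\<^sub>C x" i "c *\<^sub>C h i x"] h that scale dmod_scale[OF P] dmod_scale[OF N] by metis
    show "h i (bmap P i x) = bmap N i (h (i-1) x)" if "i \<in> {1..n-1}" "x \<in> vsp P (i-1)" for i x
      using eq[of "bmap P i x" i "bmap N i (h (i-1) x)"] h[OF that(2)] b[OF that]
        dmod_bmap_in[OF P that] dmod_bmap_in[OF N that(1)] by metis
    show "h (i-1) (amap P i x) = amap N i (h i x)" if "i \<in> {1..n-1}" "x \<in> vsp P i" for i x
      using eq[of "amap P i x" "i-1" "amap N i (h i x)"] h[OF that(2)] a[OF that]
        dmod_amap_in[OF P that] dmod_amap_in[OF N that(1)] by metis
  qed (auto simp: h, simp add: h_def)
  moreover have "R i x y \<longleftrightarrow> h i x = y" if "x \<in> vsp P i" "y \<in> vsp N i" for i x y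
    using eq h that by blast
  ultimately show ?thesis using that by blast
qed

lemma is_isoI:
  assumes M: "dmod n M" and N: "dmod n N" and f: "f \<in> Hom n M N"
    and inj: "\<And>i x. x \<in> vsp M i \<Longrightarrow> f i x = 0 \<Longrightarrow> x = 0"
    and surj: "\<And>i y. y \<in> vsp N i \<Longrightarrow> \<exists>x\<in>vsp M i. f i x = y"
  shows "is_iso n M N f"
proof -
  obtain g where g: "g \<in> Hom n N M" "\<And>i x y. x \<in> vsp N i \<Longrightarrow> y \<in> vsp M i \<Longrightarrow> f i y = x \<longleftrightarrow> g i x = y"
    by (rule Hom_of_relation[OF N M, of "\<lambda>i x y. f i y = x"])
      (use surj inj in \<open>auto simp: Hom_add[OF f] Hom_scale[OF f] Hom_bmap[OF f, simplified]
          Hom_amap[OF f, simplified]\<close>)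
  have "(g \<circ>\<^sub>h f) = hid M"
    by (rule Hom_eqI[OF Hom_hcomp[OF f g(1)] Hom_hid[OF M]])
      (metis g(2) Hom_in[OF f] hcomp_apply hid_apply)
  moreover have "(f \<circ>\<^sub>h g) = hid N"
    by (rule Hom_eqI[OF Hom_hcomp[OF g(1) f] Hom_hid[OF N]])
      (metis g(2) Hom_in[OF g(1)] hcomp_apply hid_apply)
  ultimately show ?thesis unfolding is_iso_def using f g(1) by blast
qed

lemma is_isoE:
  assumes "is_iso n M N f"
  obtains g where "f \<in> Hom n M N" "g \<in> Hom n N M" "g \<circ>\<^sub>h f = hid M" "f \<circ>\<^sub>h g = hid N"
  using assms unfolding is_iso_def by blast

lemma is_iso_inverse: "f \<in> Hom n M N \<Longrightarrow> g \<in> Hom n N M \<Longrightarrow> g \<circ>\<^sub>h f = hid M \<Longrightarrow> f \<circ>\<^sub>h g = hid N \<Longrightarrow> is_iso n M N f"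
  unfolding is_iso_def by blast

text \<open>If \<open>1 + vu\<close> is invertible with inverse \<open>w\<close>, then \<open>1 - uwv\<close> is inverse to \<open>1 + uv\<close>.\<close>

lemma iso_one_plus_swap:
  assumes M: "dmod n M" and N: "dmod n N" and u: "u \<in> Hom n M N" and v: "v \<in> Hom n N M"
    and iso: "is_iso n M M (hid M + (v \<circ>\<^sub>h u))"
  shows "is_iso n N N (hid N + (u \<circ>\<^sub>h v))"
proof -
  obtain w where w: "w \<in> Hom n M M" "w \<circ>\<^sub>h (hid M + (v \<circ>\<^sub>h u)) = hid M" "(hid M + (v \<circ>\<^sub>h u)) \<circ>\<^sub>h w = hid M"
    using iso by (elim is_isoE) blast
  have w1: "w + (w \<circ>\<^sub>h (v \<circ>\<^sub>h u)) = hid M"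
    using w(2) hcomp_plus_right[OF w(1) Hom_hid[OF M] Hom_hcomp[OF u v]] hcomp_hid_right[OF w(1)] by simp
  have w2: "w + (v \<circ>\<^sub>h (u \<circ>\<^sub>h w)) = hid M"
    using w(3) by (simp add: hcomp_plus_left hcomp_hid_left[OF w(1)] hcomp_assoc)
  have wv: "w \<circ>\<^sub>h v \<in> Hom n N M" and uw: "u \<circ>\<^sub>h w \<in> Hom n M N" and vu: "v \<circ>\<^sub>h u \<in> Hom n M M"
    and uv: "u \<circ>\<^sub>h v \<in> Hom n N N" and uwv: "u \<circ>\<^sub>h (w \<circ>\<^sub>h v) \<in> Hom n N N" and hu: "hid N \<in> Hom n N N"
    by (intro Hom_hcomp[OF v w(1)] Hom_hcomp[OF w(1) u] Hom_hcomp[OF u v] Hom_hcomp[OF v u]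
        Hom_hcomp[OF Hom_hcomp[OF v w(1)] u] Hom_hid[OF N])+
  have inner1: "(w \<circ>\<^sub>h v) + (v \<circ>\<^sub>h (u \<circ>\<^sub>h (w \<circ>\<^sub>h v))) = v"
    using arg_cong[OF w2, of "\<lambda>z. z \<circ>\<^sub>h v"] by (simp add: hcomp_plus_left hcomp_assoc hcomp_hid_left[OF v])
  have inner2: "(w \<circ>\<^sub>h v) + (w \<circ>\<^sub>h (v \<circ>\<^sub>h (u \<circ>\<^sub>h v))) = v"
    using arg_cong[OF w1, of "\<lambda>z. z \<circ>\<^sub>h v"] by (simp add: hcomp_plus_left hcomp_assoc hcomp_hid_left[OF v])
  have "(u \<circ>\<^sub>h (w \<circ>\<^sub>h v)) + (u \<circ>\<^sub>h (v \<circ>\<^sub>h (u \<circ>\<^sub>h (w \<circ>\<^sub>h v)))) = (u \<circ>\<^sub>h v)"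
    using hcomp_plus_right[OF u wv Hom_hcomp[OF uwv v]] inner1 by simp
  then have right: "(hid N + (u \<circ>\<^sub>h v)) \<circ>\<^sub>h (hid N - (u \<circ>\<^sub>h (w \<circ>\<^sub>h v))) = hid N"
    using hcomp_minus_right[OF N Hom_plus[OF N hu uv] hu uwv]
      hcomp_hid_right[OF Hom_plus[OF N hu uv]] hcomp_hid_left[OF uwv]
    by (simp add: hcomp_plus_left hcomp_assoc algebra_simps)
  have "(u \<circ>\<^sub>h (w \<circ>\<^sub>h v)) + (u \<circ>\<^sub>h (w \<circ>\<^sub>h (v \<circ>\<^sub>h (u \<circ>\<^sub>h v)))) = (u \<circ>\<^sub>h v)"
    using hcomp_plus_right[OF u wv Hom_hcomp[OF Hom_hcomp[OF uv v] w(1)]] inner2 by simp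
  then have e: "(u \<circ>\<^sub>h v) - ((u \<circ>\<^sub>h (w \<circ>\<^sub>h v)) \<circ>\<^sub>h (u \<circ>\<^sub>h v)) = (u \<circ>\<^sub>h (w \<circ>\<^sub>h v))"
    by (simp add: hcomp_assoc eq_diff_eq diff_eq_eq)
  have "(hid N - (u \<circ>\<^sub>h (w \<circ>\<^sub>h v))) \<circ>\<^sub>h (hid N + (u \<circ>\<^sub>h v)) =
      ((hid N - (u \<circ>\<^sub>h (w \<circ>\<^sub>h v))) \<circ>\<^sub>h hid N) + ((hid N - (u \<circ>\<^sub>h (w \<circ>\<^sub>h v))) \<circ>\<^sub>h (u \<circ>\<^sub>h v))"
    by (rule hcomp_plus_right[OF Hom_minus[OF N hu uwv] hu uv])
  also have "\<dots> = (hid N - (u \<circ>\<^sub>h (w \<circ>\<^sub>h v))) + ((u \<circ>\<^sub>h v) - ((u \<circ>\<^sub>h (w \<circ>\<^sub>h v)) \<circ>\<^sub>h (u \<circ>\<^sub>h v)))"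
    by (simp only: hcomp_hid_right[OF hu] hcomp_hid_right[OF uwv] hcomp_minus_left hcomp_hid_left[OF uv])
  also have "\<dots> = hid N" by (simp only: e) simp
  finally have left: "(hid N - (u \<circ>\<^sub>h (w \<circ>\<^sub>h v))) \<circ>\<^sub>h (hid N + (u \<circ>\<^sub>h v)) = hid N" .
  show ?thesis
    by (rule is_iso_inverse[OF Hom_plus[OF N hu uv] Hom_minus[OF N hu uwv] left right])
qed

section \<open>Direct sums, copies and retracts\<close>

lemma span_image_on:
  assumes "finite B" and add: "\<And>x y. x \<in> cvec.span B \<Longrightarrow> y \<in> cvec.span B \<Longrightarrow> f (x + y) = f x + f y"
    and scale: "\<And>c x. x \<in> cvec.span B \<Longrightarrow> f (c *\<^sub>C x) = c *\<^sub>C f x"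
  shows "f ` cvec.span B = cvec.span (f ` B)"
proof
  have f0: "f 0 = 0" using scale[OF cvec.span_zero, of 0] by simp
  have sum: "f (\<Sum>v\<in>A. u v *\<^sub>C v) = (\<Sum>v\<in>A. u v *\<^sub>C f v)" if "A \<subseteq> B" for u A
    using that
  proof (induction A rule: infinite_finite_induct)
    case (insert v A)
    have B: "w \<in> cvec.span B" if "w \<in> insert v A" for w
      using that insert.prems by (intro cvec.span_base) blast
    have "v \<in> cvec.span B" "u v *\<^sub>C v \<in> cvec.span B" "(\<Sum>v\<in>A. u v *\<^sub>C v) \<in> cvec.span B"
      by (intro cvec.span_sum cvec.span_scale B; simp)+
    then show ?case using insert add scale by (simp add: subset_iff)
  qed (simp_all add: f0)
  show "f ` cvec.span B \<subseteq> cvec.span (f ` B)"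
  proof
    fix y assume "y \<in> f ` cvec.span B"
    then obtain u where "y = f (\<Sum>v\<in>B. u v *\<^sub>C v)"
      unfolding cvec.span_finite[OF assms(1)] by blast
    then have "y = (\<Sum>v\<in>B. u v *\<^sub>C f v)" by (simp add: sum)
    also have "\<dots> \<in> cvec.span (f ` B)"
      by (intro cvec.span_sum cvec.span_scale cvec.span_base imageI)
    finally show "y \<in> cvec.span (f ` B)" .
  qed
  show "cvec.span (f ` B) \<subseteq> f ` cvec.span B"
  proof (rule cvec.span_minimal)
    show "f ` B \<subseteq> f ` cvec.span B" using cvec.span_base by blast
    show "cvec.subspace (f ` cvec.span B)"
      unfolding cvec.subspace_def
    proof (intro conjI ballI allI)
      show "0 \<in> f ` cvec.span B" using f0 cvec.span_zero by (metis imageI)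
      show "x + y \<in> f ` cvec.span B" if "x \<in> f ` cvec.span B" "y \<in> f ` cvec.span B" for x y
      proof -
        from that obtain u v where "u \<in> cvec.span B" "v \<in> cvec.span B" "x = f u" "y = f v" by blast
        then show ?thesis by (metis add cvec.span_add imageI)
      qed
      show "c *\<^sub>C x \<in> f ` cvec.span B" if "x \<in> f ` cvec.span B" for c x
      proof -
        from that obtain u where "u \<in> cvec.span B" "x = f u" by blast
        then show ?thesis by (metis scale cvec.span_scale imageI)
      qed
    qed
  qed
qed

lemma fin_dim_image:
  assumes "fin_dim_subspace V" and "\<And>x y. x \<in> V \<Longrightarrow> y \<in> V \<Longrightarrow> f (x + y) = f x + f y"
    and "\<And>c x. x \<in> V \<Longrightarrow> f (c *\<^sub>C x) = c *\<^sub>C f x"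
  shows "fin_dim_subspace (f ` V)"
proof -
  obtain B where B: "finite B" "V = cvec.span B" using assms(1) unfolding fin_dim_subspace_def by blast
  have "f ` cvec.span B = cvec.span (f ` B)"
    by (rule span_image_on[OF B(1)]) (simp_all add: assms(2,3)[unfolded B(2)])
  then show ?thesis unfolding fin_dim_subspace_def B(2) using B(1) by blast
qed

lemma fin_dim_subset:
  assumes "fin_dim_subspace V" "cvec.subspace W" "W \<subseteq> V"
  shows "fin_dim_subspace W"
proof -
  obtain C where C: "finite C" "V = cvec.span C" using assms(1) unfolding fin_dim_subspace_def by blast
  obtain B where B: "B \<subseteq> W" "cvec.independent B" "W \<subseteq> cvec.span B"
    by (rule cvec.basis_exists)
  have "B \<subseteq> cvec.span C" using B(1) assms(3) C(2) by (meson subset_trans)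
  then have "finite B" using cvec.independent_span_bound[OF C(1) B(2)] by simp
  moreover have "cvec.span B = W"
    by (rule subset_antisym[OF cvec.span_minimal[OF B(1) assms(2)] B(3)])
  ultimately show ?thesis unfolding fin_dim_subspace_def by blast
qed

lemma fin_dim_basis:
  assumes "fin_dim_subspace V"
  obtains B where "finite B" "cvec.independent B" "V = cvec.span B"
proof -
  obtain C where C: "finite C" "V = cvec.span C" using assms(1) unfolding fin_dim_subspace_def by blast
  obtain B where B: "B \<subseteq> V" "cvec.independent B" "V \<subseteq> cvec.span B"
    by (rule cvec.basis_exists)
  have le: "B \<subseteq> cvec.span C" using B(1) unfolding C(2) .
  have "finite B" by (rule conjunct1[OF cvec.independent_span_bound[OF C(1) B(2) le]])
  moreover have "V = cvec.span B"
    by (rule subset_antisym[OF B(3)]) (unfold C(2), rule cvec.span_minimal[OF le cvec.subspace_span])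
  ultimately show ?thesis using that[OF _ B(2)] by blast
qed

lemma dmodI:
  assumes "\<And>i. fin_dim_subspace (vsp M i)" and "\<And>i. i \<ge> n \<Longrightarrow> vsp M i = {0}"
    and "\<And>i x. i \<in> {1..n-1} \<Longrightarrow> x \<in> vsp M (i-1) \<Longrightarrow> bmap M i x \<in> vsp M i"
    and "\<And>i x y. i \<in> {1..n-1} \<Longrightarrow> x \<in> vsp M (i-1) \<Longrightarrow> y \<in> vsp M (i-1) \<Longrightarrow>
      bmap M i (x + y) = bmap M i x + bmap M i y"
    and "\<And>i c x. i \<in> {1..n-1} \<Longrightarrow> x \<in> vsp M (i-1) \<Longrightarrow> bmap M i (c *\<^sub>C x) = c *\<^sub>C bmap M i x"
    and "\<And>i x. i \<in> {1..n-1} \<Longrightarrow> x \<in> vsp M i \<Longrightarrow> amap M i x \<in> vsp M (i-1)"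
    and "\<And>i x y. i \<in> {1..n-1} \<Longrightarrow> x \<in> vsp M i \<Longrightarrow> y \<in> vsp M i \<Longrightarrow>
      amap M i (x + y) = amap M i x + amap M i y"
    and "\<And>i c x. i \<in> {1..n-1} \<Longrightarrow> x \<in> vsp M i \<Longrightarrow> amap M i (c *\<^sub>C x) = c *\<^sub>C amap M i x"
    and "\<And>x. x \<in> vsp M (n-1) \<Longrightarrow> bmap M (n-1) (amap M (n-1) x) = 0"
    and "\<And>i x. i \<in> {2..n-1} \<Longrightarrow> x \<in> vsp M (i-1) \<Longrightarrow>
      amap M i (bmap M i x) = bmap M (i-1) (amap M (i-1) x)"
  shows "dmod n M"
  unfolding dmod_def linear_between_def
  by (intro conjI allI impI ballI; rule assms; assumption)

lemma
  assumes "dmod n M"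
  shows dmod_fin_dim: "fin_dim_subspace (vsp M i)"
    and dmod_top: "x \<in> vsp M (n-1) \<Longrightarrow> bmap M (n-1) (amap M (n-1) x) = 0"
    and dmod_mesh: "i \<in> {2..n-1} \<Longrightarrow> x \<in> vsp M (i-1) \<Longrightarrow> amap M i (bmap M i x) = bmap M (i-1) (amap M (i-1) x)"
  using assms unfolding dmod_def by blast+

lemma submodule_dmod:
  assumes M: "dmod n M" and sub: "\<And>i. cvec.subspace (U i)" and le: "\<And>i. U i \<subseteq> vsp M i"
    and b: "\<And>i x. i \<in> {1..n-1} \<Longrightarrow> x \<in> U (i-1) \<Longrightarrow> bmap M i x \<in> U i"
    and a: "\<And>i x. i \<in> {1..n-1} \<Longrightarrow> x \<in> U i \<Longrightarrow> amap M i x \<in> U (i-1)"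
  shows "dmod n (subrep M U)"
proof -
  have "U i = {0}" if "n \<le> i" for i
    using le[of i] dmod_outside[OF M that] cvec.subspace_0[OF sub, of i] by blast
  then show ?thesis
    by (intro dmodI)
      (simp_all add: subrep_def fin_dim_subset[OF dmod_fin_dim[OF M] sub le] b a subsetD[OF le]
        dmod_bmap_add[OF M] dmod_bmap_scale[OF M] dmod_amap_add[OF M] dmod_amap_scale[OF M]
        dmod_top[OF M] dmod_mesh[OF M] del: One_nat_def)
qed

lemma dsum_simps [simp]:
  "vsp (M \<oplus>\<^sub>r N) i = vsp M i \<times> vsp N i"
  "bmap (M \<oplus>\<^sub>r N) i = map_prod (bmap M i) (bmap N i)"
  "amap (M \<oplus>\<^sub>r N) i = map_prod (amap M i) (amap N i)"
  by (simp_all add: dsum_def)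

lemma fin_dim_times:
  assumes "fin_dim_subspace V" "fin_dim_subspace W"
  shows "fin_dim_subspace (V \<times> W)"
proof -
  have "fin_dim_subspace ((\<lambda>x. (x, 0 :: 'b)) ` V)"
    by (rule fin_dim_image[OF assms(1)]) (simp_all add: scaleC_prod_def)
  moreover have "fin_dim_subspace ((\<lambda>y. (0 :: 'a, y)) ` W)"
    by (rule fin_dim_image[OF assms(2)]) (simp_all add: scaleC_prod_def)
  ultimately obtain B C where *: "finite B" "(\<lambda>x. (x, 0 :: 'b)) ` V = cvec.span B"
    "finite C" "(\<lambda>y. (0 :: 'a, y)) ` W = cvec.span C" unfolding fin_dim_subspace_def by blast
  have "V \<times> W = cvec.span (B \<union> C)"
    unfolding cvec.span_Un *(2,4)[symmetric] by (auto simp: image_iff)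
  then show ?thesis using * unfolding fin_dim_subspace_def by (metis finite_Un)
qed

lemma dmod_dsum:
  assumes M: "dmod n M" and N: "dmod n N"
  shows "dmod n (M \<oplus>\<^sub>r N)"
proof (rule dmodI)
  show "vsp (M \<oplus>\<^sub>r N) i = {0}" if "n \<le> i" for i
    using that by (simp add: dmod_outside[OF M] dmod_outside[OF N] zero_prod_def)
qed (use M N in \<open>auto simp: fin_dim_times dmod_fin_dim scaleC_prod_def zero_prod_def dmod_top dmod_mesh
      dmod_bmap_in dmod_amap_in dmod_bmap_add dmod_amap_add dmod_bmap_scale dmod_amap_scale
      simp del: One_nat_def atLeastAtMost_iff\<close>)

definition hinl :: "'v::complex_vector rep \<Rightarrow> 'w::complex_vector rep \<Rightarrow> nat \<Rightarrow> 'v \<Rightarrow> 'v \<times> 'w" where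
  "hinl M N = (\<lambda>i x. if x \<in> vsp M i then (x, 0) else 0)"

definition hinr :: "'v::complex_vector rep \<Rightarrow> 'w::complex_vector rep \<Rightarrow> nat \<Rightarrow> 'w \<Rightarrow> 'v \<times> 'w" where
  "hinr M N = (\<lambda>i x. if x \<in> vsp N i then (0, x) else 0)"

definition hfst :: "'v::complex_vector rep \<Rightarrow> 'w::complex_vector rep \<Rightarrow> nat \<Rightarrow> 'v \<times> 'w \<Rightarrow> 'v" where
  "hfst M N = (\<lambda>i x. if x \<in> vsp (M \<oplus>\<^sub>r N) i then fst x else 0)"

definition hsnd :: "'v::complex_vector rep \<Rightarrow> 'w::complex_vector rep \<Rightarrow> nat \<Rightarrow> 'v \<times> 'w \<Rightarrow> 'w" where
  "hsnd M N = (\<lambda>i x. if x \<in> vsp (M \<oplus>\<^sub>r N) i then snd x else 0)"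

context
  fixes n :: nat and M :: "'v::complex_vector rep" and N :: "'w::complex_vector rep"
  assumes M: "dmod n M" and N: "dmod n N"
begin

lemma Hom_hinl: "hinl M N \<in> Hom n M (M \<oplus>\<^sub>r N)"
  by (rule HomI)
    (simp_all add: hinl_def dmod_0[OF N] dmod_add[OF M] dmod_scale[OF M] dmod_bmap_in[OF M] dmod_amap_in[OF M]
      scaleC_prod_def dmod_bmap_0[OF N] dmod_amap_0[OF N] del: One_nat_def)

lemma Hom_hinr: "hinr M N \<in> Hom n N (M \<oplus>\<^sub>r N)"
  by (rule HomI)
    (simp_all add: hinr_def dmod_0[OF M] dmod_add[OF N] dmod_scale[OF N] dmod_bmap_in[OF N] dmod_amap_in[OF N]
      scaleC_prod_def dmod_bmap_0[OF M] dmod_amap_0[OF M] del: One_nat_def)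

lemma Hom_hfst: "hfst M N \<in> Hom n (M \<oplus>\<^sub>r N) M"
  by (rule HomI)
    (auto simp add: hfst_def dmod_add[OF N] dmod_scale[OF N] dmod_bmap_in[OF N] dmod_amap_in[OF N]
     dmod_add[OF M] dmod_scale[OF M] dmod_bmap_in[OF M] dmod_amap_in[OF M]
      scaleC_prod_def simp del: One_nat_def)

lemma Hom_hsnd: "hsnd M N \<in> Hom n (M \<oplus>\<^sub>r N) N"
  by (rule HomI)
    (auto simp add: hsnd_def dmod_add[OF N] dmod_scale[OF N] dmod_bmap_in[OF N] dmod_amap_in[OF N]
     dmod_add[OF M] dmod_scale[OF M] dmod_bmap_in[OF M] dmod_amap_in[OF M]
      scaleC_prod_def simp del: One_nat_def)

lemma hfst_hinl: "hfst M N \<circ>\<^sub>h hinl M N = hid M"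
  by (auto simp: fun_eq_iff hcomp_def hfst_def hinl_def hid_def dmod_0[OF N])

lemma hsnd_hinr: "hsnd M N \<circ>\<^sub>h hinr M N = hid N"
  by (auto simp: fun_eq_iff hcomp_def hsnd_def hinr_def hid_def dmod_0[OF M])

lemma hfst_hinr: "hfst M N \<circ>\<^sub>h hinr M N = 0"
  by (auto simp: fun_eq_iff hcomp_def hfst_def hinr_def)

lemma hsnd_hinl: "hsnd M N \<circ>\<^sub>h hinl M N = 0"
  by (auto simp: fun_eq_iff hcomp_def hsnd_def hinl_def)

lemma hin_hpr_sum: "(hinl M N \<circ>\<^sub>h hfst M N) + (hinr M N \<circ>\<^sub>h hsnd M N) = hid (M \<oplus>\<^sub>r N)"
  by (auto simp: fun_eq_iff hcomp_def hfst_def hinl_def hsnd_def hinr_def hid_def zero_prod_def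
      dmod_0[OF M] dmod_0[OF N])

end

lemma big_dsum_simps:
  "vsp (big_dsum K M) i = {f. (\<forall>k\<in>K. f k \<in> vsp (M k) i) \<and> (\<forall>k. k \<notin> K \<longrightarrow> f k = 0)}"
  "bmap (big_dsum K M) i f k = (if k \<in> K then bmap (M k) i (f k) else 0)"
  "amap (big_dsum K M) i f k = (if k \<in> K then amap (M k) i (f k) else 0)"
  by (simp_all add: big_dsum_def)

lemma fin_dim_big:
  assumes K: "finite K" and V: "\<And>k. k \<in> K \<Longrightarrow> fin_dim_subspace (V k)"
  shows "fin_dim_subspace {f. (\<forall>k\<in>K. f k \<in> V k) \<and> (\<forall>k. k \<notin> K \<longrightarrow> f k = 0)}" (is "fin_dim_subspace ?W")
proof -
  have subV: "cvec.subspace (V k)" if "k \<in> K" for k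
    using V[OF that] unfolding fin_dim_subspace_def by (metis cvec.subspace_span)
  have "\<forall>k\<in>K. \<exists>B. finite B \<and> (\<lambda>x l. if l = k then x else 0) ` V k = cvec.span B"
  proof
    fix k assume "k \<in> K"
    then have "fin_dim_subspace ((\<lambda>x l. if l = k then x else 0) ` V k)"
      by (intro fin_dim_image[OF V]) (auto simp: scaleC_fun_def fun_eq_iff)
    then show "\<exists>B. finite B \<and> (\<lambda>x l. if l = k then x else 0) ` V k = cvec.span B"
      unfolding fin_dim_subspace_def by blast
  qed
  then obtain B where B: "\<And>k. k \<in> K \<Longrightarrow> finite (B k)"
    "\<And>k. k \<in> K \<Longrightarrow> (\<lambda>x l. if l = k then x else 0) ` V k = cvec.span (B k)" by metis
  have W: "cvec.subspace ?W"
    using subV by (auto simp: cvec.subspace_def scaleC_fun_def)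
  have "?W = cvec.span (\<Union>k\<in>K. B k)"
  proof
    show "cvec.span (\<Union>k\<in>K. B k) \<subseteq> ?W"
    proof (rule cvec.span_minimal[OF _ W], rule)
      fix f assume "f \<in> (\<Union>k\<in>K. B k)"
      then obtain k where k: "k \<in> K" "f \<in> B k" by blast
      then have "f \<in> (\<lambda>x l. if l = k then x else 0) ` V k" using B(2)[OF k(1)] cvec.span_base by blast
      then show "f \<in> ?W" using k cvec.subspace_0[OF subV] by (auto split: if_splits)
    qed
    show "?W \<subseteq> cvec.span (\<Union>k\<in>K. B k)"
    proof
      fix f assume f: "f \<in> ?W"
      have "f = (\<Sum>k\<in>K. (\<lambda>l. if l = k then f k else 0))"
        using f K by (auto simp: fun_eq_iff sum_fun_apply)
      also have "\<dots> \<in> cvec.span (\<Union>k\<in>K. B k)"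
      proof (rule cvec.span_sum)
        fix k assume k: "k \<in> K"
        then have "(\<lambda>l. if l = k then f k else 0) \<in> cvec.span (B k)"
          unfolding B(2)[OF k, symmetric] using f by blast
        then show "(\<lambda>l. if l = k then f k else 0) \<in> cvec.span (\<Union>k\<in>K. B k)"
          using cvec.span_mono[of "B k" "\<Union>k\<in>K. B k"] k by blast
      qed
      finally show "f \<in> cvec.span (\<Union>k\<in>K. B k)" .
    qed
  qed
  moreover have "finite (\<Union>k\<in>K. B k)" using K B(1) by simp
  ultimately show ?thesis unfolding fin_dim_subspace_def by (intro exI conjI)
qed

lemma dmod_big_dsum:
  assumes K: "finite K" and M: "\<And>k. k \<in> K \<Longrightarrow> dmod n (M k)"
  shows "dmod n (big_dsum K M)"
proof (rule dmodI)
  show "fin_dim_subspace (vsp (big_dsum K M) i)" for i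
    unfolding big_dsum_simps by (rule fin_dim_big[OF K dmod_fin_dim[OF M]])
  show "vsp (big_dsum K M) i = {0}" if "n \<le> i" for i
    using dmod_outside[OF M that] unfolding big_dsum_simps by (force simp: fun_eq_iff)
  show "bmap (big_dsum K M) i (x + y) = bmap (big_dsum K M) i x + bmap (big_dsum K M) i y"
    if "i \<in> {1..n - 1}" "x \<in> vsp (big_dsum K M) (i - 1)" "y \<in> vsp (big_dsum K M) (i - 1)" for i x y
    by (rule ext) (use that dmod_bmap_add[OF M] in \<open>simp add: big_dsum_simps del: One_nat_def\<close>)
  show "amap (big_dsum K M) i (x + y) = amap (big_dsum K M) i x + amap (big_dsum K M) i y"
    if "i \<in> {1..n - 1}" "x \<in> vsp (big_dsum K M) i" "y \<in> vsp (big_dsum K M) i" for i x y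
    by (rule ext) (use that dmod_amap_add[OF M] in \<open>simp add: big_dsum_simps del: One_nat_def\<close>)
  show "bmap (big_dsum K M) i (c *\<^sub>C x) = c *\<^sub>C bmap (big_dsum K M) i x"
    if "i \<in> {1..n - 1}" "x \<in> vsp (big_dsum K M) (i - 1)" for i c x
    by (rule ext) (use that dmod_bmap_scale[OF M] in \<open>simp add: big_dsum_simps scaleC_fun_def del: One_nat_def\<close>)
  show "amap (big_dsum K M) i (c *\<^sub>C x) = c *\<^sub>C amap (big_dsum K M) i x"
    if "i \<in> {1..n - 1}" "x \<in> vsp (big_dsum K M) i" for i c x
    by (rule ext) (use that dmod_amap_scale[OF M] in \<open>simp add: big_dsum_simps scaleC_fun_def del: One_nat_def\<close>)
  show "bmap (big_dsum K M) (n - 1) (amap (big_dsum K M) (n - 1) x) = 0"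
    if "x \<in> vsp (big_dsum K M) (n - 1)" for x
    by (rule ext) (use that dmod_top[OF M] in \<open>simp add: big_dsum_simps del: One_nat_def\<close>)
  show "amap (big_dsum K M) i (bmap (big_dsum K M) i x) = bmap (big_dsum K M) (i - 1) (amap (big_dsum K M) (i - 1) x)"
    if "i \<in> {2..n - 1}" "x \<in> vsp (big_dsum K M) (i - 1)" for i x
    by (rule ext) (use that dmod_mesh[OF M] in \<open>simp add: big_dsum_simps del: One_nat_def\<close>)
qed (use dmod_bmap_in[OF M] dmod_amap_in[OF M] in \<open>simp_all add: big_dsum_simps del: One_nat_def\<close>)

definition hin :: "'k set \<Rightarrow> ('k \<Rightarrow> 'v::complex_vector rep) \<Rightarrow> 'k \<Rightarrow> nat \<Rightarrow> 'v \<Rightarrow> 'k \<Rightarrow> 'v" where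
  "hin K M k = (\<lambda>i x l. if l = k \<and> x \<in> vsp (M k) i then x else 0)"

definition hpr :: "'k set \<Rightarrow> ('k \<Rightarrow> 'v::complex_vector rep) \<Rightarrow> 'k \<Rightarrow> nat \<Rightarrow> ('k \<Rightarrow> 'v) \<Rightarrow> 'v" where
  "hpr K M k = (\<lambda>i f. if f \<in> vsp (big_dsum K M) i then f k else 0)"

context
  fixes n :: nat and K :: "'k set" and M :: "'k \<Rightarrow> 'v::complex_vector rep"
  assumes K: "finite K" and M: "\<And>k. k \<in> K \<Longrightarrow> dmod n (M k)"
begin

lemma Hom_hin: "k \<in> K \<Longrightarrow> hin K M k \<in> Hom n (M k) (big_dsum K M)"
  by (rule HomI)
    (auto simp: big_dsum_simps hin_def fun_eq_iff dmod_0[OF M] dmod_add[OF M] dmod_scale[OF M]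
      dmod_bmap_in[OF M] dmod_amap_in[OF M] scaleC_fun_def dmod_bmap_0[OF M] dmod_amap_0[OF M]
      simp del: One_nat_def)

lemma Hom_hpr: "k \<in> K \<Longrightarrow> hpr K M k \<in> Hom n (big_dsum K M) (M k)"
  by (rule HomI)
    (auto simp: big_dsum_simps hpr_def fun_eq_iff dmod_0[OF M] dmod_add[OF M] dmod_scale[OF M]
      dmod_bmap_in[OF M] dmod_amap_in[OF M] scaleC_fun_def
      simp del: One_nat_def)

lemma hpr_hin: "k \<in> K \<Longrightarrow> hpr K M k \<circ>\<^sub>h hin K M k = hid (M k)"
  by (auto simp: fun_eq_iff hcomp_def hpr_def hin_def hid_def big_dsum_simps dmod_0[OF M])

lemma hpr_hin_neq: "k \<noteq> l \<Longrightarrow> hpr K M l \<circ>\<^sub>h hin K M k = 0"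
  by (auto simp: fun_eq_iff hcomp_def hpr_def hin_def)

lemma hin_hpr_big_sum: "(\<Sum>k\<in>K. hin K M k \<circ>\<^sub>h hpr K M k) = hid (big_dsum K M)"
proof (intro ext)
  fix i f l
  have "(\<Sum>k\<in>K. hin K M k \<circ>\<^sub>h hpr K M k) i f l = (\<Sum>k\<in>K. hin K M k i (hpr K M k i f) l)"
    by (simp add: sum_hom_apply sum_fun_apply hcomp_apply)
  also have "\<dots> = hid (big_dsum K M) i f l"
  proof (cases "f \<in> vsp (big_dsum K M) i")
    case True
    then have "(\<Sum>k\<in>K. hin K M k i (hpr K M k i f) l) = (\<Sum>k\<in>K. if k = l then f l else 0)"
      by (intro sum.cong) (auto simp: hin_def hpr_def big_dsum_simps)
    then show ?thesis using True K by (auto simp: hid_def big_dsum_simps)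
  qed (simp add: hin_def hpr_def hid_def)
  finally show "(\<Sum>k\<in>K. hin K M k \<circ>\<^sub>h hpr K M k) i f l = hid (big_dsum K M) i f l" .
qed

end

text \<open>Every module is isomorphic to one carried by the standard ambient space: take coordinates.\<close>

lemma univ_copy:
  fixes M :: "'v::complex_vector rep"
  assumes M: "dmod n M"
  obtains M' :: "univ rep" and \<phi> where "dmod n M'" "is_iso n M M' \<phi>"
proof -
  have "\<exists>\<phi> :: 'v \<Rightarrow> univ. (\<forall>x\<in>vsp M i. \<forall>y\<in>vsp M i. \<phi> (x + y) = \<phi> x + \<phi> y) \<and>
     (\<forall>c. \<forall>x\<in>vsp M i. \<phi> (c *\<^sub>C x) = c *\<^sub>C \<phi> x) \<and> (\<forall>x\<in>vsp M i. \<phi> x = 0 \<longrightarrow> x = 0)" for i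
  proof -
    obtain B where B: "finite B" "cvec.independent B" "vsp M i = cvec.span B"
      by (rule fin_dim_basis[OF dmod_fin_dim[OF M]])
    obtain e where e: "bij_betw e {..<card B} B"
      using ex_bij_betw_nat_finite[OF B(1)] by (metis atLeast0LessThan)
    define \<phi> :: "'v \<Rightarrow> univ" where "\<phi> = (\<lambda>v k. cvec.representation B v (e k))"
    have zero: "x = 0" if x: "x \<in> cvec.span B" "\<phi> x = 0" for x
    proof -
      have "cvec.representation B x b = 0" if b: "b \<in> B" for b
      proof -
        have "b \<in> e ` {..<card B}" using bij_betw_imp_surj_on[OF e] b by simp
        then obtain k where k: "b = e k" by (rule imageE)
        have "cvec.representation B x (e k) = 0" using fun_cong[OF x(2), of k] by (simp add: \<phi>_def)
        then show ?thesis unfolding k .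
      qed
      moreover have "(\<Sum>b\<in>B. cvec.representation B x b *\<^sub>C b) = x"
        by (rule cvec.sum_representation_eq[OF B(2) x(1) B(1)]) simp
      ultimately show ?thesis by simp
    qed
    show ?thesis
      unfolding B(3)
      by (intro exI[of _ \<phi>] conjI ballI allI impI zero; simp add: \<phi>_def fun_eq_iff
          cvec.representation_add[OF B(2)] cvec.representation_scale[OF B(2)] scaleC_fun_def scaleC_complex_def)
  qed
  then obtain \<phi> :: "nat \<Rightarrow> 'v \<Rightarrow> univ" where
    add: "\<And>i x y. x \<in> vsp M i \<Longrightarrow> y \<in> vsp M i \<Longrightarrow> \<phi> i (x + y) = \<phi> i x + \<phi> i y" and
    scale: "\<And>i c x. x \<in> vsp M i \<Longrightarrow> \<phi> i (c *\<^sub>C x) = c *\<^sub>C \<phi> i x" and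
    zero: "\<And>i x. x \<in> vsp M i \<Longrightarrow> \<phi> i x = 0 \<Longrightarrow> x = 0" by metis
  define \<psi> where "\<psi> = (\<lambda>i. inv_into (vsp M i) (\<phi> i))"
  have inj: "inj_on (\<phi> i) (vsp M i)" for i
  proof (rule inj_onI)
    fix x y assume *: "x \<in> vsp M i" "y \<in> vsp M i" "\<phi> i x = \<phi> i y"
    have "\<phi> i (x + (-1) *\<^sub>C y) = 0"
      using * add[of x i "(-1) *\<^sub>C y"] scale[of y i "-1"] dmod_scale[OF M, of y i "-1"] by simp
    then have "x + (-1) *\<^sub>C y = 0" using * dmod_add[OF M] dmod_scale[OF M] zero by blast
    then show "x = y" by simp
  qed
  then have inv: "\<psi> i (\<phi> i x) = x" if "x \<in> vsp M i" for i x
    using that by (simp add: \<psi>_def)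
  have phi0: "\<phi> i 0 = 0" for i using scale[of 0 i 0] dmod_0[OF M] by simp
  define M' where "M' = \<lparr>vsp = (\<lambda>i. \<phi> i ` vsp M i), bmap = (\<lambda>i y. if i = 0 then 0 else \<phi> i (bmap M i (\<psi> (i-1) y))),
     amap = (\<lambda>i y. \<phi> (i-1) (amap M i (\<psi> i y)))\<rparr>"
  have rev: "\<And>i x y. x \<in> vsp M i \<Longrightarrow> y \<in> vsp M i \<Longrightarrow> \<phi> i x + \<phi> i y = \<phi> i (x + y)"
    "\<And>i c x. x \<in> vsp M i \<Longrightarrow> c *\<^sub>C \<phi> i x = \<phi> i (c *\<^sub>C x)"
    using add scale by auto
  have M': "dmod n M'"
  proof (rule dmodI)
    show "fin_dim_subspace (vsp M' i)" for i
      unfolding M'_def by (simp add: fin_dim_image[OF dmod_fin_dim[OF M] add scale])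
    show "vsp M' i = {0}" if "n \<le> i" for i
      using dmod_outside[OF M that] phi0 by (simp add: M'_def)
    show "amap M' i (bmap M' i x) = bmap M' (i - 1) (amap M' (i - 1) x)"
      if i: "i \<in> {2..n - 1}" and x: "x \<in> vsp M' (i - 1)" for i x
    proof -
      obtain y where y: "y \<in> vsp M (i-1)" "x = \<phi> (i-1) y" using x by (auto simp: M'_def)
      have *: "i \<in> {1..n-1}" "i - 1 \<in> {1..n-1}" "i \<noteq> 0" "\<not> i \<le> 1" using i by auto
      show ?thesis
        using y *(3,4) dmod_mesh[OF M i y(1)] dmod_bmap_in[OF M *(1) y(1)] dmod_amap_in[OF M *(2) y(1)]
        by (simp add: M'_def inv del: One_nat_def)
    qed
    show "bmap M' (n - 1) (amap M' (n - 1) x) = 0" if x: "x \<in> vsp M' (n - 1)" for x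
    proof (cases "n \<ge> 2")
      case True
      obtain y where y: "y \<in> vsp M (n-1)" "x = \<phi> (n-1) y" using x by (auto simp: M'_def)
      then show ?thesis using True dmod_top[OF M y(1)] dmod_amap_in[OF M, of "n-1" y]
        by (simp add: M'_def inv phi0 del: One_nat_def)
    next
      case False
      then have "n - 1 = 0" by simp
      then show ?thesis by (simp add: M'_def)
    qed
    note simps = inv dmod_add[OF M] dmod_scale[OF M] dmod_bmap_in[OF M] dmod_amap_in[OF M]
      dmod_bmap_add[OF M] dmod_amap_add[OF M] dmod_bmap_scale[OF M] dmod_amap_scale[OF M]
    show "bmap M' i (x + y) = bmap M' i x + bmap M' i y"
      if h: "i \<in> {1..n - 1}" "x \<in> vsp M' (i - 1)" "y \<in> vsp M' (i - 1)" for i x y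
    proof -
      obtain u v where "u \<in> vsp M (i-1)" "x = \<phi> (i-1) u" "v \<in> vsp M (i-1)" "y = \<phi> (i-1) v"
        using h(2,3) by (auto simp: M'_def)
      then show ?thesis using h(1) by (simp add: M'_def rev(1) simps del: One_nat_def)
    qed
    show "amap M' i (x + y) = amap M' i x + amap M' i y"
      if h: "i \<in> {1..n - 1}" "x \<in> vsp M' i" "y \<in> vsp M' i" for i x y
    proof -
      obtain u v where "u \<in> vsp M i" "x = \<phi> i u" "v \<in> vsp M i" "y = \<phi> i v"
        using h(2,3) by (auto simp: M'_def)
      then show ?thesis using h(1) by (simp add: M'_def rev(1) simps del: One_nat_def)
    qed
    show "bmap M' i (c *\<^sub>C x) = c *\<^sub>C bmap M' i x"
      if h: "i \<in> {1..n - 1}" "x \<in> vsp M' (i - 1)" for i c x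
    proof -
      obtain u where "u \<in> vsp M (i-1)" "x = \<phi> (i-1) u" using h(2) by (auto simp: M'_def)
      then show ?thesis using h(1) by (simp add: M'_def rev(2) simps del: One_nat_def)
    qed
    show "amap M' i (c *\<^sub>C x) = c *\<^sub>C amap M' i x"
      if h: "i \<in> {1..n - 1}" "x \<in> vsp M' i" for i c x
    proof -
      obtain u where "u \<in> vsp M i" "x = \<phi> i u" using h(2) by (auto simp: M'_def)
      then show ?thesis using h(1) by (simp add: M'_def rev(2) simps del: One_nat_def)
    qed
  qed (auto simp: M'_def inv dmod_bmap_in[OF M] dmod_amap_in[OF M] simp del: One_nat_def)
  define f where "f = (\<lambda>i x. if x \<in> vsp M i then \<phi> i x else 0)"
  have f: "f \<in> Hom n M M'"
    by (rule HomI)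
      (auto simp: f_def M'_def inv dmod_add[OF M] dmod_scale[OF M] dmod_bmap_in[OF M]
        dmod_amap_in[OF M] add scale simp del: One_nat_def)
  have "is_iso n M M' f"
    by (rule is_isoI[OF M M' f]) (auto simp: f_def M'_def intro: zero)
  then show ?thesis by (rule that[OF M'])
qed

lemma ker_dmod:
  assumes X: "dmod n X" and M: "dmod n M" and p: "p \<in> Hom n X M"
  shows "dmod n (subrep X (\<lambda>i. {x \<in> vsp X i. p i x = 0}))"
proof (rule submodule_dmod[OF X])
  show "cvec.subspace {x \<in> vsp X i. p i x = 0}" for i
    by (auto simp: cvec.subspace_def dmod_0[OF X] dmod_add[OF X] dmod_scale[OF X] Hom_0[OF p]
        Hom_add[OF p] Hom_scale[OF p])
qed (auto simp: dmod_bmap_in[OF X] dmod_amap_in[OF X] Hom_bmap[OF p] Hom_amap[OF p]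
    dmod_bmap_0[OF M] dmod_amap_0[OF M] simp del: One_nat_def)

text \<open>
  The complement of a retract \<open>M\<close> of \<open>X\<close> is the kernel of the retraction, and \<open>x\<close> splits as
  \<open>\<iota> (p x)\<close> and \<open>x - \<iota> (p x)\<close>.
\<close>

lemma summandI:
  assumes M: "dmod n M" and X: "dmod n X" and \<iota>: "\<iota> \<in> Hom n M X" and p: "p \<in> Hom n X M"
    and id: "p \<circ>\<^sub>h \<iota> = hid M"
  shows "summand n M X"
proof -
  define N0 where "N0 = subrep X (\<lambda>i. {x \<in> vsp X i. p i x = 0})"
  have N0: "dmod n N0" unfolding N0_def by (rule ker_dmod[OF X M p])
  have vN0: "vsp N0 i = {x \<in> vsp X i. p i x = 0}" for i by (simp add: N0_def subrep_def)
  obtain N :: "univ rep" and \<phi> where N: "dmod n N" "is_iso n N0 N \<phi>" using univ_copy[OF N0] .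
  obtain \<psi> where \<phi>: "\<phi> \<in> Hom n N0 N" and \<psi>: "\<psi> \<in> Hom n N N0" and
    inv: "\<psi> \<circ>\<^sub>h \<phi> = hid N0" "\<phi> \<circ>\<^sub>h \<psi> = hid N" using N(2) by (rule is_isoE)
  have id': "p i (\<iota> i x) = x" if "x \<in> vsp M i" for i x
    using fun_cong[OF fun_cong[OF id], of i x] that by (simp add: hcomp_apply hid_apply)
  define q where "q = (\<lambda>i x. if x \<in> vsp X i then x - \<iota> i (p i x) else 0)"
  have q_in: "q i x \<in> vsp N0 i" if "x \<in> vsp X i" for i x
    using that Hom_in[OF p that] dmod_diff[OF X] Hom_in[OF \<iota>] Hom_diff[OF X p] id'
    by (simp add: vN0 q_def)
  have q: "q \<in> Hom n X N0"
  proof (rule HomI)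
    show "q i (bmap X i x) = bmap N0 i (q (i - 1) x)" if "i \<in> {1..n - 1}" "x \<in> vsp X (i - 1)" for i x
    proof -
      have "bmap X i (x + - \<iota> (i-1) (p (i-1) x)) = bmap X i x + bmap X i (- \<iota> (i-1) (p (i-1) x))"
        by (intro dmod_bmap_add[OF X that] dmod_neg[OF X] Hom_in[OF \<iota>] Hom_in[OF p] that)
      also have "bmap X i (- \<iota> (i-1) (p (i-1) x)) = - bmap X i (\<iota> (i-1) (p (i-1) x))"
        using dmod_bmap_scale[OF X that(1) Hom_in[OF \<iota> Hom_in[OF p that(2)]], of "-1"] by simp
      finally show ?thesis
        using that by (simp add: q_def N0_def subrep_def dmod_bmap_in[OF X] Hom_bmap[OF p] Hom_bmap[OF \<iota>]
            Hom_in[OF p] del: One_nat_def)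
    qed
    show "q (i - 1) (amap X i x) = amap N0 i (q i x)" if "i \<in> {1..n - 1}" "x \<in> vsp X i" for i x
    proof -
      have "amap X i (x + - \<iota> i (p i x)) = amap X i x + amap X i (- \<iota> i (p i x))"
        by (intro dmod_amap_add[OF X that] dmod_neg[OF X] Hom_in[OF \<iota>] Hom_in[OF p] that)
      also have "amap X i (- \<iota> i (p i x)) = - amap X i (\<iota> i (p i x))"
        using dmod_amap_scale[OF X that(1) Hom_in[OF \<iota> Hom_in[OF p that(2)]], of "-1"] by simp
      finally show ?thesis
        using that by (simp add: q_def N0_def subrep_def dmod_amap_in[OF X] Hom_amap[OF p] Hom_amap[OF \<iota>]
            Hom_in[OF p] del: One_nat_def)
    qed
  qed (simp_all add: q_in, simp_all add: q_def dmod_add[OF X] dmod_scale[OF X] Hom_add[OF p] Hom_scale[OF p]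
      Hom_add[OF \<iota>] Hom_scale[OF \<iota>] Hom_in[OF p] cvec.scale_right_diff_distrib)
  define \<theta> where "\<theta> = (hinl M N \<circ>\<^sub>h p) + (hinr M N \<circ>\<^sub>h (\<phi> \<circ>\<^sub>h q))"
  have MN: "dmod n (M \<oplus>\<^sub>r N)" by (rule dmod_dsum[OF M N(1)])
  have \<theta>: "\<theta> \<in> Hom n X (M \<oplus>\<^sub>r N)"
    unfolding \<theta>_def
    by (intro Hom_plus[OF MN] Hom_hcomp[OF p Hom_hinl[OF M N(1)]]
        Hom_hcomp[OF Hom_hcomp[OF q \<phi>] Hom_hinr[OF M N(1)]])
  have val: "\<theta> i x = (p i x, \<phi> i (q i x))" if "x \<in> vsp X i" for i x
    using that by (simp add: \<theta>_def hcomp_apply hinl_def hinr_def Hom_in[OF p] Hom_in[OF \<phi>] q_in)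
  have inv1: "\<psi> i (\<phi> i x) = x" if "x \<in> vsp N0 i" for i x
    using fun_cong[OF fun_cong[OF inv(1)], of i x] that by (simp add: hcomp_apply hid_apply)
  have inv2: "\<phi> i (\<psi> i x) = x" if "x \<in> vsp N i" for i x
    using fun_cong[OF fun_cong[OF inv(2)], of i x] that by (simp add: hcomp_apply hid_apply)
  have "is_iso n X (M \<oplus>\<^sub>r N) \<theta>"
  proof (rule is_isoI[OF X MN \<theta>])
    fix i x assume x: "x \<in> vsp X i" "\<theta> i x = 0"
    then have "p i x = 0" "\<phi> i (q i x) = 0" using val[of x i] by (simp_all add: zero_prod_def)
    then have "q i x = 0" using inv1[OF q_in[OF x(1)]] Hom_0[OF \<psi>] by metis
    then show "x = 0" using \<open>p i x = 0\<close> x Hom_0[OF \<iota>] by (simp add: q_def)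
  next
    fix i y assume "y \<in> vsp (M \<oplus>\<^sub>r N) i"
    then obtain u v where y: "y = (u, v)" "u \<in> vsp M i" "v \<in> vsp N i" by auto
    define w where "w = \<psi> i v"
    have w: "w \<in> vsp X i" "p i w = 0" using Hom_in[OF \<psi> y(3)] by (auto simp: w_def vN0)
    have x: "\<iota> i u + w \<in> vsp X i" by (rule dmod_add[OF X Hom_in[OF \<iota> y(2)] w(1)])
    have px: "p i (\<iota> i u + w) = u" using Hom_add[OF p Hom_in[OF \<iota> y(2)] w(1)] id' y w by simp
    have "q i (\<iota> i u + w) = w" using x px by (simp add: q_def)
    then have "\<theta> i (\<iota> i u + w) = y" using val[OF x] px inv2[OF y(3)] y by (simp add: w_def)
    then show "\<exists>x\<in>vsp X i. \<theta> i x = y" by (rule bexI[OF _ x])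
  qed
  then show ?thesis unfolding summand_def isomorphic_def by (intro conjI exI[of _ N] exI[of _ \<theta>] M N(1))
qed

lemma summandE:
  assumes "summand n M X"
  obtains \<iota> p where "\<iota> \<in> Hom n M X" "p \<in> Hom n X M" "p \<circ>\<^sub>h \<iota> = hid M"
proof -
  obtain N :: "univ rep" and \<theta> where M: "dmod n M" and N: "dmod n N" and iso: "is_iso n X (M \<oplus>\<^sub>r N) \<theta>"
    using assms unfolding summand_def isomorphic_def by blast
  obtain \<theta>' where *: "\<theta> \<in> Hom n X (M \<oplus>\<^sub>r N)" "\<theta>' \<in> Hom n (M \<oplus>\<^sub>r N) X" "\<theta> \<circ>\<^sub>h \<theta>' = hid (M \<oplus>\<^sub>r N)"
    using iso by (rule is_isoE)
  have "hfst M N \<circ>\<^sub>h \<theta> \<circ>\<^sub>h (\<theta>' \<circ>\<^sub>h hinl M N) = hfst M N \<circ>\<^sub>h ((\<theta> \<circ>\<^sub>h \<theta>') \<circ>\<^sub>h hinl M N)"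
    by (simp add: hcomp_assoc)
  also have "\<dots> = hid M"
    by (simp add: *(3) hcomp_hid_left[OF Hom_hinl[OF M N]] hfst_hinl[OF M N])
  finally show ?thesis
    by (rule that[OF Hom_hcomp[OF Hom_hinl[OF M N] *(2)] Hom_hcomp[OF *(1) Hom_hfst[OF M N]]])
qed

lemma summand_dmod: "summand n M X \<Longrightarrow> dmod n M"
  by (simp add: summand_def)

text \<open>
  A module lies in \<open>add R\<close> when its identity is a sum of maps that factor through \<open>R\<close>; the complement
  is then the kernel of the resulting retraction from a power of \<open>R\<close>.
\<close>

lemma in_addI:
  assumes R: "dmod n R" and M: "dmod n M" and A: "finite A"
    and \<iota>: "\<And>k. k \<in> A \<Longrightarrow> \<iota> k \<in> Hom n M R" and p: "\<And>k. k \<in> A \<Longrightarrow> p k \<in> Hom n R M"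
    and id: "(\<Sum>k\<in>A. p k \<circ>\<^sub>h \<iota> k) = hid M"
  shows "in_add n R M"
proof -
  obtain e where e: "bij_betw e {..<card A} A"
    using ex_bij_betw_nat_finite[OF A] by (metis atLeast0LessThan)
  have eA: "e k \<in> A" if "k \<in> {..<card A}" for k using e that unfolding bij_betw_def by blast
  let ?K = "{..<card A}" and ?R = "\<lambda>_::nat. R"
  have X: "dmod n (big_dsum ?K ?R)" by (rule dmod_big_dsum) (auto simp: R)
  note hom_in = Hom_hin[OF finite_lessThan R] and hom_pr = Hom_hpr[OF finite_lessThan R]
  define I where "I = (\<Sum>k\<in>?K. hin ?K ?R k \<circ>\<^sub>h \<iota> (e k))"
  define P where "P = (\<Sum>k\<in>?K. p (e k) \<circ>\<^sub>h hpr ?K ?R k)"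
  have I1: "hin ?K ?R k \<circ>\<^sub>h \<iota> (e k) \<in> Hom n M (big_dsum ?K ?R)" if "k \<in> ?K" for k
    by (rule Hom_hcomp[OF \<iota>[OF eA[OF that]] hom_in[OF that]])
  have P1: "p (e k) \<circ>\<^sub>h hpr ?K ?R k \<in> Hom n (big_dsum ?K ?R) M" if "k \<in> ?K" for k
    by (rule Hom_hcomp[OF hom_pr[OF that] p[OF eA[OF that]]])
  have I: "I \<in> Hom n M (big_dsum ?K ?R)" unfolding I_def by (rule Hom_sum[OF X I1])
  have P: "P \<in> Hom n (big_dsum ?K ?R) M" unfolding P_def by (rule Hom_sum[OF M P1])
  have "P \<circ>\<^sub>h I = (\<Sum>k\<in>?K. (p (e k) \<circ>\<^sub>h hpr ?K ?R k) \<circ>\<^sub>h I)"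
    unfolding P_def by (rule hcomp_sum_left)
  also have "\<dots> = (\<Sum>k\<in>?K. p (e k) \<circ>\<^sub>h \<iota> (e k))"
  proof (rule sum.cong[OF refl])
    fix k assume k: "k \<in> ?K"
    have "hpr ?K ?R k \<circ>\<^sub>h I = (\<Sum>l\<in>?K. hpr ?K ?R k \<circ>\<^sub>h (hin ?K ?R l \<circ>\<^sub>h \<iota> (e l)))"
      unfolding I_def by (rule hcomp_sum_right[OF X hom_pr[OF k] I1])
    also have "\<dots> = (\<Sum>l\<in>?K. if l = k then \<iota> (e k) else 0)"
    proof (rule sum.cong[OF refl])
      fix l assume l: "l \<in> ?K"
      have "hpr ?K ?R k \<circ>\<^sub>h (hin ?K ?R l \<circ>\<^sub>h \<iota> (e l)) = (hpr ?K ?R k \<circ>\<^sub>h hin ?K ?R l) \<circ>\<^sub>h \<iota> (e l)"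
        by (simp only: hcomp_assoc)
      also have "\<dots> = (if l = k then \<iota> (e k) else 0)"
        using hpr_hin[OF finite_lessThan R, of k] hpr_hin_neq[OF finite_lessThan R, of l k] l k
          hcomp_hid_left[OF \<iota>[OF eA[OF k]]] by (cases "l = k") (auto simp: hcomp_zero_left)
      finally show "hpr ?K ?R k \<circ>\<^sub>h (hin ?K ?R l \<circ>\<^sub>h \<iota> (e l)) = (if l = k then \<iota> (e k) else 0)" .
    qed
    also have "\<dots> = \<iota> (e k)" using k by (subst sum.delta) auto
    finally show "(p (e k) \<circ>\<^sub>h hpr ?K ?R k) \<circ>\<^sub>h I = p (e k) \<circ>\<^sub>h \<iota> (e k)" by (simp only: hcomp_assoc)
  qed
  also have "\<dots> = (\<Sum>k\<in>A. p k \<circ>\<^sub>h \<iota> k)" 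
    by (rule sum.reindex_bij_betw[OF e, of "\<lambda>k. p k \<circ>\<^sub>h \<iota> k"])
  finally have "P \<circ>\<^sub>h I = hid M" unfolding id .
  then have "summand n M (big_dsum {..<card A} (\<lambda>_. R))" by (rule summandI[OF M X I P])
  then show ?thesis unfolding in_add_def by (intro exI[of _ "card A"])
qed

lemma in_addE:
  assumes R: "dmod n R" and "in_add n R M"
  obtains m \<iota> p where "\<And>k. k < (m::nat) \<Longrightarrow> \<iota> k \<in> Hom n M R" "\<And>k. k < m \<Longrightarrow> p k \<in> Hom n R M"
    "(\<Sum>k<m. p k \<circ>\<^sub>h \<iota> k) = hid M"
proof -
  obtain m :: nat where s: "summand n M (big_dsum {..<m} (\<lambda>_. R))" using assms(2) unfolding in_add_def by blast
  then have M: "dmod n M" by (rule summand_dmod)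
  let ?X = "big_dsum {..<m} (\<lambda>_. R)"
  obtain I P where I: "I \<in> Hom n M ?X" and P: "P \<in> Hom n ?X M" and id: "P \<circ>\<^sub>h I = hid M"
    using s by (rule summandE)
  note hom_in = Hom_hin[OF finite_lessThan R] and hom_pr = Hom_hpr[OF finite_lessThan R]
  let ?in = "hin {..<m} (\<lambda>_. R)" and ?pr = "hpr {..<m} (\<lambda>_. R)"
  have X: "dmod n ?X" by (rule dmod_big_dsum) (auto simp: R)
  have "(\<Sum>k<m. (P \<circ>\<^sub>h ?in k) \<circ>\<^sub>h (?pr k \<circ>\<^sub>h I)) = (\<Sum>k<m. P \<circ>\<^sub>h (?in k \<circ>\<^sub>h ?pr k)) \<circ>\<^sub>h I"
    by (simp only: hcomp_sum_left hcomp_assoc)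
  also have "(\<Sum>k<m. P \<circ>\<^sub>h (?in k \<circ>\<^sub>h ?pr k)) = P \<circ>\<^sub>h (\<Sum>k<m. ?in k \<circ>\<^sub>h ?pr k)"
    by (rule hcomp_sum_right[OF X P, symmetric]) (rule Hom_hcomp[OF hom_pr hom_in])
  also have "(\<Sum>k<m. ?in k \<circ>\<^sub>h ?pr k) = hid ?X" by (rule hin_hpr_big_sum[OF finite_lessThan R])
  also have "P \<circ>\<^sub>h hid ?X = P" by (rule hcomp_hid_right[OF P])
  finally have "(\<Sum>k<m. (P \<circ>\<^sub>h ?in k) \<circ>\<^sub>h (?pr k \<circ>\<^sub>h I)) = hid M" using id by simp
  then show ?thesis
    by (intro that[of m "\<lambda>k. ?pr k \<circ>\<^sub>h I" "\<lambda>k. P \<circ>\<^sub>h ?in k"] Hom_hcomp[OF I hom_pr] Hom_hcomp[OF hom_in P]) auto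
qed

section \<open>Good modules as flagged modules\<close>

text \<open>
  Being filtered by standard modules is equivalent to this condition, which is far easier to check.
\<close>

definition a_injective :: "nat \<Rightarrow> 'v::complex_vector rep \<Rightarrow> bool" where
  "a_injective n M \<longleftrightarrow> (\<forall>i\<in>{1..n-1}. \<forall>x\<in>vsp M i. amap M i x = 0 \<longrightarrow> x = 0)"

lemma a_injectiveD: "a_injective n M \<Longrightarrow> i \<in> {1..n-1} \<Longrightarrow> x \<in> vsp M i \<Longrightarrow> amap M i x = 0 \<Longrightarrow> x = 0"
  unfolding a_injective_def by simp

fun apath :: "'v rep \<Rightarrow> nat \<Rightarrow> 'v \<Rightarrow> 'v" where
  "apath M 0 x = x"
| "apath M (Suc j) x = apath M j (amap M (Suc j) x)"

text \<open>
  The image of \<open>e\<^sub>j M\<close> in \<open>e\<^sub>0 M\<close>.  On a good module \<open>e\<^sub>j M\<close> can be recovered from it.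
\<close>

definition flag :: "'v::complex_vector rep \<Rightarrow> nat \<Rightarrow> 'v set" where
  "flag M j = apath M j ` vsp M j"

lemma index_Suc: "Suc j < n \<Longrightarrow> Suc j \<in> {1..n-1}"
  by auto

context
  fixes n :: nat and M :: "'v::complex_vector rep"
  assumes n: "n > 1" and M: "dmod n M"
begin

lemma amap_Suc_in: "Suc j < n \<Longrightarrow> x \<in> vsp M (Suc j) \<Longrightarrow> amap M (Suc j) x \<in> vsp M j"
  using dmod_amap_in[OF M index_Suc, of j x] by simp

lemma apath_in: "j < n \<Longrightarrow> x \<in> vsp M j \<Longrightarrow> apath M j x \<in> vsp M 0"
  by (induction j arbitrary: x) (simp_all add: amap_Suc_in)

lemma apath_add: "j < n \<Longrightarrow> x \<in> vsp M j \<Longrightarrow> y \<in> vsp M j \<Longrightarrow> apath M j (x + y) = apath M j x + apath M j y"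
  by (induction j arbitrary: x y) (simp_all add: amap_Suc_in dmod_amap_add[OF M index_Suc])

lemma apath_scale: "j < n \<Longrightarrow> x \<in> vsp M j \<Longrightarrow> apath M j (c *\<^sub>C x) = c *\<^sub>C apath M j x"
  by (induction j arbitrary: x) (simp_all add: amap_Suc_in dmod_amap_scale[OF M index_Suc])

lemma apath_0: "j < n \<Longrightarrow> apath M j 0 = 0"
  by (induction j) (simp_all add: dmod_amap_0[OF M index_Suc])

lemma apath_neg: "j < n \<Longrightarrow> x \<in> vsp M j \<Longrightarrow> apath M j (- x) = - apath M j x"
  using apath_scale[of j x "-1"] by simp

lemma apath_diff: "j < n \<Longrightarrow> x \<in> vsp M j \<Longrightarrow> y \<in> vsp M j \<Longrightarrow> apath M j (x - y) = apath M j x - apath M j y"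
  using apath_add[of j x "- y"] apath_neg[of j y] dmod_neg[OF M, of y j] by simp

lemma apath_eq_0:
  assumes "a_injective n M"
  shows "j < n \<Longrightarrow> x \<in> vsp M j \<Longrightarrow> apath M j x = 0 \<Longrightarrow> x = 0"
proof (induction j arbitrary: x)
  case (Suc j)
  then have "amap M (Suc j) x = 0" by (simp add: amap_Suc_in)
  then show ?case using a_injectiveD[OF assms index_Suc] Suc.prems by simp
qed simp

lemma apath_inj:
  assumes "a_injective n M" "j < n" "x \<in> vsp M j" "y \<in> vsp M j" "apath M j x = apath M j y"
  shows "x = y"
proof -
  have "apath M j (x - y) = 0" using assms by (simp add: apath_diff)
  then have "x - y = 0" using apath_eq_0[OF assms(1,2) dmod_diff[OF M assms(3,4)]] by simp
  then show ?thesis by simp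
qed

text \<open>The loop at vertex \<open>0\<close> is the action of \<open>t\<close>; it moves the flag one step down.\<close>

lemma loop_apath: "Suc j < n \<Longrightarrow> x \<in> vsp M j \<Longrightarrow> loop M (apath M j x) = apath M (Suc j) (bmap M (Suc j) x)"
proof (induction j arbitrary: x)
  case (Suc j)
  have "amap M (Suc (Suc j)) (bmap M (Suc (Suc j)) x) = bmap M (Suc j) (amap M (Suc j) x)"
    using dmod_mesh[OF M, of "Suc (Suc j)" x] Suc.prems by simp
  then show ?case using Suc by (simp add: amap_Suc_in)
qed (simp add: loop_def)

lemma loop_apath_top: "x \<in> vsp M (n - 1) \<Longrightarrow> loop M (apath M (n - 1) x) = 0"
proof -
  assume x: "x \<in> vsp M (n - 1)"
  define j where "j = n - 2"
  have j: "n - 1 = Suc j" "Suc j < n" using n by (auto simp: j_def)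
  have "bmap M (Suc j) (amap M (Suc j) x) = 0" using dmod_top[OF M x] j by simp
  then have "loop M (apath M j (amap M (Suc j) x)) = apath M (Suc j) 0"
    using loop_apath[OF j(2) amap_Suc_in] x j by simp
  then show ?thesis using j by (simp add: apath_0 dmod_amap_0[OF M index_Suc])
qed

lemma loop_add: "x \<in> vsp M 0 \<Longrightarrow> y \<in> vsp M 0 \<Longrightarrow> loop M (x + y) = loop M x + loop M y"
  using dmod_bmap_add[OF M, of 1 x y] dmod_amap_add[OF M, of 1 "bmap M 1 x" "bmap M 1 y"]
    dmod_bmap_in[OF M, of 1] n by (simp add: loop_def)

lemma loop_scale: "x \<in> vsp M 0 \<Longrightarrow> loop M (c *\<^sub>C x) = c *\<^sub>C loop M x"
  using dmod_bmap_scale[OF M, of 1 x c] dmod_amap_scale[OF M, of 1 "bmap M 1 x" c]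
    dmod_bmap_in[OF M, of 1] n by (simp add: loop_def)

lemma loop_0: "loop M 0 = 0"
  using loop_scale[of 0 0] dmod_0[OF M] by simp

lemma loop_pow_add: "x \<in> vsp M 0 \<Longrightarrow> y \<in> vsp M 0 \<Longrightarrow> (loop M ^^ k) (x + y) = (loop M ^^ k) x + (loop M ^^ k) y"
  by (induction k) (simp_all add: loop_add loop_pow_in[OF n M])

lemma loop_pow_scale: "x \<in> vsp M 0 \<Longrightarrow> (loop M ^^ k) (c *\<^sub>C x) = c *\<^sub>C (loop M ^^ k) x"
  by (induction k) (simp_all add: loop_scale loop_pow_in[OF n M])

lemma loop_pow_0: "(loop M ^^ k) 0 = 0"
  by (induction k) (simp_all add: loop_0)

lemma loop_pow_diff: "x \<in> vsp M 0 \<Longrightarrow> y \<in> vsp M 0 \<Longrightarrow> (loop M ^^ k) (x - y) = (loop M ^^ k) x - (loop M ^^ k) y"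
  using loop_pow_add[of x "- y" k] loop_pow_scale[of y k "-1"] dmod_neg[OF M, of y 0] by simp

lemma loop_pow_n: "x \<in> vsp M 0 \<Longrightarrow> (loop M ^^ n) x = 0"
  using loop_pow_bpath_zero[OF n M, of 0 x] n by simp

lemma flag_0: "flag M 0 = vsp M 0"
  by (simp add: flag_def)

lemma flag_in: "j < n \<Longrightarrow> x \<in> flag M j \<Longrightarrow> x \<in> vsp M 0"
  by (auto simp: flag_def apath_in)

lemma flag_subspace: "j < n \<Longrightarrow> cvec.subspace (flag M j)"
  unfolding cvec.subspace_def flag_def
proof (intro conjI ballI allI)
  assume j: "j < n"
  show "0 \<in> apath M j ` vsp M j" using apath_0[OF j] dmod_0[OF M] by (metis imageI)
  show "x + y \<in> apath M j ` vsp M j" if xy: "x \<in> apath M j ` vsp M j" "y \<in> apath M j ` vsp M j" for x y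
  proof -
    from xy obtain u v where "u \<in> vsp M j" "x = apath M j u" "v \<in> vsp M j" "y = apath M j v" by blast
    then show ?thesis using apath_add[OF j] dmod_add[OF M] by (metis imageI)
  qed
  show "c *\<^sub>C x \<in> apath M j ` vsp M j" if xy: "x \<in> apath M j ` vsp M j" for c x
  proof -
    from xy obtain u where "u \<in> vsp M j" "x = apath M j u" by blast
    then show ?thesis using apath_scale[OF j] dmod_scale[OF M] by (metis imageI)
  qed
qed

lemma flag_Suc_subset: "Suc j < n \<Longrightarrow> flag M (Suc j) \<subseteq> flag M j"
  by (auto simp: flag_def amap_Suc_in)

lemma loop_flag: "Suc j < n \<Longrightarrow> x \<in> flag M j \<Longrightarrow> loop M x \<in> flag M (Suc j)"
  unfolding flag_def
proof -
  assume j: "Suc j < n" and "x \<in> apath M j ` vsp M j"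
  then obtain y where y: "y \<in> vsp M j" "x = apath M j y" by blast
  have "bmap M (Suc j) y \<in> vsp M (Suc j)" using dmod_bmap_in[OF M index_Suc[OF j]] y by simp
  then show "loop M x \<in> apath M (Suc j) ` vsp M (Suc j)"
    unfolding y(2) loop_apath[OF j y(1)] by (rule imageI)
qed

lemma loop_flag_top: "x \<in> flag M (n - 1) \<Longrightarrow> loop M x = 0"
  using loop_apath_top by (auto simp: flag_def)

lemma loop_flag_same: "j < n \<Longrightarrow> x \<in> flag M j \<Longrightarrow> loop M x \<in> flag M j"
proof (cases "Suc j < n")
  case True
  then show "x \<in> flag M j \<Longrightarrow> loop M x \<in> flag M j" using loop_flag flag_Suc_subset by blast
next
  assume j: "j < n" and x: "x \<in> flag M j"
  case False
  then have "j = n - 1" using j by simp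
  then show "loop M x \<in> flag M j" using loop_flag_top x cvec.subspace_0[OF flag_subspace[OF j]] by simp
qed

lemma loop_pow_flag: "j < n \<Longrightarrow> x \<in> flag M j \<Longrightarrow> (loop M ^^ k) x \<in> flag M j"
  by (induction k) (simp_all add: loop_flag_same)

end

lemma Hom_apath:
  assumes n: "n > 1" and M: "dmod n M" and h: "h \<in> Hom n M N"
  shows "j < n \<Longrightarrow> x \<in> vsp M j \<Longrightarrow> h 0 (apath M j x) = apath N j (h j x)"
proof (induction j arbitrary: x)
  case (Suc j)
  then show ?case
    using Hom_amap[OF h index_Suc[of j n], of x] by (simp add: amap_Suc_in[OF n M])
qed simp

lemma Hom_flag:
  assumes n: "n > 1" and M: "dmod n M" and h: "h \<in> Hom n M N" and "j < n" "x \<in> flag M j"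
  shows "h 0 x \<in> flag N j"
  using assms(4,5) Hom_apath[OF n M h] Hom_in[OF h] by (auto simp: flag_def)

lemma Hom_loop: "n > 1 \<Longrightarrow> dmod n M \<Longrightarrow> h \<in> Hom n M N \<Longrightarrow> x \<in> vsp M 0 \<Longrightarrow> h 0 (loop M x) = loop N (h 0 x)"
  using Hom_loop_pow[of n M h N x 1] by simp

text \<open>
  Over a target on which the maps \<open>a\<^sub>i\<close> are injective, a homomorphism is the same as a
  \<open>\<complex>[t]\<close>-linear map at vertex \<open>0\<close> that respects the flags.
\<close>

lemma Hom_eq_of_vertex_0:
  assumes n: "n > 1" and M: "dmod n M" and N: "dmod n N" "a_injective n N"
    and g: "g \<in> Hom n M N" and h: "h \<in> Hom n M N" and eq: "\<And>x. x \<in> vsp M 0 \<Longrightarrow> g 0 x = h 0 x"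
  shows "g = h"
proof (rule Hom_eqI[OF g h])
  fix i x assume x: "x \<in> vsp M i"
  show "g i x = h i x"
  proof (cases "i < n")
    case True
    have "apath N i (g i x) = apath N i (h i x)"
      using Hom_apath[OF n M g True x] Hom_apath[OF n M h True x] eq[OF apath_in[OF n M True x]] by simp
    then show ?thesis
      by (rule apath_inj[OF n N(1,2) True Hom_in[OF g x] Hom_in[OF h x]])
  next
    case False
    then have "x = 0" using x dmod_outside[OF M, of i] by simp
    then show ?thesis using Hom_0[OF g] Hom_0[OF h] by simp
  qed
qed

text \<open>
  At vertex \<open>j\<close> the map is obtained by transport along the injection \<open>a\<^sub>1 \<cdots> a\<^sub>j\<close> of the target; it
  commutes with \<open>b\<^sub>j\<close> because \<open>t a\<^sub>1 \<cdots> a\<^bsub>j-1\<^esub> = a\<^sub>1 \<cdots> a\<^sub>j b\<^sub>j\<close>.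
\<close>

lemma Hom_of_vertex_0:
  assumes n: "n > 1" and M: "dmod n M" and N: "dmod n N" "a_injective n N"
    and in0: "\<And>x. x \<in> vsp M 0 \<Longrightarrow> \<phi> x \<in> vsp N 0"
    and add: "\<And>x y. x \<in> vsp M 0 \<Longrightarrow> y \<in> vsp M 0 \<Longrightarrow> \<phi> (x + y) = \<phi> x + \<phi> y"
    and scale: "\<And>c x. x \<in> vsp M 0 \<Longrightarrow> \<phi> (c *\<^sub>C x) = c *\<^sub>C \<phi> x"
    and loop: "\<And>x. x \<in> vsp M 0 \<Longrightarrow> \<phi> (loop M x) = loop N (\<phi> x)"
    and flag: "\<And>j x. j < n \<Longrightarrow> x \<in> flag M j \<Longrightarrow> \<phi> x \<in> flag N j"
  obtains h where "h \<in> Hom n M N" "\<And>x. x \<in> vsp M 0 \<Longrightarrow> h 0 x = \<phi> x"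
proof -
  define R where "R = (\<lambda>j x y. if j < n then apath N j y = \<phi> (apath M j x) else y = 0)"
  have phi0: "\<phi> 0 = 0" using scale[OF dmod_0[OF M], of 0] by simp
  obtain h where h: "h \<in> Hom n M N" "\<And>i x y. x \<in> vsp M i \<Longrightarrow> y \<in> vsp N i \<Longrightarrow> R i x y \<longleftrightarrow> h i x = y"
  proof (rule Hom_of_relation[OF M N(1), of R])
    show "\<exists>y\<in>vsp N i. R i x y" if x: "x \<in> vsp M i" for i x
    proof (cases "i < n")
      case True
      have "apath M i x \<in> flag M i" using x by (simp add: flag_def)
      then have "\<phi> (apath M i x) \<in> apath N i ` vsp N i" using flag[OF True] by (simp add: flag_def)
      then obtain y where "y \<in> vsp N i" "\<phi> (apath M i x) = apath N i y" by (rule imageE)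
      then show ?thesis using True by (intro bexI[of _ y]) (simp_all add: R_def)
    qed (intro bexI[of _ 0], simp_all add: R_def dmod_0[OF N(1)])
    show "y = 0" if "y \<in> vsp N i" "R i 0 y" for i y
    proof (cases "i < n")
      case True
      then show ?thesis using that apath_0[OF n M True] phi0 apath_eq_0[OF n N True that(1)] by (simp add: R_def)
    qed (use that in \<open>simp add: R_def\<close>)
    show "R i (x + x') (y + y')"
      if "x \<in> vsp M i" "y \<in> vsp N i" "x' \<in> vsp M i" "y' \<in> vsp N i" "R i x y" "R i x' y'" for i x y x' y'
      using that by (auto simp: R_def apath_add[OF n M] apath_add[OF n N(1)] add apath_in[OF n M])
    show "R i (c *\<^sub>C x) (c *\<^sub>C y)" if "x \<in> vsp M i" "y \<in> vsp N i" "R i x y" for i c x y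
      using that by (auto simp: R_def apath_scale[OF n M] apath_scale[OF n N(1)] scale apath_in[OF n M])
    show "R i (bmap M i x) (bmap N i y)"
      if i: "i \<in> {1..n - 1}" and xy: "x \<in> vsp M (i - 1)" "y \<in> vsp N (i - 1)" "R (i - 1) x y" for i x y
    proof -
      obtain j where j: "i = Suc j" "Suc j < n" using i n by (cases i) auto
      have "apath N j y = \<phi> (apath M j x)" using xy(3) j by (simp add: R_def)
      then have "apath N i (bmap N i y) = loop N (\<phi> (apath M j x))"
        using loop_apath[OF n N(1) j(2), of y] xy(2) j by simp
      also have "\<dots> = \<phi> (apath M i (bmap M i x))"
        using loop[OF apath_in[OF n M, of j x]] loop_apath[OF n M j(2), of x] xy(1) j by simp
      finally show ?thesis using j by (simp add: R_def)
    qed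
    show "R (i - 1) (amap M i x) (amap N i y)"
      if i: "i \<in> {1..n - 1}" and xy: "x \<in> vsp M i" "y \<in> vsp N i" "R i x y" for i x y
    proof -
      obtain j where j: "i = Suc j" "Suc j < n" using i n by (cases i) auto
      then show ?thesis using xy(3) by (simp add: R_def)
    qed
  qed blast
  have "h 0 x = \<phi> x" if "x \<in> vsp M 0" for x
    using h(2)[OF that in0[OF that]] n by (simp add: R_def)
  then show ?thesis using that h(1) by simp
qed

text \<open>
  A submodule of a module with injective \<open>a\<^sub>i\<close> inherits this property.
\<close>

lemma a_injective_iso:
  assumes M: "dmod n M" and N: "dmod n N" and f: "f \<in> Hom n M N" and inj: "\<And>i x. x \<in> vsp M i \<Longrightarrow> f i x = 0 \<Longrightarrow> x = 0"
    and N': "a_injective n N"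
  shows "a_injective n M"
  unfolding a_injective_def
proof (intro ballI impI)
  fix i x assume i: "i \<in> {1..n-1}" and x: "x \<in> vsp M i" "amap M i x = 0"
  have "amap N i (f i x) = 0" using Hom_amap[OF f i x(1)] x(2) Hom_0[OF f] by simp
  then have "f i x = 0" by (rule a_injectiveD[OF N' i Hom_in[OF f x(1)]])
  then show "x = 0" by (rule inj[OF x(1)])
qed

lemma a_injective_dsum: "a_injective n M \<Longrightarrow> a_injective n N \<Longrightarrow> a_injective n (M \<oplus>\<^sub>r N)"
  unfolding a_injective_def by (auto simp: zero_prod_def simp del: One_nat_def)

lemma submoduleD:
  assumes M: "dmod n M" and U: "submodule n M U"
  shows "dmod n (subrep M U)" "U i \<subseteq> vsp M i"
    and "cvec.subspace (U i)"
    and "i \<in> {1..n-1} \<Longrightarrow> x \<in> U (i-1) \<Longrightarrow> bmap M i x \<in> U i"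
    and "i \<in> {1..n-1} \<Longrightarrow> x \<in> U i \<Longrightarrow> amap M i x \<in> U (i-1)"
proof -
  show *: "dmod n (subrep M U)" "U i \<subseteq> vsp M i" using U unfolding submodule_def by auto
  show "cvec.subspace (U i)" using dmod_subspace[OF *(1), of i] by (simp add: subrep_def)
  show "i \<in> {1..n-1} \<Longrightarrow> x \<in> U (i-1) \<Longrightarrow> bmap M i x \<in> U i"
    using dmod_bmap_in[OF *(1), of i x] by (simp add: subrep_def)
  show "i \<in> {1..n-1} \<Longrightarrow> x \<in> U i \<Longrightarrow> amap M i x \<in> U (i-1)"
    using dmod_amap_in[OF *(1), of i x] by (simp add: subrep_def)
qed

lemma subrep_vsp [simp]: "vsp (subrep M U) = U" "bmap (subrep M U) = bmap M" "amap (subrep M U) = amap M"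
  by (simp_all add: subrep_def)

lemma dmod_amap_diff:
  assumes M: "dmod n M" and i: "i \<in> {1..n-1}" and x: "x \<in> vsp M i" and y: "y \<in> vsp M i"
  shows "amap M i (x - y) = amap M i x - amap M i y"
  using dmod_amap_add[OF M i x dmod_scale[OF M y, of "-1"]] dmod_amap_scale[OF M i y, of "-1"] by simp

lemma dmod_Delta:
  assumes "1 \<le> l" "l \<le> n"
  shows "dmod n (Delta l)"
proof (rule dmodI)
  show "fin_dim_subspace (vsp (Delta l) i)" for i
  proof (cases "i < l")
    case True
    have "(UNIV :: complex set) = cvec.span {1}"
    proof (intro subset_antisym subsetI UNIV_I)
      fix x :: complex
      have "x *\<^sub>C 1 \<in> cvec.span {1 :: complex}" by (intro cvec.span_scale cvec.span_base) simp
      then show "x \<in> cvec.span {1}" by (simp add: scaleC_complex_def)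
    qed
    then show ?thesis using True unfolding fin_dim_subspace_def Delta_def
      by (intro exI[of _ "{1}"]) simp
  next
    case False
    then show ?thesis unfolding fin_dim_subspace_def Delta_def
      by (intro exI[of _ "{}"]) simp
  qed
qed (use assms in \<open>auto simp: Delta_def split: if_splits\<close>)

lemma good_imp_a_injective:
  assumes "good n M"
  shows "a_injective n M"
proof -
  obtain ls U where M: "dmod n M" and sub: "\<And>k. k \<le> length ls \<Longrightarrow> submodule n M (U k)"
    and U0: "U 0 = (\<lambda>_. {0})" and U1: "U (length ls) = vsp M"
    and step: "\<And>k. k < length ls \<Longrightarrow> \<exists>p. ses n (subrep M (U k)) (subrep M (U (Suc k))) (Delta (ls ! k))
                 (hid (subrep M (U k))) p"
    using assms unfolding good_def delta_filtration_def by blast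
  have "k \<le> length ls \<Longrightarrow> a_injective n (subrep M (U k))" for k
  proof (induction k)
    case 0
    then show ?case by (simp add: a_injective_def U0)
  next
    case (Suc k)
    then obtain p where p: "ses n (subrep M (U k)) (subrep M (U (Suc k))) (Delta (ls ! k))
                 (hid (subrep M (U k))) p" using step[of k] by auto
    have pH: "p \<in> Hom n (subrep M (U (Suc k))) (Delta (ls ! k))"
      and ker: "hid (subrep M (U k)) i ` U k i = {y \<in> U (Suc k) i. p i y = 0}" for i
      using p unfolding ses_def by auto
    show ?case
      unfolding a_injective_def
    proof (intro ballI impI)
      fix i x assume i: "i \<in> {1..n-1}" and x: "x \<in> vsp (subrep M (U (Suc k))) i" "amap (subrep M (U (Suc k))) i x = 0"
      have "p i x = 0" using Hom_amap[OF pH i x(1)] x(2) Hom_0[OF pH, of "i-1"] by (simp add: Delta_def)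
      then have "x \<in> hid (subrep M (U k)) i ` U k i" unfolding ker using x(1) by simp
      then have "x \<in> U k i" by (auto simp: hid_def)
      then show "x = 0" using a_injectiveD[OF Suc.IH i, of x] Suc.prems x(2) by simp
    qed
  qed
  from this[of "length ls"] show ?thesis unfolding U1 by (simp add: a_injective_def)
qed

text \<open>
  The element \<open>a\<^bsub>i+1\<^esub> \<cdots> a\<^bsub>i+d\<^esub> x\<close> at vertex \<open>i\<close>, for \<open>x\<close> at vertex \<open>i + d\<close>.
\<close>

fun ladder :: "'v rep \<Rightarrow> nat \<Rightarrow> nat \<Rightarrow> 'v \<Rightarrow> 'v" where
  "ladder M i 0 x = x"
| "ladder M i (Suc d) x = amap M (Suc i) (ladder M (Suc i) d x)"

text \<open>
  The maps \<open>a\<^sub>i\<close> are injective on \<open>M / U\<close>.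
\<close>

definition saturated :: "nat \<Rightarrow> 'v rep \<Rightarrow> (nat \<Rightarrow> 'v set) \<Rightarrow> bool" where
  "saturated n M U \<longleftrightarrow> (\<forall>i\<in>{1..n-1}. \<forall>y\<in>vsp M i. amap M i y \<in> U (i-1) \<longrightarrow> y \<in> U i)"

text \<open>
  A vector outside \<open>U\<close> at the last vertex where \<open>U\<close> is proper generates, modulo \<open>U\<close>, a standard
  module: the vertex above contributes nothing, so all \<open>b\<^sub>i\<close> vanish on the images under the \<open>a\<^sub>i\<close>.
\<close>

lemma extend_by_Delta:
  assumes n: "n > 1" and M: "dmod n M" and U: "submodule n M U"
    and satU: "saturated n M U"
    and j: "j < n" and top': "\<forall>i>j. U i = vsp M i" and x: "x \<in> vsp M j" "x \<notin> U j"
  obtains U' p where "submodule n M U'" "\<forall>i. U i \<subseteq> U' i" "x \<in> U' j" "saturated n M U'"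
    "ses n (subrep M U) (subrep M U') (Delta (Suc j)) (hid (subrep M U)) p"
proof -
  note Us = submoduleD[OF M U]
  have sat: "y \<in> U i" if "i \<in> {1..n-1}" "y \<in> vsp M i" "amap M i y \<in> U (i-1)" for i y
    using satU that unfolding saturated_def by blast
  have top: "U i = vsp M i" if "j < i" for i using top' that by simp
  \<comment> \<open>the elements generated by \<open>x\<close> under the maps \<open>a\<^sub>i\<close>, one at each vertex up to \<open>j\<close>\<close>
  define y where "y = (\<lambda>i. ladder M i (j - i) x)"
  have yj: "y j = x" by (simp add: y_def)
  have ya: "amap M i (y i) = y (i-1)" if "1 \<le> i" "i \<le> j" for i
  proof -
    have "j - (i - 1) = Suc (j - i)" "Suc (i - 1) = i" using that by auto
    then show ?thesis by (simp add: y_def)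
  qed
  have y_in: "d \<le> j \<Longrightarrow> y (j - d) \<in> vsp M (j - d) \<and> y (j - d) \<notin> U (j - d)" for d
  proof (induction d)
    case 0
    then show ?case using x yj by simp
  next
    case (Suc d)
    define i where "i = j - d"
    have i: "1 \<le> i" "i \<le> j" "i \<in> {1..n-1}" "j - Suc d = i - 1" using Suc.prems j by (auto simp: i_def)
    have "y i \<in> vsp M i" "y i \<notin> U i" using Suc by (auto simp: i_def)
    then show ?case
      using dmod_amap_in[OF M i(3), of "y i"] sat[OF i(3), of "y i"] ya[OF i(1,2)] unfolding i(4) by auto
  qed
  have yV: "y i \<in> vsp M i" and yU: "y i \<notin> U i" if "i \<le> j" for i
    using y_in[of "j - i"] that by auto
  \<comment> \<open>at \<open>j\<close> because \<open>U\<close> is everything above, then downwards by the mesh relation\<close>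
  have yb: "d \<le> j \<Longrightarrow> Suc (j - d) < n \<Longrightarrow> bmap M (Suc (j - d)) (y (j - d)) \<in> U (Suc (j - d))" for d
  proof (induction d)
    case 0
    then show ?case using top[of "Suc j"] dmod_bmap_in[OF M index_Suc, of j "y j"] yV[of j] by simp
  next
    case (Suc d)
    define i where "i = j - d"
    have i: "1 \<le> i" "i \<le> j" "i \<in> {1..n-1}" "j - Suc d = i - 1" "Suc (i - 1) = i" using Suc.prems j by (auto simp: i_def)
    have e: "y (i-1) = amap M i (y i)" using ya[OF i(1,2)] by simp
    have "bmap M i (y (i-1)) \<in> U i"
    proof (cases "Suc i < n")
      case True
      have "amap M (Suc i) (bmap M (Suc i) (y i)) = bmap M i (amap M i (y i))"
        using dmod_mesh[OF M, of "Suc i" "y i"] True i yV by auto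
      moreover have "bmap M (Suc i) (y i) \<in> U (Suc i)" using Suc True by (simp add: i_def)
      then have "amap M (Suc i) (bmap M (Suc i) (y i)) \<in> U i" using Us(5)[OF index_Suc[OF True]] by simp
      ultimately show ?thesis using e by simp
    next
      case False
      then have "i = n - 1" using i by auto
      then have "bmap M i (amap M i (y i)) = 0" using dmod_top[OF M, of "y i"] yV[OF i(2)] by simp
      then show ?thesis using e cvec.subspace_0[OF Us(3)] by simp
    qed
    then show ?case unfolding i(4) by (simp only: i(5))
  qed
  have yb': "bmap M i (y (i-1)) \<in> U i" if "i \<in> {1..n-1}" "i - 1 \<le> j" for i
    using yb[of "j - (i - 1)"] that n by auto
  define U' where "U' = (\<lambda>i. if i \<le> j then {z. \<exists>c. z - c *\<^sub>C y i \<in> U i} else U i)"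
  have U'I: "z \<in> U' i" if "i \<le> j" "z - c *\<^sub>C y i \<in> U i" for z c i using that by (auto simp: U'_def)
  have U'E: "\<exists>c. z - c *\<^sub>C y i \<in> U i" if "i \<le> j" "z \<in> U' i" for z i using that by (auto simp: U'_def)
  have U'top: "U' i = vsp M i" if "j < i" for i using that top by (simp add: U'_def)
  have UU': "U i \<subseteq> U' i" for i
  proof
    fix u assume u: "u \<in> U i"
    show "u \<in> U' i"
      by (cases "i \<le> j") (use U'I[of i u 0] u in \<open>simp_all add: U'_def\<close>)
  qed
  have U'V: "U' i \<subseteq> vsp M i" for i
  proof
    fix z assume z: "z \<in> U' i"
    show "z \<in> vsp M i"
    proof (cases "i \<le> j")
      case True
      then obtain c where c: "z - c *\<^sub>C y i \<in> U i" using U'E[OF True z] by blast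
      have "z - c *\<^sub>C y i + c *\<^sub>C y i \<in> vsp M i"
        using c Us(2) yV[OF True] dmod_add[OF M] dmod_scale[OF M] by (meson subsetD)
      then show ?thesis by simp
    qed (use z U'top in simp)
  qed
  have sub': "cvec.subspace (U' i)" for i
  proof (cases "i \<le> j")
    case True
    show ?thesis
      unfolding cvec.subspace_def
    proof (intro conjI ballI allI)
      show "0 \<in> U' i" using U'I[OF True, of 0 0] cvec.subspace_0[OF Us(3)] by simp
      show "z + z' \<in> U' i" if zz: "z \<in> U' i" "z' \<in> U' i" for z z'
      proof -
        obtain c c' where "z - c *\<^sub>C y i \<in> U i" "z' - c' *\<^sub>C y i \<in> U i" using U'E[OF True] zz by blast
        then have "(z - c *\<^sub>C y i) + (z' - c' *\<^sub>C y i) \<in> U i" by (rule cvec.subspace_add[OF Us(3)])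
        then show ?thesis by (intro U'I[OF True, of _ "c + c'"]) (simp add: scaleC_add_left algebra_simps)
      qed
      show "a *\<^sub>C z \<in> U' i" if zz: "z \<in> U' i" for a z
      proof -
        obtain c where "z - c *\<^sub>C y i \<in> U i" using U'E[OF True zz] by blast
        then have "a *\<^sub>C (z - c *\<^sub>C y i) \<in> U i" by (rule cvec.subspace_scale[OF Us(3)])
        then show ?thesis
          by (intro U'I[OF True, of _ "a * c"]) (simp add: cvec.scale_right_diff_distrib scaleC_scaleC)
      qed
    qed
  next
    case False
    then show ?thesis using U'top[of i] dmod_subspace[OF M] by simp
  qed
  have bU: "bmap M i z \<in> U i" if i: "i \<in> {1..n-1}" and z: "z \<in> U' (i-1)" for i z
  proof (cases "i - 1 \<le> j")
    case True
    then obtain c where c: "z - c *\<^sub>C y (i-1) \<in> U (i-1)" using U'E[OF True z] by blast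
    let ?u = "z - c *\<^sub>C y (i-1)"
    have "bmap M i (?u + c *\<^sub>C y (i-1)) = bmap M i ?u + bmap M i (c *\<^sub>C y (i-1))"
      by (intro dmod_bmap_add[OF M i] subsetD[OF Us(2) c] dmod_scale[OF M] yV[OF True])
    also have "bmap M i (c *\<^sub>C y (i-1)) = c *\<^sub>C bmap M i (y (i-1))"
      by (intro dmod_bmap_scale[OF M i] yV[OF True])
    finally have "bmap M i z = bmap M i ?u + c *\<^sub>C bmap M i (y (i-1))" by simp
    then show ?thesis
      using cvec.subspace_add[OF Us(3) Us(4)[OF i c] cvec.subspace_scale[OF Us(3) yb'[OF i True]], of c] by simp
  next
    case False
    then have "U i = vsp M i" "U' (i-1) = vsp M (i-1)" using top[of i] U'top[of "i-1"] by auto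
    then show ?thesis using z dmod_bmap_in[OF M i] by simp
  qed
  have aE: "amap M i z - c *\<^sub>C y (i-1) \<in> U (i-1)"
    if i: "i \<in> {1..n-1}" and z: "i \<le> j" "z \<in> vsp M i" "z - c *\<^sub>C y i \<in> U i" for i z c
  proof -
    have "amap M i (z - c *\<^sub>C y i) = amap M i z - c *\<^sub>C amap M i (y i)"
      using dmod_amap_diff[OF M i z(2) dmod_scale[OF M yV[OF z(1)]]] dmod_amap_scale[OF M i yV[OF z(1)]] by simp
    then show ?thesis using Us(5)[OF i z(3)] ya[of i] i z(1) by simp
  qed
  have aU: "amap M i z \<in> U' (i-1)" if i: "i \<in> {1..n-1}" and z: "z \<in> U' i" for i z
  proof (cases "i \<le> j")
    case True
    then obtain c where c: "z - c *\<^sub>C y i \<in> U i" using U'E[OF True z] by blast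
    then show ?thesis using aE[OF i True subsetD[OF U'V z] c] U'I[of "i-1"] True by simp
  next
    case False
    then have "z \<in> U i" using z by (simp add: U'_def)
    then show ?thesis using Us(5)[OF i] UU' by blast
  qed
  have dU': "dmod n (subrep M U')" by (rule submodule_dmod[OF M sub' U'V]) (simp_all add: aU subsetD[OF UU' bU] del: One_nat_def)
  have subU': "submodule n M U'" using dU' U'V by (simp add: submodule_def)
  have sat': "z \<in> U' i" if i: "i \<in> {1..n-1}" and z: "z \<in> vsp M i" "amap M i z \<in> U' (i-1)" for i z
  proof (cases "i \<le> j")
    case True
    then have "i - 1 \<le> j" by simp
    then obtain c where c: "amap M i z - c *\<^sub>C y (i-1) \<in> U (i-1)" using U'E[of "i-1", OF _ z(2)] by blast
    have "amap M i (z - c *\<^sub>C y i) = amap M i z - c *\<^sub>C amap M i (y i)"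
      using dmod_amap_diff[OF M i z(1) dmod_scale[OF M yV[OF True]]] dmod_amap_scale[OF M i yV[OF True]] by simp
    then have "amap M i (z - c *\<^sub>C y i) \<in> U (i-1)" using c ya[of i] i True by simp
    then have "z - c *\<^sub>C y i \<in> U i"
      by (intro sat[OF i] dmod_diff[OF M z(1)] dmod_scale[OF M yV[OF True]])
    then show ?thesis using U'I[OF True, of z c] by simp
  qed (use z U'top in simp)
  have D: "dmod n (Delta (Suc j))" using j by (intro dmod_Delta) auto
  define R where "R = (\<lambda>i z (c::complex). if i \<le> j then z - c *\<^sub>C y i \<in> U i else c = 0)"
  have "\<exists>p\<in>Hom n (subrep M U') (Delta (Suc j)). \<forall>i. \<forall>z\<in>U' i. \<forall>c\<in>vsp (Delta (Suc j)) i. R i z c \<longleftrightarrow> p i z = c"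
  proof (rule Hom_of_relation[OF dU' D, of R], goal_cases)
    case (1 i z)
    show ?case
    proof (cases "i \<le> j")
      case True
      then obtain c where c: "z - c *\<^sub>C y i \<in> U i" using U'E[OF True] 1 by auto
      then show ?thesis using True by (intro bexI[of _ c]) (simp_all add: R_def Delta_def)
    qed (auto simp: R_def Delta_def)
  next
    case (2 i c)
    show ?case
    proof (rule ccontr)
      assume c: "c \<noteq> 0"
      then have i: "i \<le> j" "- c *\<^sub>C y i \<in> U i" using 2 by (auto simp: R_def split: if_splits)
      have "(- inverse c) *\<^sub>C (- c *\<^sub>C y i) \<in> U i" by (rule cvec.subspace_scale[OF Us(3) i(2)])
      then show False using c yU[OF i(1)] by (simp add: scaleC_scaleC scaleC_one)
    qed
  next
    case (3 i z c z' c')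
    then show ?case
      using cvec.subspace_add[OF Us(3), of "z - c *\<^sub>C y i" i "z' - c' *\<^sub>C y i"]
      by (auto simp: R_def scaleC_add_left algebra_simps split: if_splits)
  next
    case (4 i a z c)
    then show ?case
      using cvec.subspace_scale[OF Us(3), of "z - c *\<^sub>C y i" i a]
      by (auto simp: R_def scaleC_scaleC cvec.scale_right_diff_distrib scaleC_complex_def split: if_splits)
  next
    case (5 i z c)
    then show ?case using bU[of i z] by (auto simp: R_def Delta_def)
  next
    case (6 i z c)
    show ?case
    proof (cases "i \<le> j")
      case True
      then show ?thesis using 6 aE[of i z c] U'V by (auto simp: R_def Delta_def)
    next
      case False
      then have z: "c = 0" "z \<in> U i" using 6 by (auto simp: R_def U'_def)
      then have "amap M i z \<in> U (i-1)" using 6 Us(5) by blast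
      then show ?thesis using z False 6 by (auto simp: R_def Delta_def)
    qed
  next
    case (7 h)
    then show ?case by (intro bexI[of _ h]) auto
  qed
  then obtain p where p: "p \<in> Hom n (subrep M U') (Delta (Suc j))"
    and pR': "\<forall>i. \<forall>z\<in>U' i. \<forall>c\<in>vsp (Delta (Suc j)) i. R i z c \<longleftrightarrow> p i z = c" by (rule bexE)
  note pR = pR'[rule_format]
  have hidH: "hid (subrep M U) \<in> Hom n (subrep M U) (subrep M U')"
  proof (rule HomI)
  qed (use UU' Us cvec.subspace_add[OF Us(3)] cvec.subspace_scale[OF Us(3)] in \<open>auto simp: hid_def simp del: One_nat_def\<close>)
  have "ses n (subrep M U) (subrep M U') (Delta (Suc j)) (hid (subrep M U)) p"
    unfolding ses_def
  proof (intro conjI allI Us(1) dU' D hidH p)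
    fix i
    show "inj_on (hid (subrep M U) i) (vsp (subrep M U) i)" by (auto simp: inj_on_def hid_def)
    have "hid (subrep M U) i ` U i = U i" by (auto simp: hid_def image_iff)
    also have "U i = {z \<in> U' i. p i z = 0}"
    proof -
      have "p i z = 0 \<longleftrightarrow> z \<in> U i" if "z \<in> U' i" for z
        using pR[OF that, of 0] that by (auto simp: R_def Delta_def U'_def split: if_splits)
      then show ?thesis using UU' by blast
    qed
    finally show "hid (subrep M U) i ` vsp (subrep M U) i = {z \<in> vsp (subrep M U') i. p i z = 0}" by simp
    show "p i ` vsp (subrep M U') i = vsp (Delta (Suc j)) i"
    proof (intro subset_antisym subsetI)
      fix c assume "c \<in> p i ` vsp (subrep M U') i"
      then show "c \<in> vsp (Delta (Suc j)) i" using Hom_in[OF p] by auto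
    next
      fix c assume c: "c \<in> vsp (Delta (Suc j)) i"
      show "c \<in> p i ` vsp (subrep M U') i"
      proof (cases "i \<le> j")
        case True
        have "c *\<^sub>C y i - c *\<^sub>C y i \<in> U i" using cvec.subspace_0[OF Us(3)] by simp
        then have "c *\<^sub>C y i \<in> U' i" "R i (c *\<^sub>C y i) c" using U'I[OF True, of "c *\<^sub>C y i" c] True by (simp_all add: R_def)
        then show ?thesis using pR c by (metis imageI subrep_vsp(1))
      next
        case False
        then have "c = 0" using c by (simp add: Delta_def split: if_splits)
        then show ?thesis using Hom_0[OF p, of i] cvec.subspace_0[OF sub', of i] by (metis imageI subrep_vsp(1))
      qed
    qed
  qed
  note sesU' = this
  have xU': "x \<in> U' j" using U'I[of j x 1] yj cvec.subspace_0[OF Us(3), of j] by (simp add: scaleC_one)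
  have satU': "saturated n M U'" unfolding saturated_def using sat' by simp
  show ?thesis by (rule that[OF subU' allI[OF UU'] xU' satU' sesU'])
qed

definition Delta_chain :: "nat \<Rightarrow> 'v::complex_vector rep \<Rightarrow> (nat \<Rightarrow> 'v set) \<Rightarrow> nat list \<Rightarrow> bool" where
  "Delta_chain n M U ls \<longleftrightarrow> set ls \<subseteq> {1..n} \<and>
     (\<exists>W. (\<forall>k\<le>length ls. submodule n M (W k)) \<and> W 0 = U \<and> W (length ls) = vsp M \<and>
       (\<forall>k<length ls. (\<forall>i. W k i \<subseteq> W (Suc k) i) \<and>
          (\<exists>p. ses n (subrep M (W k)) (subrep M (W (Suc k))) (Delta (ls ! k))
                 (hid (subrep M (W k))) p)))"

text \<open>
  The standard modules are split off one at a time from the bottom of \<open>M / U\<close>, beginning at the largest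
  vertex where \<open>U\<close> is proper; finite sets \<open>B i\<close> that complete \<open>U\<close> to \<open>M\<close> bound the number of steps.
\<close>

lemma filtration_exists:
  assumes n: "n > 1" and M: "dmod n M"
  shows "submodule n M U \<Longrightarrow>
    saturated n M U \<Longrightarrow> \<forall>i. finite (B i) \<and> vsp M i = cvec.span (U i \<union> B i) \<Longrightarrow>
    \<exists>ls. Delta_chain n M U ls"
proof (induction "\<Sum>i<n. card (B i)" arbitrary: U B rule: less_induct)
  case less
  note U = less.prems(1) and sat = less.prems(2) and B = less.prems(3)[rule_format]
  show ?case
  proof (cases "U = vsp M")
    case True
    then show ?thesis using U unfolding Delta_chain_def by (intro exI[of _ "[]"] conjI exI[of _ "\<lambda>_. U"]) simp_all
  next
    case False
    note Us = submoduleD[OF M U]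
    define A where "A = {i. U i \<noteq> vsp M i}"
    have A: "A \<subseteq> {..<n}" using dmod_outside[OF M] dmod_outside[OF Us(1)] by (auto simp: A_def not_less[symmetric])
    then have fin: "finite A" by (rule finite_subset) simp
    have "A \<noteq> {}" using False by (auto simp: A_def fun_eq_iff)
    define j where "j = Max A"
    have jA: "j \<in> A" using Max_in[OF fin \<open>A \<noteq> {}\<close>] by (simp add: j_def)
    have top: "U i = vsp M i" if "j < i" for i
      using Max_ge[OF fin, of i] that by (auto simp: j_def A_def)
    have j: "j < n" "U j \<noteq> vsp M j" using jA A by (auto simp: A_def)
    have "\<not> B j \<subseteq> U j"
    proof
      assume "B j \<subseteq> U j"
      then have "U j \<union> B j = U j" by blast
      then have "vsp M j = U j" using B[of j] cvec.span_eq_iff[of "U j"] Us(3)[of j] by simp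
      then show False using j by simp
    qed
    then obtain x where x: "x \<in> B j" "x \<notin> U j" by blast
    have xV: "x \<in> vsp M j" using B[of j] x cvec.span_base[of x "U j \<union> B j"] by simp
    have top': "\<forall>i>j. U i = vsp M i" using top by simp
    obtain U' p where U': "submodule n M U'" "\<forall>i. U i \<subseteq> U' i" "x \<in> U' j" "saturated n M U'"
      "ses n (subrep M U) (subrep M U') (Delta (Suc j)) (hid (subrep M U)) p"
      by (rule extend_by_Delta[OF n M U sat j(1) top' xV x(2)])
    note U's = submoduleD[OF M U'(1)]
    define B' where "B' = B(j := B j - {x})"
    have lt: "(\<Sum>i<n. card (B' i)) < (\<Sum>i<n. card (B i))"
    proof (rule sum_strict_mono_ex1)
      show "\<forall>i\<in>{..<n}. card (B' i) \<le> card (B i)"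
        using B by (auto simp: B'_def intro: card_mono)
      have "card (B j - {x}) < card (B j)" using B[of j] x(1) by (intro psubset_card_mono) auto
      then show "\<exists>i\<in>{..<n}. card (B' i) < card (B i)"
        using j(1) by (intro bexI[of _ j]) (simp_all add: B'_def)
    qed simp
    have B': "finite (B' i) \<and> vsp M i = cvec.span (U' i \<union> B' i)" for i
    proof (intro conjI subset_antisym)
      show "finite (B' i)" using B by (simp add: B'_def)
      have "U i \<union> B i \<subseteq> U' i \<union> B' i" using U'(2)[rule_format, of i] U'(3) by (auto simp: B'_def)
      then show "vsp M i \<subseteq> cvec.span (U' i \<union> B' i)" using B[of i] cvec.span_mono by metis
      have "B i \<subseteq> vsp M i" using B[of i] cvec.span_superset[of "U i \<union> B i"] by auto
      then have "U' i \<union> B' i \<subseteq> vsp M i" using U's(2)[of i] by (auto simp: B'_def)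
      then show "cvec.span (U' i \<union> B' i) \<subseteq> vsp M i" by (rule cvec.span_minimal[OF _ dmod_subspace[OF M]])
    qed
    obtain ls W where W: "set ls \<subseteq> {1..n}" "\<forall>k\<le>length ls. submodule n M (W k)" "W 0 = U'" "W (length ls) = vsp M"
       "\<forall>k<length ls. (\<forall>i. W k i \<subseteq> W (Suc k) i) \<and>
          (\<exists>p. ses n (subrep M (W k)) (subrep M (W (Suc k))) (Delta (ls ! k)) (hid (subrep M (W k))) p)"
      using less.hyps[OF lt U'(1) U'(4) allI[OF B']] unfolding Delta_chain_def by blast
    define W' where "W' = (\<lambda>k. case k of 0 \<Rightarrow> U | Suc k \<Rightarrow> W k)"
    show ?thesis
      unfolding Delta_chain_def
    proof (intro exI[of _ "Suc j # ls"] exI[of _ W'] conjI allI impI)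
      show "set (Suc j # ls) \<subseteq> {1..n}" using W(1) j(1) by auto
      show "submodule n M (W' k)" if "k \<le> length (Suc j # ls)" for k
        using that W(2) U by (cases k) (auto simp: W'_def)
      show "W' 0 = U" by (simp add: W'_def)
      show "W' (length (Suc j # ls)) = vsp M" using W(4) by (simp add: W'_def)
      show "W' k i \<subseteq> W' (Suc k) i" if "k < length (Suc j # ls)" for k i
        using that W(3,5) U'(2) by (cases k) (auto simp: W'_def)
      show "\<exists>p. ses n (subrep M (W' k)) (subrep M (W' (Suc k))) (Delta ((Suc j # ls) ! k)) (hid (subrep M (W' k))) p"
        if "k < length (Suc j # ls)" for k
        using that W(3,5) U'(5) by (cases k) (auto simp: W'_def)
    qed
  qed
qed

text \<open>
  An extension of modules with injective \<open>a\<^sub>i\<close> has injective \<open>a\<^sub>i\<close>, and this holds for standard modules; the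
  converse is the filtration above, started at \<open>0\<close>.
\<close>

lemma good_iff_a_injective:
  assumes n: "n > 1" and M: "dmod n M"
  shows "good n M \<longleftrightarrow> a_injective n M"
proof
  assume a: "a_injective n M"
  have "\<forall>i. \<exists>B. finite B \<and> vsp M i = cvec.span B"
    using dmod_fin_dim[OF M] unfolding fin_dim_subspace_def by simp
  then obtain B where B: "\<And>i. finite (B i) \<and> vsp M i = cvec.span (B i)" by metis
  have "dmod n (subrep M (\<lambda>_. {0}))"
    by (rule submodule_dmod[OF M])
      (simp_all add: dmod_0[OF M] dmod_bmap_0[OF M] dmod_amap_0[OF M] del: One_nat_def)
  then have sub: "submodule n M (\<lambda>_. {0})" by (simp add: submodule_def dmod_0[OF M])
  have sat: "saturated n M (\<lambda>_. {0})" using a by (simp add: saturated_def a_injective_def)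
  have "\<forall>i. finite (B i) \<and> vsp M i = cvec.span ({0} \<union> B i)"
    using B by (simp add: cvec.span_insert_0)
  from filtration_exists[OF n M sub sat this] have "\<exists>ls. delta_filtration n M ls"
    unfolding delta_filtration_def Delta_chain_def .
  then show "good n M" unfolding good_def by (rule conjI[OF M])
qed (rule good_imp_a_injective)

section \<open>The submodules of \<open>D e\<^sub>0\<close>\<close>

definition tail :: "nat set \<Rightarrow> nat \<Rightarrow> nat" where
  "tail I j = card {k \<in> I. j < k}"

lemma tail_pred:
  assumes "finite I" "1 \<le> j"
  shows "tail I (j - 1) = tail I j + (if j \<in> I then 1 else 0)"
proof -
  have "j - 1 < k \<longleftrightarrow> k = j \<or> j < k" for k using assms(2) by linarith
  then have "{k \<in> I. j - 1 < k} = {k \<in> I. j < k} \<union> (if j \<in> I then {j} else {})" by auto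
  then show ?thesis using assms(1) by (simp add: tail_def)
qed

lemma tail_mono: "finite I \<Longrightarrow> i \<le> j \<Longrightarrow> tail I j \<le> tail I i"
  unfolding tail_def by (intro card_mono) auto

lemma tail_le:
  assumes "I \<subseteq> {1..n}"
  shows "tail I j \<le> n - j"
proof -
  have "{k \<in> I. j < k} \<subseteq> {j<..n}" using assms by auto
  from card_mono[OF _ this] show ?thesis by (simp add: tail_def)
qed

lemma tail_0: "I \<subseteq> {1..n} \<Longrightarrow> tail I 0 = card I"
  unfolding tail_def by (intro arg_cong[of _ _ card]) auto

lemma tail_le_card: "finite I \<Longrightarrow> tail I j \<le> card I"
  unfolding tail_def by (intro card_mono) auto

lemma tail_outside: "I \<subseteq> {1..n} \<Longrightarrow> n \<le> j \<Longrightarrow> tail I j = 0"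
  using tail_le[of I n j] by simp

lemma tail_inj:
  assumes "I \<subseteq> {1..n}" "J \<subseteq> {1..n}" "\<And>j. j < n \<Longrightarrow> tail I j = tail J j"
  shows "I = J"
proof -
  have fin: "finite I" "finite J" using assms(1,2) by (auto intro: finite_subset)
  have eq: "tail I j = tail J j" for j
    using assms(3)[of j] tail_outside[OF assms(1)] tail_outside[OF assms(2)] by (cases "j < n") auto
  show ?thesis
  proof (rule Set.set_eqI)
    fix j
    show "j \<in> I \<longleftrightarrow> j \<in> J"
    proof (cases "1 \<le> j")
      case True
      have "tail J j + (if j \<in> I then 1 else 0) = tail J j + (if j \<in> J then 1 else 0)"
        using tail_pred[OF fin(1) True] tail_pred[OF fin(2) True] unfolding eq by (rule trans[OF sym])
      then show ?thesis by (cases "j \<in> I"; cases "j \<in> J") simp_all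
    next
      case False
      then show ?thesis using assms(1,2) by auto
    qed
  qed
qed

text \<open>
  In terms of \<open>e\<^sub>j D e\<^sub>0 = \<complex>[t]/t\<^bsup>n-j\<^esup>\<close> this is the ideal of dimension \<open>tail I j\<close>, spanned by the highest powers.
\<close>

definition MIv :: "nat \<Rightarrow> nat set \<Rightarrow> nat \<Rightarrow> univ set" where
  "MIv n I j = {f. \<forall>k. f k \<noteq> 0 \<longrightarrow> n - j \<le> k + tail I j \<and> k < n - j}"

lemma MIvD:
  assumes "f \<in> MIv n I j" "f k \<noteq> 0"
  shows "n - j \<le> k + tail I j" "k < n - j"
  using assms unfolding MIv_def by blast+

lemma MIvI: "(\<And>k. f k \<noteq> 0 \<Longrightarrow> n - j \<le> k + tail I j \<and> k < n - j) \<Longrightarrow> f \<in> MIv n I j"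
  unfolding MIv_def by blast

lemma subspace_MIv: "cvec.subspace (MIv n I j)"
proof -
  have "f k \<noteq> 0 \<or> g k \<noteq> 0" if "f k + g k \<noteq> 0" for f g :: univ and k using that by auto
  then show ?thesis
    unfolding cvec.subspace_def MIv_def scaleC_fun_def scaleC_complex_def by fastforce
qed

lemma MIv_unit: "unit_vec0 k \<in> MIv n I j \<longleftrightarrow> n - j \<le> k + tail I j \<and> k < n - j"
  by (auto simp: MIv_def unit_vec0_def)

lemma MIv_empty: "MIv n {} = (\<lambda>_. {0})"
proof
  fix j
  have "f = 0" if f: "f \<in> MIv n {} j" for f
  proof
    fix k
    show "f k = 0 k" using f unfolding MIv_def tail_def by fastforce
  qed
  moreover have "0 \<in> MIv n {} j" by (simp add: MIv_def)
  ultimately show "MIv n {} j = {0}" by blast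
qed

lemma MIv_tail_le: "j < n \<Longrightarrow> I \<subseteq> {1..n} \<Longrightarrow> MIv n I j \<subseteq> MIv n J j \<Longrightarrow> tail I j \<le> tail J j"
proof (cases "tail I j = 0")
  case False
  assume j: "j < n" and I: "I \<subseteq> {1..n}" and le: "MIv n I j \<subseteq> MIv n J j"
  have "unit_vec0 (n - j - tail I j) \<in> MIv n I j"
    unfolding MIv_unit using j False tail_le[OF I, of j] by auto
  then have "unit_vec0 (n - j - tail I j) \<in> MIv n J j" using le by blast
  then show ?thesis unfolding MIv_unit using tail_le[OF I, of j] j by auto
qed simp

lemma D0_simps:
  "vsp (D0 n) j = {f. \<forall>k\<ge>n - j. f k = 0}"
  "bmap (D0 n) j f k = (if k < n - j then f k else 0)"
  "amap (D0 n) j f k = (if k = 0 then 0 else f (k - 1))"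
  by (simp_all add: D0_def)

context
  fixes n :: nat
  assumes n: "n > 1"
begin

lemma MIv_submodule:
  assumes I: "I \<subseteq> {1..n}"
  shows "submodule n (D0 n) (MIv n I)"
proof -
  have fin: "finite I" using I by (auto intro: finite_subset)
  have le: "MIv n I i \<subseteq> vsp (D0 n) i" for i
  proof
    fix f assume f: "f \<in> MIv n I i"
    have "f k = 0" if "n - i \<le> k" for k using MIvD(2)[OF f, of k] that by (meson not_less)
    then show "f \<in> vsp (D0 n) i" unfolding D0_simps by blast
  qed
  have "dmod n (subrep (D0 n) (MIv n I))"
  proof (rule submodule_dmod[OF dmod_D0[OF n] subspace_MIv le])
    fix i f assume i: "i \<in> {1..n-1}" and f: "f \<in> MIv n I (i-1)"
    have t1: "tail I (i-1) \<le> tail I i + 1" using tail_pred[OF fin, of i] i by simp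
    have t2: "n - (i-1) = Suc (n - i)" using i n by auto
    have "n - i \<le> k + tail I i" if "f k \<noteq> 0" for k
    proof -
      have "n - (i-1) \<le> k + tail I (i-1)" by (rule MIvD(1)[OF f that])
      then have "Suc (n - i) \<le> k + (tail I i + 1)" unfolding t2 using t1 by (rule order_trans[OF _ add_left_mono])
      then show ?thesis by simp
    qed
    then show "bmap (D0 n) i f \<in> MIv n I i" by (intro MIvI) (simp add: D0_simps split: if_splits)
  next
    fix i f assume i: "i \<in> {1..n-1}" and f: "f \<in> MIv n I i"
    have t: "tail I i \<le> tail I (i-1)" by (rule tail_mono[OF fin]) simp
    have *: "n - (i-1) = Suc (n - i)" using i n by auto
    have "n - (i-1) \<le> Suc k + tail I (i-1) \<and> Suc k < n - (i-1)" if "f k \<noteq> 0" for k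
    proof -
      note a = MIvD(1)[OF f that] and b = MIvD(2)[OF f that]
      have "n - i \<le> k + tail I (i-1)" by (rule order_trans[OF a add_left_mono[OF t]])
      then show ?thesis unfolding * using b by (simp only: add_Suc Suc_le_mono Suc_less_eq simp_thms)
    qed
    then have "n - (i-1) \<le> k + tail I (i-1) \<and> k < n - (i-1)" if "amap (D0 n) i f k \<noteq> 0" for k
      using that by (cases k) (simp_all add: D0_simps del: One_nat_def)
    then show "amap (D0 n) i f \<in> MIv n I (i-1)" by (rule MIvI)
  qed
  then show ?thesis using le by (simp add: submodule_def)
qed

text \<open>A subspace of \<open>\<complex>[t]/t\<^sup>N\<close> stable under \<open>t\<close> is generated by a power of \<open>t\<close>.\<close>

lemma shift_stable_subspace:
  fixes V :: "univ set"
  assumes V: "cvec.subspace V" and le: "\<And>f k. f \<in> V \<Longrightarrow> N \<le> k \<Longrightarrow> f k = 0"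
    and stable: "\<And>f. f \<in> V \<Longrightarrow> (\<lambda>k. if k = 0 \<or> N \<le> k then 0 else f (k - 1)) \<in> V"
  shows "\<exists>r\<le>N. V = {f. \<forall>k. f k \<noteq> 0 \<longrightarrow> N \<le> k + r \<and> k < N}"
proof (cases "\<exists>f\<in>V. \<exists>k. f k \<noteq> 0")
  case False
  have "V = {f. \<forall>k. f k \<noteq> 0 \<longrightarrow> N \<le> k + 0 \<and> k < N}" (is "V = ?W")
  proof (rule subset_antisym)
    show "V \<subseteq> ?W" using False by blast
    show "?W \<subseteq> V"
    proof
      fix f :: univ assume f: "f \<in> ?W"
      have "f k = 0" for k
      proof (rule ccontr)
        assume "f k \<noteq> 0"
        then have "N \<le> k + 0 \<and> k < N" using f by blast
        then show False by linarith
      qed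
      then have "f = 0" by (simp add: fun_eq_iff)
      then show "f \<in> V" using cvec.subspace_0[OF V] by simp
    qed
  qed
  then show ?thesis by (intro exI[of _ 0]) simp
next
  case True
  define u where "u = (LEAST k. \<exists>f\<in>V. f k \<noteq> 0)"
  have "\<exists>f\<in>V. f u \<noteq> 0" unfolding u_def by (rule LeastI_ex) (use True in blast)
  then obtain f0 where f0: "f0 \<in> V" "f0 u \<noteq> 0" by blast
  have least: "f k = 0" if "f \<in> V" "k < u" for f k
    using not_less_Least[of k "\<lambda>k. \<exists>f\<in>V. f k \<noteq> 0"] that unfolding u_def by blast
  have uN: "u < N" using le[OF f0(1), of u] f0(2) by (meson not_less)
  define S where "S = (\<lambda>(f::univ) k. if k = 0 \<or> N \<le> k then 0 else f (k - 1))"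
  have SV: "(S ^^ d) f \<in> V" if "f \<in> V" for d f
    using that by (induction d) (use stable in \<open>simp_all add: S_def\<close>)
  have S_val: "k < N \<Longrightarrow> (S ^^ d) f k = (if d \<le> k then f (k - d) else 0)" for d f k
  proof (induction d arbitrary: k)
    case (Suc d)
    have "(S ^^ Suc d) f k = (if k = 0 then 0 else (S ^^ d) f (k - 1))"
      using Suc.prems by (simp add: S_def)
    also have "\<dots> = (if Suc d \<le> k then f (k - Suc d) else 0)" using Suc by (cases k) auto
    finally show ?case .
  qed simp
  have unit: "u \<le> k \<Longrightarrow> k < N \<Longrightarrow> unit_vec0 k \<in> V" for k
  proof (induction "N - k" arbitrary: k rule: less_induct)
    case less
    define g where "g = (S ^^ (k - u)) f0"
    have g: "g \<in> V" using SV f0 by (simp add: g_def)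
    have gk: "g k = f0 u" using S_val[OF less(3), of "k - u" f0] less(2) by (simp add: g_def)
    have g0: "g i = 0" if "i < k" for i
    proof -
      have "i < N" using that less(3) by simp
      then show ?thesis using S_val[of i "k - u" f0] least[OF f0(1), of "i - (k - u)"] that less(2)
        by (auto simp: g_def)
    qed
    have "g = (\<Sum>i<N. g i *\<^sub>C unit_vec0 i)" using le[OF g] by (intro unit_vec0_expansion) simp
    also have "\<dots> = (\<Sum>i\<in>{k<..<N}. g i *\<^sub>C unit_vec0 i) + g k *\<^sub>C unit_vec0 k"
    proof -
      have "(\<Sum>i<N. g i *\<^sub>C unit_vec0 i) = (\<Sum>i\<in>insert k {k<..<N}. g i *\<^sub>C unit_vec0 i)"
        using less(3) g0 by (intro sum.mono_neutral_right) (auto simp: not_less)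
      then show ?thesis by (simp add: add.commute)
    qed
    finally have e: "g k *\<^sub>C unit_vec0 k = g - (\<Sum>i\<in>{k<..<N}. g i *\<^sub>C unit_vec0 i)"
      by (simp add: eq_diff_eq add.commute)
    have "(\<Sum>i\<in>{k<..<N}. g i *\<^sub>C unit_vec0 i) \<in> V"
      using less by (intro cvec.subspace_sum[OF V] cvec.subspace_scale[OF V]) auto
    then have "g k *\<^sub>C unit_vec0 k \<in> V" unfolding e by (rule cvec.subspace_diff[OF V g])
    then have "inverse (g k) *\<^sub>C (g k *\<^sub>C unit_vec0 k) \<in> V" by (rule cvec.subspace_scale[OF V])
    then show ?case using gk f0(2) by (simp add: scaleC_scaleC scaleC_one)
  qed
  have "V = {f. \<forall>k. f k \<noteq> 0 \<longrightarrow> N \<le> k + (N - u) \<and> k < N}"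
  proof (intro subset_antisym subsetI)
    fix f assume f: "f \<in> V"
    then have "u \<le> k \<and> k < N" if "f k \<noteq> 0" for k
      using that least[OF f, of k] le[OF f, of k] by (meson not_le)
    then have "N \<le> k + (N - u) \<and> k < N" if "f k \<noteq> 0" for k using that by fastforce
    then show "f \<in> {f. \<forall>k. f k \<noteq> 0 \<longrightarrow> N \<le> k + (N - u) \<and> k < N}" by blast
  next
    fix f :: univ assume "f \<in> {f. \<forall>k. f k \<noteq> 0 \<longrightarrow> N \<le> k + (N - u) \<and> k < N}"
    then have f: "f k \<noteq> 0 \<Longrightarrow> u \<le> k \<and> k < N" for k using uN by force
    have "f = (\<Sum>i<N. f i *\<^sub>C unit_vec0 i)" using f by (intro unit_vec0_expansion) (meson not_le)
    also have "\<dots> \<in> V"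
    proof (rule cvec.subspace_sum[OF V])
      fix i
      show "f i *\<^sub>C unit_vec0 i \<in> V"
        using unit[of i] f[of i] cvec.subspace_scale[OF V] cvec.subspace_0[OF V] by (cases "f i = 0") auto
    qed
    finally show "f \<in> V" .
  qed
  then show ?thesis by (intro exI[of _ "N - u"]) simp
qed

text \<open>
  A submodule of \<open>D e\<^sub>0\<close> is an ideal of \<open>\<complex>[t]/t\<^bsup>n-j\<^esup>\<close> at each vertex \<open>j\<close>, so it is given by its dimensions.
  Stability under \<open>a\<^sub>j\<close> and \<open>b\<^sub>j\<close> says that they drop by \<open>0\<close> or \<open>1\<close> from one vertex to the next; \<open>I\<close> records where
  they drop.
\<close>

lemma D0_submodule_cases:
  assumes U: "submodule n (D0 n) U"
  obtains I where "I \<subseteq> {1..n}" "U = MIv n I"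
proof -
  note Us = submoduleD[OF dmod_D0[OF n] U]
  have "\<exists>r\<le>n - j. U j = {f. \<forall>k. f k \<noteq> 0 \<longrightarrow> n - j \<le> k + r \<and> k < n - j}" for j
  proof (rule shift_stable_subspace[OF Us(3)])
    show "f k = 0" if "f \<in> U j" "n - j \<le> k" for f k using Us(2)[of j] that by (auto simp: D0_simps)
    show "(\<lambda>k. if k = 0 \<or> n - j \<le> k then 0 else f (k - 1)) \<in> U j" if f: "f \<in> U j" for f
    proof (cases "Suc j < n")
      case True
      have "amap (D0 n) (Suc j) (bmap (D0 n) (Suc j) f) \<in> U j"
        using Us(5)[OF index_Suc[OF True]] Us(4)[OF index_Suc[OF True]] f by simp
      also have "amap (D0 n) (Suc j) (bmap (D0 n) (Suc j) f) = (\<lambda>k. if k = 0 \<or> n - j \<le> k then 0 else f (k - 1))"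
        using True by (auto simp: D0_simps fun_eq_iff)
      finally show ?thesis .
    next
      case False
      then have "(\<lambda>k. if k = 0 \<or> n - j \<le> k then 0 else f (k - 1)) = 0" by (auto simp: fun_eq_iff)
      then show ?thesis using cvec.subspace_0[OF Us(3)] by simp
    qed
  qed
  then have "\<forall>j. \<exists>r. r \<le> n - j \<and> U j = {f. \<forall>k. f k \<noteq> 0 \<longrightarrow> n - j \<le> k + r \<and> k < n - j}" by (rule allI)
  from choice[OF this] obtain r where
    r0: "\<forall>j. r j \<le> n - j \<and> U j = {f. \<forall>k. f k \<noteq> 0 \<longrightarrow> n - j \<le> k + r j \<and> k < n - j}" by (rule exE)
  have r: "r j \<le> n - j" "U j = {f. \<forall>k. f k \<noteq> 0 \<longrightarrow> n - j \<le> k + r j \<and> k < n - j}" for j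
    using spec[OF r0, of j] by (rule conjunct1, rule conjunct2)
  have unit: "unit_vec0 k \<in> U j \<longleftrightarrow> n - j \<le> k + r j \<and> k < n - j" for k j
    by (auto simp: r(2) unit_vec0_def)
  have step: "r j \<le> r (j-1) \<and> r (j-1) \<le> r j + 1" if j: "j \<in> {1..n}" for j
  proof (cases "j = n")
    case True
    then show ?thesis using r(1)[of n] r(1)[of "n-1"] n by simp
  next
    case False
    then have j': "j \<in> {1..n-1}" "n - (j - 1) = Suc (n - j)" "j < n" using j by auto
    have "r j \<le> r (j-1)"
    proof (cases "r j = 0")
      case False
      have "unit_vec0 (n - j - r j) \<in> U j" unfolding unit using r(1)[of j] False j' by auto
      then have "amap (D0 n) j (unit_vec0 (n - j - r j)) \<in> U (j-1)" by (rule Us(5)[OF j'(1)])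
      also have "amap (D0 n) j (unit_vec0 (n - j - r j)) = unit_vec0 (Suc (n - j - r j))"
        by (auto simp: D0_simps unit_vec0_def fun_eq_iff)
      finally have "n - (j-1) \<le> Suc (n - j - r j) + r (j-1)" unfolding unit by (rule conjunct1)
      then show ?thesis using r(1)[of j] j'(2) by linarith
    qed simp
    moreover have "r (j-1) \<le> r j + 1"
    proof (cases "r (j-1) \<le> 1")
      case False
      have lt: "n - (j-1) - r (j-1) < n - j" using False r(1)[of "j-1"] j' by auto
      have "unit_vec0 (n - (j-1) - r (j-1)) \<in> U (j-1)"
        unfolding unit using r(1)[of "j-1"] False j' by auto
      then have "bmap (D0 n) j (unit_vec0 (n - (j-1) - r (j-1))) \<in> U j" by (rule Us(4)[OF j'(1)])
      also have "bmap (D0 n) j (unit_vec0 (n - (j-1) - r (j-1))) = unit_vec0 (n - (j-1) - r (j-1))"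
        using lt by (auto simp: D0_simps unit_vec0_def fun_eq_iff)
      finally have "n - j \<le> n - (j-1) - r (j-1) + r j" unfolding unit by (rule conjunct1)
      then show ?thesis using r(1)[of "j-1"] j'(2) by linarith
    qed simp
    ultimately show ?thesis by simp
  qed
  \<comment> \<open>\<open>r j\<close> is the dimension of \<open>U\<close> at vertex \<open>j\<close>\<close>
  define I where "I = {j \<in> {1..n}. r (j-1) = r j + 1}"
  have I: "I \<subseteq> {1..n}" and fin: "finite I" by (auto simp: I_def)
  have "d \<le> n \<Longrightarrow> tail I (n - d) = r (n - d)" for d
  proof (induction d)
    case 0
    then show ?case using r(1)[of n] tail_outside[OF I, of n] by simp
  next
    case (Suc d)
    have *: "n - d \<in> {1..n}" "n - d - 1 = n - Suc d" "1 \<le> n - d" using Suc.prems by auto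
    then show ?case
      using Suc tail_pred[OF fin *(3)] step[OF *(1)] unfolding *(2) by (auto simp: I_def *(2))
  qed
  then have "tail I j = r j" if "j \<le> n" for j
    using that by (metis diff_diff_cancel diff_le_self)
  moreover have "tail I j = r j" if "n < j" for j
    using tail_outside[OF I, of j] r(1)[of j] that by simp
  ultimately have "tail I j = r j" for j by (meson not_le)
  then have "U = MIv n I" by (simp add: fun_eq_iff MIv_def r(2))
  then show ?thesis by (rule that[OF I])
qed

lemma a_injective_D0_sub: "a_injective n (subrep (D0 n) U)"
  unfolding a_injective_def
proof (intro ballI impI ext)
  fix i x k assume "amap (subrep (D0 n) U) i x = 0"
  then have "amap (D0 n) i x (Suc k) = 0" by (simp add: fun_eq_iff)
  then show "x k = 0 k" by (simp add: D0_simps)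
qed

text \<open>
  A factor \<open>\<Delta>\<^sub>l\<close> raises the dimension by one at the vertices below \<open>l\<close> only, which adds \<open>l\<close> to the set of drops.
\<close>

lemma Delta_step_tail:
  assumes A: "A \<subseteq> {1..n}" and B: "B \<subseteq> {1..n}" and l: "1 \<le> l" "l \<le> n"
    and s: "ses n (subrep (D0 n) (MIv n A)) (subrep (D0 n) (MIv n B)) (Delta l) (hid (subrep (D0 n) (MIv n A))) p"
  shows "B = insert l A"
proof -
  have fin: "finite A" "finite B" using A B by (auto intro: finite_subset)
  have p: "p \<in> Hom n (subrep (D0 n) (MIv n B)) (Delta l)"
    and ker0: "\<And>i. hid (subrep (D0 n) (MIv n A)) i ` MIv n A i = {y \<in> MIv n B i. p i y = 0}"
    and surj: "\<And>i. p i ` MIv n B i = vsp (Delta l) i"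
    using s unfolding ses_def by auto
  have "hid (subrep (D0 n) (MIv n A)) i ` MIv n A i = MIv n A i" for i
    by (auto simp: hid_def image_iff)
  then have ker: "MIv n A i = {y \<in> MIv n B i. p i y = 0}" for i using ker0 by simp
  have t: "tail B j = tail A j + (if j < l then 1 else 0)" if j: "j < n" for j
  proof (cases "j < l")
    case False
    then have "p j y = 0" if "y \<in> MIv n B j" for y
      using Hom_in[OF p, of y j] that by (simp add: Delta_def)
    then have "MIv n A j = MIv n B j" using ker[of j] by blast
    then show ?thesis using MIv_tail_le[OF j A, of B] MIv_tail_le[OF j B, of A] False by simp
  next
    case True
    have "(1::complex) \<in> p j ` MIv n B j" using surj True by (simp add: Delta_def)
    then obtain w where w: "w \<in> MIv n B j" "p j w = 1" by (metis imageE)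
    have le: "tail A j \<le> tail B j" using MIv_tail_le[OF j A, of B] ker[of j] by blast
    have ne: "tail A j \<noteq> tail B j"
    proof
      assume "tail A j = tail B j"
      then have "MIv n A j = MIv n B j" by (simp add: MIv_def)
      then have "w \<in> MIv n A j" using w(1) by simp
      then have "p j w = 0" unfolding ker[of j] by simp
      then show False using w(2) by simp
    qed
    have "tail B j \<le> tail A j + 1"
    proof (cases "tail B j \<le> 1")
      case False
      have Sj: "Suc j < n" using tail_le[OF B, of j] False by simp
      define m where "m = n - j - tail B j"
      have m: "m + tail B j = n - j" "Suc m < n - j" using tail_le[OF B, of j] False by (auto simp: m_def)
      have e: "unit_vec0 m \<in> MIv n B j" unfolding MIv_unit using m by simp
      note i = index_Suc[OF Sj]
      let ?b = "bmap (D0 n) (Suc j) (unit_vec0 m)"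
      have bB: "?b \<in> MIv n B (Suc j)"
        using submoduleD(4)[OF dmod_D0[OF n] MIv_submodule[OF B] i] e by simp
      have "amap (D0 n) (Suc j) ?b = unit_vec0 (Suc m)"
        using m by (auto simp: D0_simps unit_vec0_def fun_eq_iff)
      then have u: "unit_vec0 (Suc m) = amap (D0 n) (Suc j) ?b" by simp
      have "p j (amap (D0 n) (Suc j) ?b) = p (Suc j) ?b"
        using Hom_amap[OF p i, of ?b] bB by (simp add: Delta_def)
      also have "\<dots> = 0" using Hom_bmap[OF p i, of "unit_vec0 m"] e by (simp add: Delta_def)
      finally have "p j (unit_vec0 (Suc m)) = 0" unfolding u .
      moreover have "unit_vec0 (Suc m) \<in> MIv n B j" unfolding MIv_unit using m by simp
      ultimately have "unit_vec0 (Suc m) \<in> MIv n A j" unfolding ker[of j] by simp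
      then show ?thesis unfolding MIv_unit using m by simp
    qed simp
    then show ?thesis using le ne True by simp
  qed
  have t': "tail B j = tail A j + (if j < l then 1 else 0)" for j
    using t[of j] tail_outside[OF A, of j] tail_outside[OF B, of j] l by (cases "j < n") auto
  have tl: "tail (insert l A) j = tail A j + (if j < l \<and> l \<notin> A then 1 else 0)" for j
  proof -
    have "{k \<in> insert l A. j < k} = (if j < l then insert l {k \<in> A. j < k} else {k \<in> A. j < k})" by auto
    then show ?thesis using fin(1) by (auto simp: tail_def card_insert_if)
  qed
  have lA: "l \<notin> A"
  proof
    assume "l \<in> A"
    have "tail B (l-1) = tail B l + (if l \<in> B then 1 else 0)" by (rule tail_pred[OF fin(2) l(1)])
    moreover have "tail A (l-1) = tail A l + 1" using tail_pred[OF fin(1) l(1)] \<open>l \<in> A\<close> by simp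
    moreover have "tail B (l-1) = tail A (l-1) + 1" "tail B l = tail A l" using t'[of "l-1"] t'[of l] l by simp_all
    ultimately show False by (simp split: if_splits)
  qed
  show ?thesis
    by (rule tail_inj[OF B]) (use A l lA t' tl in simp_all)
qed

text \<open>
  Every filtration of this submodule passes through submodules of the same kind, so its factors are
  read off from the growing sets of drops.
\<close>

lemma delta_support_MIv:
  assumes I: "I \<subseteq> {1..n}"
  shows "good n (subrep (D0 n) (MIv n I))" "delta_support n (subrep (D0 n) (MIv n I)) = I"
proof -
  let ?M = "subrep (D0 n) (MIv n I)"
  have M: "dmod n ?M" using MIv_submodule[OF I] by (simp add: submodule_def)
  show g: "good n ?M" using good_iff_a_injective[OF n M] a_injective_D0_sub by simp
  have subsub: "subrep ?M U = subrep (D0 n) U" for U by (simp add: subrep_def)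
  have set: "set ls = I" if ls: "delta_filtration n ?M ls" for ls
  proof -
    obtain U where lsn: "set ls \<subseteq> {1..n}" and sub: "\<And>k. k \<le> length ls \<Longrightarrow> submodule n ?M (U k)"
      and U0: "U 0 = (\<lambda>_. {0})" and U1: "U (length ls) = vsp ?M"
      and step: "\<And>k. k < length ls \<Longrightarrow> \<exists>p. ses n (subrep ?M (U k)) (subrep ?M (U (Suc k))) (Delta (ls ! k))
                 (hid (subrep ?M (U k))) p"
      using ls unfolding delta_filtration_def by blast
    have subD: "submodule n (D0 n) (U k)" if "k \<le> length ls" for k
      using sub[OF that] submoduleD(2)[OF dmod_D0[OF n] MIv_submodule[OF I]]
      unfolding submodule_def subsub by (auto simp: subset_iff)
    have "k \<le> length ls \<Longrightarrow> U k = MIv n (set (take k ls))" for k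
    proof (induction k)
      case 0
      show ?case by (simp add: U0 MIv_empty)
    next
      case (Suc k)
      obtain B where B: "B \<subseteq> {1..n}" "U (Suc k) = MIv n B"
        by (rule D0_submodule_cases[OF subD[OF Suc.prems]])
      have k: "k < length ls" using Suc.prems by simp
      have A: "set (take k ls) \<subseteq> {1..n}" by (rule subset_trans[OF set_take_subset lsn])
      have "ls ! k \<in> {1..n}" by (rule subsetD[OF lsn nth_mem[OF k]])
      then have l: "1 \<le> ls ! k" "ls ! k \<le> n" by simp_all
      have Uk: "U k = MIv n (set (take k ls))" using Suc.IH k by simp
      obtain p where p: "ses n (subrep ?M (U k)) (subrep ?M (U (Suc k))) (Delta (ls ! k)) (hid (subrep ?M (U k))) p"
        using step[OF k] by (rule exE)
      have "B = insert (ls ! k) (set (take k ls))"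
        by (rule Delta_step_tail[OF A B(1) l p[unfolded subsub B(2) Uk]])
      then show ?case using B(2) k by (simp add: take_Suc_conv_app_nth)
    qed
    from this[of "length ls"] have "MIv n (set ls) = MIv n I" using U1 by simp
    then show ?thesis
      using MIv_tail_le[OF _ lsn, of _ I] MIv_tail_le[OF _ I, of _ "set ls"]
      by (intro tail_inj[OF lsn I] antisym) simp_all
  qed
  obtain ls where "delta_filtration n ?M ls" using g unfolding good_def by blast
  then show "delta_support n ?M = I" unfolding delta_support_def using set by auto
qed

lemma MI_eq:
  assumes I: "I \<subseteq> {1..n}"
  shows "MI n I = subrep (D0 n) (MIv n I)"
proof -
  have "(THE U. submodule n (D0 n) U \<and> good n (subrep (D0 n) U) \<and> delta_support n (subrep (D0 n) U) = I) = MIv n I"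
  proof (rule the_equality)
    show "submodule n (D0 n) (MIv n I) \<and> good n (subrep (D0 n) (MIv n I)) \<and> delta_support n (subrep (D0 n) (MIv n I)) = I"
      by (intro conjI MIv_submodule[OF I] delta_support_MIv[OF I])
    fix U assume U: "submodule n (D0 n) U \<and> good n (subrep (D0 n) U) \<and> delta_support n (subrep (D0 n) U) = I"
    obtain A where A: "A \<subseteq> {1..n}" "U = MIv n A" by (rule D0_submodule_cases[OF conjunct1[OF U]])
    have "delta_support n (subrep (D0 n) U) = I" using U by (elim conjE)
    then have "A = I" unfolding A(2) delta_support_MIv(2)[OF A(1)] .
    then show "U = MIv n I" using A(2) by simp
  qed
  then show ?thesis unfolding MI_def by (rule arg_cong)
qed

lemma MI_simps:
  assumes "I \<subseteq> {1..n}"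
  shows "vsp (MI n I) = MIv n I" "bmap (MI n I) = bmap (D0 n)" "amap (MI n I) = amap (D0 n)"
  unfolding MI_eq[OF assms] by (rule subrep_vsp)+

lemma dmod_MI:
  assumes "I \<subseteq> {1..n}"
  shows "dmod n (MI n I)"
  unfolding MI_eq[OF assms] by (rule submoduleD(1)[OF dmod_D0[OF n] MIv_submodule[OF assms]])

lemma a_injective_MI:
  assumes "I \<subseteq> {1..n}"
  shows "a_injective n (MI n I)"
  unfolding MI_eq[OF assms] by (rule a_injective_D0_sub)

end

section \<open>Homomorphisms between the modules \<open>M\<^sub>I\<close>\<close>

text \<open>
  The condition under which multiplication by \<open>t\<^sup>i\<close> maps \<open>M\<^sub>K\<close> into \<open>M\<^sub>I\<close>: in each ideal of
  \<open>\<complex>[t]/t\<^bsup>n-j\<^esup>\<close> it lowers the dimension by \<open>i\<close>, as far as possible.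
\<close>

definition hle :: "nat \<Rightarrow> nat set \<Rightarrow> nat set \<Rightarrow> bool" where
  "hle i K I \<longleftrightarrow> (\<forall>j. tail K j \<le> i + tail I j)"

definition tmap :: "nat \<Rightarrow> nat set \<Rightarrow> nat \<Rightarrow> nat \<Rightarrow> univ \<Rightarrow> univ" where
  "tmap n K i = (\<lambda>j f. if f \<in> MIv n K j then (\<lambda>k. if i \<le> k \<and> k < n - j then f (k - i) else 0) else 0)"

definition gen :: "nat \<Rightarrow> nat set \<Rightarrow> univ" where
  "gen n I = unit_vec0 (n - card I)"

lemma hleD: "hle i K I \<Longrightarrow> tail K j \<le> i + tail I j"
  unfolding hle_def by (rule spec)

lemma hle_mono:
  assumes "hle i K I" "i \<le> i'"
  shows "hle i' K I"
  unfolding hle_def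
proof
  fix j show "tail K j \<le> i' + tail I j" using hleD[OF assms(1), of j] assms(2) by linarith
qed

lemma funpow_split: "m \<le> i \<Longrightarrow> (f ^^ i) x = (f ^^ (i - m)) ((f ^^ m) x)"
  using funpow_add[of "i - m" m f] by simp

lemma hle_antisym: "hle 0 K I \<Longrightarrow> hle 0 I K \<Longrightarrow> K \<subseteq> {1..n} \<Longrightarrow> I \<subseteq> {1..n} \<Longrightarrow> K = I"
  by (rule tail_inj[of K n I]) (use hleD[of 0 K I] hleD[of 0 I K] in \<open>auto intro: antisym\<close>)

context
  fixes n :: nat
  assumes n: "n > 1"
begin

lemma tmap_in: "hle i K I \<Longrightarrow> f \<in> MIv n K j \<Longrightarrow> tmap n K i j f \<in> MIv n I j"
proof -
  assume h: "hle i K I" and f: "f \<in> MIv n K j"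
  have "n - j \<le> k + tail I j" if k: "i \<le> k" "f (k - i) \<noteq> 0" for k
  proof -
    have "n - j \<le> (k - i) + tail K j" by (rule MIvD(1)[OF f k(2)])
    moreover have "tail K j \<le> i + tail I j" by (rule hleD[OF h])
    ultimately show ?thesis using k(1) by linarith
  qed
  then show "tmap n K i j f \<in> MIv n I j" using f by (intro MIvI) (simp add: tmap_def split: if_splits)
qed

lemma MIv_outside: "f \<in> MIv n K j \<Longrightarrow> n - j \<le> k \<Longrightarrow> f k = 0"
  using MIvD(2)[of f n K j k] by (meson not_less)

lemma tmap_Hom:
  assumes K: "K \<subseteq> {1..n}" and I: "I \<subseteq> {1..n}" and h: "hle i K I"
  shows "tmap n K i \<in> Hom n (MI n K) (MI n I)"
proof (rule HomI)
  note simps = MI_simps[OF n K] MI_simps[OF n I]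
  have b: "bmap (D0 n) j f \<in> MIv n K j" if "j \<in> {1..n-1}" "f \<in> MIv n K (j-1)" for j f
    using dmod_bmap_in[OF dmod_MI[OF n K] that(1), of f] that(2) by (simp add: simps)
  have a: "amap (D0 n) j f \<in> MIv n K (j-1)" if "j \<in> {1..n-1}" "f \<in> MIv n K j" for j f
    using dmod_amap_in[OF dmod_MI[OF n K] that(1), of f] that(2) by (simp add: simps)
  show "tmap n K i j x \<in> vsp (MI n I) j" if "x \<in> vsp (MI n K) j" for j x
    using that by (simp add: simps tmap_in[OF h])
  show "tmap n K i j (x + y) = tmap n K i j x + tmap n K i j y"
    if "x \<in> vsp (MI n K) j" "y \<in> vsp (MI n K) j" for j x y
    using that cvec.subspace_add[OF subspace_MIv, of x n K j y] by (auto simp: simps tmap_def fun_eq_iff)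
  show "tmap n K i j (c *\<^sub>C x) = c *\<^sub>C tmap n K i j x" if "x \<in> vsp (MI n K) j" for j c x
    using that cvec.subspace_scale[OF subspace_MIv, of x n K j c]
    by (auto simp: simps tmap_def fun_eq_iff scaleC_fun_def)
  show "tmap n K i j x = 0" if "x \<notin> vsp (MI n K) j" for j x using that by (simp add: simps tmap_def)
  show "tmap n K i j (bmap (MI n K) j x) = bmap (MI n I) j (tmap n K i (j - 1) x)"
    if j: "j \<in> {1..n - 1}" and x: "x \<in> vsp (MI n K) (j - 1)" for j x
  proof
    fix k
    have *: "k < n - j \<Longrightarrow> k < n - (j - 1)" by linarith
    show "tmap n K i j (bmap (MI n K) j x) k = bmap (MI n I) j (tmap n K i (j - 1) x) k"
      using b[OF j] x * by (auto simp: simps tmap_def D0_simps)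
  qed
  show "tmap n K i (j - 1) (amap (MI n K) j x) = amap (MI n I) j (tmap n K i j x)"
    if j: "j \<in> {1..n - 1}" and x: "x \<in> vsp (MI n K) j" for j x
  proof
    fix k
    have *: "k \<noteq> 0 \<Longrightarrow> k - 1 < n - j \<longleftrightarrow> k < n - (j - 1)" using j by auto
    have **: "k \<noteq> 0 \<Longrightarrow> k - i \<noteq> 0 \<Longrightarrow> i \<le> k - 1 \<and> k - i - 1 = k - 1 - i" by auto
    have ***: "k - i = 0 \<Longrightarrow> k \<noteq> 0 \<Longrightarrow> \<not> i \<le> k - 1" by auto
    show "tmap n K i (j - 1) (amap (MI n K) j x) k = amap (MI n I) j (tmap n K i j x) k"
      using a[OF j] x * ** *** by (cases "k = 0"; cases "k - i = 0") (auto simp: simps tmap_def D0_simps)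
  qed
qed

lemma tmap_comp:
  assumes "hle i K I"
  shows "tmap n I i' \<circ>\<^sub>h tmap n K i = tmap n K (i + i')"
proof (intro ext)
  fix j f k
  show "(tmap n I i' \<circ>\<^sub>h tmap n K i) j f k = tmap n K (i + i') j f k"
  proof (cases "f \<in> MIv n K j")
    case True
    have "k - i' - i = k - (i + i')" by simp
    then show ?thesis
      using True tmap_in[OF assms True]
      by (auto simp: hcomp_apply tmap_def[of n I] tmap_def[of n K])
  next
    case False
    then have "tmap n K i j f = 0" by (simp add: tmap_def)
    then show ?thesis using False by (simp add: hcomp_apply tmap_def[of n I] tmap_def[of n K "i + i'"])
  qed
qed

lemma tmap_0: "K \<subseteq> {1..n} \<Longrightarrow> tmap n K 0 = hid (MI n K)"
  by (auto simp: tmap_def hid_def MI_simps[OF n] fun_eq_iff MIv_outside)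

lemma apath_MI:
  assumes "I \<subseteq> {1..n}"
  shows "j < n \<Longrightarrow> apath (MI n I) j g k = (if j \<le> k then g (k - j) else 0)"
proof (induction j arbitrary: g k)
  case (Suc j)
  then show ?case by (simp add: MI_simps[OF n assms] D0_simps Suc_diff_Suc)
qed simp

lemma loop_MI: "I \<subseteq> {1..n} \<Longrightarrow> loop (MI n I) = loop (D0 n)"
  by (simp add: loop_def MI_simps[OF n] fun_eq_iff)

lemma loop_D0_pow:
  assumes "\<And>k. n \<le> k \<Longrightarrow> f k = 0"
  shows "(loop (D0 n) ^^ i) f k = (if i \<le> k \<and> k < n then f (k - i) else 0)"
proof (induction i arbitrary: k)
  case (Suc i)
  have "(loop (D0 n) ^^ Suc i) f k = (if k = 0 then 0 else if k - 1 < n - 1 then (loop (D0 n) ^^ i) f (k - 1) else 0)"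
    by (simp add: loop_def D0_simps)
  also have "\<dots> = (if Suc i \<le> k \<and> k < n then f (k - Suc i) else 0)"
    using n by (cases k) (auto simp: Suc)
  finally show ?case .
qed (use assms in auto)

lemma loop_pow_gen:
  assumes "I \<subseteq> {1..n}" "i < card I"
  shows "(loop (MI n I) ^^ i) (gen n I) = unit_vec0 (n - card I + i)"
proof
  fix k
  have c: "card I \<le> n" using tail_le[OF assms(1), of 0] tail_0[OF assms(1)] by simp
  show "(loop (MI n I) ^^ i) (gen n I) k = unit_vec0 (n - card I + i) k"
    unfolding loop_MI[OF assms(1)]
    by (subst loop_D0_pow) (use c assms(2) in \<open>auto simp: gen_def unit_vec0_def\<close>)
qed

lemma gen_in: "I \<subseteq> {1..n} \<Longrightarrow> I \<noteq> {} \<Longrightarrow> gen n I \<in> vsp (MI n I) 0"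
proof -
  assume I: "I \<subseteq> {1..n}" "I \<noteq> {}"
  then have "0 < card I" by (simp add: card_gt_0_iff finite_subset[OF I(1)])
  then show ?thesis using tail_0[OF I(1)] n by (simp add: MI_simps[OF n I(1)] gen_def MIv_unit)
qed

lemma MI_vertex_0_expansion:
  assumes I: "I \<subseteq> {1..n}" and f: "f \<in> vsp (MI n I) 0"
  shows "f = (\<Sum>i<card I. f (n - card I + i) *\<^sub>C (loop (MI n I) ^^ i) (gen n I))"
proof
  fix k
  have c: "card I \<le> n" using tail_le[OF I, of 0] tail_0[OF I] by simp
  have "(\<Sum>i<card I. f (n - card I + i) *\<^sub>C (loop (MI n I) ^^ i) (gen n I)) k =
      (\<Sum>i<card I. if n - card I + i = k then f k else 0)"
    unfolding sum_fun_apply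
    by (intro sum.cong) (auto simp: loop_pow_gen[OF I] unit_vec0_def scaleC_fun_def scaleC_complex_def)
  also have "\<dots> = f k"
  proof (cases "n - card I \<le> k \<and> k < n")
    case True
    then have "(\<Sum>i<card I. if n - card I + i = k then f k else 0) =
        (\<Sum>i<card I. if i = k - (n - card I) then f k else 0)"
      by (intro sum.cong) auto
    moreover have "k - (n - card I) < card I" "k + card I - n < card I" using True c by linarith+
    ultimately show ?thesis by simp
  next
    case False
    then have "f k = 0" using MIvD[of f n I 0 k] f c tail_0[OF I] by (fastforce simp: MI_simps[OF n I])
    then show ?thesis by (simp add: sum.neutral)
  qed
  finally show "f k = (\<Sum>i<card I. f (n - card I + i) *\<^sub>C (loop (MI n I) ^^ i) (gen n I)) k" by simp
qed

lemma loop_pow_MI_zero: "I \<subseteq> {1..n} \<Longrightarrow> f \<in> vsp (MI n I) 0 \<Longrightarrow> (loop (MI n I) ^^ card I) f = 0"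
proof
  fix k assume I: "I \<subseteq> {1..n}" and f: "f \<in> vsp (MI n I) 0"
  have f': "f k \<noteq> 0 \<Longrightarrow> n \<le> k + card I \<and> k < n" for k
    using MIvD[of f n I 0 k] f tail_0[OF I] by (simp add: MI_simps[OF n I])
  show "(loop (MI n I) ^^ card I) f k = 0 k"
    unfolding loop_MI[OF I] by (subst loop_D0_pow) (use f' in \<open>force+\<close>)
qed

lemma Hom_MI_eqI:
  assumes I: "I \<subseteq> {1..n}" and N: "dmod n N" "a_injective n N" and g: "g \<in> Hom n (MI n I) N"
    and h: "h \<in> Hom n (MI n I) N" and eq: "g 0 (gen n I) = h 0 (gen n I)"
  shows "g = h"
proof (cases "I = {}")
  case True
  have "vsp (MI n I) i = {0}" for i using MI_simps(1)[OF n I] MIv_empty[of n] True by simp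
  then show ?thesis by (intro Hom_eqI[OF g h]) (simp add: Hom_0[OF g] Hom_0[OF h])
next
  case False
  note M = dmod_MI[OF n I] and z = gen_in[OF I False]
  show ?thesis
  proof (rule Hom_eq_of_vertex_0[OF n M N g h])
    fix x assume x: "x \<in> vsp (MI n I) 0"
    have *: "x (n - card I + i) *\<^sub>C (loop (MI n I) ^^ i) (gen n I) \<in> vsp (MI n I) 0" for i
      by (intro dmod_scale[OF M] loop_pow_in[OF n M z])
    have val: "k 0 x = (\<Sum>i<card I. x (n - card I + i) *\<^sub>C (loop N ^^ i) (k 0 (gen n I)))"
      if k: "k \<in> Hom n (MI n I) N" for k
    proof -
      have "k 0 x = k 0 (\<Sum>i<card I. x (n - card I + i) *\<^sub>C (loop (MI n I) ^^ i) (gen n I))"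
        by (rule arg_cong[OF MI_vertex_0_expansion[OF I x]])
      also have "\<dots> = (\<Sum>i<card I. k 0 (x (n - card I + i) *\<^sub>C (loop (MI n I) ^^ i) (gen n I)))"
        by (rule Hom_sum_arg[OF M k *])
      also have "\<dots> = (\<Sum>i<card I. x (n - card I + i) *\<^sub>C (loop N ^^ i) (k 0 (gen n I)))"
        by (simp add: Hom_scale[OF k loop_pow_in[OF n M z]] Hom_loop_pow[OF n M k z])
      finally show ?thesis .
    qed
    show "g 0 x = h 0 x" unfolding val[OF g] val[OF h] eq ..
  qed
qed

text \<open>
  \<open>M\<^sub>I\<close> is presented by a generator \<open>y\<close> at vertex \<open>0\<close> with \<open>t\<^sup>m y = 0\<close>, \<open>m = |I|\<close>, whose multiple
  \<open>t\<^sup>r y\<close> with \<open>r = |I \<inter> [j]|\<close> lies in the \<open>j\<close>-th step of the flag.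
\<close>

lemma Hom_from_MI:
  assumes I: "I \<subseteq> {1..n}" "I \<noteq> {}" and N: "dmod n N" "a_injective n N" and y: "y \<in> vsp N 0"
    and zero: "(loop N ^^ card I) y = 0"
    and flag: "\<And>j. j < n \<Longrightarrow> (loop N ^^ (card I - tail I j)) y \<in> flag N j"
  obtains h where "h \<in> Hom n (MI n I) N" "h 0 (gen n I) = y"
proof -
  note M = dmod_MI[OF n I(1)] and z = gen_in[OF I]
  have fin: "finite I" using I(1) by (auto intro: finite_subset)
  have c: "card I \<le> n" "0 < card I" using tail_le[OF I(1), of 0] tail_0[OF I(1)] I(2) fin by (auto simp: card_gt_0_iff)
  have ly: "(loop N ^^ i) y \<in> vsp N 0" for i by (rule loop_pow_in[OF n N(1) y])
  have zero': "(loop N ^^ i) y = 0" if "card I \<le> i" for i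
  proof -
    have "(loop N ^^ i) y = (loop N ^^ (i - card I)) ((loop N ^^ card I) y)"
      by (rule funpow_split[OF that])
    then show ?thesis using zero loop_pow_0[OF n N(1)] by simp
  qed
  define \<phi> where "\<phi> = (\<lambda>f :: univ. \<Sum>i<card I. f (n - card I + i) *\<^sub>C (loop N ^^ i) y)"
  have apD: "j < n \<Longrightarrow> apath (MI n I) j g k = (if j \<le> k then g (k - j) else 0)" for j g k
  proof (induction j arbitrary: g k)
    case (Suc j)
    then show ?case by (simp add: MI_simps[OF n I(1)] D0_simps Suc_diff_Suc)
  qed simp
  obtain h where h: "h \<in> Hom n (MI n I) N" "\<And>x. x \<in> vsp (MI n I) 0 \<Longrightarrow> h 0 x = \<phi> x"
  proof (rule Hom_of_vertex_0[OF n M N, of \<phi>])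
    show "\<phi> x \<in> vsp N 0" for x
      unfolding \<phi>_def by (intro dmod_sum[OF N(1)] dmod_scale[OF N(1)] ly)
    show "\<phi> (x + x') = \<phi> x + \<phi> x'" for x x'
      by (simp add: \<phi>_def scaleC_add_left sum.distrib)
    show "\<phi> (a *\<^sub>C x) = a *\<^sub>C \<phi> x" for a x
      by (simp add: \<phi>_def scaleC_fun_def scaleC_complex_def cvec.scale_sum_right scaleC_scaleC)
    show "\<phi> (loop (MI n I) x) = loop N (\<phi> x)" if x: "x \<in> vsp (MI n I) 0" for x
    proof -
      have x': "x k \<noteq> 0 \<Longrightarrow> n \<le> k + card I \<and> k < n" for k
        using MIvD[of x n I 0 k] x tail_0[OF I(1)] by (simp add: MI_simps[OF n I(1)])
      have lx: "loop (MI n I) x k = (if 1 \<le> k \<and> k < n then x (k - 1) else 0)" for k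
        using loop_D0_pow[of x 1 k] x' by (force simp: loop_MI[OF I(1)])
      obtain m where m: "card I = Suc m" using c(2) by (cases "card I") auto
      have "\<phi> (loop (MI n I) x) = (\<Sum>i<Suc m. loop (MI n I) x (n - card I + i) *\<^sub>C (loop N ^^ i) y)"
        by (simp add: \<phi>_def m)
      also have "\<dots> = loop (MI n I) x (n - card I) *\<^sub>C y +
          (\<Sum>i<m. loop (MI n I) x (n - card I + Suc i) *\<^sub>C (loop N ^^ Suc i) y)"
        by (subst sum.lessThan_Suc_shift) simp
      also have "loop (MI n I) x (n - card I) = 0"
      proof (cases "1 \<le> n - card I \<and> x (n - card I - 1) \<noteq> 0")
        case True
        then have "n \<le> n - card I - 1 + card I" using x'[of "n - card I - 1"] by simp
        then show ?thesis using True by linarith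
      qed (auto simp: lx)
      also have "(\<Sum>i<m. loop (MI n I) x (n - card I + Suc i) *\<^sub>C (loop N ^^ Suc i) y) =
          (\<Sum>i<m. x (n - card I + i) *\<^sub>C (loop N ^^ Suc i) y)"
        using m c by (intro sum.cong) (auto simp: lx)
      also have "0 *\<^sub>C y + \<dots> = (\<Sum>i<Suc m. x (n - card I + i) *\<^sub>C (loop N ^^ Suc i) y)"
        using zero m by simp
      also have "\<dots> = (\<Sum>i<Suc m. loop N (x (n - card I + i) *\<^sub>C (loop N ^^ i) y))"
        by (simp add: loop_scale[OF n N(1) ly])
      also have "\<dots> = loop N (\<Sum>i<Suc m. x (n - card I + i) *\<^sub>C (loop N ^^ i) y)"
      proof -
        have "loop N (sum v A) = (\<Sum>i\<in>A. loop N (v i))" if "\<And>i. v i \<in> vsp N 0" for v and A :: "nat set"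
          by (induction A rule: infinite_finite_induct)
            (simp_all add: loop_0[OF n N(1)] loop_add[OF n N(1)] that dmod_sum[OF N(1)])
        then show ?thesis by (simp only: dmod_scale[OF N(1) ly])
      qed
      finally show ?thesis by (simp add: \<phi>_def m)
    qed
    show "\<phi> x \<in> flag N j" if j: "j < n" and x: "x \<in> flag (MI n I) j" for j x
    proof -
      obtain g where g: "g \<in> MIv n I j" "x = apath (MI n I) j g"
        using x by (auto simp: flag_def MI_simps[OF n I(1)])
      show ?thesis
        unfolding \<phi>_def
      proof (rule cvec.subspace_sum[OF flag_subspace[OF n N(1) j]])
        fix i assume i: "i \<in> {..<card I}"
        show "x (n - card I + i) *\<^sub>C (loop N ^^ i) y \<in> flag N j"
        proof (cases "x (n - card I + i) = 0")
          case True
          then show ?thesis using cvec.subspace_0[OF flag_subspace[OF n N(1) j]] by simp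
        next
          case False
          then have "j \<le> n - card I + i" "g (n - card I + i - j) \<noteq> 0" using apD[OF j] g(2) by (auto split: if_splits)
          then have "n - j \<le> n - card I + i - j + tail I j" using MIvD(1)[OF g(1)] by blast
          then have le: "card I - tail I j \<le> i" using \<open>j \<le> n - card I + i\<close> j c by linarith
          have "(loop N ^^ i) y = (loop N ^^ (i - (card I - tail I j))) ((loop N ^^ (card I - tail I j)) y)"
            by (rule funpow_split[OF le])
          also have "\<dots> \<in> flag N j" by (rule loop_pow_flag[OF n N(1) j flag[OF j]])
          finally show ?thesis by (rule cvec.subspace_scale[OF flag_subspace[OF n N(1) j]])
        qed
      qed
    qed
  qed blast
  have "h 0 (gen n I) = \<phi> (gen n I)" by (rule h(2)[OF z])
  also have "\<dots> = (\<Sum>i<card I. if i = 0 then y else 0)"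
    unfolding \<phi>_def by (intro sum.cong) (auto simp: gen_def unit_vec0_def scaleC_one)
  also have "\<dots> = y" using c(2) by simp
  finally show ?thesis by (rule that[OF h(1)])
qed

text \<open>
  The image of the generator is a power series in \<open>t\<close> applied to the largest power available; if \<open>t\<^sup>i\<close>
  occurs in it, the flag conditions on the generator at each vertex \<open>j\<close> are the inequalities of \<open>hle i K I\<close>.
\<close>

lemma Hom_MI_expansion:
  assumes K: "K \<subseteq> {1..n}" and I: "I \<subseteq> {1..n}" and h: "h \<in> Hom n (MI n K) (MI n I)"
  obtains p where "\<forall>i. p i \<noteq> 0 \<longrightarrow> hle i K I" "h = (\<Sum>i<n. p i *\<^sub>C tmap n K i)"
proof (cases "K = {}")
  case True
  have "vsp (MI n K) i = {0}" for i using MI_simps(1)[OF n K] MIv_empty[of n] True by simp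
  then have hz: "h = 0" by (intro Hom_eqI[OF h Hom_zero[OF dmod_MI[OF n I]]]) (simp add: Hom_0[OF h])
  show ?thesis by (rule that[of "\<lambda>_. 0"]) (simp_all add: hz)
next
  case False
  note M = dmod_MI[OF n K] and N = dmod_MI[OF n I] and z = gen_in[OF K False]
  have fin: "finite K" using K by (auto intro: finite_subset)
  have c: "card K \<le> n" using tail_le[OF K, of 0] tail_0[OF K] by simp
  define y where "y = h 0 (gen n K)"
  have y: "y \<in> vsp (MI n I) 0" unfolding y_def by (rule Hom_in[OF h z])
  have yn: "y k = 0" if "n \<le> k" for k using y MIv_outside[of y I 0 k] that by (simp add: MI_simps[OF n I])
  have ly: "(loop (MI n I) ^^ i) y k = (if i \<le> k \<and> k < n then y (k - i) else 0)" for i k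
    unfolding loop_MI[OF I] by (rule loop_D0_pow[OF yn])
  have hl: "h 0 ((loop (MI n K) ^^ i) (gen n K)) = (loop (MI n I) ^^ i) y" for i
    unfolding y_def by (rule Hom_loop_pow[OF n M h z])
  have lK: "(loop (MI n I) ^^ card K) y = 0"
    using hl[of "card K"] loop_pow_MI_zero[OF K z] Hom_0[OF h] by simp
  have y0: "y k = 0" if k: "k < n - card K" for k
  proof -
    have "y k = (loop (MI n I) ^^ card K) y (k + card K)" using ly[of "card K" "k + card K"] k by simp
    then show ?thesis unfolding lK by simp
  qed
  define p where "p = (\<lambda>i. if i < card K then y (n - card K + i) else 0)"
  have p: "hle i K I" if "p i \<noteq> 0" for i
    unfolding hle_def
  proof
    fix j
    have i: "i < card K" "y (n - card K + i) \<noteq> 0" using that by (auto simp: p_def split: if_splits)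
    show "tail K j \<le> i + tail I j"
    proof (cases "i < tail K j")
      case True
      then have j: "j < n" using tail_outside[OF K, of j] by (metis not_less not_less0)
      have tK: "tail K j \<le> card K" "tail K j \<le> n - j" using tail_le_card[OF fin] tail_le[OF K] by auto
      define e where "e = (unit_vec0 (n - j - tail K j) :: univ)"
      have e: "e \<in> vsp (MI n K) j"
        unfolding MI_simps[OF n K] e_def MIv_unit using True tK j by auto
      have ap: "apath (MI n J) j g k = (if j \<le> k then g (k - j) else 0)" if "J \<subseteq> {1..n}" for J g k
        by (rule apath_MI[OF that j])
      have "apath (MI n K) j e = unit_vec0 (n - tail K j)"
        using tK j by (auto simp: ap[OF K] e_def unit_vec0_def fun_eq_iff)
      also have "\<dots> = (loop (MI n K) ^^ (card K - tail K j)) (gen n K)"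
        using loop_pow_gen[OF K, of "card K - tail K j"] True tK c by simp
      finally have "apath (MI n I) j (h j e) = (loop (MI n I) ^^ (card K - tail K j)) y"
        using hl[of "card K - tail K j"] Hom_apath[OF n M h j e] by simp
      then have "apath (MI n I) j (h j e) (n - tail K j + i) = (loop (MI n I) ^^ (card K - tail K j)) y (n - tail K j + i)"
        by simp
      also have "\<dots> = y (n - card K + i)"
      proof -
        have "n - tail K j + i - (card K - tail K j) = n - card K + i" "card K - tail K j \<le> n - tail K j + i"
          "n - tail K j + i < n" using tK c True by linarith+
        then show ?thesis unfolding ly by simp
      qed
      finally have "h j e (n - tail K j + i - j) \<noteq> 0" "j \<le> n - tail K j + i"
        using i(2) unfolding ap[OF I] by (auto split: if_splits)
      moreover have "h j e \<in> MIv n I j" using Hom_in[OF h e] by (simp add: MI_simps[OF n I])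
      ultimately have "n - j \<le> n - tail K j + i - j + tail I j" using MIvD(1) by blast
      then show ?thesis using \<open>j \<le> n - tail K j + i\<close> tK j by linarith
    qed simp
  qed
  have H: "p i *\<^sub>C tmap n K i \<in> Hom n (MI n K) (MI n I)" for i
  proof (cases "p i = 0")
    case False
    then show ?thesis by (intro Hom_scaleC[OF N] tmap_Hom[OF K I] p)
  qed (simp add: Hom_zero[OF N])
  have eq: "h = (\<Sum>i<n. p i *\<^sub>C tmap n K i)"
  proof (rule Hom_MI_eqI[OF K N a_injective_MI[OF n I] h Hom_sum[OF N H]])
    have zK: "gen n K \<in> MIv n K 0" using z by (simp add: MI_simps[OF n K])
    have "y k = (\<Sum>i<n. p i *\<^sub>C tmap n K i) 0 (gen n K) k" for k
    proof -
      have "(\<Sum>i<n. p i *\<^sub>C tmap n K i) 0 (gen n K) k = (\<Sum>i<n. p i * tmap n K i 0 (gen n K) k)"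
        by (simp add: sum_hom_apply sum_fun_apply scaleC_fun_def scaleC_complex_def)
      also have "\<dots> = (\<Sum>i<n. if n - card K + i = k then y k else 0)"
      proof (rule sum.cong[OF refl])
        fix i assume i: "i \<in> {..<n}"
        show "p i * tmap n K i 0 (gen n K) k = (if n - card K + i = k then y k else 0)"
          using zK i c yn[of k] by (auto simp: tmap_def p_def gen_def unit_vec0_def)
      qed
      also have "\<dots> = y k"
      proof (cases "n - card K \<le> k \<and> k < n")
        case True
        then have "(\<Sum>i<n. if n - card K + i = k then y k else 0) = (\<Sum>i<n. if i = k - (n - card K) then y k else 0)"
          by (intro sum.cong) auto
        moreover have "k - (n - card K) < n" using True by linarith
        ultimately show ?thesis by simp
      next
        case False
        then have "y k = 0" using y0[of k] yn[of k] by (meson not_le)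
        then show ?thesis by (simp add: sum.neutral)
      qed
      finally show ?thesis by simp
    qed
    then show "h 0 (gen n K) = (\<Sum>i<n. p i *\<^sub>C tmap n K i) 0 (gen n K)" unfolding y_def[symmetric] by (rule ext)
  qed
  show ?thesis by (rule that[OF _ eq]) (simp add: p)
qed

end

section \<open>Endomorphisms of \<open>M\<^sub>I\<close> are local\<close>

text \<open>The coefficient of \<open>1\<close> in the power series in \<open>t\<close> by which an endomorphism of \<open>M\<^sub>I\<close> acts.\<close>

definition cst :: "nat \<Rightarrow> nat set \<Rightarrow> (nat \<Rightarrow> univ \<Rightarrow> univ) \<Rightarrow> complex" where
  "cst n I h = h 0 (gen n I) (n - card I)"

lemma cst_add: "cst n I (g + h) = cst n I g + cst n I h"
  by (simp add: cst_def)

lemma cst_sum: "cst n I (sum h A) = (\<Sum>k\<in>A. cst n I (h k))"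
  by (simp add: cst_def sum_hom_apply sum_fun_apply)

context
  fixes n :: nat
  assumes n: "n > 1"
begin

lemma cst_hid: "I \<subseteq> {1..n} \<Longrightarrow> I \<noteq> {} \<Longrightarrow> cst n I (hid (MI n I)) = 1"
  using gen_in[OF n, of I] by (simp add: cst_def hid_apply) (simp add: gen_def unit_vec0_def)

lemma power_series_apply:
  assumes "x \<in> MIv n K j"
  shows "(\<Sum>i<n. p i *\<^sub>C tmap n K i) j x k = (\<Sum>i<n. if i \<le> k \<and> k < n - j then p i * x (k - i) else 0)"
  using assms by (simp add: sum_hom_apply sum_fun_apply scaleC_fun_def scaleC_complex_def tmap_def if_distrib
      cong: if_cong)

lemma power_series_order:
  assumes x: "x \<in> MIv n K j" and zero: "\<And>k. k < l \<Longrightarrow> x k = 0"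
  shows "k < l \<Longrightarrow> (\<Sum>i<n. p i *\<^sub>C tmap n K i) j x k = 0"
    and "(\<Sum>i<n. p i *\<^sub>C tmap n K i) j x l = p 0 * x l"
proof -
  assume k: "k < l"
  have "x (k - i) = 0" for i using zero[of "k - i"] k by simp
  then show "(\<Sum>i<n. p i *\<^sub>C tmap n K i) j x k = 0" unfolding power_series_apply[OF x] by simp
next
  have "(\<Sum>i<n. p i *\<^sub>C tmap n K i) j x l = (\<Sum>i<n. if i = 0 then p 0 * x l else 0)"
    unfolding power_series_apply[OF x]
  proof (rule sum.cong[OF refl])
    fix i assume "i \<in> {..<n}"
    show "(if i \<le> l \<and> l < n - j then p i * x (l - i) else 0) = (if i = 0 then p 0 * x l else 0)"
    proof (cases "i = 0")
      case True
      have "x l = 0" if "\<not> l < n - j" using MIv_outside[OF n x, of l] that by simp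
      then show ?thesis using True by simp
    next
      case False
      then have "i \<le> l \<Longrightarrow> x (l - i) = 0" using zero[of "l - i"] by simp
      then show ?thesis using False by simp
    qed
  qed
  then show "(\<Sum>i<n. p i *\<^sub>C tmap n K i) j x l = p 0 * x l" using n by simp
qed

lemma gen_zero: "k < n - card I \<Longrightarrow> gen n I k = 0" "gen n I (n - card I) = 1"
  by (simp_all add: gen_def unit_vec0_def)

text \<open>
  If both maps had a term in \<open>t\<^sup>0\<close>, then \<open>hle 0\<close> would hold in both directions and \<open>K = I\<close>.
\<close>

lemma cst_comp_zero:
  assumes I: "I \<subseteq> {1..n}" "I \<noteq> {}" and K: "K \<subseteq> {1..n}" "K \<noteq> I"
    and g: "g \<in> Hom n (MI n I) (MI n K)" and h: "h \<in> Hom n (MI n K) (MI n I)"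
  shows "cst n I (h \<circ>\<^sub>h g) = 0"
proof -
  obtain p where p: "\<forall>i. p i \<noteq> 0 \<longrightarrow> hle i I K" "g = (\<Sum>i<n. p i *\<^sub>C tmap n I i)"
    by (rule Hom_MI_expansion[OF n I(1) K(1) g])
  obtain q where q: "\<forall>i. q i \<noteq> 0 \<longrightarrow> hle i K I" "h = (\<Sum>i<n. q i *\<^sub>C tmap n K i)"
    by (rule Hom_MI_expansion[OF n K(1) I(1) h])
  have z: "gen n I \<in> MIv n I 0" using gen_in[OF n I] by (simp add: MI_simps[OF n I(1)])
  let ?x = "g 0 (gen n I)"
  have x: "?x \<in> MIv n K 0" using Hom_in[OF g gen_in[OF n I]] by (simp add: MI_simps[OF n K(1)])
  have x0: "?x k = 0" if "k < n - card I" for k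
    unfolding p(2) by (rule power_series_order(1)[OF z gen_zero(1) that])
  have x1: "?x (n - card I) = p 0"
    unfolding p(2) using power_series_order(2)[OF z gen_zero(1), where p = p] gen_zero(2)[of I] by simp
  have "cst n I (h \<circ>\<^sub>h g) = h 0 ?x (n - card I)" by (simp add: cst_def hcomp_apply)
  also have "\<dots> = q 0 * p 0"
    unfolding q(2) using power_series_order(2)[OF x x0, where p = q] x1 by simp
  also have "\<dots> = 0"
    using spec[OF p(1), of 0] spec[OF q(1), of 0] hle_antisym[of I K n] I(1) K by auto
  finally show ?thesis .
qed

lemma cst_power_series:
  assumes I: "I \<subseteq> {1..n}" "I \<noteq> {}"
  shows "cst n I (\<Sum>i<n. p i *\<^sub>C tmap n I i) = p 0"
proof -
  have z: "gen n I \<in> MIv n I 0" using gen_in[OF n I] by (simp add: MI_simps[OF n I(1)])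
  show ?thesis unfolding cst_def using power_series_order(2)[OF z gen_zero(1), where p = p] gen_zero(2)[of I] by simp
qed

text \<open>
  A power series with nonzero constant term preserves the order of vanishing and multiplies the leading
  coefficient by the constant term; preimages are found by successive approximation.
\<close>

lemma iso_of_cst:
  assumes I: "I \<subseteq> {1..n}" "I \<noteq> {}" and h: "h \<in> Hom n (MI n I) (MI n I)" and c: "cst n I h \<noteq> 0"
  shows "is_iso n (MI n I) (MI n I) h"
proof (rule is_isoI[OF dmod_MI[OF n I(1)] dmod_MI[OF n I(1)] h])
  note M = dmod_MI[OF n I(1)]
  obtain p where p: "h = (\<Sum>i<n. p i *\<^sub>C tmap n I i)"
    by (rule Hom_MI_expansion[OF n I(1) I(1) h])
  have p0: "p 0 \<noteq> 0" using c unfolding p cst_power_series[OF I] .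
  show "x = 0" if x: "x \<in> vsp (MI n I) j" and hx: "h j x = 0" for j x
  proof
    fix k
    have x': "x \<in> MIv n I j" using x by (simp add: MI_simps[OF n I(1)])
    show "x k = 0 k"
    proof (induction k rule: less_induct)
      case (less k)
      then have "h j x k = p 0 * x k" unfolding p by (intro power_series_order(2)[OF x']) simp
      then show ?case using hx p0 by simp
    qed
  qed
  show "\<exists>x\<in>vsp (MI n I) j. h j x = y" if y: "y \<in> vsp (MI n I) j" for j y
  proof -
    have "y \<in> vsp (MI n I) j \<Longrightarrow> \<forall>k<n - d. y k = 0 \<Longrightarrow> \<exists>x\<in>vsp (MI n I) j. h j x = y" for d
    proof (induction d arbitrary: y)
      case 0
      have "y k = 0" for k
      proof (cases "k < n")
        case False
        then show ?thesis using MIv_outside[OF n, of y I j k] 0(1) by (simp add: MI_simps[OF n I(1)])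
      qed (use 0(2) in simp)
      then have y0: "y = 0" by (simp add: fun_eq_iff)
      show ?case unfolding y0 by (rule bexI[where x = 0]) (rule Hom_0[OF h] dmod_0[OF M])+
    next
      case (Suc d)
      define x0 where "x0 = inverse (p 0) *\<^sub>C y"
      have x0: "x0 \<in> vsp (MI n I) j" unfolding x0_def by (rule dmod_scale[OF M Suc.prems(1)])
      have x0': "x0 \<in> MIv n I j" using x0 by (simp add: MI_simps[OF n I(1)])
      have x0z: "x0 k = 0" if "k < n - Suc d" for k
        using Suc.prems(2) that by (simp add: x0_def scaleC_fun_def scaleC_complex_def)
      let ?y = "y - h j x0"
      have "?y k = 0" if k: "k < n - d" for k
      proof (cases "k < n - Suc d")
        case True
        have "h j x0 k = 0" unfolding p by (rule power_series_order(1)[OF x0' x0z True])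
        then show ?thesis using Suc.prems(2) True by simp
      next
        case False
        then have k': "k = n - Suc d" using k by linarith
        have "h j x0 k = p 0 * x0 k" unfolding p k' by (rule power_series_order(2)[OF x0' x0z])
        then show ?thesis using p0 by (simp add: x0_def scaleC_fun_def scaleC_complex_def)
      qed
      then have "\<exists>x\<in>vsp (MI n I) j. h j x = ?y"
        by (intro Suc.IH dmod_diff[OF M Suc.prems(1) Hom_in[OF h x0]]) simp
      then obtain x1 where x1: "x1 \<in> vsp (MI n I) j" "h j x1 = ?y" by (rule bexE)
      have "h j (x0 + x1) = h j x0 + ?y" by (simp only: Hom_add[OF h x0 x1(1)] x1(2))
      also have "\<dots> = y" by (simp only: add_diff_eq add_diff_cancel_left')
      finally show ?case by (rule bexI[OF _ dmod_add[OF M x0 x1(1)]])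
    qed
    from this[of n] y show ?thesis by simp
  qed
qed

lemma iso_one_plus_radical:
  assumes I: "I \<subseteq> {1..n}" "I \<noteq> {}" and h: "h \<in> Hom n (MI n I) (MI n I)" and c: "cst n I h = 0"
  shows "is_iso n (MI n I) (MI n I) (hid (MI n I) + h)"
  by (rule iso_of_cst[OF I Hom_plus[OF dmod_MI[OF n I(1)] Hom_hid[OF dmod_MI[OF n I(1)]] h]])
    (simp add: cst_add cst_hid[OF I] c)

text \<open>
  A decomposition writes the identity as the sum of two idempotents, one of which has nonzero
  constant term and is therefore invertible; the complementary summand vanishes.
\<close>

lemma indecomposable_MI:
  assumes I: "I \<subseteq> {1..n}" "I \<noteq> {}"
  shows "indecomposable n (MI n I)"
proof -
  note M = dmod_MI[OF n I(1)]
  have nz: "\<not> is_zero (MI n I)"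
  proof
    assume "is_zero (MI n I)"
    then have "gen n I = 0" using gen_in[OF n I] by (simp add: is_zero_def)
    then show False using gen_zero(2)[of I] by simp
  qed
  have "is_zero X \<or> is_zero Y" if XY: "dmod n X \<and> dmod n Y \<and> isomorphic n (MI n I) (X \<oplus>\<^sub>r Y)"
    for X Y :: "univ rep"
  proof -
    have X: "dmod n X" and Y: "dmod n Y" using XY by simp_all
    obtain \<theta> where "is_iso n (MI n I) (X \<oplus>\<^sub>r Y) \<theta>" using XY unfolding isomorphic_def by (elim conjE exE)
    then obtain \<theta>' where \<theta>: "\<theta> \<in> Hom n (MI n I) (X \<oplus>\<^sub>r Y)" and \<theta>': "\<theta>' \<in> Hom n (X \<oplus>\<^sub>r Y) (MI n I)"
      and inv: "\<theta>' \<circ>\<^sub>h \<theta> = hid (MI n I)" "\<theta> \<circ>\<^sub>h \<theta>' = hid (X \<oplus>\<^sub>r Y)" by (rule is_isoE)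
    note homs = Hom_hinl[OF X Y] Hom_hinr[OF X Y] Hom_hfst[OF X Y] Hom_hsnd[OF X Y]
    define i1 where "i1 = \<theta>' \<circ>\<^sub>h hinl X Y"
    define i2 where "i2 = \<theta>' \<circ>\<^sub>h hinr X Y"
    define p1 where "p1 = hfst X Y \<circ>\<^sub>h \<theta>"
    define p2 where "p2 = hsnd X Y \<circ>\<^sub>h \<theta>"
    have H: "i1 \<in> Hom n X (MI n I)" "i2 \<in> Hom n Y (MI n I)" "p1 \<in> Hom n (MI n I) X" "p2 \<in> Hom n (MI n I) Y"
      unfolding i1_def i2_def p1_def p2_def
      by (rule Hom_hcomp[OF homs(1) \<theta>'] Hom_hcomp[OF homs(2) \<theta>'] Hom_hcomp[OF \<theta> homs(3)] Hom_hcomp[OF \<theta> homs(4)])+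
    have mid: "(\<theta> \<circ>\<^sub>h (\<theta>' \<circ>\<^sub>h u)) = u" if "u \<in> Hom n W (X \<oplus>\<^sub>r Y)" for u and W :: "univ rep"
      using hcomp_hid_left[OF that] by (simp only: hcomp_assoc[symmetric] inv)
    have r: "p1 \<circ>\<^sub>h i1 = hid X" "p2 \<circ>\<^sub>h i2 = hid Y" "p1 \<circ>\<^sub>h i2 = 0" "p2 \<circ>\<^sub>h i1 = 0"
      unfolding i1_def i2_def p1_def p2_def
      by (simp_all only: hcomp_assoc mid[OF homs(1)] mid[OF homs(2)] hfst_hinl[OF X Y] hsnd_hinr[OF X Y]
          hfst_hinr[OF X Y] hsnd_hinl[OF X Y])
    have "(i1 \<circ>\<^sub>h p1) + (i2 \<circ>\<^sub>h p2) = \<theta>' \<circ>\<^sub>h (((hinl X Y \<circ>\<^sub>h hfst X Y) + (hinr X Y \<circ>\<^sub>h hsnd X Y)) \<circ>\<^sub>h \<theta>)"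
      unfolding hcomp_plus_left
        hcomp_plus_right[OF \<theta>' Hom_hcomp[OF \<theta> Hom_hcomp[OF homs(3,1)]] Hom_hcomp[OF \<theta> Hom_hcomp[OF homs(4,2)]]]
      by (simp only: i1_def i2_def p1_def p2_def hcomp_assoc)
    also have "\<dots> = hid (MI n I)" by (simp only: hin_hpr_sum[OF X Y] hcomp_hid_left[OF \<theta>] inv)
    finally have "cst n I (i1 \<circ>\<^sub>h p1) + cst n I (i2 \<circ>\<^sub>h p2) = 1"
      using cst_hid[OF I] by (simp only: cst_add[symmetric])
    then consider "cst n I (i1 \<circ>\<^sub>h p1) \<noteq> 0" | "cst n I (i2 \<circ>\<^sub>h p2) \<noteq> 0" by fastforce
    then show ?thesis
    proof cases
      case 1
      obtain w where w: "w \<in> Hom n (MI n I) (MI n I)" "w \<circ>\<^sub>h (i1 \<circ>\<^sub>h p1) = hid (MI n I)"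
        using iso_of_cst[OF I Hom_hcomp[OF H(3,1)] 1] by (rule is_isoE)
      have "i2 = (w \<circ>\<^sub>h (i1 \<circ>\<^sub>h p1)) \<circ>\<^sub>h i2" by (simp only: w(2) hcomp_hid_left[OF H(2)])
      also have "\<dots> = 0" by (simp only: hcomp_assoc r hcomp_zero_right[OF H(1)] hcomp_zero_right[OF w(1)])
      finally have i20: "i2 = 0" .
      have "hid Y = 0" unfolding r(2)[symmetric] i20 by (rule hcomp_zero_right[OF H(4)])
      then have "y = 0" if "y \<in> vsp Y i" for y i
        using fun_cong[OF fun_cong[OF \<open>hid Y = 0\<close>], of i y] hid_apply[OF that] by simp
      then have "vsp Y i = {0}" for i using dmod_0[OF Y, of i] by blast
      then show ?thesis by (simp add: is_zero_def)
    next
      case 2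
      obtain w where w: "w \<in> Hom n (MI n I) (MI n I)" "w \<circ>\<^sub>h (i2 \<circ>\<^sub>h p2) = hid (MI n I)"
        using iso_of_cst[OF I Hom_hcomp[OF H(4,2)] 2] by (rule is_isoE)
      have "i1 = (w \<circ>\<^sub>h (i2 \<circ>\<^sub>h p2)) \<circ>\<^sub>h i1" by (simp only: w(2) hcomp_hid_left[OF H(1)])
      also have "\<dots> = 0" by (simp only: hcomp_assoc r hcomp_zero_right[OF H(2)] hcomp_zero_right[OF w(1)])
      finally have i10: "i1 = 0" .
      have "hid X = 0" unfolding r(1)[symmetric] i10 by (rule hcomp_zero_right[OF H(3)])
      then have "y = 0" if "y \<in> vsp X i" for y i
        using fun_cong[OF fun_cong[OF \<open>hid X = 0\<close>], of i y] hid_apply[OF that] by simp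
      then have "vsp X i = {0}" for i using dmod_0[OF X, of i] by blast
      then show ?thesis by (simp add: is_zero_def)
    qed
  qed
  then show ?thesis unfolding indecomposable_def using M nz by simp
qed

text \<open>
  If \<open>I\<close> were not in \<open>S\<close>, the identity of \<open>M\<^sub>I\<close> would be a sum of composites through modules \<open>M\<^sub>K\<close> with
  \<open>K \<noteq> I\<close>, all of which have constant term \<open>0\<close>.
\<close>

lemma summand_MI_imp_mem:
  assumes I: "I \<subseteq> {1..n}" "I \<noteq> {}" and S: "\<And>K. K \<in> S \<Longrightarrow> K \<subseteq> {1..n}" and s: "summand n (MI n I) (TS n S)"
  shows "I \<in> S"
proof (rule ccontr)
  assume "I \<notin> S"
  have fin: "finite S" by (rule finite_subset[of S "Pow {1..n}"]) (use S in auto)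
  have M: "K \<in> S \<Longrightarrow> dmod n (MI n K)" for K by (rule dmod_MI[OF n S])
  obtain \<iota> p where \<iota>: "\<iota> \<in> Hom n (MI n I) (TS n S)" and p: "p \<in> Hom n (TS n S) (MI n I)"
    and id: "p \<circ>\<^sub>h \<iota> = hid (MI n I)" using s by (rule summandE)
  note \<iota>' = \<iota>[unfolded TS_def] and p' = p[unfolded TS_def]
  have X: "dmod n (big_dsum S (MI n))" by (rule dmod_big_dsum[OF fin]) (rule M)
  have hinH: "hin S (MI n) K \<in> Hom n (MI n K) (big_dsum S (MI n))" if "K \<in> S" for K
    by (rule Hom_hin[OF fin _ that]) (rule M)
  have hprH: "hpr S (MI n) K \<in> Hom n (big_dsum S (MI n)) (MI n K)" if "K \<in> S" for K
    by (rule Hom_hpr[OF fin _ that]) (rule M)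
  have one: "(\<Sum>K\<in>S. hin S (MI n) K \<circ>\<^sub>h hpr S (MI n) K) = hid (big_dsum S (MI n))"
    by (rule hin_hpr_big_sum[OF fin]) (rule M)
  have "p \<circ>\<^sub>h ((\<Sum>K\<in>S. hin S (MI n) K \<circ>\<^sub>h hpr S (MI n) K) \<circ>\<^sub>h \<iota>) =
      (\<Sum>K\<in>S. p \<circ>\<^sub>h ((hin S (MI n) K \<circ>\<^sub>h hpr S (MI n) K) \<circ>\<^sub>h \<iota>))"
    unfolding hcomp_sum_left
    by (rule hcomp_sum_right[OF X p']) (rule Hom_hcomp[OF \<iota>' Hom_hcomp[OF hprH hinH]])
  also have "(\<Sum>K\<in>S. hin S (MI n) K \<circ>\<^sub>h hpr S (MI n) K) \<circ>\<^sub>h \<iota> = \<iota>"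
    unfolding one by (rule hcomp_hid_left[OF \<iota>'])
  finally have "1 = (\<Sum>K\<in>S. cst n I (p \<circ>\<^sub>h ((hin S (MI n) K \<circ>\<^sub>h hpr S (MI n) K) \<circ>\<^sub>h \<iota>)))"
    unfolding id cst_sum[symmetric] using cst_hid[OF I] by simp
  also have "\<dots> = 0"
  proof (rule sum.neutral, rule ballI)
    fix K assume K: "K \<in> S"
    have "K \<noteq> I" using K \<open>I \<notin> S\<close> by blast
    then have "cst n I ((p \<circ>\<^sub>h hin S (MI n) K) \<circ>\<^sub>h (hpr S (MI n) K \<circ>\<^sub>h \<iota>)) = 0"
      by (rule cst_comp_zero[OF I S[OF K] _ Hom_hcomp[OF \<iota>' hprH[OF K]] Hom_hcomp[OF hinH[OF K] p']])
    then show "cst n I (p \<circ>\<^sub>h ((hin S (MI n) K \<circ>\<^sub>h hpr S (MI n) K) \<circ>\<^sub>h \<iota>)) = 0" by (simp only: hcomp_assoc)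
  qed
  finally show False by simp
qed

end

section \<open>The exact structure\<close>

context
  fixes n :: nat and M :: "'v::complex_vector rep"
  assumes n: "n > 1" and M: "dmod n M"
begin

lemma bpath_add: "j < n \<Longrightarrow> x \<in> vsp M 0 \<Longrightarrow> y \<in> vsp M 0 \<Longrightarrow> bpath M j (x + y) = bpath M j x + bpath M j y"
proof (induction j)
  case (Suc j)
  then show ?case
    using dmod_bmap_add[OF M index_Suc, of j "bpath M j x" "bpath M j y"] bpath_in[OF n M, of j] by simp
qed simp

lemma bpath_scale: "j < n \<Longrightarrow> x \<in> vsp M 0 \<Longrightarrow> bpath M j (c *\<^sub>C x) = c *\<^sub>C bpath M j x"
proof (induction j)
  case (Suc j)
  then show ?case
    using dmod_bmap_scale[OF M index_Suc, of j "bpath M j x" c] bpath_in[OF n M, of j] by simp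
qed simp

lemma bpath_diff: "j < n \<Longrightarrow> x \<in> vsp M 0 \<Longrightarrow> y \<in> vsp M 0 \<Longrightarrow> bpath M j (x - y) = bpath M j x - bpath M j y"
  using bpath_add[of j x "- y"] bpath_scale[of j y "-1"] dmod_neg[OF M, of y 0] by simp

lemma apath_bpath: "j < n \<Longrightarrow> x \<in> vsp M 0 \<Longrightarrow> apath M j (bpath M j x) = (loop M ^^ j) x"
proof (induction j arbitrary: x)
  case (Suc j)
  have "apath M (Suc j) (bpath M (Suc j) x) = apath M j (amap M (Suc j) (bpath M (Suc j) x))" by simp
  also have "amap M (Suc j) (bpath M (Suc j) x) = bpath M j (loop M x)"
    using amap_bpath[OF n M, of "Suc j" x] Suc.prems by simp
  also have "apath M j (bpath M j (loop M x)) = (loop M ^^ j) (loop M x)"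
    using Suc.IH[of "loop M x"] Suc.prems loop_in[OF n M] by simp
  finally show ?case by (simp add: funpow_swap1)
qed simp

text \<open>
  The paths starting at \<open>0\<close> are \<open>b\<^sub>j \<cdots> b\<^sub>1 t\<^sup>k\<close> modulo the relations, so \<open>D e\<^sub>0 M\<close> at vertex \<open>j\<close> is
  \<open>b\<^sub>j \<cdots> b\<^sub>1 e\<^sub>0 M\<close>.
\<close>

lemma eta_sub_eq: "eta_sub n M = (\<lambda>j. if j < n then bpath M j ` vsp M 0 else {0})" (is "_ = ?V")
  and submodule_eta: "submodule n M (eta_sub n M)"
proof -
  have V_sub: "cvec.subspace (?V j)" for j
  proof (cases "j < n")
    case True
    have "0 \<in> bpath M j ` vsp M 0" using bpath_scale[OF True dmod_0[OF M], of 0] dmod_0[OF M] by (metis cvec.scale_zero_left imageI)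
    moreover have "x + y \<in> bpath M j ` vsp M 0" if xy: "x \<in> bpath M j ` vsp M 0" "y \<in> bpath M j ` vsp M 0" for x y
    proof -
      from xy(1) obtain u where u: "x = bpath M j u" "u \<in> vsp M 0" by (rule imageE)
      from xy(2) obtain v where v: "y = bpath M j v" "v \<in> vsp M 0" by (rule imageE)
      show ?thesis unfolding u(1) v(1) bpath_add[OF True u(2) v(2), symmetric]
        by (rule imageI[OF dmod_add[OF M u(2) v(2)]])
    qed
    moreover have "c *\<^sub>C x \<in> bpath M j ` vsp M 0" if xy: "x \<in> bpath M j ` vsp M 0" for c x
    proof -
      from xy obtain u where u: "x = bpath M j u" "u \<in> vsp M 0" by (rule imageE)
      show ?thesis unfolding u(1) bpath_scale[OF True u(2), symmetric]
        by (rule imageI[OF dmod_scale[OF M u(2)]])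
    qed
    ultimately show ?thesis using True by (simp add: cvec.subspace_def)
  qed simp
  have V_le: "?V j \<subseteq> vsp M j" for j
    using bpath_in[OF n M, of j] dmod_0[OF M, of j] by auto
  have V: "dmod n (subrep M ?V)"
  proof (rule submodule_dmod[OF M V_sub V_le])
    fix i x assume i: "i \<in> {1..n-1}" and x: "x \<in> ?V (i-1)"
    obtain j where j: "i = Suc j" "Suc j < n" using i n by (cases i) auto
    from x j have "x \<in> bpath M j ` vsp M 0" by simp
    then obtain u where u: "x = bpath M j u" "u \<in> vsp M 0" by (rule imageE)
    have "bpath M (Suc j) u \<in> bpath M (Suc j) ` vsp M 0" by (rule imageI[OF u(2)])
    then show "bmap M i x \<in> ?V i" using j u by simp
  next
    fix i x assume i: "i \<in> {1..n-1}" and x: "x \<in> ?V i"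
    obtain j where j: "i = Suc j" "Suc j < n" using i n by (cases i) auto
    from x j have "x \<in> bpath M (Suc j) ` vsp M 0" by simp
    then obtain u where u: "x = bpath M (Suc j) u" "u \<in> vsp M 0" by (rule imageE)
    have "amap M (Suc j) x = bpath M j (loop M u)"
      unfolding u(1) using amap_bpath[OF n M, of "Suc j" u] j u(2) by simp
    also have "\<dots> \<in> bpath M j ` vsp M 0" by (rule imageI[OF loop_in[OF n M u(2)]])
    finally show "amap M i x \<in> ?V (i-1)" using j by simp
  qed
  have subV: "submodule n M ?V" unfolding submodule_def by (intro conjI allI V V_le)
  have le: "?V j \<subseteq> U j" if U: "submodule n M U" "vsp M 0 \<subseteq> U 0" for U j
  proof -
    note Us = submoduleD[OF M U(1)]
    have b: "j < n \<Longrightarrow> x \<in> vsp M 0 \<Longrightarrow> bpath M j x \<in> U j" for j x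
    proof (induction j)
      case (Suc j)
      then show ?case using Us(4)[OF index_Suc, of j "bpath M j x"] by simp
    qed (use U(2) in auto)
    show ?thesis
    proof (cases "j < n")
      case True
      then show ?thesis using b by (simp add: image_subset_iff)
    next
      case False
      then show ?thesis using cvec.subspace_0[OF Us(3), of j] by simp
    qed
  qed
  have V0: "vsp M 0 \<subseteq> ?V 0"
  proof
    fix x assume "x \<in> vsp M 0"
    then have "bpath M 0 x \<in> bpath M 0 ` vsp M 0" by (rule imageI)
    then show "x \<in> ?V 0" using n by simp
  qed
  show eq: "eta_sub n M = ?V"
  proof
    fix j
    have "?V j \<in> {U j | U. submodule n M U \<and> vsp M 0 \<subseteq> U 0}"
      by (rule CollectI) (intro exI[of _ ?V] conjI refl subV V0)
    then have "eta_sub n M j \<subseteq> ?V j" unfolding eta_sub_def by (rule Inter_lower)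
    moreover have "?V j \<subseteq> eta_sub n M j"
      unfolding eta_sub_def
    proof (rule Inter_greatest)
      fix W assume "W \<in> {U j | U. submodule n M U \<and> vsp M 0 \<subseteq> U 0}"
      then obtain U where "W = U j" "submodule n M U" "vsp M 0 \<subseteq> U 0" by blast
      then show "?V j \<subseteq> W" using le by simp
    qed
    ultimately show "eta_sub n M j = ?V j" by (rule subset_antisym)
  qed
  show "submodule n M (eta_sub n M)" unfolding eq by (rule subV)
qed

lemma dmod_eta: "dmod n (eta n M)"
  unfolding eta_def by (rule submoduleD(1)[OF M submodule_eta])

lemma vsp_eta: "vsp (eta n M) j = (if j < n then bpath M j ` vsp M 0 else {0})"
  by (simp add: eta_def eta_sub_eq)

end

lemma Hom_eta:
  assumes n: "n > 1" and M: "dmod n M" and N: "dmod n N" and f: "f \<in> Hom n M N"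
  shows "hrestrict (eta_sub n M) f \<in> Hom n (eta n M) (eta n N)"
proof -
  note eM = submoduleD[OF M submodule_eta[OF n M]] and eN = submoduleD[OF N submodule_eta[OF n N]]
  have img: "f j x \<in> eta_sub n N j" if x: "x \<in> eta_sub n M j" for j x
  proof (cases "j < n")
    case True
    then have "x \<in> bpath M j ` vsp M 0" using x by (simp add: eta_sub_eq[OF n M])
    then obtain u where u: "x = bpath M j u" "u \<in> vsp M 0" by (rule imageE)
    have "f j x = bpath N j (f 0 u)" unfolding u(1) by (rule Hom_bpath[OF n M f True u(2)])
    also have "\<dots> \<in> bpath N j ` vsp N 0" by (rule imageI[OF Hom_in[OF f u(2)]])
    finally show ?thesis using True by (simp add: eta_sub_eq[OF n N])
  next
    case False
    then have "x = 0" using x by (simp add: eta_sub_eq[OF n M])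
    then show ?thesis using Hom_0[OF f] cvec.subspace_0[OF eN(3)] by simp
  qed
  note inM = subsetD[OF eM(2)]
  show ?thesis
    by (rule HomI)
      (simp_all add: eta_def hrestrict_def img cvec.subspace_add[OF eM(3)] cvec.subspace_scale[OF eM(3)]
        Hom_add[OF f] Hom_scale[OF f] inM eM(4,5) Hom_bmap[OF f] Hom_amap[OF f] del: One_nat_def)
qed

lemma bpath_MI:
  assumes n: "n > 1" and I: "I \<subseteq> {1..n}" and f: "f \<in> MIv n I 0"
  shows "bpath (MI n I) j f k = (if k < n - j then f k else 0)"
proof (induction j arbitrary: k)
  case 0
  then show ?case using MIv_outside[OF n f, of k] by simp
next
  case (Suc j)
  then show ?case by (auto simp: MI_simps[OF n I] D0_simps)
qed

lemma eta_MI: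
  assumes n: "n > 1" and I: "I \<subseteq> {1..n}"
  shows "eta n (MI n I) = TT n (card I)"
proof -
  note M = dmod_MI[OF n I]
  have c: "card I \<le> n" using tail_le[OF I, of 0] tail_0[OF I] by simp
  have T: "{1..card I} \<subseteq> {1..n}" using c by auto
  have tT: "tail {1..card I} j = card I - j" for j
  proof -
    have "{k \<in> {1..card I}. j < k} = {Suc j..card I}" by auto
    then show ?thesis by (simp add: tail_def)
  qed
  have "eta_sub n (MI n I) j = MIv n {1..card I} j" for j
  proof (cases "j < n")
    case False
    have "f k = 0" if "f \<in> MIv n {1..card I} j" for f k
      using MIv_outside[OF n that, of k] False by simp
    then have "MIv n {1..card I} j \<subseteq> {0}" by (auto simp: fun_eq_iff)
    then show ?thesis
      using False cvec.subspace_0[OF subspace_MIv, of n "{1..card I}" j] by (auto simp: eta_sub_eq[OF n M])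
  next
    case True
    have "bpath (MI n I) j ` MIv n I 0 = MIv n {1..card I} j"
    proof (intro subset_antisym subsetI)
      fix g assume "g \<in> bpath (MI n I) j ` MIv n I 0"
      then obtain f where f: "g = bpath (MI n I) j f" "f \<in> MIv n I 0" by (rule imageE)
      show "g \<in> MIv n {1..card I} j"
      proof (rule MIvI)
        fix k assume "g k \<noteq> 0"
        then have k: "k < n - j" "f k \<noteq> 0" unfolding f(1) bpath_MI[OF n I f(2)] by (auto split: if_splits)
        have "n \<le> k + card I" using MIvD(1)[OF f(2) k(2)] tail_0[OF I] by simp
        then show "n - j \<le> k + tail {1..card I} j \<and> k < n - j" using k(1) unfolding tT by linarith
      qed
    next
      fix g assume g: "g \<in> MIv n {1..card I} j"
      have "g \<in> MIv n I 0"
      proof (rule MIvI)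
        fix k assume k: "g k \<noteq> 0"
        show "n - 0 \<le> k + tail I 0 \<and> k < n - 0"
          using MIvD[OF g k] unfolding tT tail_0[OF I] by linarith
      qed
      then have im: "bpath (MI n I) j g \<in> bpath (MI n I) j ` MIv n I 0" by (rule imageI)
      have "bpath (MI n I) j g = g"
      proof
        fix k
        show "bpath (MI n I) j g k = g k"
          unfolding bpath_MI[OF n I \<open>g \<in> MIv n I 0\<close>] using MIv_outside[OF n g, of k] by simp
      qed
      with im show "g \<in> bpath (MI n I) j ` MIv n I 0" by (simp only:)
    qed
    then show ?thesis using True by (simp add: eta_sub_eq[OF n M] MI_simps[OF n I])
  qed
  then have e: "eta_sub n (MI n I) = MIv n {1..card I}" by (rule ext)
  have "eta n (MI n I) = subrep (MI n I) (MIv n {1..card I})" unfolding eta_def e ..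
  also have "\<dots> = TT n (card I)"
    unfolding TT_def MI_eq[OF n I] MI_eq[OF n T] by (simp add: subrep_def)
  finally show ?thesis .
qed

lemma sesD:
  assumes "ses n X Y Z f g"
  shows "dmod n X" "dmod n Y" "dmod n Z" "f \<in> Hom n X Y" "g \<in> Hom n Y Z"
    "x \<in> vsp X i \<Longrightarrow> f i x = 0 \<Longrightarrow> x = 0"
    "y \<in> vsp Y i \<Longrightarrow> g i y = 0 \<Longrightarrow> \<exists>x\<in>vsp X i. f i x = y"
    "x \<in> vsp X i \<Longrightarrow> g i (f i x) = 0"
    "z \<in> vsp Z i \<Longrightarrow> \<exists>y\<in>vsp Y i. g i y = z"
proof -
  show *: "dmod n X" "dmod n Y" "dmod n Z" "f \<in> Hom n X Y" "g \<in> Hom n Y Z" using assms unfolding ses_def by simp_all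
  have inj: "inj_on (f i) (vsp X i)" and im: "f i ` vsp X i = {y \<in> vsp Y i. g i y = 0}" and sur: "g i ` vsp Y i = vsp Z i"
    using assms unfolding ses_def by simp_all
  show "x \<in> vsp X i \<Longrightarrow> f i x = 0 \<Longrightarrow> x = 0" using inj_onD[OF inj, of x 0] Hom_0[OF *(4)] dmod_0[OF *(1)] by simp
  show "\<exists>x\<in>vsp X i. f i x = y" if "y \<in> vsp Y i" "g i y = 0"
  proof -
    have "y \<in> f i ` vsp X i" unfolding im using that by simp
    then obtain x where "y = f i x" "x \<in> vsp X i" by (rule imageE)
    then show ?thesis by (intro bexI[of _ x]) simp_all
  qed
  show "g i (f i x) = 0" if "x \<in> vsp X i" using imageI[OF that, of "f i"] unfolding im by simp
  show "\<exists>y\<in>vsp Y i. g i y = z" if "z \<in> vsp Z i"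
  proof -
    have "z \<in> g i ` vsp Y i" unfolding sur by (rule that)
    then obtain y where "z = g i y" "y \<in> vsp Y i" by (rule imageE)
    then show ?thesis by (intro bexI[of _ y]) simp_all
  qed
qed

lemma sesI:
  assumes "dmod n X" "dmod n Y" "dmod n Z" "f \<in> Hom n X Y" "g \<in> Hom n Y Z"
    and inj: "\<And>i x. x \<in> vsp X i \<Longrightarrow> f i x = 0 \<Longrightarrow> x = 0"
    and ker: "\<And>i y. y \<in> vsp Y i \<Longrightarrow> g i y = 0 \<Longrightarrow> \<exists>x\<in>vsp X i. f i x = y"
    and comp: "\<And>i x. x \<in> vsp X i \<Longrightarrow> g i (f i x) = 0"
    and sur: "\<And>i z. z \<in> vsp Z i \<Longrightarrow> \<exists>y\<in>vsp Y i. g i y = z"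
  shows "ses n X Y Z f g"
  unfolding ses_def
proof (intro conjI allI assms(1-5))
  fix i
  show "inj_on (f i) (vsp X i)"
  proof (rule inj_onI)
    fix x y assume xy: "x \<in> vsp X i" "y \<in> vsp X i" "f i x = f i y"
    have "f i (x - y) = 0" using Hom_diff[OF assms(1,4) xy(1,2)] xy(3) by simp
    then have "x - y = 0" by (rule inj[OF dmod_diff[OF assms(1) xy(1,2)]])
    then show "x = y" by simp
  qed
  show "f i ` vsp X i = {y \<in> vsp Y i. g i y = 0}"
  proof (intro subset_antisym subsetI)
    fix y assume "y \<in> f i ` vsp X i"
    then obtain x where x: "y = f i x" "x \<in> vsp X i" by (rule imageE)
    show "y \<in> {y \<in> vsp Y i. g i y = 0}" unfolding x(1) using Hom_in[OF assms(4) x(2)] comp[OF x(2)] by simp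
  next
    fix y assume y: "y \<in> {y \<in> vsp Y i. g i y = 0}"
    then have "\<exists>x\<in>vsp X i. f i x = y" using ker[of y i] by simp
    then obtain x where "x \<in> vsp X i" "f i x = y" by (rule bexE)
    then show "y \<in> f i ` vsp X i" by (intro rev_image_eqI[of x]) simp_all
  qed
  show "g i ` vsp Y i = vsp Z i"
  proof (intro subset_antisym subsetI)
    fix z assume "z \<in> g i ` vsp Y i"
    then obtain y where y: "z = g i y" "y \<in> vsp Y i" by (rule imageE)
    show "z \<in> vsp Z i" unfolding y(1) by (rule Hom_in[OF assms(5) y(2)])
  next
    fix z assume "z \<in> vsp Z i"
    from sur[OF this] obtain y where "y \<in> vsp Y i" "g i y = z" by (rule bexE)
    then show "z \<in> g i ` vsp Y i" by (intro rev_image_eqI[of y]) simp_all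
  qed
qed

text \<open>
  Since \<open>a\<^sub>1 \<cdots> a\<^sub>j b\<^sub>j \<cdots> b\<^sub>1 = t\<^sup>j\<close>, exactness of \<open>\<eta>\<close> at vertex \<open>j\<close> is a question about \<open>t\<^sup>j e\<^sub>0 Y\<close>: an
  element \<open>t\<^sup>j y\<close> that vanishes in \<open>M\<^sub>I\<close> must come from \<open>t\<^sup>j e\<^sub>0 X\<close>.  For \<open>j > m = |I|\<close> it is \<open>0\<close>; otherwise
  the image of \<open>y\<close> in \<open>M\<^sub>I\<close> is \<open>t\<^bsup>m-j\<^esup> w\<close>, and correcting \<open>y\<close> by \<open>t\<^bsup>m-j\<^esup>\<close> times a lift of \<open>w\<close> changes \<open>t\<^sup>j y\<close> by
  a multiple of \<open>t\<^sup>m\<close>, hence not at all.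
\<close>

lemma E_sesI:
  assumes n: "n > 1" and I: "I \<subseteq> {1..n}" and s: "ses n X Y (MI n I) f g"
    and X: "a_injective n X" and Y: "a_injective n Y"
    and zero: "\<And>y. y \<in> vsp Y 0 \<Longrightarrow> (loop Y ^^ card I) y = 0"
  shows "E_ses n X Y (MI n I) f g"
proof -
  note S = sesD[OF s]
  let ?Z = "MI n I" and ?m = "card I"
  have c: "?m \<le> n" using tail_le[OF I, of 0] tail_0[OF I] by simp
  have key: "\<exists>x\<in>vsp X 0. f 0 ((loop X ^^ j) x) = (loop Y ^^ j) y"
    if j: "j < n" and y: "y \<in> vsp Y 0" and gy: "(loop ?Z ^^ j) (g 0 y) = 0" for j y
  proof (cases "?m < j")
    case True
    then have "(loop Y ^^ j) y = 0"
      using funpow_split[of ?m j "loop Y" y] zero[OF y] loop_pow_0[OF n S(2)] by simp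
    then show ?thesis
      by (intro bexI[of _ 0]) (simp_all only: loop_pow_0[OF n S(1)] Hom_0[OF S(4)] dmod_0[OF S(1)])
  next
    case False
    define w where "w = g 0 y"
    have w: "w \<in> MIv n I 0" using Hom_in[OF S(5) y] by (simp add: w_def MI_simps[OF n I])
    have wn: "w k = 0" if "n \<le> k" for k using MIv_outside[OF n w] that by simp
    have lw: "(loop ?Z ^^ i) w k = (if i \<le> k \<and> k < n then w (k - i) else 0)" for i k
      unfolding loop_MI[OF n I] by (rule loop_D0_pow[OF n]) (rule wn)
    have w0: "w k = 0" if k: "k < n - j" for k
    proof -
      have "w k = (loop ?Z ^^ j) w (k + j)" unfolding lw using k by simp
      then show ?thesis using gy by (simp add: w_def)
    qed
    \<comment> \<open>\<open>w\<close> is killed by \<open>t\<^sup>j\<close> in \<open>\<complex>[t]/t\<^sup>m\<close>, so it is \<open>t\<^bsup>m-j\<^esup> w'\<close>\<close>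
    define w' where "w' = (\<lambda>k. if n - ?m \<le> k \<and> k < n then w (k + (?m - j)) else 0)"
    have w': "w' \<in> vsp ?Z 0"
      unfolding MI_simps[OF n I] by (rule MIvI) (auto simp: w'_def tail_0[OF I] split: if_splits)
    have w'n: "w' k = 0" if "n \<le> k" for k using that by (simp add: w'_def)
    have lw': "(loop ?Z ^^ i) w' k = (if i \<le> k \<and> k < n then w' (k - i) else 0)" for i k
      unfolding loop_MI[OF n I] by (rule loop_D0_pow[OF n]) (rule w'n)
    have "w = (loop ?Z ^^ (?m - j)) w'"
    proof
      fix k
      show "w k = (loop ?Z ^^ (?m - j)) w' k"
      proof (cases "n - j \<le> k \<and> k < n")
        case True
        then have "?m - j \<le> k" "n - ?m \<le> k - (?m - j)" "k - (?m - j) < n" "k - (?m - j) + (?m - j) = k"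
          using c False by linarith+
        then show ?thesis unfolding lw' using True by (simp add: w'_def)
      next
        case False': False
        have "(loop ?Z ^^ (?m - j)) w' k = 0"
          unfolding lw' using False' False c by (auto simp: w'_def)
        moreover have "w k = 0" using False' w0[of k] wn[of k] by (meson not_le)
        ultimately show ?thesis by simp
      qed
    qed
    obtain y' where y': "y' \<in> vsp Y 0" "g 0 y' = w'" using S(9)[OF w'] by (rule bexE)
    have ly': "(loop Y ^^ i) y' \<in> vsp Y 0" for i by (rule loop_pow_in[OF n S(2) y'(1)])
    have "g 0 (y - (loop Y ^^ (?m - j)) y') = w - (loop ?Z ^^ (?m - j)) w'"
      using Hom_diff[OF S(2) S(5) y ly'] Hom_loop_pow[OF n S(2) S(5) y'(1)] y'(2) by (simp add: w_def)
    then have "g 0 (y - (loop Y ^^ (?m - j)) y') = 0" using \<open>w = (loop ?Z ^^ (?m - j)) w'\<close> by simp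
    then have "\<exists>x\<in>vsp X 0. f 0 x = y - (loop Y ^^ (?m - j)) y'"
      by (rule S(7)[OF dmod_diff[OF S(2) y ly']])
    then obtain x where x: "x \<in> vsp X 0" "f 0 x = y - (loop Y ^^ (?m - j)) y'" by (rule bexE)
    have "f 0 ((loop X ^^ j) x) = (loop Y ^^ j) (y - (loop Y ^^ (?m - j)) y')"
      using Hom_loop_pow[OF n S(1) S(4) x(1)] x(2) by simp
    also have "\<dots> = (loop Y ^^ j) y - (loop Y ^^ j) ((loop Y ^^ (?m - j)) y')"
      by (rule loop_pow_diff[OF n S(2) y ly'])
    also have "(loop Y ^^ j) ((loop Y ^^ (?m - j)) y') = (loop Y ^^ ?m) y'"
      using False funpow_split[of "?m - j" ?m "loop Y" y'] by simp
    also have "\<dots> = 0" by (rule zero[OF y'(1)])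
    finally have "f 0 ((loop X ^^ j) x) = (loop Y ^^ j) y" by simp
    then show ?thesis by (rule bexI[OF _ x(1)])
  qed
  note eX = submoduleD[OF S(1) submodule_eta[OF n S(1)]] and eY = submoduleD[OF S(2) submodule_eta[OF n S(2)]]
  have vX: "vsp (eta n X) = eta_sub n X" and vY: "vsp (eta n Y) = eta_sub n Y" and vZ: "vsp (eta n ?Z) = eta_sub n ?Z"
    by (simp_all add: eta_def)
  have "ses n (eta n X) (eta n Y) (eta n ?Z) (hrestrict (eta_sub n X) f) (hrestrict (eta_sub n Y) g)"
  proof (rule sesI[OF dmod_eta[OF n S(1)] dmod_eta[OF n S(2)] dmod_eta[OF n S(3)]
        Hom_eta[OF n S(1,2,4)] Hom_eta[OF n S(2,3,5)]], unfold vX vY vZ)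
    have fin: "f i x \<in> eta_sub n Y i" if "x \<in> eta_sub n X i" for i x
      using Hom_in[OF Hom_eta[OF n S(1,2,4)], of x i] that by (simp add: vX vY hrestrict_def)
    show "x = 0" if "x \<in> eta_sub n X i" "hrestrict (eta_sub n X) f i x = 0" for i x
      using S(6)[OF subsetD[OF eX(2) that(1)]] that by (simp add: hrestrict_def)
    show "hrestrict (eta_sub n Y) g i (hrestrict (eta_sub n X) f i x) = 0" if "x \<in> eta_sub n X i" for i x
      using S(8)[OF subsetD[OF eX(2) that]] that fin by (simp add: hrestrict_def)
    show "\<exists>x\<in>eta_sub n X i. hrestrict (eta_sub n X) f i x = y"
      if y: "y \<in> eta_sub n Y i" "hrestrict (eta_sub n Y) g i y = 0" for i y
    proof (cases "i < n")
      case True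
      then have "y \<in> bpath Y i ` vsp Y 0" using y(1) by (simp add: eta_sub_eq[OF n S(2)])
      then obtain u where u: "y = bpath Y i u" "u \<in> vsp Y 0" by (rule imageE)
      have "g i y = bpath ?Z i (g 0 u)" unfolding u(1) by (rule Hom_bpath[OF n S(2) S(5) True u(2)])
      then have "bpath ?Z i (g 0 u) = 0" using y by (simp add: hrestrict_def)
      then have "(loop ?Z ^^ i) (g 0 u) = 0"
        using apath_bpath[OF n S(3) True Hom_in[OF S(5) u(2)]] apath_0[OF n S(3) True] by simp
      from key[OF True u(2) this] obtain x where x: "x \<in> vsp X 0" "f 0 ((loop X ^^ i) x) = (loop Y ^^ i) u" by (rule bexE)
      have bx: "bpath X i x \<in> eta_sub n X i" using True x(1) by (simp add: eta_sub_eq[OF n S(1)])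
      have "f i (bpath X i x) = y"
      proof (rule apath_inj[OF n S(2) Y True])
        show "f i (bpath X i x) \<in> vsp Y i" by (rule Hom_in[OF S(4) subsetD[OF eX(2) bx]])
        show "y \<in> vsp Y i" by (rule subsetD[OF eY(2) y(1)])
        have "apath Y i (f i (bpath X i x)) = f 0 (apath X i (bpath X i x))"
          by (rule Hom_apath[OF n S(1) S(4) True subsetD[OF eX(2) bx], symmetric])
        also have "\<dots> = apath Y i y"
          unfolding u(1) apath_bpath[OF n S(1) True x(1)] apath_bpath[OF n S(2) True u(2)] by (rule x(2))
        finally show "apath Y i (f i (bpath X i x)) = apath Y i y" .
      qed
      then show ?thesis using bx by (intro bexI[of _ "bpath X i x"]) (simp_all add: hrestrict_def)
    next
      case False
      then have "y = 0" using y(1) by (simp add: eta_sub_eq[OF n S(2)])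
      moreover have "hrestrict (eta_sub n X) f i 0 = 0" using Hom_0[OF S(4), of i] by (simp add: hrestrict_def)
      ultimately show ?thesis using cvec.subspace_0[OF eX(3), of i] by (intro bexI[of _ 0]) simp_all
    qed
    show "\<exists>y\<in>eta_sub n Y i. hrestrict (eta_sub n Y) g i y = z" if z: "z \<in> eta_sub n ?Z i" for i z
    proof (cases "i < n")
      case True
      then have "z \<in> bpath ?Z i ` vsp ?Z 0" using z by (simp add: eta_sub_eq[OF n S(3)])
      then obtain w where w: "z = bpath ?Z i w" "w \<in> vsp ?Z 0" by (rule imageE)
      obtain u where u: "u \<in> vsp Y 0" "g 0 u = w" using S(9)[OF w(2)] by (rule bexE)
      have bu: "bpath Y i u \<in> eta_sub n Y i" using True u(1) by (simp add: eta_sub_eq[OF n S(2)])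
      have "g i (bpath Y i u) = z" unfolding w(1) u(2)[symmetric] by (rule Hom_bpath[OF n S(2) S(5) True u(1)])
      then show ?thesis using bu by (intro bexI[of _ "bpath Y i u"]) (simp_all add: hrestrict_def)
    next
      case False
      then have "z = 0" using z by (simp add: eta_sub_eq[OF n S(3)])
      moreover have "hrestrict (eta_sub n Y) g i 0 = 0" using Hom_0[OF S(5), of i] by (simp add: hrestrict_def)
      ultimately show ?thesis using cvec.subspace_0[OF eY(3), of i] by (intro bexI[of _ 0]) simp_all
    qed
  qed
  then show ?thesis
    unfolding E_ses_def using s good_iff_a_injective[OF n S(1)] good_iff_a_injective[OF n S(2)]
      good_iff_a_injective[OF n S(3)] X Y a_injective_MI[OF n I] by simp
qed

text \<open>
  The path \<open>b\<^sub>m \<cdots> b\<^sub>1\<close>, with \<open>m = |I|\<close>, kills the generator of \<open>M\<^sub>I\<close>.  So for a lift \<open>y\<close> of the generator,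
  exactness of \<open>\<eta>\<close> at vertex \<open>m\<close> gives \<open>x\<close> in \<open>e\<^sub>0 X\<close> with \<open>b\<^sub>m \<cdots> b\<^sub>1 (y - f x) = 0\<close>, and then \<open>t\<^sup>m (y - f x) = 0\<close>.
\<close>

lemma E_ses_lift:
  assumes n: "n > 1" and I: "I \<subseteq> {1..n}" "I \<noteq> {}" and E: "E_ses n X Y (MI n I) f g"
  obtains y where "y \<in> vsp Y 0" "g 0 y = gen n I" "(loop Y ^^ card I) y = 0"
proof -
  let ?Z = "MI n I" and ?m = "card I"
  have s: "ses n X Y ?Z f g"
    and s': "ses n (eta n X) (eta n Y) (eta n ?Z) (hrestrict (eta_sub n X) f) (hrestrict (eta_sub n Y) g)"
    using E unfolding E_ses_def by simp_all
  note S = sesD[OF s]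
  have z: "gen n I \<in> vsp ?Z 0" by (rule gen_in[OF n I])
  obtain y where y: "y \<in> vsp Y 0" "g 0 y = gen n I" using S(9)[OF z] by (rule bexE)
  show ?thesis
  proof (cases "?m < n")
    case False
    have "(loop Y ^^ ?m) y = (loop Y ^^ (?m - n)) ((loop Y ^^ n) y)" using False by (intro funpow_split) simp
    then have "(loop Y ^^ ?m) y = 0" using loop_pow_n[OF n S(2) y(1)] loop_pow_0[OF n S(2)] by simp
    then show ?thesis by (rule that[OF y])
  next
    case True
    let ?b = "bpath Y ?m y"
    have b: "?b \<in> eta_sub n Y ?m" using True y(1) by (simp add: eta_sub_eq[OF n S(2)])
    have "g ?m ?b = bpath ?Z ?m (gen n I)" using Hom_bpath[OF n S(2) S(5) True y(1)] y(2) by simp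
    also have "\<dots> = 0"
    proof
      fix k
      have "gen n I \<in> MIv n I 0" using z by (simp add: MI_simps[OF n I(1)])
      from bpath_MI[OF n I(1) this, of ?m k] show "bpath ?Z ?m (gen n I) k = 0 k" by (simp add: gen_zero(1)[OF n])
    qed
    finally have "hrestrict (eta_sub n Y) g ?m ?b = 0" by (simp add: hrestrict_def)
    then have "\<exists>x\<in>vsp (eta n X) ?m. hrestrict (eta_sub n X) f ?m x = ?b"
      using b by (intro sesD(7)[OF s']) (simp add: eta_def)
    then obtain x' where x': "x' \<in> vsp (eta n X) ?m" "hrestrict (eta_sub n X) f ?m x' = ?b" by (rule bexE)
    have "x' \<in> bpath X ?m ` vsp X 0" using x'(1) True by (simp add: vsp_eta[OF n S(1)])
    then obtain x where x: "x' = bpath X ?m x" "x \<in> vsp X 0" by (rule imageE)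
    have "x' \<in> eta_sub n X ?m" using x'(1) by (simp add: eta_def)
    then have "f ?m (bpath X ?m x) = ?b" using x'(2) x(1) by (simp add: hrestrict_def)
    then have fb: "bpath Y ?m (f 0 x) = ?b" using Hom_bpath[OF n S(1) S(4) True x(2)] by simp
    note fx = Hom_in[OF S(4) x(2)]
    have "bpath Y ?m (y - f 0 x) = 0" using bpath_diff[OF n S(2) True y(1) fx] fb by simp
    then have "(loop Y ^^ ?m) (y - f 0 x) = 0"
      using apath_bpath[OF n S(2) True dmod_diff[OF S(2) y(1) fx]] apath_0[OF n S(2) True] by simp
    moreover have "g 0 (y - f 0 x) = gen n I"
      using Hom_diff[OF S(2) S(5) y(1) fx] S(8)[OF x(2)] y(2) by simp
    ultimately show ?thesis by (intro that[OF dmod_diff[OF S(2) y(1) fx]])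
  qed
qed

text \<open>
  This is the vanishing of \<open>ext\<^sup>1(M\<^sub>K, M\<^sub>J)\<close> when \<open>K\<close> arises from \<open>J\<close> by exchanging \<open>d\<close> for \<open>a\<close>, in the form in
  which it is used: an element \<open>y\<close> whose image satisfies the flag conditions of \<open>M\<^sub>K\<close> can be moved
  inside its coset modulo \<open>M\<^sub>J\<close> so that it satisfies them itself.  The condition at \<open>j - 1\<close> implies the one at \<open>j\<close>
  unless \<open>j = d\<close>, and the condition at \<open>j\<close> implies the one at \<open>j - 1\<close> unless \<open>j = a\<close>.  The conditions at \<open>0\<close> and
  \<open>n\<close> hold because \<open>t\<^sup>m y = 0\<close>.  If \<open>a < d\<close>, they spread upwards from \<open>0\<close> to \<open>d - 1\<close> and downwards from \<open>n\<close> to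
  \<open>d\<close>, and \<open>y\<close> itself is suitable.  If \<open>d < a\<close>, an element \<open>x\<close> of \<open>M\<^sub>J\<close> that corrects the condition at \<open>d\<close>
  is divisible by the required power of \<open>t\<close> because \<open>J\<close> and \<open>K\<close> agree below \<open>d\<close>, and from \<open>d\<close>
  the conditions spread upwards to \<open>n\<close>.
\<close>

lemma lift_flag_conditions:
  assumes n: "n > 1" and s: "ses n (MI n J) Y Z f g" and Y: "a_injective n Y" and Z: "a_injective n Z"
    and J: "J \<subseteq> {1..n}" and K: "K \<subseteq> {1..n}" and card: "card K = card J"
    and a: "K - J = {a}" and d: "J - K = {d}"
    and y: "y \<in> vsp Y 0" "(loop Y ^^ card K) y = 0"
    and gy: "\<And>j. j < n \<Longrightarrow> (loop Z ^^ (card K - tail K j)) (g 0 y) \<in> flag Z j"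
  obtains x where "x \<in> vsp (MI n J) 0"
    "\<And>j. j < n \<Longrightarrow> (loop Y ^^ (card K - tail K j)) (y + f 0 x) \<in> flag Y j"
    "(loop Y ^^ card K) (y + f 0 x) = 0"
proof -
  note S = sesD[OF s]
  let ?X = "MI n J"
  define m where "m = card K"
  have finK: "finite K" and finJ: "finite J" using K J by (auto intro: finite_subset)
  define rK where "rK = (\<lambda>j. m - tail K j)"
  define rJ where "rJ = (\<lambda>j. m - tail J j)"
  have tK: "tail K j \<le> m" and tJ: "tail J j \<le> m" for j
    using tail_le_card[OF finK, of j] tail_le_card[OF finJ, of j] card by (simp_all add: m_def)
  have r0: "rK 0 = 0" "rJ 0 = 0" using tail_0[OF K] tail_0[OF J] card by (simp_all add: rK_def rJ_def m_def)
  have rn: "rK n = m" "rJ n = m" using tail_outside[OF K, of n] tail_outside[OF J, of n] by (simp_all add: rK_def rJ_def)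
  have stepK: "rK (Suc j) = rK j + (if Suc j \<in> K then 1 else 0)" for j
    using tail_pred[OF finK, of "Suc j"] tK[of j] tK[of "Suc j"] by (auto simp: rK_def split: if_splits)
  have stepJ: "rJ (Suc j) = rJ j + (if Suc j \<in> J then 1 else 0)" for j
    using tail_pred[OF finJ, of "Suc j"] tJ[of j] tJ[of "Suc j"] by (auto simp: rJ_def split: if_splits)
  have ad: "a \<in> K" "a \<notin> J" "d \<in> J" "d \<notin> K" using a d by auto
  have ad1: "1 \<le> a" "a \<le> n" "1 \<le> d" "d \<le> n" using ad K J by auto
  have other: "Suc j \<in> K \<longleftrightarrow> Suc j \<in> J" if "Suc j \<noteq> a" "Suc j \<noteq> d" for j
    using a d that by (metis Diff_iff singletonD)
  have rel: "rJ j + (if a \<le> j then 1 else 0) = rK j + (if d \<le> j then 1 else 0)" for j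
  proof (induction j)
    case 0
    then show ?case using r0 ad1 by simp
  next
    case (Suc j)
    have "a \<noteq> d" using ad by blast
    then show ?case
      using Suc stepK[of j] stepJ[of j] other[of j] ad
      by (cases "Suc j = a"; cases "Suc j = d") (auto simp: le_Suc_eq split: if_splits)
  qed
  \<comment> \<open>the flags of \<open>M\<^sub>J\<close> inside the flags of \<open>Y\<close>\<close>
  define N where "N = (\<lambda>j. if j < n then flag Y j else {0})"
  define NX where "NX = (\<lambda>j. {x \<in> MIv n J 0. \<forall>k<n - m + rJ j. x k = 0})"
  define NZ where "NZ = (\<lambda>j. if j < n then flag Z j else {0})"
  note apX = apath_MI[OF n J]
  have mn: "m \<le> n" using tail_le[OF J, of 0] tail_0[OF J] card by (simp add: m_def)
  have NX_flag: "NX j = flag ?X j" if j: "j < n" for j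
  proof (intro subset_antisym subsetI)
    fix x assume x: "x \<in> NX j"
    define u where "u = (\<lambda>k. x (k + j))"
    have x0: "x \<in> MIv n J 0" using x by (simp add: NX_def)
    have tj: "tail J j \<le> n - j" by (rule tail_le[OF J])
    have e: "n - m + rJ j = n - tail J j" using tJ[of j] mn by (simp add: rJ_def)
    have lowx: "n - tail J j \<le> k" if "x k \<noteq> 0" for k
    proof (rule ccontr)
      assume "\<not> n - tail J j \<le> k"
      then have "x k = 0" using x e by (simp add: NX_def)
      with that show False ..
    qed
    have u: "u \<in> MIv n J j"
    proof (rule MIvI)
      fix k assume k: "u k \<noteq> 0"
      have "n - tail J j \<le> k + j" using k by (intro lowx) (simp add: u_def)
      moreover have "k + j < n" using k MIvD(2)[OF x0, of "k + j"] by (simp add: u_def)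
      ultimately show "n - j \<le> k + tail J j \<and> k < n - j" by linarith
    qed
    have "x = apath ?X j u"
    proof
      fix k
      show "x k = apath ?X j u k"
      proof (cases "j \<le> k")
        case True
        then show ?thesis using apX[OF j] by (simp add: u_def)
      next
        case False
        then have "\<not> n - tail J j \<le> k" using tj j by linarith
        then have "x k = 0" using lowx[of k] by (rule contrapos_np)
        then show ?thesis using apX[OF j] False by simp
      qed
    qed
    then show "x \<in> flag ?X j" unfolding flag_def MI_simps[OF n J] using u by (rule image_eqI)
  next
    fix x assume xf: "x \<in> flag ?X j"
    then have "x \<in> apath ?X j ` MIv n J j" unfolding flag_def MI_simps[OF n J] .
    then obtain u where u: "x = apath ?X j u" "u \<in> MIv n J j" by (rule imageE)
    have "x \<in> MIv n J 0" using flag_in[OF n dmod_MI[OF n J] j xf] by (simp add: MI_simps[OF n J])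
    moreover have "x k = 0" if k: "k < n - m + rJ j" for k
    proof (rule ccontr)
      assume "x k \<noteq> 0"
      then have jk: "j \<le> k" "u (k - j) \<noteq> 0" unfolding u(1) apX[OF j] by (auto split: if_splits)
      have "n - j \<le> k - j + tail J j" by (rule MIvD(1)[OF u(2) jk(2)])
      then show False using k tJ[of j] mn jk(1) j by (simp add: rJ_def)
    qed
    ultimately show "x \<in> NX j" by (simp add: NX_def)
  qed
  have fN: "f 0 x \<in> N j" if "x \<in> NX j" for x j
  proof (cases "j < n")
    case True
    then show ?thesis using Hom_flag[OF n S(1,4) True] that NX_flag[OF True] by (simp add: N_def)
  next
    case False
    have "tail J j = 0" using tail_outside[OF J] False by simp
    then have "x k = 0" for k
      using that mn MIv_outside[OF n, of x J 0 k] by (cases "k < n") (auto simp: NX_def rJ_def)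
    then have "x = 0" by (simp add: fun_eq_iff)
    then show ?thesis using False Hom_0[OF S(4)] by (simp add: N_def)
  qed
  have Nin: "v \<in> vsp Y 0" if "v \<in> N j" for v j
    using that flag_in[OF n S(2), of j] dmod_0[OF S(2)] by (auto simp: N_def split: if_splits)
  have Nsub: "cvec.subspace (N j)" for j
    using flag_subspace[OF n S(2), of j] by (cases "j < n") (simp_all add: N_def)
  have Ndec: "N (Suc j) \<subseteq> N j" for j
    using flag_Suc_subset[OF n S(2), of j] cvec.subspace_0[OF Nsub, of j] by (cases "Suc j < n") (auto simp: N_def)
  have Nloop: "loop Y v \<in> N (Suc j)" if v: "v \<in> N j" for v j
  proof (cases "Suc j < n")
    case True
    then show ?thesis using loop_flag[OF n S(2) True] v by (simp add: N_def)
  next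
    case False
    show ?thesis
    proof (cases "j < n")
      case True
      then have "j = n - 1" using False by simp
      then show ?thesis using loop_flag_top[OF n S(2)] v True False by (simp add: N_def)
    next
      case F: False
      then show ?thesis using v loop_0[OF n S(2)] by (simp add: N_def)
    qed
  qed
  \<comment> \<open>lifting elements of the flag of \<open>Z\<close>; the kernel of the flags is the flag of \<open>M\<^sub>J\<close>\<close>
  have lift: "\<exists>x\<in>MIv n J 0. v + f 0 x \<in> N j" if j: "j < n" and v: "v \<in> vsp Y 0" "g 0 v \<in> flag Z j" for v j
  proof -
    have "g 0 v \<in> apath Z j ` vsp Z j" using v(2) by (simp add: flag_def)
    then obtain z where z: "g 0 v = apath Z j z" "z \<in> vsp Z j" by (rule imageE)
    obtain w where w: "w \<in> vsp Y j" "g j w = z" using S(9)[OF z(2)] by (rule bexE)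
    have aw: "apath Y j w \<in> flag Y j" using w(1) by (simp add: flag_def)
    have aw0: "apath Y j w \<in> vsp Y 0" by (rule flag_in[OF n S(2) j aw])
    have "g 0 (apath Y j w - v) = 0"
      using Hom_diff[OF S(2) S(5) aw0 v(1)] Hom_apath[OF n S(2) S(5) j w(1)] w(2) z(1) by simp
    then have "\<exists>x\<in>vsp ?X 0. f 0 x = apath Y j w - v" by (rule S(7)[OF dmod_diff[OF S(2) aw0 v(1)]])
    then obtain x where x: "x \<in> vsp ?X 0" "f 0 x = apath Y j w - v" by (rule bexE)
    have "v + f 0 x \<in> N j" using aw j by (simp add: x(2) N_def)
    then show ?thesis using x(1) unfolding MI_simps[OF n J] by (rule bexI)
  qed
  have ker: "x \<in> NX j" if x: "x \<in> MIv n J 0" and fx: "f 0 x \<in> N j" for x j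
  proof (cases "j < n")
    case True
    have x': "x \<in> vsp ?X 0" using x by (simp add: MI_simps[OF n J])
    have "f 0 x \<in> apath Y j ` vsp Y j" using fx True by (simp add: N_def flag_def)
    then obtain w where w: "f 0 x = apath Y j w" "w \<in> vsp Y j" by (rule imageE)
    have "apath Z j (g j w) = 0"
      using Hom_apath[OF n S(2) S(5) True w(2)] w(1) S(8)[OF x'] by simp
    then have "g j w = 0" by (rule apath_eq_0[OF n S(3) Z True Hom_in[OF S(5) w(2)]])
    then have "\<exists>u\<in>vsp ?X j. f j u = w" by (rule S(7)[OF w(2)])
    then obtain u where u: "u \<in> vsp ?X j" "f j u = w" by (rule bexE)
    have au: "apath ?X j u \<in> flag ?X j" using u(1) by (simp add: flag_def)
    have au0: "apath ?X j u \<in> vsp ?X 0" by (rule flag_in[OF n S(1) True au])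
    have "f 0 (x - apath ?X j u) = 0"
      using Hom_diff[OF S(1) S(4) x' au0] Hom_apath[OF n S(1) S(4) True u(1)] u(2) w(1) by simp
    then have "x - apath ?X j u = 0" by (rule S(6)[OF dmod_diff[OF S(1) x' au0]])
    then have "x = apath ?X j u" by simp
    then show ?thesis unfolding NX_flag[OF True] using au by (simp only:)
  next
    case False
    then have "f 0 x = 0" using fx by (simp add: N_def)
    then have "x = 0" using S(6)[of x 0] x by (simp add: MI_simps[OF n J])
    then show ?thesis using x by (simp add: NX_def)
  qed
  have add_cancel: "v \<in> N j" if "v + w \<in> N j" "w \<in> N j" for v w j
    using cvec.subspace_diff[OF Nsub that] by simp
  have add_cancel': "w \<in> N j" if "v + w \<in> N j" "v \<in> N j" for v w j
    using add_cancel[of w v j] that by (simp add: add.commute)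
  have X0: "x \<in> vsp ?X 0" if "x \<in> MIv n J 0" for x using that by (simp add: MI_simps[OF n J])
  \<comment> \<open>the flag condition at \<open>j\<close>, and the elements of the coset for which it is considered\<close>
  define P where "P = (\<lambda>y' j. (loop Y ^^ rK j) y' \<in> N j)"
  define C where "C = (\<lambda>y'. y' \<in> vsp Y 0 \<and> g 0 y' = g 0 y \<and> (loop Y ^^ m) y' = 0)"
  have Cv: "(loop Y ^^ i) y' \<in> vsp Y 0" if "C y'" for y' i
    using that loop_pow_in[OF n S(2)] by (simp add: C_def)
  have Cg: "g 0 ((loop Y ^^ rK j) y') \<in> flag Z j" if "C y'" "j < n" for y' j
    using that gy[OF that(2)] Hom_loop_pow[OF n S(2) S(5), of y' "rK j"] by (simp add: C_def rK_def m_def)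
  have forward: "P y' (Suc j)" if c: "C y'" and p: "P y' j" and j: "Suc j \<le> n" "Suc j \<noteq> d" for y' j
  proof (cases "Suc j \<in> K")
    case True
    then have "(loop Y ^^ rK (Suc j)) y' = loop Y ((loop Y ^^ rK j) y')" using stepK[of j] by simp
    then show ?thesis using Nloop p by (simp add: P_def)
  next
    case notK: False
    show ?thesis
    proof (cases "Suc j = n")
      case True
      then show ?thesis using c cvec.subspace_0[OF Nsub] rn by (simp add: P_def C_def)
    next
      case False
      then have jn: "Suc j < n" using j by simp
      have "Suc j \<noteq> a" using notK ad(1) by auto
      then have "Suc j \<notin> J" using other[OF _ j(2)] notK by simp
      then have same: "rK (Suc j) = rK j" "rJ (Suc j) = rJ j" using notK stepK[of j] stepJ[of j] by simp_all
      let ?v = "(loop Y ^^ rK j) y'"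
      have "g 0 ?v \<in> flag Z (Suc j)" using Cg[OF c jn] same by simp
      from lift[OF jn Cv[OF c] this] obtain x where x: "x \<in> MIv n J 0" "?v + f 0 x \<in> N (Suc j)" by (rule bexE)
      have "f 0 x \<in> N j" by (rule add_cancel'[OF subsetD[OF Ndec x(2)]]) (use p in \<open>simp add: P_def\<close>)
      then have "x \<in> NX j" by (rule ker[OF x(1)])
      then have "x \<in> NX (Suc j)" using same by (simp add: NX_def)
      then have "?v \<in> N (Suc j)" by (rule add_cancel[OF x(2) fN])
      then show ?thesis using same by (simp add: P_def)
    qed
  qed
  have backward: "P y' j" if c: "C y'" and p: "P y' (Suc j)" and j: "j < n" "Suc j \<noteq> a" for y' j
  proof (cases "Suc j \<in> K")
    case False
    then show ?thesis using p subsetD[OF Ndec, of _ j] stepK[of j] by (simp add: P_def)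
  next
    case True
    then have "Suc j \<noteq> d" using ad(4) by auto
    then have inJ: "Suc j \<in> J" using other[OF j(2)] True by simp
    let ?v = "(loop Y ^^ rK j) y'"
    have lv: "loop Y ?v \<in> N (Suc j)" using p True stepK[of j] by (simp add: P_def)
    from lift[OF j(1) Cv[OF c] Cg[OF c j(1)]] obtain x where x: "x \<in> MIv n J 0" "?v + f 0 x \<in> N j" by (rule bexE)
    have "loop Y (?v + f 0 x) = loop Y ?v + f 0 (loop ?X x)"
      using loop_add[OF n S(2) Cv[OF c] Hom_in[OF S(4) X0[OF x(1)]]] Hom_loop[OF n S(1,4) X0[OF x(1)]] by simp
    then have "loop Y ?v + f 0 (loop ?X x) \<in> N (Suc j)" using Nloop[OF x(2)] by simp
    then have "f 0 (loop ?X x) \<in> N (Suc j)" by (rule add_cancel'[OF _ lv])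
    moreover have "loop ?X x \<in> MIv n J 0" using loop_in[OF n S(1) X0[OF x(1)]] by (simp add: MI_simps[OF n J])
    ultimately have lx: "loop ?X x \<in> NX (Suc j)" by (intro ker)
    have xn: "x k = 0" if "n \<le> k" for k using MIv_outside[OF n x(1)] that by simp
    have "x k = 0" if k: "k < n - m + rJ j" for k
    proof -
      have rs: "rJ (Suc j) = Suc (rJ j)" using inJ stepJ[of j] by simp
      have "rJ (Suc j) \<le> m" by (simp add: rJ_def)
      then have kn: "Suc k < n" using k rs mn by linarith
      have "(loop ?X ^^ 1) x (Suc k) = (if 1 \<le> Suc k \<and> Suc k < n then x (Suc k - 1) else 0)"
        unfolding loop_MI[OF n J] by (rule loop_D0_pow[OF n]) (rule xn)
      then have "x k = loop ?X x (Suc k)" using kn by simp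
      also have "\<dots> = 0" using lx k rs by (simp add: NX_def)
      finally show ?thesis .
    qed
    then have "x \<in> NX j" using x(1) by (simp add: NX_def)
    then have "?v \<in> N j" by (rule add_cancel[OF x(2) fN])
    then show ?thesis by (simp add: P_def)
  qed
  have P0: "P y' 0" if "C y'" for y' using that n by (simp add: P_def C_def r0 N_def flag_0[OF n S(2)])
  have Cy: "C y" using y by (simp add: C_def m_def)
  have low: "j < d \<Longrightarrow> P y' j" if "C y'" for y' j
  proof (induction j)
    case (Suc j)
    then show ?case using forward[OF that, of j] ad1 by simp
  qed (rule P0[OF that])
  have "\<exists>x. x \<in> MIv n J 0 \<and> C (y + f 0 x) \<and> (\<forall>j\<le>n. P (y + f 0 x) j)"
  proof (cases "a < d")
    case True
    have high: "d \<le> j \<Longrightarrow> j \<le> n \<Longrightarrow> P y j" for j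
    proof (induction "n - j" arbitrary: j)
      case 0
      then have "j = n" by simp
      then show ?case using Cy cvec.subspace_0[OF Nsub] rn by (simp add: P_def C_def)
    next
      case (Suc i)
      have i: "i = n - Suc j" "d \<le> Suc j" "Suc j \<le> n" "j < n" "Suc j \<noteq> a"
        using Suc.hyps(2) Suc.prems True by linarith+
      show ?case by (rule backward[OF Cy Suc.hyps(1)[OF i(1-3)] i(4,5)])
    qed
    have "P y j" if "j \<le> n" for j using low[OF Cy, of j] high[of j] that by (cases "j < d") simp_all
    moreover have "y + f 0 0 = y" using Hom_0[OF S(4), of 0] by simp
    ultimately show ?thesis
      using Cy cvec.subspace_0[OF subspace_MIv, of n J 0] by (intro exI[of _ 0] conjI allI impI) (simp_all only:)
  next
    case False
    moreover have "a \<noteq> d" using ad(1,4) by auto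
    ultimately have da: "d < a" by linarith
    then have dn: "d < n" using ad1 by simp
    define j where "j = d - 1"
    have jd: "d = Suc j" using ad1 by (simp add: j_def)
    have same: "rK d = rK j" using stepK[of j] ad jd by simp
    have eqr: "rJ j = rK j" using rel[of j] da jd by simp
    let ?v = "(loop Y ^^ rK j) y"
    have "g 0 ?v \<in> flag Z d" using Cg[OF Cy dn] same by simp
    from lift[OF dn Cv[OF Cy] this] obtain x where x: "x \<in> MIv n J 0" "?v + f 0 x \<in> N d" by (rule bexE)
    have "f 0 x \<in> N j"
      by (rule add_cancel'[of ?v]) (use subsetD[OF Ndec[of j]] x(2) low[OF Cy, of j] jd in \<open>simp_all add: P_def\<close>)
    then have xNX: "x \<in> NX j" by (rule ker[OF x(1)])
    \<comment> \<open>\<open>x = t\<^sup>r x'\<close> for the power \<open>r\<close> occurring in the condition at \<open>d\<close>\<close>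
    define x' where "x' = (\<lambda>k. if n - m \<le> k \<and> k < n then x (k + rK j) else 0)"
    have x': "x' \<in> MIv n J 0"
      by (rule MIvI) (auto simp: x'_def tail_0[OF J] card[symmetric] m_def split: if_splits)
    have x'n: "x' k = 0" if "n \<le> k" for k using that by (simp add: x'_def)
    have "(loop ?X ^^ rK j) x' = x"
    proof
      fix k
      have l: "(loop ?X ^^ rK j) x' k = (if rK j \<le> k \<and> k < n then x' (k - rK j) else 0)"
        unfolding loop_MI[OF n J] by (rule loop_D0_pow[OF n]) (rule x'n)
      show "(loop ?X ^^ rK j) x' k = x k"
      proof (cases "n - m + rK j \<le> k \<and> k < n")
        case True
        then have "rK j \<le> k" "n - m \<le> k - rK j" "k - rK j < n" "k - rK j + rK j = k" by linarith+
        then show ?thesis unfolding l using True by (simp only: x'_def if_True simp_thms)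
      next
        case False
        then have "x k = 0" using xNX MIv_outside[OF n x(1), of k] by (auto simp: NX_def eqr not_le)
        moreover have "(loop ?X ^^ rK j) x' k = 0" unfolding l using False by (auto simp: x'_def)
        ultimately show ?thesis by simp
      qed
    qed
    then have "(loop Y ^^ rK j) (f 0 x') = f 0 x"
      using Hom_loop_pow[OF n S(1,4) X0[OF x'], of "rK j"] by (simp only:)
    moreover note fx' = Hom_in[OF S(4) X0[OF x']]
    ultimately have "(loop Y ^^ rK d) (y + f 0 x') \<in> N d"
      using x(2) loop_pow_add[OF n S(2) y(1) fx'] same by simp
    then have Pd: "P (y + f 0 x') d" by (simp add: P_def)
    have "(loop Y ^^ m) (f 0 x') = 0"
      using Hom_loop_pow[OF n S(1,4) X0[OF x'], of m, symmetric] loop_pow_MI_zero[OF n J X0[OF x']] Hom_0[OF S(4)]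
      by (simp add: m_def card)
    moreover have "g 0 (y + f 0 x') = g 0 y" using Hom_add[OF S(5) y(1) fx'] S(8)[OF X0[OF x']] by simp
    ultimately have Cy': "C (y + f 0 x')"
      using y dmod_add[OF S(2) y(1) fx'] loop_pow_add[OF n S(2) y(1) fx'] by (simp add: C_def m_def)
    have high: "d + i \<le> n \<Longrightarrow> P (y + f 0 x') (d + i)" for i
    proof (induction i)
      case (Suc i)
      then show ?case using forward[OF Cy', of "d + i"] by simp
    qed (use Pd in simp)
    have "P (y + f 0 x') j" if "j \<le> n" for j
      using low[OF Cy', of j] high[of "j - d"] that by (cases "j < d") simp_all
    then show ?thesis using x' Cy' by (intro exI[of _ x'] conjI) simp_all
  qed
  then obtain x where x: "x \<in> MIv n J 0" "C (y + f 0 x)" "\<forall>j\<le>n. P (y + f 0 x) j"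
    by (elim exE conjE)
  show ?thesis
  proof (rule that[OF X0[OF x(1)]])
    show "(loop Y ^^ (card K - tail K j)) (y + f 0 x) \<in> flag Y j" if "j < n" for j
      using spec[OF x(3), of j] that by (simp add: P_def N_def rK_def m_def)
    show "(loop Y ^^ card K) (y + f 0 x) = 0" using x(2) by (simp add: C_def m_def)
  qed
qed

lemma loop_pow_gen_flag:
  assumes n: "n > 1" and I: "I \<subseteq> {1..n}" "I \<noteq> {}" and j: "j < n"
  shows "(loop (MI n I) ^^ (card I - tail I j)) (gen n I) \<in> flag (MI n I) j"
proof (cases "tail I j = 0")
  case True
  then show ?thesis
    using loop_pow_MI_zero[OF n I(1) gen_in[OF n I]] cvec.subspace_0[OF flag_subspace[OF n dmod_MI[OF n I(1)] j]]
    by simp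
next
  case False
  have fin: "finite I" using I by (auto intro: finite_subset)
  have c: "card I \<le> n" using tail_le[OF I(1), of 0] tail_0[OF I(1)] by simp
  have t: "tail I j \<le> card I" "tail I j \<le> n - j" using tail_le_card[OF fin] tail_le[OF I(1)] by auto
  define e where "e = (unit_vec0 (n - j - tail I j) :: univ)"
  have e: "e \<in> vsp (MI n I) j"
    unfolding MI_simps[OF n I(1)] e_def MIv_unit using False t j by auto
  have "(loop (MI n I) ^^ (card I - tail I j)) (gen n I) = unit_vec0 (n - tail I j)"
    using loop_pow_gen[OF n I(1), of "card I - tail I j"] False t c by simp
  also have "\<dots> = apath (MI n I) j e"
    using t j by (auto simp: apath_MI[OF n I(1) j] e_def unit_vec0_def fun_eq_iff)
  also have "\<dots> \<in> flag (MI n I) j" unfolding flag_def using e by (rule imageI)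
  finally show ?thesis .
qed

lemma tmap_gen:
  assumes n: "n > 1" and K: "K \<subseteq> {1..n}" "K \<noteq> {}" and I: "I \<subseteq> {1..n}" and card: "card K = card I"
  shows "tmap n K s 0 (gen n K) = (loop (MI n I) ^^ s) (gen n I)"
proof
  fix k
  have g: "gen n K \<in> MIv n K 0" using gen_in[OF n K] by (simp add: MI_simps[OF n K(1)])
  have e: "gen n I = gen n K" by (simp add: gen_def card)
  have "(loop (MI n I) ^^ s) (gen n I) k = (if s \<le> k \<and> k < n then gen n K (k - s) else 0)"
    unfolding e loop_MI[OF n I] by (rule loop_D0_pow[OF n MIv_outside[OF n g]]) simp
  then show "tmap n K s 0 (gen n K) k = (loop (MI n I) ^^ s) (gen n I) k"
    using g by (simp add: tmap_def)
qed

lemma E_sesD: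
  assumes "n > 1" "E_ses n X Y Z f g"
  shows "ses n X Y Z f g" "a_injective n X" "a_injective n Y" "a_injective n Z"
  using assms good_iff_a_injective[OF assms(1)] by (auto simp: E_ses_def good_def)

text \<open>
  The preimage \<open>t\<^sup>s y\<close> of the image of the generator, corrected as above, satisfies the relations of \<open>M\<^sub>K\<close>.
\<close>

lemma E_ses_lift_tmap:
  assumes n: "n > 1" and K: "K \<subseteq> {1..n}" "K \<noteq> {}" and I: "I \<subseteq> {1..n}" and J: "J \<subseteq> {1..n}"
    and card: "card K = card I" "card K = card J" and a: "K - J = {a}" and d: "J - K = {d}"
    and le: "hle s K I" and E: "E_ses n (MI n J) Y (MI n I) f g"
  shows "\<exists>h\<in>Hom n (MI n K) Y. g \<circ>\<^sub>h h = tmap n K s"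
proof -
  note D = E_sesD[OF n E]
  note S = sesD[OF D(1)]
  have finK: "finite K" using K by (auto intro: finite_subset)
  have "card I \<noteq> 0" using K(2) finK by (simp add: card(1)[symmetric])
  then have "I \<noteq> {}" by auto
  from E_ses_lift[OF n I this E] obtain y
    where y: "y \<in> vsp Y 0" "g 0 y = gen n I" "(loop Y ^^ card I) y = 0" .
  define u where "u = (loop Y ^^ s) y"
  have u: "u \<in> vsp Y 0" unfolding u_def by (rule loop_pow_in[OF n S(2) y(1)])
  have "(loop Y ^^ card K) u = (loop Y ^^ s) ((loop Y ^^ card I) y)"
    unfolding u_def card(1) by (simp only: funpow_add[unfolded comp_def, THEN fun_cong, symmetric] add.commute)
  then have u0: "(loop Y ^^ card K) u = 0" by (simp only: y(3) loop_pow_0[OF n S(2)])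
  note t = tmap_Hom[OF n K(1) I le] and z = gen_in[OF n K]
  have gu: "g 0 u = tmap n K s 0 (gen n K)"
    unfolding u_def tmap_gen[OF n K I card(1)] Hom_loop_pow[OF n S(2,5) y(1)] y(2) ..
  have fl: "(loop (MI n I) ^^ (card K - tail K j)) (g 0 u) \<in> flag (MI n I) j" if j: "j < n" for j
    unfolding gu Hom_loop_pow[OF n dmod_MI[OF n K(1)] t z, symmetric]
    by (rule Hom_flag[OF n dmod_MI[OF n K(1)] t j loop_pow_gen_flag[OF n K j]])
  obtain x where x: "x \<in> vsp (MI n J) 0"
    "\<And>j. j < n \<Longrightarrow> (loop Y ^^ (card K - tail K j)) (u + f 0 x) \<in> flag Y j"
    "(loop Y ^^ card K) (u + f 0 x) = 0"
  proof (rule lift_flag_conditions[OF n D(1,3,4) J K(1) card(2) a d u u0])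
    show "(loop (MI n I) ^^ (card K - tail K j)) (g 0 u) \<in> flag (MI n I) j" if "j < n" for j
      by (rule fl[OF that])
    fix x assume "x \<in> vsp (MI n J) 0"
      "\<And>j. j < n \<Longrightarrow> (loop Y ^^ (card K - tail K j)) (u + f 0 x) \<in> flag Y j"
      "(loop Y ^^ card K) (u + f 0 x) = 0"
    then show thesis by (rule that)
  qed
  have v: "u + f 0 x \<in> vsp Y 0" by (rule dmod_add[OF S(2) u Hom_in[OF S(4) x(1)]])
  obtain h where h: "h \<in> Hom n (MI n K) Y" "h 0 (gen n K) = u + f 0 x"
    by (rule Hom_from_MI[OF n K S(2) D(3) v x(3)]) (rule x(2))
  have "(g \<circ>\<^sub>h h) 0 (gen n K) = tmap n K s 0 (gen n K)"
    unfolding hcomp_apply h(2) Hom_add[OF S(5) u Hom_in[OF S(4) x(1)]] gu S(8)[OF x(1)] by simp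
  then have "g \<circ>\<^sub>h h = tmap n K s"
    by (rule Hom_MI_eqI[OF n K(1) S(3) D(4) Hom_hcomp[OF h(1) S(5)] t])
  then show ?thesis using h(1) by (rule bexI)
qed

lemma ses_kernel_factor:
  assumes s: "ses n X Y Z f g" and W: "dmod n W" and h: "h \<in> Hom n W Y" and z: "g \<circ>\<^sub>h h = 0"
  shows "\<exists>k\<in>Hom n W X. f \<circ>\<^sub>h k = h"
proof -
  note S = sesD[OF s]
  have gh: "g i (h i w) = 0" for i w using fun_cong[OF fun_cong[OF z], of i w] by (simp add: hcomp_apply)
  obtain k where k: "k \<in> Hom n W X"
    "\<And>i w x. w \<in> vsp W i \<Longrightarrow> x \<in> vsp X i \<Longrightarrow> f i x = h i w \<longleftrightarrow> k i w = x"
  proof (rule Hom_of_relation[OF W S(1), of "\<lambda>i w x. f i x = h i w"], goal_cases)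
    case (1 i w) show ?case by (rule S(7)[OF Hom_in[OF h 1(2)] gh])
  next
    case (2 i x) then show ?case using S(6) Hom_0[OF h] by simp
  next
    case 3 then show ?case by (simp add: Hom_add[OF S(4)] Hom_add[OF h])
  next
    case 4 then show ?case by (simp add: Hom_scale[OF S(4)] Hom_scale[OF h])
  next
    case 5 then show ?case by (simp add: Hom_bmap[OF S(4)] Hom_bmap[OF h] del: One_nat_def)
  next
    case 6 then show ?case by (simp add: Hom_amap[OF S(4)] Hom_amap[OF h] del: One_nat_def)
  qed blast
  have "f \<circ>\<^sub>h k = h"
    by (rule Hom_eqI[OF Hom_hcomp[OF k(1) S(4)] h]) (simp add: hcomp_apply k(2)[OF _ Hom_in[OF k(1)]])
  then show ?thesis using k(1) by (rule bexI)
qed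

lemma epi_factor:
  assumes Y: "dmod n Y" and Z: "dmod n Z" and W: "dmod n W" and g: "g \<in> Hom n Y Z" and h: "h \<in> Hom n Y W"
    and sur: "\<And>i z. z \<in> vsp Z i \<Longrightarrow> \<exists>y\<in>vsp Y i. g i y = z"
    and ker: "\<And>i y. y \<in> vsp Y i \<Longrightarrow> g i y = 0 \<Longrightarrow> h i y = 0"
  shows "\<exists>k\<in>Hom n Z W. k \<circ>\<^sub>h g = h"
proof -
  define R where "R = (\<lambda>i z w. \<exists>y\<in>vsp Y i. g i y = z \<and> h i y = w)"
  obtain k where k: "k \<in> Hom n Z W" "\<And>i z w. z \<in> vsp Z i \<Longrightarrow> w \<in> vsp W i \<Longrightarrow> R i z w \<longleftrightarrow> k i z = w"
  proof (rule Hom_of_relation[OF Z W, of R], goal_cases)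
    case (1 i z)
    obtain y where y: "y \<in> vsp Y i" "g i y = z" using sur[OF 1(2)] by (rule bexE)
    show ?case by (rule bexI[OF _ Hom_in[OF h y(1)]]) (unfold R_def, rule bexI[OF _ y(1)], simp add: y(2))
  next
    case (2 i w) then show ?case using ker unfolding R_def by auto
  next
    case (3 i x y x' y')
    from 3(6) obtain u where u: "u \<in> vsp Y i" "g i u = x \<and> h i u = y" unfolding R_def by (rule bexE)
    from 3(7) obtain v where v: "v \<in> vsp Y i" "g i v = x' \<and> h i v = y'" unfolding R_def by (rule bexE)
    show ?case unfolding R_def
      by (rule bexI[OF _ dmod_add[OF Y u(1) v(1)]]) (use u v in \<open>simp add: Hom_add[OF g] Hom_add[OF h]\<close>)
  next
    case (4 i c x y)
    from 4(4) obtain u where u: "u \<in> vsp Y i" "g i u = x \<and> h i u = y" unfolding R_def by (rule bexE)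
    show ?case unfolding R_def
      by (rule bexI[OF _ dmod_scale[OF Y u(1), of c]]) (use u in \<open>simp add: Hom_scale[OF g] Hom_scale[OF h]\<close>)
  next
    case (5 i x y)
    from 5(5) obtain u where u: "u \<in> vsp Y (i-1)" "g (i-1) u = x \<and> h (i-1) u = y" unfolding R_def by (rule bexE)
    show ?case unfolding R_def
      by (rule bexI[OF _ dmod_bmap_in[OF Y 5(2) u(1)]])
        (use u 5 in \<open>simp add: Hom_bmap[OF g] Hom_bmap[OF h] del: One_nat_def\<close>)
  next
    case (6 i x y)
    from 6(5) obtain u where u: "u \<in> vsp Y i" "g i u = x \<and> h i u = y" unfolding R_def by (rule bexE)
    show ?case unfolding R_def
      by (rule bexI[OF _ dmod_amap_in[OF Y 6(2) u(1)]])
        (use u 6 in \<open>simp add: Hom_amap[OF g] Hom_amap[OF h] del: One_nat_def\<close>)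
  qed blast
  have "k \<circ>\<^sub>h g = h"
  proof (rule Hom_eqI[OF Hom_hcomp[OF g k(1)] h])
    fix i y assume y: "y \<in> vsp Y i"
    have "R i (g i y) (h i y)" unfolding R_def by (rule bexI[OF _ y]) simp
    then show "(k \<circ>\<^sub>h g) i y = h i y" unfolding hcomp_apply k(2)[OF Hom_in[OF g y] Hom_in[OF h y]] .
  qed
  then show ?thesis using k(1) by (rule bexI)
qed

lemma ses_cokernel_factor:
  assumes s: "ses n X Y Z f g" and W: "dmod n W" and h: "h \<in> Hom n Y W" and z: "h \<circ>\<^sub>h f = 0"
  shows "\<exists>k\<in>Hom n Z W. k \<circ>\<^sub>h g = h"
proof -
  note S = sesD[OF s]
  have hf: "h i (f i x) = 0" for i x using fun_cong[OF fun_cong[OF z], of i x] by (simp add: hcomp_apply)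
  have ker: "h i y = 0" if y: "y \<in> vsp Y i" "g i y = 0" for i y
  proof -
    obtain x where "x \<in> vsp X i" "f i x = y" using S(7)[OF y] by (rule bexE)
    then show ?thesis using hf[of i x] by simp
  qed
  show ?thesis by (rule epi_factor[OF S(2,3) W S(5) h S(9)]) (simp_all add: ker)
qed

lemma loop_dsum_pow: "(loop (M \<oplus>\<^sub>r N) ^^ i) (x, y) = ((loop M ^^ i) x, (loop N ^^ i) y)"
  by (induction i) (simp_all add: loop_def)

lemma E_ses_middle_iso:
  assumes n: "n > 1" and I: "I \<subseteq> {1..n}" and s: "ses n X Y (MI n I) f g"
    and X: "a_injective n X" and Y: "a_injective n Y"
    and zero: "\<And>y. y \<in> vsp Y 0 \<Longrightarrow> (loop Y ^^ card I) y = 0"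
    and Y': "dmod n Y'" and \<phi>: "\<phi> \<in> Hom n Y Y'" and \<psi>: "\<psi> \<in> Hom n Y' Y"
    and inv: "\<psi> \<circ>\<^sub>h \<phi> = hid Y" "\<phi> \<circ>\<^sub>h \<psi> = hid Y'"
  shows "E_ses n X Y' (MI n I) (\<phi> \<circ>\<^sub>h f) (g \<circ>\<^sub>h \<psi>)"
proof -
  note S = sesD[OF s]
  have pf: "\<psi> i (\<phi> i y) = y" if "y \<in> vsp Y i" for i y
    using fun_cong[OF fun_cong[OF inv(1)], of i y] hid_apply[OF that] by (simp add: hcomp_apply)
  have fp: "\<phi> i (\<psi> i y) = y" if "y \<in> vsp Y' i" for i y
    using fun_cong[OF fun_cong[OF inv(2)], of i y] hid_apply[OF that] by (simp add: hcomp_apply)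
  have s': "ses n X Y' (MI n I) (\<phi> \<circ>\<^sub>h f) (g \<circ>\<^sub>h \<psi>)"
  proof (rule sesI[OF S(1) Y' S(3) Hom_hcomp[OF S(4) \<phi>] Hom_hcomp[OF \<psi> S(5)]])
    fix i x assume x: "x \<in> vsp X i"
    note p = pf[OF Hom_in[OF S(4) x]]
    show "(g \<circ>\<^sub>h \<psi>) i ((\<phi> \<circ>\<^sub>h f) i x) = 0" unfolding hcomp_apply p by (rule S(8)[OF x])
    assume z: "(\<phi> \<circ>\<^sub>h f) i x = 0"
    have "f i x = \<psi> i (\<phi> i (f i x))" by (rule p[symmetric])
    also have "\<dots> = 0" using z Hom_0[OF \<psi>] by (simp add: hcomp_apply)
    finally show "x = 0" by (rule S(6)[OF x])
  next
    fix i y assume y: "y \<in> vsp Y' i" "(g \<circ>\<^sub>h \<psi>) i y = 0"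
    obtain x where x: "x \<in> vsp X i" "f i x = \<psi> i y"
      using S(7)[OF Hom_in[OF \<psi> y(1)] y(2)[unfolded hcomp_apply]] by (rule bexE)
    show "\<exists>x\<in>vsp X i. (\<phi> \<circ>\<^sub>h f) i x = y" by (rule bexI[OF _ x(1)]) (simp add: hcomp_apply x(2) fp[OF y(1)])
  next
    fix i z assume z: "z \<in> vsp (MI n I) i"
    obtain y where y: "y \<in> vsp Y i" "g i y = z" using S(9)[OF z] by (rule bexE)
    show "\<exists>y\<in>vsp Y' i. (g \<circ>\<^sub>h \<psi>) i y = z"
      by (rule bexI[OF _ Hom_in[OF \<phi> y(1)]]) (simp add: hcomp_apply pf[OF y(1)] y(2))
  qed
  show ?thesis
  proof (rule E_sesI[OF n I s' X a_injective_iso[OF Y' S(2) \<psi> _ Y]])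
    show "y = 0" if "y \<in> vsp Y' i" "\<psi> i y = 0" for i y using fp[OF that(1)] that(2) Hom_0[OF \<phi>] by simp
    show "(loop Y' ^^ card I) y = 0" if y: "y \<in> vsp Y' 0" for y
    proof -
      note py = Hom_in[OF \<psi> y]
      have "(loop Y' ^^ card I) y = (loop Y' ^^ card I) (\<phi> 0 (\<psi> 0 y))" unfolding fp[OF y] ..
      also have "\<dots> = \<phi> 0 ((loop Y ^^ card I) (\<psi> 0 y))" by (rule Hom_loop_pow[OF n S(2) \<phi> py, symmetric])
      also have "\<dots> = 0" unfolding zero[OF py] by (rule Hom_0[OF \<phi>])
      finally show ?thesis .
    qed
  qed
qed

lemma ses_scale:
  assumes s: "ses n X Y Z f g" and c: "c \<noteq> 0"
  shows "ses n X Y Z (c *\<^sub>C f) g"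
proof -
  note S = sesD[OF s]
  have a: "(c *\<^sub>C f) i x = c *\<^sub>C f i x" for i x by (simp add: scaleC_fun_def)
  show ?thesis
  proof (rule sesI[OF S(1-3) Hom_scaleC[OF S(2,4)] S(5)])
    fix i x assume x: "x \<in> vsp X i"
    show "g i ((c *\<^sub>C f) i x) = 0"
      unfolding a Hom_scale[OF S(5) Hom_in[OF S(4) x]] S(8)[OF x] by (rule cvec.scale_zero_right)
    assume "(c *\<^sub>C f) i x = 0"
    then have "f i x = 0" using c by (simp add: a)
    then show "x = 0" by (rule S(6)[OF x])
  next
    fix i y assume y: "y \<in> vsp Y i" "g i y = 0"
    obtain x where x: "x \<in> vsp X i" "f i x = y" using S(7)[OF y] by (rule bexE)
    have "c *\<^sub>C f i ((1 / c) *\<^sub>C x) = y"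
      unfolding Hom_scale[OF S(4) x(1)] x(2) using c by (simp add: scaleC_scaleC scaleC_one)
    then show "\<exists>x\<in>vsp X i. (c *\<^sub>C f) i x = y"
      unfolding a[symmetric] by (rule bexI[OF _ dmod_scale[OF S(1) x(1)]])
  qed (rule S(9))
qed

lemma ses_dsum:
  assumes "dmod n X" "dmod n Z"
  shows "ses n X (X \<oplus>\<^sub>r Z) Z (hinl X Z) (hsnd X Z)"
proof (rule sesI[OF assms(1) dmod_dsum[OF assms] assms(2) Hom_hinl[OF assms] Hom_hsnd[OF assms]])
  fix i z assume "z \<in> vsp Z i"
  then show "\<exists>y\<in>vsp (X \<oplus>\<^sub>r Z) i. hsnd X Z i y = z"
    using dmod_0[OF assms(1), of i] by (intro bexI[of _ "(0, z)"]) (simp_all add: hsnd_def)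
next
  fix i y assume y: "y \<in> vsp (X \<oplus>\<^sub>r Z) i" "hsnd X Z i y = 0"
  then show "\<exists>x\<in>vsp X i. hinl X Z i x = y" by (intro bexI[of _ "fst y"]) (auto simp: hsnd_def hinl_def)
qed (use dmod_0[OF assms(2)] in \<open>auto simp: hinl_def hsnd_def zero_prod_def\<close>)

section \<open>Exchange squares\<close>

text \<open>
  The square of \<open>t\<^bsup>\<alpha>1\<^esup> : A \<rightarrow> B1\<close>, \<open>t\<^bsup>\<alpha>2\<^esup> : A \<rightarrow> B2\<close>, \<open>t\<^bsup>\<alpha>2\<^esup> : B1 \<rightarrow> C\<close>, \<open>t\<^bsup>\<alpha>1\<^esup> : B2 \<rightarrow> C\<close>.  One of the
  exponents is \<open>0\<close>, which makes the map from \<open>M\<^sub>A\<close> injective.  The last two conditions say that at each vertex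
  one of the maps into \<open>M\<^sub>C\<close> is onto, and that a pair with equal images in \<open>M\<^sub>C\<close> comes from \<open>M\<^sub>A\<close>.  The
  condition \<open>ret\<close> lets multiplication by \<open>t\<close> on \<open>M\<^sub>A\<close> factor through \<open>M\<^bsub>B1\<^esub>\<close>.
\<close>

locale exchange_square =
  fixes n m :: nat and A B1 B2 C :: "nat set" and \<alpha>1 \<alpha>2 :: nat
  assumes n: "n > 1" and A: "A \<subseteq> {1..n}" and B1: "B1 \<subseteq> {1..n}" and B2: "B2 \<subseteq> {1..n}" and C: "C \<subseteq> {1..n}"
    and cards: "card A = m" "card B1 = m" "card B2 = m" "card C = m" and m: "0 < m"
    and ne: "B1 \<noteq> A" "B2 \<noteq> A" "B1 \<noteq> C" "B2 \<noteq> C"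
    and \<alpha>: "\<alpha>1 \<le> 1" "\<alpha>2 \<le> 1" "\<alpha>1 = 0 \<or> \<alpha>2 = 0"
    and le: "hle \<alpha>1 A B1" "hle \<alpha>2 A B2" "hle \<alpha>2 B1 C" "hle \<alpha>1 B2 C"
    and ret: "hle (1 - \<alpha>1) B1 A"
    and sur: "\<And>j. tail C j + \<alpha>2 \<le> tail B1 j \<or> tail C j + \<alpha>1 \<le> tail B2 j"
    and ker: "\<And>j. tail B1 j + \<alpha>1 \<le> tail A j \<or> tail B2 j + \<alpha>2 \<le> tail A j"
begin

abbreviation E :: "(univ \<times> univ) rep" where "E \<equiv> MI n B1 \<oplus>\<^sub>r MI n B2"
abbreviation "in1 \<equiv> hinl (MI n B1) (MI n B2)"
abbreviation "in2 \<equiv> hinr (MI n B1) (MI n B2)"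
abbreviation "pr1 \<equiv> hfst (MI n B1) (MI n B2)"
abbreviation "pr2 \<equiv> hsnd (MI n B1) (MI n B2)"

definition inc :: "nat \<Rightarrow> univ \<Rightarrow> univ \<times> univ" where
  "inc = (in1 \<circ>\<^sub>h tmap n A \<alpha>1) + (in2 \<circ>\<^sub>h tmap n A \<alpha>2)"

definition pro :: "nat \<Rightarrow> univ \<times> univ \<Rightarrow> univ" where
  "pro = (tmap n B1 \<alpha>2 \<circ>\<^sub>h pr1) - (tmap n B2 \<alpha>1 \<circ>\<^sub>h pr2)"

lemmas M = dmod_MI[OF n A] dmod_MI[OF n B1] dmod_MI[OF n B2] dmod_MI[OF n C]
lemmas dE = dmod_dsum[OF M(2,3)]
lemmas fr = Hom_hfst[OF M(2,3)] Hom_hsnd[OF M(2,3)] Hom_hinl[OF M(2,3)] Hom_hinr[OF M(2,3)]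
lemmas th = tmap_Hom[OF n A B1 le(1)] tmap_Hom[OF n A B2 le(2)] tmap_Hom[OF n B1 C le(3)] tmap_Hom[OF n B2 C le(4)]

lemma nonempty: "A \<noteq> {}" "B1 \<noteq> {}" "B2 \<noteq> {}" "C \<noteq> {}"
  using cards m by auto

lemma Hom_inc: "inc \<in> Hom n (MI n A) E"
  unfolding inc_def by (rule Hom_plus[OF dE Hom_hcomp[OF th(1) fr(3)] Hom_hcomp[OF th(2) fr(4)]])

lemma Hom_pro: "pro \<in> Hom n E (MI n C)"
  unfolding pro_def by (rule Hom_minus[OF M(4) Hom_hcomp[OF fr(1) th(3)] Hom_hcomp[OF fr(2) th(4)]])

lemma inc_apply: "x \<in> vsp (MI n A) i \<Longrightarrow> inc i x = (tmap n A \<alpha>1 i x, tmap n A \<alpha>2 i x)"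
  using Hom_in[OF th(1), of x i] Hom_in[OF th(2), of x i] by (simp add: inc_def hcomp_apply hinl_def hinr_def)

lemma pro_apply:
  "y1 \<in> vsp (MI n B1) i \<Longrightarrow> y2 \<in> vsp (MI n B2) i \<Longrightarrow> pro i (y1, y2) = tmap n B1 \<alpha>2 i y1 - tmap n B2 \<alpha>1 i y2"
  by (simp add: pro_def hcomp_apply hfst_def hsnd_def)

lemma hfst_inc: "pr1 \<circ>\<^sub>h inc = tmap n A \<alpha>1"
proof (rule Hom_eqI[OF Hom_hcomp[OF Hom_inc fr(1)] th(1)])
  fix i x assume x: "x \<in> vsp (MI n A) i"
  show "(pr1 \<circ>\<^sub>h inc) i x = tmap n A \<alpha>1 i x"
    using Hom_in[OF th(1) x] Hom_in[OF th(2) x] by (simp add: hcomp_apply inc_apply[OF x] hfst_def)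
qed

lemma hsnd_inc: "pr2 \<circ>\<^sub>h inc = tmap n A \<alpha>2"
proof (rule Hom_eqI[OF Hom_hcomp[OF Hom_inc fr(2)] th(2)])
  fix i x assume x: "x \<in> vsp (MI n A) i"
  show "(pr2 \<circ>\<^sub>h inc) i x = tmap n A \<alpha>2 i x"
    using Hom_in[OF th(1) x] Hom_in[OF th(2) x] by (simp add: hcomp_apply inc_apply[OF x] hsnd_def)
qed

lemma pro_hinl: "pro \<circ>\<^sub>h in1 = tmap n B1 \<alpha>2"
proof (rule Hom_eqI[OF Hom_hcomp[OF fr(3) Hom_pro] th(3)])
  fix i x assume x: "x \<in> vsp (MI n B1) i"
  show "(pro \<circ>\<^sub>h in1) i x = tmap n B1 \<alpha>2 i x"
    using x pro_apply[OF x dmod_0[OF M(3)]] Hom_0[OF th(4)] by (simp add: hcomp_apply hinl_def)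
qed

lemma pro_hinr: "pro \<circ>\<^sub>h in2 = - tmap n B2 \<alpha>1"
proof (rule Hom_eqI[OF Hom_hcomp[OF fr(4) Hom_pro] Hom_uminus[OF M(4) th(4)]])
  fix i x assume x: "x \<in> vsp (MI n B2) i"
  show "(pro \<circ>\<^sub>h in2) i x = (- tmap n B2 \<alpha>1) i x"
    using x pro_apply[OF dmod_0[OF M(2)] x] Hom_0[OF th(3)] by (simp add: hcomp_apply hinr_def)
qed

text \<open>
  In the kernel one of the two components determines the other, as one exponent is \<open>0\<close>.  The component
  that has to lie in \<open>M\<^sub>A\<close> may have entries that the other map shifts out of range; the tail
  condition bounds these directly and the remaining ones through the other component.
\<close>

lemma ses_square: "ses n (MI n A) E (MI n C) inc pro"
proof (rule sesI[OF M(1) dE M(4) Hom_inc Hom_pro])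
  fix i x assume x: "x \<in> vsp (MI n A) i"
  have x': "x \<in> MIv n A i" using x by (simp add: MI_simps[OF n A])
  have t: "tmap n A \<alpha>1 i x \<in> vsp (MI n B1) i" "tmap n A \<alpha>2 i x \<in> vsp (MI n B2) i"
    using Hom_in[OF th(1) x] Hom_in[OF th(2) x] .
  show "pro i (inc i x) = 0"
    unfolding inc_apply[OF x] pro_apply[OF t]
    using fun_cong[OF fun_cong[OF tmap_comp[OF n le(1)], of \<alpha>2 i], of x]
      fun_cong[OF fun_cong[OF tmap_comp[OF n le(2)], of \<alpha>1 i], of x]
    by (simp add: hcomp_apply add.commute)
  assume z: "inc i x = 0"
  have "tmap n A 0 i x = 0" using z \<alpha>(3) unfolding inc_apply[OF x] by (auto simp: zero_prod_def)
  then show "x = 0" by (simp add: tmap_0[OF n A] hid_apply[OF x])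
next
  fix i y assume y: "y \<in> vsp E i" and gy: "pro i y = 0"
  obtain y1 y2 where yy: "y = (y1, y2)" by (rule prod.exhaust)
  have in1: "y1 \<in> vsp (MI n B1) i" and in2: "y2 \<in> vsp (MI n B2) i" using y yy by auto
  have m1: "y1 \<in> MIv n B1 i" and m2: "y2 \<in> MIv n B2 i"
    using in1 in2 by (simp_all add: MI_simps[OF n B1] MI_simps[OF n B2])
  have "tmap n B1 \<alpha>2 i y1 = tmap n B2 \<alpha>1 i y2" using gy unfolding yy pro_apply[OF in1 in2] by simp
  then have eq: "(if \<alpha>2 \<le> k \<and> k < n - i then y1 (k - \<alpha>2) else 0) = (if \<alpha>1 \<le> k \<and> k < n - i then y2 (k - \<alpha>1) else 0)" for k
    using m1 m2 by (simp add: tmap_def fun_eq_iff)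
  have out: "y1 k = 0" "y2 k = 0" if "n - i \<le> k" for k
    using MIv_outside[OF n m1 that] MIv_outside[OF n m2 that] .
  show "\<exists>x\<in>vsp (MI n A) i. inc i x = y"
  proof (cases "\<alpha>2 = 0")
    case True
    have e: "y1 k = (if \<alpha>1 \<le> k \<and> k < n - i then y2 (k - \<alpha>1) else 0)" for k
      using eq[of k] out(1)[of k] True by (cases "k < n - i") simp_all
    have x: "y2 \<in> MIv n A i"
    proof (rule MIvI)
      fix k assume k: "y2 k \<noteq> 0"
      have k1: "k < n - i" "n - i \<le> k + tail B2 i" using MIvD[OF m2 k] by simp_all
      show "n - i \<le> k + tail A i \<and> k < n - i"
      proof (cases "tail B2 i + \<alpha>2 \<le> tail A i")
        case False
        then have l: "tail B1 i + \<alpha>1 \<le> tail A i" using ker[of i] by simp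
        show ?thesis
        proof (cases "k + \<alpha>1 < n - i")
          case True
          then have "y1 (k + \<alpha>1) \<noteq> 0" using e[of "k + \<alpha>1"] k by simp
          then have "n - i \<le> k + \<alpha>1 + tail B1 i" by (rule MIvD(1)[OF m1])
          then show ?thesis using l k1 by linarith
        qed (use l k1 in linarith)
      qed (use k1 in linarith)
    qed
    then have x': "y2 \<in> vsp (MI n A) i" by (simp add: MI_simps[OF n A])
    have "tmap n A \<alpha>1 i y2 = y1" using x by (simp add: tmap_def fun_eq_iff e)
    moreover have "tmap n A \<alpha>2 i y2 = y2" by (simp add: True tmap_0[OF n A] hid_apply[OF x'])
    ultimately have "inc i y2 = y" unfolding inc_apply[OF x'] yy by simp
    then show ?thesis using x' by (rule bexI)
  next
    case False
    then have z: "\<alpha>1 = 0" using \<alpha>(3) by simp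
    have e: "y2 k = (if \<alpha>2 \<le> k \<and> k < n - i then y1 (k - \<alpha>2) else 0)" for k
      using eq[of k] out(2)[of k] z by (cases "k < n - i") simp_all
    have x: "y1 \<in> MIv n A i"
    proof (rule MIvI)
      fix k assume k: "y1 k \<noteq> 0"
      have k1: "k < n - i" "n - i \<le> k + tail B1 i" using MIvD[OF m1 k] by simp_all
      show "n - i \<le> k + tail A i \<and> k < n - i"
      proof (cases "tail B1 i + \<alpha>1 \<le> tail A i")
        case False
        then have l: "tail B2 i + \<alpha>2 \<le> tail A i" using ker[of i] by simp
        show ?thesis
        proof (cases "k + \<alpha>2 < n - i")
          case True
          then have "y2 (k + \<alpha>2) \<noteq> 0" using e[of "k + \<alpha>2"] k by simp
          then have "n - i \<le> k + \<alpha>2 + tail B2 i" by (rule MIvD(1)[OF m2])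
          then show ?thesis using l k1 by linarith
        qed (use l k1 in linarith)
      qed (use k1 in linarith)
    qed
    then have x': "y1 \<in> vsp (MI n A) i" by (simp add: MI_simps[OF n A])
    have "tmap n A \<alpha>2 i y1 = y2" using x by (simp add: tmap_def fun_eq_iff e)
    moreover have "tmap n A \<alpha>1 i y1 = y1" by (simp add: z tmap_0[OF n A] hid_apply[OF x'])
    ultimately have "inc i y1 = y" unfolding inc_apply[OF x'] yy by simp
    then show ?thesis using x' by (rule bexI)
  qed
next
  fix i z assume z: "z \<in> vsp (MI n C) i"
  have mz: "z \<in> MIv n C i" using z by (simp add: MI_simps[OF n C])
  \<comment> \<open>the shift by \<open>\<beta>\<close> maps onto \<open>M\<^sub>C\<close> at vertex \<open>i\<close> where the tails differ by at least \<open>\<beta>\<close>\<close>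
  have onto: "\<exists>x\<in>MIv n B i. tmap n B \<beta> i x = z" if B: "B \<subseteq> {1..n}" and b: "tail C i + \<beta> \<le> tail B i" for B \<beta>
  proof -
    define x where "x = (\<lambda>k. if k + \<beta> < n - i then z (k + \<beta>) else 0)"
    have x: "x \<in> MIv n B i"
    proof (rule MIvI)
      fix k assume "x k \<noteq> 0"
      then have k: "k + \<beta> < n - i" "z (k + \<beta>) \<noteq> 0" by (auto simp: x_def split: if_splits)
      show "n - i \<le> k + tail B i \<and> k < n - i" using MIvD(1)[OF mz k(2)] k(1) b by linarith
    qed
    have "tmap n B \<beta> i x k = z k" for k
    proof (cases "\<beta> \<le> k \<and> k < n - i")
      case True
      then show ?thesis using x by (simp add: tmap_def x_def)
    next
      case False
      have "z k = 0"
      proof (rule ccontr)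
        assume k: "z k \<noteq> 0"
        show False using MIvD[OF mz k] b tail_le[OF B, of i] False by linarith
      qed
      then show ?thesis using x False by (auto simp: tmap_def)
    qed
    then show ?thesis using x by (intro bexI[of _ x] ext)
  qed
  show "\<exists>y\<in>vsp E i. pro i y = z"
  proof (cases "tail C i + \<alpha>2 \<le> tail B1 i")
    case True
    from onto[OF B1 True] obtain x where x: "x \<in> MIv n B1 i" "tmap n B1 \<alpha>2 i x = z" by (rule bexE)
    have x': "x \<in> vsp (MI n B1) i" using x(1) by (simp add: MI_simps[OF n B1])
    have "pro i (x, 0) = z" unfolding pro_apply[OF x' dmod_0[OF M(3)]] x(2) Hom_0[OF th(4)] by simp
    then show ?thesis using x' dmod_0[OF M(3), of i] by (intro bexI[of _ "(x, 0)"]) simp_all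
  next
    case False
    then have "tail C i + \<alpha>1 \<le> tail B2 i" using sur[of i] by simp
    from onto[OF B2 this] obtain x where x: "x \<in> MIv n B2 i" "tmap n B2 \<alpha>1 i x = z" by (rule bexE)
    have x': "x \<in> vsp (MI n B2) i" using x(1) by (simp add: MI_simps[OF n B2])
    have "pro i (0, - x) = z"
      unfolding pro_apply[OF dmod_0[OF M(2)] dmod_neg[OF M(3) x']] Hom_neg[OF th(4) x'] x(2) Hom_0[OF th(3)] by simp
    then show ?thesis using dmod_neg[OF M(3) x'] dmod_0[OF M(2), of i] by (intro bexI[of _ "(0, - x)"]) simp_all
  qed
qed


lemma good_middle: "a_injective n E"
  by (rule a_injective_dsum[OF a_injective_MI[OF n B1] a_injective_MI[OF n B2]])

lemma loop_pow_middle: "y \<in> vsp E 0 \<Longrightarrow> (loop E ^^ card C) y = 0"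
proof -
  assume y: "y \<in> vsp E 0"
  obtain y1 y2 where yy: "y = (y1, y2)" by (rule prod.exhaust)
  have in1: "y1 \<in> vsp (MI n B1) 0" and in2: "y2 \<in> vsp (MI n B2) 0" using y yy by auto
  show ?thesis
    using loop_pow_MI_zero[OF n B1 in1] loop_pow_MI_zero[OF n B2 in2] by (simp add: yy loop_dsum_pow cards zero_prod_def)
qed

lemma E_ses_square: "E_ses n (MI n A) E (MI n C) inc pro"
  by (rule E_sesI[OF n C ses_square a_injective_MI[OF n A] good_middle loop_pow_middle])

text \<open>
  A section would write the identity of \<open>M\<^sub>C\<close> as a sum of two composites with constant term \<open>0\<close>.
\<close>

lemma nonsplit: "s \<in> Hom n (MI n C) E \<Longrightarrow> pro \<circ>\<^sub>h s \<noteq> hid (MI n C)"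
proof
  assume s: "s \<in> Hom n (MI n C) E" and h: "pro \<circ>\<^sub>h s = hid (MI n C)"
  let ?s1 = "pr1 \<circ>\<^sub>h s" and ?s2 = "- (pr2 \<circ>\<^sub>h s)"
  have s12: "?s1 \<in> Hom n (MI n C) (MI n B1)" "?s2 \<in> Hom n (MI n C) (MI n B2)"
    by (rule Hom_hcomp[OF s fr(1)]) (rule Hom_uminus[OF M(3) Hom_hcomp[OF s fr(2)]])
  have "pro \<circ>\<^sub>h s = (tmap n B1 \<alpha>2 \<circ>\<^sub>h ?s1) + (tmap n B2 \<alpha>1 \<circ>\<^sub>h ?s2)"
    unfolding pro_def hcomp_minus_left hcomp_assoc hcomp_uminus_right[OF th(4) Hom_hcomp[OF s fr(2)]]
    by (rule diff_conv_add_uminus)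
  then have "cst n C (hid (MI n C)) = 0"
    unfolding h[symmetric] using cst_comp_zero[OF n C nonempty(4) B1 ne(3) s12(1) th(3)]
      cst_comp_zero[OF n C nonempty(4) B2 ne(4) s12(2) th(4)]
    by (simp only: cst_add add_0)
  then show False using cst_hid[OF n C nonempty(4)] by simp
qed

text \<open>
  The powers \<open>t\<^sup>i\<close> with \<open>i \<ge> 1\<close> already factor through the first component of the middle term.
\<close>

lemma radical_factor:
  assumes h: "h \<in> Hom n (MI n A) (MI n A)" and c: "cst n A h = 0"
  shows "\<exists>\<rho>\<in>Hom n E (MI n A). \<rho> \<circ>\<^sub>h inc = h"
proof -
  obtain p where p: "\<forall>i. p i \<noteq> 0 \<longrightarrow> hle i A A" "h = (\<Sum>i<n. p i *\<^sub>C tmap n A i)"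
    by (rule Hom_MI_expansion[OF n A A h])
  have p0: "p 0 = 0" using c unfolding p(2) cst_power_series[OF n A nonempty(1)] .
  define r where "r = (\<Sum>i\<in>{1..<n}. p i *\<^sub>C tmap n B1 (i - \<alpha>1))"
  have r: "r \<in> Hom n (MI n B1) (MI n A)"
    unfolding r_def
    by (intro Hom_sum[OF M(1)] Hom_scaleC[OF M(1)] tmap_Hom[OF n B1 A] hle_mono[OF ret]) auto
  have "(r \<circ>\<^sub>h pr1) \<circ>\<^sub>h inc = r \<circ>\<^sub>h tmap n A \<alpha>1"
    by (simp only: hcomp_assoc hfst_inc)
  also have "\<dots> = (\<Sum>i\<in>{1..<n}. p i *\<^sub>C tmap n A i)"
    unfolding r_def hcomp_sum_left hcomp_scaleC_left tmap_comp[OF n le(1)]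
  proof (rule sum.cong[OF refl])
    fix i assume "i \<in> {1..<n}"
    then have "\<alpha>1 + (i - \<alpha>1) = i" using \<alpha>(1) by simp
    then show "p i *\<^sub>C tmap n A (\<alpha>1 + (i - \<alpha>1)) = p i *\<^sub>C tmap n A i" by simp
  qed
  also have "\<dots> = h"
    unfolding p(2) by (rule sum.mono_neutral_left) (use p0 n in \<open>auto simp: not_le less_one cvec.scale_zero_left\<close>)
  finally show ?thesis using Hom_hcomp[OF fr(1) r] by (rule bexI)
qed

lemma lift_to_middle:
  assumes K: "K \<subseteq> {1..n}" and h: "h \<in> Hom n (MI n K) (MI n C)"
    and split: "\<And>i. hle i K C \<Longrightarrow> \<alpha>2 \<le> i \<and> hle (i - \<alpha>2) K B1 \<or> \<alpha>1 \<le> i \<and> hle (i - \<alpha>1) K B2"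
  shows "\<exists>h'\<in>Hom n (MI n K) E. pro \<circ>\<^sub>h h' = h"
proof -
  obtain p where p: "\<forall>i. p i \<noteq> 0 \<longrightarrow> hle i K C" "h = (\<Sum>i<n. p i *\<^sub>C tmap n K i)"
    by (rule Hom_MI_expansion[OF n K C h])
  have MK: "dmod n (MI n K)" by (rule dmod_MI[OF n K])
  have "\<exists>u\<in>Hom n (MI n K) E. pro \<circ>\<^sub>h u = p i *\<^sub>C tmap n K i" for i
  proof (cases "p i = 0")
    case True
    show ?thesis
      by (rule bexI[OF _ Hom_zero[OF dE]]) (simp only: True cvec.scale_zero_left hcomp_zero_right[OF Hom_pro])
  next
    case False
    then have "hle i K C" using p(1) by simp
    from split[OF this] show ?thesis
    proof
      assume i: "\<alpha>2 \<le> i \<and> hle (i - \<alpha>2) K B1"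
      note t = tmap_Hom[OF n K B1 conjunct2[OF i]]
      note u = Hom_hcomp[OF t fr(3)]
      have "pro \<circ>\<^sub>h (p i *\<^sub>C (in1 \<circ>\<^sub>h tmap n K (i - \<alpha>2))) = p i *\<^sub>C tmap n K i"
        unfolding hcomp_scaleC_right[OF Hom_pro u] hcomp_assoc[symmetric] pro_hinl
          tmap_comp[OF n conjunct2[OF i]] using i by simp
      then show ?thesis by (rule bexI[OF _ Hom_scaleC[OF dE u]])
    next
      assume i: "\<alpha>1 \<le> i \<and> hle (i - \<alpha>1) K B2"
      note t = tmap_Hom[OF n K B2 conjunct2[OF i]]
      note u = Hom_hcomp[OF t fr(4)]
      have "pro \<circ>\<^sub>h ((- p i) *\<^sub>C (in2 \<circ>\<^sub>h tmap n K (i - \<alpha>1))) = p i *\<^sub>C tmap n K i"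
        unfolding hcomp_scaleC_right[OF Hom_pro u] hcomp_assoc[symmetric] pro_hinr hcomp_uminus_left
          tmap_comp[OF n conjunct2[OF i]] using i by (simp add: cvec.scale_minus_left cvec.scale_minus_right)
      then show ?thesis by (rule bexI[OF _ Hom_scaleC[OF dE u]])
    qed
  qed
  then have "\<forall>i. \<exists>u. u \<in> Hom n (MI n K) E \<and> pro \<circ>\<^sub>h u = p i *\<^sub>C tmap n K i" by (simp only: Bex_def simp_thms)
  from choice[OF this] obtain u where
    u: "\<forall>i. u i \<in> Hom n (MI n K) E \<and> pro \<circ>\<^sub>h u i = p i *\<^sub>C tmap n K i" ..
  have uH: "u i \<in> Hom n (MI n K) E" and pu: "pro \<circ>\<^sub>h u i = p i *\<^sub>C tmap n K i" for i using u by simp_all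
  have "pro \<circ>\<^sub>h (\<Sum>i<n. u i) = h"
    unfolding p(2) hcomp_sum_right[OF dE Hom_pro uH] pu ..
  then show ?thesis by (rule bexI[OF _ Hom_sum[OF dE uH]])
qed

lemma extend_from_middle:
  assumes K: "K \<subseteq> {1..n}" and h: "h \<in> Hom n (MI n A) (MI n K)"
    and split: "\<And>i. hle i A K \<Longrightarrow> \<alpha>1 \<le> i \<and> hle (i - \<alpha>1) B1 K \<or> \<alpha>2 \<le> i \<and> hle (i - \<alpha>2) B2 K"
  shows "\<exists>h'\<in>Hom n E (MI n K). h' \<circ>\<^sub>h inc = h"
proof -
  obtain p where p: "\<forall>i. p i \<noteq> 0 \<longrightarrow> hle i A K" "h = (\<Sum>i<n. p i *\<^sub>C tmap n A i)"
    by (rule Hom_MI_expansion[OF n A K h])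
  have MK: "dmod n (MI n K)" by (rule dmod_MI[OF n K])
  have "\<exists>u\<in>Hom n E (MI n K). u \<circ>\<^sub>h inc = p i *\<^sub>C tmap n A i" for i
  proof (cases "p i = 0")
    case True
    show ?thesis
      by (rule bexI[OF _ Hom_zero[OF MK]]) (simp only: True cvec.scale_zero_left hcomp_zero_left)
  next
    case False
    then have "hle i A K" using p(1) by simp
    from split[OF this] show ?thesis
    proof
      assume i: "\<alpha>1 \<le> i \<and> hle (i - \<alpha>1) B1 K"
      note u = Hom_hcomp[OF fr(1) tmap_Hom[OF n B1 K conjunct2[OF i]]]
      have "(p i *\<^sub>C (tmap n B1 (i - \<alpha>1) \<circ>\<^sub>h pr1)) \<circ>\<^sub>h inc = p i *\<^sub>C tmap n A i"
        unfolding hcomp_scaleC_left hcomp_assoc hfst_inc tmap_comp[OF n le(1)] using i by simp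
      then show ?thesis by (rule bexI[OF _ Hom_scaleC[OF MK u]])
    next
      assume i: "\<alpha>2 \<le> i \<and> hle (i - \<alpha>2) B2 K"
      note u = Hom_hcomp[OF fr(2) tmap_Hom[OF n B2 K conjunct2[OF i]]]
      have "(p i *\<^sub>C (tmap n B2 (i - \<alpha>2) \<circ>\<^sub>h pr2)) \<circ>\<^sub>h inc = p i *\<^sub>C tmap n A i"
        unfolding hcomp_scaleC_left hcomp_assoc hsnd_inc tmap_comp[OF n le(2)] using i by simp
      then show ?thesis by (rule bexI[OF _ Hom_scaleC[OF MK u]])
    qed
  qed
  then have "\<forall>i. \<exists>u. u \<in> Hom n E (MI n K) \<and> u \<circ>\<^sub>h inc = p i *\<^sub>C tmap n A i" by (simp only: Bex_def simp_thms)
  from choice[OF this] obtain u where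
    u: "\<forall>i. u i \<in> Hom n E (MI n K) \<and> u i \<circ>\<^sub>h inc = p i *\<^sub>C tmap n A i" ..
  have uH: "u i \<in> Hom n E (MI n K)" and pu: "u i \<circ>\<^sub>h inc = p i *\<^sub>C tmap n A i" for i using u by simp_all
  have "(\<Sum>i<n. u i) \<circ>\<^sub>h inc = h"
    unfolding p(2) hcomp_sum_left pu ..
  then show ?thesis by (rule bexI[OF _ Hom_sum[OF MK uH]])
qed

text \<open>
  The difference \<open>\<phi> - 1\<close> factors as \<open>inc \<circ> \<sigma>\<close>, and \<open>1 + inc \<circ> \<sigma>\<close> is invertible because \<open>1 + \<sigma> \<circ> inc\<close> is:
  the endomorphism \<open>\<sigma> \<circ> inc\<close> of \<open>M\<^sub>A\<close> passes through \<open>M\<^bsub>B1\<^esub>\<close> and \<open>M\<^bsub>B2\<^esub>\<close>, so it lies in the radical.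
\<close>

lemma right_minimal:
  assumes \<phi>: "\<phi> \<in> Hom n E E" and eq: "pro \<circ>\<^sub>h \<phi> = pro"
  shows "is_iso n E E \<phi>"
proof -
  define \<rho> where "\<rho> = \<phi> - hid E"
  have \<rho>: "\<rho> \<in> Hom n E E" unfolding \<rho>_def by (rule Hom_minus[OF dE \<phi> Hom_hid[OF dE]])
  have "pro \<circ>\<^sub>h \<rho> = 0"
    unfolding \<rho>_def hcomp_minus_right[OF dE Hom_pro \<phi> Hom_hid[OF dE]] eq hcomp_hid_right[OF Hom_pro] by simp
  from ses_kernel_factor[OF ses_square dE \<rho> this] obtain \<sigma>
    where \<sigma>: "\<sigma> \<in> Hom n E (MI n A)" "inc \<circ>\<^sub>h \<sigma> = \<rho>" by (rule bexE)
  have "\<sigma> \<circ>\<^sub>h inc = ((\<sigma> \<circ>\<^sub>h in1) \<circ>\<^sub>h tmap n A \<alpha>1) + ((\<sigma> \<circ>\<^sub>h in2) \<circ>\<^sub>h tmap n A \<alpha>2)"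
    unfolding inc_def hcomp_plus_right[OF \<sigma>(1) Hom_hcomp[OF th(1) fr(3)] Hom_hcomp[OF th(2) fr(4)]] hcomp_assoc ..
  then have "cst n A (\<sigma> \<circ>\<^sub>h inc) = 0"
    using cst_comp_zero[OF n A nonempty(1) B1 ne(1) th(1) Hom_hcomp[OF fr(3) \<sigma>(1)]]
      cst_comp_zero[OF n A nonempty(1) B2 ne(2) th(2) Hom_hcomp[OF fr(4) \<sigma>(1)]]
    by (simp only: cst_add add_0)
  then have "is_iso n (MI n A) (MI n A) (hid (MI n A) + (\<sigma> \<circ>\<^sub>h inc))"
    by (rule iso_one_plus_radical[OF n A nonempty(1) Hom_hcomp[OF Hom_inc \<sigma>(1)]])
  then have "is_iso n E E (hid E + (inc \<circ>\<^sub>h \<sigma>))"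
    by (rule iso_one_plus_swap[OF M(1) dE Hom_inc \<sigma>(1)])
  moreover have "hid E + (inc \<circ>\<^sub>h \<sigma>) = \<phi>" unfolding \<sigma>(2) \<rho>_def by (subst add.commute) (rule diff_add_cancel)
  ultimately show ?thesis by (simp only:)
qed

lemma left_minimal:
  assumes \<phi>: "\<phi> \<in> Hom n E E" and eq: "\<phi> \<circ>\<^sub>h inc = inc"
  shows "is_iso n E E \<phi>"
proof -
  define \<rho> where "\<rho> = \<phi> - hid E"
  have \<rho>: "\<rho> \<in> Hom n E E" unfolding \<rho>_def by (rule Hom_minus[OF dE \<phi> Hom_hid[OF dE]])
  have "\<rho> \<circ>\<^sub>h inc = 0"
    unfolding \<rho>_def hcomp_minus_left eq hcomp_hid_left[OF Hom_inc] by simp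
  from ses_cokernel_factor[OF ses_square dE \<rho> this] obtain \<sigma>
    where \<sigma>: "\<sigma> \<in> Hom n (MI n C) E" "\<sigma> \<circ>\<^sub>h pro = \<rho>" by (rule bexE)
  let ?s1 = "pr1 \<circ>\<^sub>h \<sigma>" and ?s2 = "- (pr2 \<circ>\<^sub>h \<sigma>)"
  have s12: "?s1 \<in> Hom n (MI n C) (MI n B1)" "?s2 \<in> Hom n (MI n C) (MI n B2)"
    by (rule Hom_hcomp[OF \<sigma>(1) fr(1)]) (rule Hom_uminus[OF M(3) Hom_hcomp[OF \<sigma>(1) fr(2)]])
  have "pro \<circ>\<^sub>h \<sigma> = (tmap n B1 \<alpha>2 \<circ>\<^sub>h ?s1) + (tmap n B2 \<alpha>1 \<circ>\<^sub>h ?s2)"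
    unfolding pro_def hcomp_minus_left hcomp_assoc hcomp_uminus_right[OF th(4) Hom_hcomp[OF \<sigma>(1) fr(2)]]
    by (rule diff_conv_add_uminus)
  then have "cst n C (pro \<circ>\<^sub>h \<sigma>) = 0"
    using cst_comp_zero[OF n C nonempty(4) B1 ne(3) s12(1) th(3)]
      cst_comp_zero[OF n C nonempty(4) B2 ne(4) s12(2) th(4)]
    by (simp only: cst_add add_0)
  then have "is_iso n (MI n C) (MI n C) (hid (MI n C) + (pro \<circ>\<^sub>h \<sigma>))"
    by (rule iso_one_plus_radical[OF n C nonempty(4) Hom_hcomp[OF \<sigma>(1) Hom_pro]])
  then have "is_iso n E E (hid E + (\<sigma> \<circ>\<^sub>h pro))"
    by (rule iso_one_plus_swap[OF M(4) dE \<sigma>(1) Hom_pro])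
  moreover have "hid E + (\<sigma> \<circ>\<^sub>h pro) = \<phi>" unfolding \<sigma>(2) \<rho>_def by (subst add.commute) (rule diff_add_cancel)
  ultimately show ?thesis by (simp only:)
qed

end

lemma tail_insert2:
  assumes "L \<subseteq> {1..n}" "x \<notin> L" "y \<notin> L" "x \<noteq> y"
  shows "tail (L \<union> {x, y}) j = tail L j + of_bool (j < x) + of_bool (j < y)"
proof -
  have fin: "finite L" using assms(1) by (rule finite_subset) simp
  have "{k \<in> L \<union> {x, y}. j < k} = {k \<in> L. j < k} \<union> ({k \<in> {x}. j < k} \<union> {k \<in> {y}. j < k})" by auto
  moreover have "card ({k \<in> L. j < k} \<union> ({k \<in> {x}. j < k} \<union> {k \<in> {y}. j < k})) =
      card {k \<in> L. j < k} + (card {k \<in> {x}. j < k} + card {k \<in> {y}. j < k})"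
    using assms fin by (subst card_Un_disjoint; (subst card_Un_disjoint)?) auto
  moreover have "card {k \<in> {z}. j < k} = of_bool (j < z)" for z
  proof (cases "j < z")
    case True
    then have "{k \<in> {z}. j < k} = {z}" by auto
    then show ?thesis using True by simp
  next
    case False
    then have "{k \<in> {z}. j < k} = {}" by auto
    then show ?thesis using False by simp
  qed
  ultimately show ?thesis by (simp add: tail_def)
qed

text \<open>
  Multiplication by \<open>t\<close> is needed where the linear order breaks the cyclic one: replacing \<open>c\<close> by \<open>d\<close> costs a
  factor \<open>t\<close> if \<open>d < c\<close>, and replacing \<open>a\<close> by \<open>b\<close> costs one if \<open>b < a\<close>.  The two replacements change
  the tails on disjoint cyclic intervals, which gives the two disjunctive conditions.
\<close>

lemma exchange_square_cyclic:
  assumes n: "n > 1" and L: "L \<subseteq> {1..n}" "{a, b, c, d} \<subseteq> {1..n}" "L \<inter> {a, b, c, d} = {}"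
    and dist: "distinct [a, b, c, d]" and cyc: "cyclically_ordered a b c d"
  shows "exchange_square n (card L + 2) (L \<union> {a, c}) (L \<union> {a, d}) (L \<union> {b, c}) (L \<union> {b, d})
    (of_bool (d < c)) (of_bool (b < a))"
proof -
  have fin: "finite L" using L(1) by (rule finite_subset) simp
  have nin: "a \<notin> L" "b \<notin> L" "c \<notin> L" "d \<notin> L" using L(3) by auto
  have neq: "a \<noteq> b" "a \<noteq> c" "a \<noteq> d" "b \<noteq> c" "b \<noteq> d" "c \<noteq> d" using dist by auto
  have card2: "card (L \<union> {x, y}) = card L + 2" if "x \<notin> L" "y \<notin> L" "x \<noteq> y" for x y
    using that fin by simp
  note t = tail_insert2[OF L(1)]
  note t' = t[OF nin(1,3) neq(2)] t[OF nin(1,4) neq(3)] t[OF nin(2,3) neq(4)] t[OF nin(2,4) neq(5)]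
  have or: "d < c \<longrightarrow> a < b" using cyc neq unfolding cyclically_ordered_def by linarith
  have split: "(of_bool (j < b) + of_bool (b < a) \<le> (of_bool (j < a) :: nat)) \<or>
      (of_bool (j < d) + of_bool (d < c) \<le> (of_bool (j < c) :: nat))" for j
    using cyc unfolding cyclically_ordered_def of_bool_def by (simp split: if_splits) linarith
  show ?thesis
  proof (rule exchange_square.intro)
    show "L \<union> {a, c} \<subseteq> {1..n}" "L \<union> {a, d} \<subseteq> {1..n}" "L \<union> {b, c} \<subseteq> {1..n}" "L \<union> {b, d} \<subseteq> {1..n}"
      using L by simp_all
    have diff: "X \<noteq> Y" if "w \<in> Y" "w \<notin> X" for X Y :: "nat set" and w using that by blast
    show "L \<union> {a, d} \<noteq> L \<union> {a, c}" by (rule diff[of c]) (use nin neq in simp_all)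
    show "L \<union> {b, c} \<noteq> L \<union> {a, c}" by (rule diff[of a]) (use nin neq in simp_all)
    show "L \<union> {a, d} \<noteq> L \<union> {b, d}" by (rule diff[of b]) (use nin neq in simp_all)
    show "L \<union> {b, c} \<noteq> L \<union> {b, d}" by (rule diff[of d]) (use nin neq in simp_all)
    show "of_bool (d < c) = (0::nat) \<or> of_bool (b < a) = (0::nat)" using or by auto
    have ob: "of_bool (j < x) \<le> of_bool (y < x) + (of_bool (j < y) :: nat)" for j x y :: nat
      by (simp add: of_bool_def)
    have ob': "of_bool (j < d) \<le> 1 - of_bool (d < c) + (of_bool (j < c) :: nat)" for j
      by (simp add: of_bool_def)
    show "hle (of_bool (d < c)) (L \<union> {a, c}) (L \<union> {a, d})" "hle (of_bool (b < a)) (L \<union> {a, c}) (L \<union> {b, c})"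
      "hle (of_bool (b < a)) (L \<union> {a, d}) (L \<union> {b, d})" "hle (of_bool (d < c)) (L \<union> {b, c}) (L \<union> {b, d})"
      "hle (1 - of_bool (d < c)) (L \<union> {a, d}) (L \<union> {a, c})"
      unfolding hle_def t' using ob[of _ a b] ob[of _ c d] ob' by (simp_all add: algebra_simps del: of_bool_eq_iff)
    show "tail (L \<union> {b, d}) j + of_bool (b < a) \<le> tail (L \<union> {a, d}) j \<or>
        tail (L \<union> {b, d}) j + of_bool (d < c) \<le> tail (L \<union> {b, c}) j" for j
      using split[of j] unfolding t' by (rule disj_forward) simp_all
    show "tail (L \<union> {a, d}) j + of_bool (d < c) \<le> tail (L \<union> {a, c}) j \<or>
        tail (L \<union> {b, c}) j + of_bool (b < a) \<le> tail (L \<union> {a, c}) j" for j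
      using split[of j, THEN disj_commute[THEN iffD1]] unfolding t' by (rule disj_forward) simp_all
  qed (use n nin neq card2 in simp_all)
qed

section \<open>Extension groups of dimension one\<close>

lemma dim_eq_1_of_coordinate:
  fixes M :: "(complex, 'a) module" and C :: "complex \<Rightarrow> 'a"
  assumes carrier: "carrier M = range C" and inj: "inj C" and zero: "\<zero>\<^bsub>M\<^esub> = C 0"
    and add: "\<And>x y. C x \<oplus>\<^bsub>M\<^esub> C y = C (x + y)" and smult: "\<And>x y. x \<odot>\<^bsub>M\<^esub> C y = C (x * y)"
  shows "vectorspace.dim class_ring M = 1"
proof -
  have ab: "abelian_group M"
  proof (rule abelian_groupI)
    fix x assume "x \<in> carrier M"
    then obtain u where u: "x = C u" unfolding carrier by (rule imageE)
    show "\<exists>y\<in>carrier M. y \<oplus>\<^bsub>M\<^esub> x = \<zero>\<^bsub>M\<^esub>"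
      unfolding u carrier by (rule bexI[of _ "C (- u)"]) (simp_all add: add zero)
  qed (auto simp: carrier zero add algebra_simps)
  have K: "cring (class_ring :: complex ring)" ..
  have mod: "module class_ring M"
    by (rule Module.module.intro[OF K ab], unfold_locales)
      (auto simp: carrier add smult class_ring_simps algebra_simps)
  interpret V: vectorspace class_ring M
    unfolding vectorspace_def by (intro conjI) (rule mod, rule class_field)
  have C1: "{C 1} \<subseteq> carrier M" unfolding carrier by simp
  show ?thesis
  proof (rule V.dim1I[of "C 1"])
    show "C 1 \<in> carrier M" unfolding carrier by simp
    show "C 1 \<noteq> \<zero>\<^bsub>M\<^esub>" unfolding zero using inj by (simp add: inj_eq)
    show "V.span {C 1} = carrier M"
    proof (rule subset_antisym[OF V.span_is_subset2[OF C1]], rule subsetI)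
      fix x assume "x \<in> carrier M"
      then obtain u where u: "x = C u" unfolding carrier by (rule imageE)
      have 1: "u \<in> carrier class_ring" by (simp add: class_ring_simps)
      have "u \<odot>\<^bsub>M\<^esub> C 1 \<in> V.span {C 1}"
        by (rule submodule.smult_closed[OF V.span_is_submodule[OF C1] 1
              subsetD[OF V.in_own_span[OF C1] singletonI]])
      then show "x \<in> V.span {C 1}" unfolding u smult by (simp only: mult_1_right)
    qed
  qed
qed

lemma dmod_fibre_product:
  assumes Y1: "dmod n Y1" and Y2: "dmod n Y2" and g1: "g1 \<in> Hom n Y1 Z" and g2: "g2 \<in> Hom n Y2 Z"
  shows "dmod n (fibre_product Y1 g1 Y2 g2)"
  unfolding fibre_product_def
proof (rule submodule_dmod[OF dmod_dsum[OF Y1 Y2]])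
  fix i
  show "cvec.subspace {(y1, y2). y1 \<in> vsp Y1 i \<and> y2 \<in> vsp Y2 i \<and> g1 i y1 = g2 i y2}"
    by (rule cvec.subspaceI)
      (auto simp: zero_prod_def scaleC_prod_def dmod_0[OF Y1] dmod_0[OF Y2] Hom_0[OF g1] Hom_0[OF g2]
        dmod_add[OF Y1] dmod_add[OF Y2] Hom_add[OF g1] Hom_add[OF g2]
        dmod_scale[OF Y1] dmod_scale[OF Y2] Hom_scale[OF g1] Hom_scale[OF g2])
qed (auto simp: dmod_bmap_in[OF Y1] dmod_bmap_in[OF Y2] dmod_amap_in[OF Y1] dmod_amap_in[OF Y2]
      Hom_bmap[OF g1] Hom_bmap[OF g2] Hom_amap[OF g1] Hom_amap[OF g2] simp del: One_nat_def)

lemma fibre_product_simps: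
  "vsp (fibre_product Y1 g1 Y2 g2) i = {(y1, y2). y1 \<in> vsp Y1 i \<and> y2 \<in> vsp Y2 i \<and> g1 i y1 = g2 i y2}"
  "bmap (fibre_product Y1 g1 Y2 g2) i = map_prod (bmap Y1 i) (bmap Y2 i)"
  "amap (fibre_product Y1 g1 Y2 g2) i = map_prod (amap Y1 i) (amap Y2 i)"
  by (simp_all add: fibre_product_def subrep_def dsum_def)

lemma Hom_fibre_productI:
  assumes g: "g \<in> Hom n W Y1" and h: "h \<in> Hom n W Y2" and eq: "g1 \<circ>\<^sub>h g = g2 \<circ>\<^sub>h h"
  shows "(\<lambda>i w. (g i w, h i w)) \<in> Hom n W (fibre_product Y1 g1 Y2 g2)"
proof -
  have eq': "g1 i (g i w) = g2 i (h i w)" for i w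
    using fun_cong[OF fun_cong[OF eq], of i w] by (simp only: hcomp_apply)
  show ?thesis
    by (rule HomI)
      (simp_all add: fibre_product_simps eq' Hom_in[OF g] Hom_in[OF h] Hom_add[OF g] Hom_add[OF h] scaleC_prod_def
        Hom_scale[OF g] Hom_scale[OF h] Hom_out[OF g] Hom_out[OF h] zero_prod_def Hom_bmap[OF g] Hom_bmap[OF h]
        Hom_amap[OF g] Hom_amap[OF h] del: One_nat_def)
qed

lemma is_scaledE:
  assumes "is_scaled n X c (Y1, f1, g1) (Y2, f2, g2)"
  obtains h where "h \<in> Hom n Y1 Y2" "\<forall>i. \<forall>x\<in>vsp X i. h i (f1 i x) = f2 i (c *\<^sub>C x)" "g2 \<circ>\<^sub>h h = g1"
  using assms unfolding is_scaled_def by blast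

lemma is_scaledI:
  assumes "h \<in> Hom n Y1 Y2" "\<And>i x. x \<in> vsp X i \<Longrightarrow> h i (f1 i x) = f2 i (c *\<^sub>C x)" "g2 \<circ>\<^sub>h h = g1"
  shows "is_scaled n X c (Y1, f1, g1) (Y2, f2, g2)"
  unfolding is_scaled_def prod.case by (rule bexI[OF _ assms(1)]) (simp add: assms)

lemma is_scaled_trans:
  assumes "is_scaled n X c (Y1, f1, g1) (Y2, f2, g2)" "is_scaled n X d (Y2, f2, g2) (Y3, f3, g3)" and X: "dmod n X"
  shows "is_scaled n X (c * d) (Y1, f1, g1) (Y3, f3, g3)"
proof -
  obtain h where h: "h \<in> Hom n Y1 Y2" "\<forall>i. \<forall>x\<in>vsp X i. h i (f1 i x) = f2 i (c *\<^sub>C x)" "g2 \<circ>\<^sub>h h = g1"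
    by (rule is_scaledE[OF assms(1)])
  obtain k where k: "k \<in> Hom n Y2 Y3" "\<forall>i. \<forall>x\<in>vsp X i. k i (f2 i x) = f3 i (d *\<^sub>C x)" "g3 \<circ>\<^sub>h k = g2"
    by (rule is_scaledE[OF assms(2)])
  show ?thesis
  proof (rule is_scaledI[OF Hom_hcomp[OF h(1) k(1)]])
    show "(k \<circ>\<^sub>h h) i (f1 i x) = f3 i ((c * d) *\<^sub>C x)" if "x \<in> vsp X i" for i x
      using h(2) k(2) that dmod_scale[OF X that] by (simp add: hcomp_apply scaleC_scaleC mult.commute)
    show "g3 \<circ>\<^sub>h (k \<circ>\<^sub>h h) = g1" by (simp only: hcomp_assoc[symmetric] k(3) h(3))
  qed
qed

text \<open>
  A morphism of extensions that is the identity on the quotient makes its target the sum of its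
  image and the kernel.
\<close>

lemma extension_generated:
  assumes e0: "ses n X Y0 Z f0 g0" and e1: "ses n X' Y1 Z f1 g1"
    and k: "k \<in> Hom n Y0 Y1" "g1 \<circ>\<^sub>h k = g0" and z: "z \<in> vsp Y1 i" and y: "y \<in> vsp Y0 i" "g0 i y = g1 i z"
  shows "\<exists>x\<in>vsp X' i. z = k i y + f1 i x"
proof -
  note S0 = sesD[OF e0] and S1 = sesD[OF e1]
  have gk: "g1 i (k i y) = g0 i y" using fun_cong[OF fun_cong[OF k(2)], of i y] by (simp only: hcomp_apply)
  have "g1 i (z - k i y) = 0" using Hom_diff[OF S1(2,5) z Hom_in[OF k(1) y(1)]] gk y(2) by simp
  from S1(7)[OF dmod_diff[OF S1(2) z Hom_in[OF k(1) y(1)]] this]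
  obtain x where x: "x \<in> vsp X' i" "f1 i x = z - k i y" by (rule bexE)
  show ?thesis by (rule bexI[OF _ x(1)]) (simp add: x(2))
qed

lemma extension_relation:
  assumes e0: "ses n X Y0 Z f0 g0" and e1: "ses n X Y1 Z f1 g1"
    and k: "k \<in> Hom n Y0 Y1" "\<forall>i. \<forall>x\<in>vsp X i. k i (f0 i x) = f1 i (c *\<^sub>C x)" "g1 \<circ>\<^sub>h k = g0"
    and y: "y \<in> vsp Y0 i" and x: "x \<in> vsp X i" and z: "k i y + f1 i x = 0"
  shows "g0 i y = 0" "u \<in> vsp X i \<Longrightarrow> f0 i u = y \<Longrightarrow> x = - (c *\<^sub>C u)"
proof -
  note S0 = sesD[OF e0] and S1 = sesD[OF e1]
  have gk: "g1 i (k i y) = g0 i y" using fun_cong[OF fun_cong[OF k(3)], of i y] by (simp only: hcomp_apply)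
  have "g1 i (k i y + f1 i x) = g0 i y"
    using Hom_add[OF S1(5) Hom_in[OF k(1) y] Hom_in[OF S1(4) x]] gk S1(8)[OF x] by simp
  then show "g0 i y = 0" using z Hom_0[OF S1(5)] by simp
  assume u: "u \<in> vsp X i" "f0 i u = y"
  have "k i y = f1 i (c *\<^sub>C u)" unfolding u(2)[symmetric] using k(2) u(1) by simp
  then have "f1 i (c *\<^sub>C u + x) = k i y + f1 i x"
    using Hom_add[OF S1(4) dmod_scale[OF S1(1) u(1)] x] by simp
  then have "c *\<^sub>C u + x = 0" using z S1(6)[OF dmod_add[OF S1(1) dmod_scale[OF S1(1) u(1)] x]] by simp
  then show "x = - (c *\<^sub>C u)" by (simp add: eq_neg_iff_add_eq_0 add.commute)
qed

text \<open>
  The target of a pushout is generated by the images of \<open>Y0\<close> and \<open>X\<close>, with the single relation identifying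
  \<open>f0 u\<close> and \<open>c u\<close>; so compatible maps on \<open>Y0\<close> and \<open>X\<close> define a map on \<open>Y1\<close>, also when \<open>c = 0\<close>.
\<close>

lemma is_scaled_cancel:
  assumes e0: "ses n X Y0 Z f0 g0" and e1: "ses n X Y1 Z f1 g1" and e2: "ses n X Y2 Z f2 g2"
    and s1: "is_scaled n X c (Y0, f0, g0) (Y1, f1, g1)" and s2: "is_scaled n X (c * d) (Y0, f0, g0) (Y2, f2, g2)"
  shows "is_scaled n X d (Y1, f1, g1) (Y2, f2, g2)"
proof -
  note S0 = sesD[OF e0] and S1 = sesD[OF e1] and S2 = sesD[OF e2]
  obtain h where h: "h \<in> Hom n Y0 Y1" "\<forall>i. \<forall>x\<in>vsp X i. h i (f0 i x) = f1 i (c *\<^sub>C x)" "g1 \<circ>\<^sub>h h = g0"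
    by (rule is_scaledE[OF s1])
  obtain k where k: "k \<in> Hom n Y0 Y2" "\<forall>i. \<forall>x\<in>vsp X i. k i (f0 i x) = f2 i ((c * d) *\<^sub>C x)" "g2 \<circ>\<^sub>h k = g0"
    by (rule is_scaledE[OF s2])
  define q where "q = (h \<circ>\<^sub>h hfst Y0 X) + (f1 \<circ>\<^sub>h hsnd Y0 X)"
  define q' where "q' = (k \<circ>\<^sub>h hfst Y0 X) + d *\<^sub>C (f2 \<circ>\<^sub>h hsnd Y0 X)"
  note W = dmod_dsum[OF S0(2,1)]
  note fr = Hom_hfst[OF S0(2,1)] Hom_hsnd[OF S0(2,1)]
  have q: "q \<in> Hom n (Y0 \<oplus>\<^sub>r X) Y1"
    unfolding q_def by (rule Hom_plus[OF S1(2) Hom_hcomp[OF fr(1) h(1)] Hom_hcomp[OF fr(2) S1(4)]])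
  have q': "q' \<in> Hom n (Y0 \<oplus>\<^sub>r X) Y2"
    unfolding q'_def
    by (rule Hom_plus[OF S2(2) Hom_hcomp[OF fr(1) k(1)] Hom_scaleC[OF S2(2) Hom_hcomp[OF fr(2) S2(4)]]])
  have qa: "q i (y, x) = h i y + f1 i x" "q' i (y, x) = k i y + d *\<^sub>C f2 i x"
    if "y \<in> vsp Y0 i" "x \<in> vsp X i" for i y x
    using that by (simp_all add: q_def q'_def hcomp_apply hfst_def hsnd_def scaleC_fun_def)
  have gen: "\<exists>y\<in>vsp Y0 i. \<exists>x\<in>vsp X i. z = h i y + f1 i x" if z: "z \<in> vsp Y1 i" for i z
  proof -
    obtain y where y: "y \<in> vsp Y0 i" "g0 i y = g1 i z" using S0(9)[OF Hom_in[OF S1(5) z]] by (rule bexE)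
    show ?thesis by (intro bexI[where x = y] extension_generated[OF e0 e1 h(1,3) z y(1), OF y(2)] y(1))
  qed
  have "\<exists>l\<in>Hom n Y1 Y2. l \<circ>\<^sub>h q = q'"
  proof (rule epi_factor[OF W S1(2) S2(2) q q'])
    fix i z assume z: "z \<in> vsp Y1 i"
    from gen[OF z] obtain y where y: "y \<in> vsp Y0 i" "\<exists>x\<in>vsp X i. z = h i y + f1 i x" by (rule bexE)
    from y(2) obtain x where x: "x \<in> vsp X i" "z = h i y + f1 i x" by (rule bexE)
    show "\<exists>w\<in>vsp (Y0 \<oplus>\<^sub>r X) i. q i w = z"
      by (rule bexI[of _ "(y, x)"]) (simp_all add: qa[OF y(1) x(1)] x y(1))
  next
    fix i w assume w: "w \<in> vsp (Y0 \<oplus>\<^sub>r X) i" "q i w = 0"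
    obtain y x where yx: "w = (y, x)" by (rule prod.exhaust)
    have y: "y \<in> vsp Y0 i" and x: "x \<in> vsp X i" using w(1) yx by auto
    have z: "h i y + f1 i x = 0" using w(2) unfolding yx qa[OF y x] .
    obtain u where u: "u \<in> vsp X i" "f0 i u = y"
      using S0(7)[OF y extension_relation(1)[of n X Y0 Z f0 g0 Y1 f1 g1 h c y i x, OF e0 e1 h y x z]] by (rule bexE)
    have xu: "x = - (c *\<^sub>C u)" by (rule extension_relation(2)[of n X Y0 Z f0 g0 Y1 f1 g1 h c y i x, OF e0 e1 h y x z u])
    have "k i y = f2 i ((c * d) *\<^sub>C u)" unfolding u(2)[symmetric] using k(2) u(1) by simp
    moreover have "d *\<^sub>C f2 i x = - f2 i ((c * d) *\<^sub>C u)"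
      unfolding xu Hom_neg[OF S2(4) dmod_scale[OF S2(1) u(1)]] Hom_scale[OF S2(4) u(1)]
      by (simp add: cvec.scale_minus_right scaleC_scaleC mult.commute)
    ultimately show "q' i w = 0" unfolding yx qa[OF y x] by simp
  qed
  then obtain l where l: "l \<in> Hom n Y1 Y2" "l \<circ>\<^sub>h q = q'" by (rule bexE)
  have lq: "l i (h i y + f1 i x) = k i y + d *\<^sub>C f2 i x" if "y \<in> vsp Y0 i" "x \<in> vsp X i" for i y x
    using fun_cong[OF fun_cong[OF l(2)], of i "(y, x)"] by (simp add: hcomp_apply qa[OF that])
  show ?thesis
  proof (rule is_scaledI[OF l(1)])
    show "l i (f1 i x) = f2 i (d *\<^sub>C x)" if x: "x \<in> vsp X i" for i x
      using lq[OF dmod_0[OF S0(2)] x] by (simp add: Hom_0[OF h(1)] Hom_0[OF k(1)] Hom_scale[OF S2(4) x])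
    show "g2 \<circ>\<^sub>h l = g1"
    proof (rule Hom_eqI[OF Hom_hcomp[OF l(1) S2(5)] S1(5)])
      fix i z assume z: "z \<in> vsp Y1 i"
      from gen[OF z] obtain y where y: "y \<in> vsp Y0 i" "\<exists>x\<in>vsp X i. z = h i y + f1 i x" by (rule bexE)
      from y(2) obtain x where x: "x \<in> vsp X i" "z = h i y + f1 i x" by (rule bexE)
      have a: "g1 i (h i y) = g0 i y" "g2 i (k i y) = g0 i y"
        using fun_cong[OF fun_cong[OF h(3)], of i y] fun_cong[OF fun_cong[OF k(3)], of i y]
        by (simp_all only: hcomp_apply)
      have "g2 i (l i z) = g0 i y"
        unfolding x(2) lq[OF y(1) x(1)]
          Hom_add[OF S2(5) Hom_in[OF k(1) y(1)] dmod_scale[OF S2(2) Hom_in[OF S2(4) x(1)]]]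
          Hom_scale[OF S2(5) Hom_in[OF S2(4) x(1)]] S2(8)[OF x(1)] a by simp
      moreover have "g1 i z = g0 i y"
        unfolding x(2) Hom_add[OF S1(5) Hom_in[OF h(1) y(1)] Hom_in[OF S1(4) x(1)]] S1(8)[OF x(1)] a by simp
      ultimately show "(g2 \<circ>\<^sub>h l) i z = g1 i z" by (simp only: hcomp_apply)
    qed
  qed
qed

text \<open>
  The five lemma.
\<close>

lemma is_scaled_1_iso:
  assumes e1: "ses n X Y1 Z f1 g1" and e2: "ses n X Y2 Z f2 g2" and s: "is_scaled n X 1 (Y1, f1, g1) (Y2, f2, g2)"
  shows "\<exists>h. is_iso n Y1 Y2 h \<and> h \<circ>\<^sub>h f1 = f2 \<and> g2 \<circ>\<^sub>h h = g1"
proof -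
  note S1 = sesD[OF e1] and S2 = sesD[OF e2]
  obtain h where h: "h \<in> Hom n Y1 Y2" "\<forall>i. \<forall>x\<in>vsp X i. h i (f1 i x) = f2 i (1 *\<^sub>C x)" "g2 \<circ>\<^sub>h h = g1"
    by (rule is_scaledE[OF s])
  have hf: "h i (f1 i x) = f2 i x" if "x \<in> vsp X i" for i x using h(2) that by (simp add: scaleC_one)
  have gh: "g2 i (h i y) = g1 i y" for i y using fun_cong[OF fun_cong[OF h(3)], of i y] by (simp only: hcomp_apply)
  have "is_iso n Y1 Y2 h"
  proof (rule is_isoI[OF S1(2) S2(2) h(1)])
    fix i y assume y: "y \<in> vsp Y1 i" "h i y = 0"
    have "g1 i y = 0" using gh[of i y] y(2) Hom_0[OF S2(5)] by simp
    from S1(7)[OF y(1) this] obtain x where x: "x \<in> vsp X i" "f1 i x = y" by (rule bexE)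
    have "f2 i x = 0" using hf[OF x(1)] x(2) y(2) by simp
    then have "x = 0" by (rule S2(6)[OF x(1)])
    then show "y = 0" using x(2) Hom_0[OF S1(4)] by simp
  next
    fix i z assume z: "z \<in> vsp Y2 i"
    obtain y where y: "y \<in> vsp Y1 i" "g1 i y = g2 i z" using S1(9)[OF Hom_in[OF S2(5) z]] by (rule bexE)
    from extension_generated[OF e1 e2 h(1,3) z y(1), OF y(2)] obtain x where x: "x \<in> vsp X i" "z = h i y + f2 i x" by (rule bexE)
    have "h i (y + f1 i x) = z"
      unfolding Hom_add[OF h(1) y(1) Hom_in[OF S1(4) x(1)]] hf[OF x(1)] x(2) ..
    then show "\<exists>y\<in>vsp Y1 i. h i y = z" by (rule bexI[OF _ dmod_add[OF S1(2) y(1) Hom_in[OF S1(4) x(1)]]])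
  qed
  moreover have "h \<circ>\<^sub>h f1 = f2"
    by (rule Hom_eqI[OF Hom_hcomp[OF S1(4) h(1)] S2(4)]) (simp add: hcomp_apply hf)
  ultimately show ?thesis using h(3) by (intro exI[of _ h] conjI)
qed

text \<open>
  The fibre product of two pushouts is generated by the diagonal image of \<open>Y0\<close> and two copies of \<open>X\<close>.  On
  it the map to \<open>Y3\<close> required of a Baer sum is given on \<open>Y0\<close> by a morphism that scales by \<open>c + d\<close>, and
  conversely the map of a Baer sum restricts along \<open>Y0\<close> to such a morphism.
\<close>

lemma baer_sum_of_scaled:
  assumes e0: "ses n X Y0 Z f0 g0" and e1: "ses n X Y1 Z f1 g1" and e2: "ses n X Y2 Z f2 g2"
    and e3: "ses n X Y3 Z f3 g3"
    and s1: "is_scaled n X c (Y0, f0, g0) (Y1, f1, g1)" and s2: "is_scaled n X d (Y0, f0, g0) (Y2, f2, g2)"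
  shows "is_baer_sum n X (Y1, f1, g1) (Y2, f2, g2) (Y3, f3, g3) \<longleftrightarrow> is_scaled n X (c + d) (Y0, f0, g0) (Y3, f3, g3)"
proof -
  note S0 = sesD[OF e0] and S1 = sesD[OF e1] and S2 = sesD[OF e2] and S3 = sesD[OF e3]
  let ?P = "fibre_product Y1 g1 Y2 g2"
  have P: "dmod n ?P" by (rule dmod_fibre_product[OF S1(2) S2(2) S1(5) S2(5)])
  obtain h where h: "h \<in> Hom n Y0 Y1" "\<forall>i. \<forall>x\<in>vsp X i. h i (f0 i x) = f1 i (c *\<^sub>C x)" "g1 \<circ>\<^sub>h h = g0"
    by (rule is_scaledE[OF s1])
  obtain k where k: "k \<in> Hom n Y0 Y2" "\<forall>i. \<forall>x\<in>vsp X i. k i (f0 i x) = f2 i (d *\<^sub>C x)" "g2 \<circ>\<^sub>h k = g0"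
    by (rule is_scaledE[OF s2])
  have gh: "g1 i (h i y) = g0 i y" for i y using fun_cong[OF fun_cong[OF h(3)], of i y] by (simp only: hcomp_apply)
  have gk: "g2 i (k i y) = g0 i y" for i y using fun_cong[OF fun_cong[OF k(3)], of i y] by (simp only: hcomp_apply)
  have hk: "(\<lambda>i w. (h i w, k i w)) \<in> Hom n Y0 ?P"
    by (rule Hom_fibre_productI[OF h(1) k(1)]) (simp only: h(3) k(3))
  show ?thesis
  proof
    assume "is_baer_sum n X (Y1, f1, g1) (Y2, f2, g2) (Y3, f3, g3)"
    then have "\<exists>l\<in>Hom n ?P Y3. (\<forall>i. \<forall>x1\<in>vsp X i. \<forall>x2\<in>vsp X i. l i (f1 i x1, f2 i x2) = f3 i (x1 + x2)) \<and>
       (\<forall>i. \<forall>(y1, y2)\<in>vsp ?P i. g3 i (l i (y1, y2)) = g1 i y1)"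
      unfolding is_baer_sum_def prod.case .
    then obtain l where l: "l \<in> Hom n ?P Y3"
      "\<forall>i. \<forall>x1\<in>vsp X i. \<forall>x2\<in>vsp X i. l i (f1 i x1, f2 i x2) = f3 i (x1 + x2)"
      "\<forall>i. \<forall>(y1, y2)\<in>vsp ?P i. g3 i (l i (y1, y2)) = g1 i y1"
      by (elim bexE conjE)
    show "is_scaled n X (c + d) (Y0, f0, g0) (Y3, f3, g3)"
    proof (rule is_scaledI[OF Hom_hcomp[OF hk l(1)]])
      fix i x assume x: "x \<in> vsp X i"
      show "(l \<circ>\<^sub>h (\<lambda>i w. (h i w, k i w))) i (f0 i x) = f3 i ((c + d) *\<^sub>C x)"
        using x h(2) k(2) l(2) dmod_scale[OF S0(1) x] by (simp add: hcomp_apply scaleC_add_left)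
    next
      show "g3 \<circ>\<^sub>h (l \<circ>\<^sub>h (\<lambda>i w. (h i w, k i w))) = g0"
      proof (rule Hom_eqI[OF Hom_hcomp[OF Hom_hcomp[OF hk l(1)] S3(5)] S0(5)])
        fix i y assume y: "y \<in> vsp Y0 i"
        have "(h i y, k i y) \<in> vsp ?P i" using Hom_in[OF hk y] .
        then have "g3 i (l i (h i y, k i y)) = g1 i (h i y)" using l(3) by auto
        then show "(g3 \<circ>\<^sub>h (l \<circ>\<^sub>h (\<lambda>i w. (h i w, k i w)))) i y = g0 i y" by (simp only: hcomp_apply gh)
      qed
    qed
  next
    assume "is_scaled n X (c + d) (Y0, f0, g0) (Y3, f3, g3)"
    then obtain m where m: "m \<in> Hom n Y0 Y3" "\<forall>i. \<forall>x\<in>vsp X i. m i (f0 i x) = f3 i ((c + d) *\<^sub>C x)" "g3 \<circ>\<^sub>h m = g0"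
      by (rule is_scaledE)
    have gm: "g3 i (m i y) = g0 i y" for i y using fun_cong[OF fun_cong[OF m(3)], of i y] by (simp only: hcomp_apply)
    note XX = dmod_dsum[OF S0(1,1)]
    note W = dmod_dsum[OF S0(2) XX]
    let ?W = "Y0 \<oplus>\<^sub>r (X \<oplus>\<^sub>r X)"
    note fr = Hom_hfst[OF S0(2) XX] Hom_hcomp[OF Hom_hsnd[OF S0(2) XX] Hom_hfst[OF S0(1,1)]]
      Hom_hcomp[OF Hom_hsnd[OF S0(2) XX] Hom_hsnd[OF S0(1,1)]]
    define a where "a = hfst Y0 (X \<oplus>\<^sub>r X)"
    define b1 where "b1 = hfst X X \<circ>\<^sub>h hsnd Y0 (X \<oplus>\<^sub>r X)"
    define b2 where "b2 = hsnd X X \<circ>\<^sub>h hsnd Y0 (X \<oplus>\<^sub>r X)"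
    note fr = fr[folded a_def b1_def b2_def]
    have ab: "a i (y, x1, x2) = y" "b1 i (y, x1, x2) = x1" "b2 i (y, x1, x2) = x2"
      if "y \<in> vsp Y0 i" "x1 \<in> vsp X i" "x2 \<in> vsp X i" for i y x1 x2
      using that by (simp_all add: a_def b1_def b2_def hcomp_apply hfst_def hsnd_def)
    define q1 where "q1 = (h \<circ>\<^sub>h a) + (f1 \<circ>\<^sub>h b1)"
    define q2 where "q2 = (k \<circ>\<^sub>h a) + (f2 \<circ>\<^sub>h b2)"
    define q' where "q' = (m \<circ>\<^sub>h a) + (f3 \<circ>\<^sub>h (b1 + b2))"
    have q1: "q1 \<in> Hom n ?W Y1"
      unfolding q1_def by (rule Hom_plus[OF S1(2) Hom_hcomp[OF fr(1) h(1)] Hom_hcomp[OF fr(2) S1(4)]])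
    have q2: "q2 \<in> Hom n ?W Y2"
      unfolding q2_def by (rule Hom_plus[OF S2(2) Hom_hcomp[OF fr(1) k(1)] Hom_hcomp[OF fr(3) S2(4)]])
    have q': "q' \<in> Hom n ?W Y3"
      unfolding q'_def
      by (rule Hom_plus[OF S3(2) Hom_hcomp[OF fr(1) m(1)] Hom_hcomp[OF Hom_plus[OF S0(1) fr(2,3)] S3(4)]])
    have qa: "q1 i (y, x1, x2) = h i y + f1 i x1" "q2 i (y, x1, x2) = k i y + f2 i x2"
      "q' i (y, x1, x2) = m i y + f3 i (x1 + x2)"
      if "y \<in> vsp Y0 i" "x1 \<in> vsp X i" "x2 \<in> vsp X i" for i y x1 x2
      by (simp_all add: q1_def q2_def q'_def hcomp_apply ab[OF that])
    have gq: "g1 \<circ>\<^sub>h q1 = g0 \<circ>\<^sub>h a" "g2 \<circ>\<^sub>h q2 = g0 \<circ>\<^sub>h a"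
    proof -
      show "g1 \<circ>\<^sub>h q1 = g0 \<circ>\<^sub>h a"
      proof (rule Hom_eqI[OF Hom_hcomp[OF q1 S1(5)] Hom_hcomp[OF fr(1) S0(5)]])
        fix i w assume "w \<in> vsp ?W i"
        then obtain y x1 x2 where w: "w = (y, x1, x2)" "y \<in> vsp Y0 i" "x1 \<in> vsp X i" "x2 \<in> vsp X i" by auto
        show "(g1 \<circ>\<^sub>h q1) i w = (g0 \<circ>\<^sub>h a) i w"
          unfolding hcomp_apply w(1) qa[OF w(2-4)] ab[OF w(2-4)]
            Hom_add[OF S1(5) Hom_in[OF h(1) w(2)] Hom_in[OF S1(4) w(3)]] gh S1(8)[OF w(3)] by simp
      qed
      show "g2 \<circ>\<^sub>h q2 = g0 \<circ>\<^sub>h a"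
      proof (rule Hom_eqI[OF Hom_hcomp[OF q2 S2(5)] Hom_hcomp[OF fr(1) S0(5)]])
        fix i w assume "w \<in> vsp ?W i"
        then obtain y x1 x2 where w: "w = (y, x1, x2)" "y \<in> vsp Y0 i" "x1 \<in> vsp X i" "x2 \<in> vsp X i" by auto
        show "(g2 \<circ>\<^sub>h q2) i w = (g0 \<circ>\<^sub>h a) i w"
          unfolding hcomp_apply w(1) qa[OF w(2-4)] ab[OF w(2-4)]
            Hom_add[OF S2(5) Hom_in[OF k(1) w(2)] Hom_in[OF S2(4) w(4)]] gk S2(8)[OF w(4)] by simp
      qed
    qed
    define q where "q = (\<lambda>i w. (q1 i w, q2 i w))"
    have q: "q \<in> Hom n ?W ?P" unfolding q_def by (rule Hom_fibre_productI[OF q1 q2]) (simp only: gq)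
    have gen: "\<exists>w\<in>vsp ?W i. q i w = p" if p: "p \<in> vsp ?P i" for i p
    proof -
      obtain y1 y2 where p: "p = (y1, y2)" "y1 \<in> vsp Y1 i" "y2 \<in> vsp Y2 i" "g1 i y1 = g2 i y2"
        using p by (auto simp: fibre_product_simps)
      obtain y where y: "y \<in> vsp Y0 i" "g0 i y = g1 i y1" using S0(9)[OF Hom_in[OF S1(5) p(2)]] by (rule bexE)
      obtain x1 where x1: "x1 \<in> vsp X i" "y1 = h i y + f1 i x1"
        using extension_generated[OF e0 e1 h(1,3) p(2) y(1), OF y(2)] by (rule bexE)
      obtain x2 where x2: "x2 \<in> vsp X i" "y2 = k i y + f2 i x2"
        using extension_generated[OF e0 e2 k(1,3) p(3) y(1), OF y(2)[unfolded p(4)]] by (rule bexE)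
      show ?thesis
        by (rule bexI[of _ "(y, x1, x2)"])
          (simp_all add: q_def qa[OF y(1) x1(1) x2(1)] x1(2)[symmetric] x2(2)[symmetric] p(1) y(1) x1(1) x2(1))
    qed
    have "\<exists>l\<in>Hom n ?P Y3. l \<circ>\<^sub>h q = q'"
    proof (rule epi_factor[OF W P S3(2) q q'])
      show "\<exists>w\<in>vsp ?W i. q i w = p" if "p \<in> vsp ?P i" for i p by (rule gen[OF that])
      fix i w assume w: "w \<in> vsp ?W i" "q i w = 0"
      obtain y x1 x2 where v: "w = (y, x1, x2)" "y \<in> vsp Y0 i" "x1 \<in> vsp X i" "x2 \<in> vsp X i" using w(1) by auto
      have z: "h i y + f1 i x1 = 0" "k i y + f2 i x2 = 0"
        using w(2) unfolding q_def v(1) qa[OF v(2-4)] by (simp_all add: zero_prod_def)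
      obtain u where u: "u \<in> vsp X i" "f0 i u = y"
        using S0(7)[OF v(2) extension_relation(1)[of n X Y0 Z f0 g0 Y1 f1 g1 h c y i x1, OF e0 e1 h v(2,3) z(1)]] by (rule bexE)
      have "x1 = - (c *\<^sub>C u)" "x2 = - (d *\<^sub>C u)"
        by (rule extension_relation(2)[of n X Y0 Z f0 g0 Y1 f1 g1 h c y i x1, OF e0 e1 h v(2,3) z(1) u]) (rule extension_relation(2)[of n X Y0 Z f0 g0 Y2 f2 g2 k d y i x2, OF e0 e2 k v(2,4) z(2) u])
      then have "x1 + x2 = - ((c + d) *\<^sub>C u)" by (simp add: scaleC_add_left)
      moreover have "m i y = f3 i ((c + d) *\<^sub>C u)" unfolding u(2)[symmetric] using m(2) u(1) by simp
      ultimately show "q' i w = 0"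
        unfolding v(1) qa[OF v(2-4)] using Hom_neg[OF S3(4) dmod_scale[OF S3(1) u(1), of "c + d"]] by simp
    qed
    then obtain l where l: "l \<in> Hom n ?P Y3" "l \<circ>\<^sub>h q = q'" by (rule bexE)
    have lq: "l i (h i y + f1 i x1, k i y + f2 i x2) = m i y + f3 i (x1 + x2)"
      if "y \<in> vsp Y0 i" "x1 \<in> vsp X i" "x2 \<in> vsp X i" for i y x1 x2
      using fun_cong[OF fun_cong[OF l(2)], of i "(y, x1, x2)"] by (simp add: hcomp_apply q_def qa[OF that])
    show "is_baer_sum n X (Y1, f1, g1) (Y2, f2, g2) (Y3, f3, g3)"
      unfolding is_baer_sum_def prod.case
    proof (rule bexI[OF _ l(1)], intro conjI allI ballI)
      fix i x1 x2 assume "x1 \<in> vsp X i" "x2 \<in> vsp X i"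
      then show "l i (f1 i x1, f2 i x2) = f3 i (x1 + x2)"
        using lq[OF dmod_0[OF S0(2)]] by (simp add: Hom_0[OF h(1)] Hom_0[OF k(1)] Hom_0[OF m(1)])
    next
      fix i p assume p: "p \<in> vsp ?P i"
      obtain w where w: "w \<in> vsp ?W i" "q i w = p" using gen[OF p] by (rule bexE)
      obtain y x1 x2 where v: "w = (y, x1, x2)" "y \<in> vsp Y0 i" "x1 \<in> vsp X i" "x2 \<in> vsp X i" using w(1) by auto
      have p': "p = (h i y + f1 i x1, k i y + f2 i x2)" using w(2) by (simp add: q_def v(1) qa[OF v(2-4)])
      have "g3 i (l i p) = g0 i y"
        unfolding p' lq[OF v(2-4)] Hom_add[OF S3(5) Hom_in[OF m(1) v(2)] Hom_in[OF S3(4) dmod_add[OF S3(1) v(3,4)]]]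
          gm S3(8)[OF dmod_add[OF S3(1) v(3,4)]] by simp
      moreover have "g1 i (h i y + f1 i x1) = g0 i y"
        unfolding Hom_add[OF S1(5) Hom_in[OF h(1) v(2)] Hom_in[OF S1(4) v(3)]] gh S1(8)[OF v(3)] by simp
      ultimately show "case p of (y1, y2) \<Rightarrow> g3 i (l i (y1, y2)) = g1 i y1" by (simp add: p')
    qed
  qed
qed


text \<open>
  If every extension is the pushout of one fixed extension along a scalar, and all scalars occur, then
  the extensions with scalar \<open>c\<close> form one equivalence class \<open>C c\<close>, and the operations on classes are those on scalars.
  The scalar is unique: two morphisms with scalars \<open>c \<noteq> d\<close> differ by a map to \<open>X\<close> whose restriction to \<open>X\<close> is
  \<open>c - d\<close>, so the fixed extension would split.
\<close>

theorem ext1_dim_1: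
  assumes n: "n > 1" and e0: "E_ses n X Y0 Z f0 g0"
    and nonsplit: "\<And>s. s \<in> Hom n Z Y0 \<Longrightarrow> g0 \<circ>\<^sub>h s \<noteq> hid Z"
    and scaled: "\<And>e. e \<in> extensions n Z X \<Longrightarrow> \<exists>c. is_scaled n X c (Y0, f0, g0) e"
    and realised: "\<And>c. \<exists>e\<in>extensions n Z X. is_scaled n X c (Y0, f0, g0) e"
  shows "vectorspace.dim class_ring (ext1 n Z X) = 1"
proof -
  let ?e0 = "(Y0, f0, g0)" and ?E = "extensions n Z X" and ?R = "ext_equiv n Z X"
  have s0: "ses n X Y0 Z f0 g0" using e0 by (simp add: E_ses_def)
  note S0 = sesD[OF s0]
  have ses: "ses n X Y Z f g" if "(Y, f, g) \<in> ?E" for Y f g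
    using that by (simp add: extensions_def E_ses_def)
  define C where "C = (\<lambda>c. {e \<in> ?E. is_scaled n X c ?e0 e})"
  have CD: "(Y, f, g) \<in> ?E" "is_scaled n X c ?e0 (Y, f, g)" "ses n X Y Z f g" if "(Y, f, g) \<in> C c" for c Y f g
    using that ses by (simp_all add: C_def)
  have CI: "(Y, f, g) \<in> C c" if "(Y, f, g) \<in> ?E" "is_scaled n X c ?e0 (Y, f, g)" for Y f g c
    using that by (simp add: C_def)
  have ne: "\<exists>Y f g. (Y, f, g) \<in> C c" for c
  proof -
    obtain e where e: "e \<in> ?E" "is_scaled n X c ?e0 e" using realised[of c] by (rule bexE)
    obtain Y f g where "e = (Y, f, g)" by (rule prod_cases3)
    then show ?thesis using e by (intro exI[of _ Y] exI[of _ f] exI[of _ g]) (simp add: C_def)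
  qed
  have unique: "c = d" if c: "(Y, f, g) \<in> C c" and d: "(Y, f, g) \<in> C d" for Y f g c d
  proof (rule ccontr)
    assume "c \<noteq> d"
    note S = sesD[OF CD(3)[OF c]]
    obtain h where h: "h \<in> Hom n Y0 Y" "\<forall>i. \<forall>x\<in>vsp X i. h i (f0 i x) = f i (c *\<^sub>C x)" "g \<circ>\<^sub>h h = g0"
      by (rule is_scaledE[OF CD(2)[OF c]])
    obtain k where k: "k \<in> Hom n Y0 Y" "\<forall>i. \<forall>x\<in>vsp X i. k i (f0 i x) = f i (d *\<^sub>C x)" "g \<circ>\<^sub>h k = g0"
      by (rule is_scaledE[OF CD(2)[OF d]])
    have "g \<circ>\<^sub>h (h - k) = 0" unfolding hcomp_minus_right[OF S(2,5) h(1) k(1)] h(3) k(3) by simp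
    from ses_kernel_factor[OF CD(3)[OF c] S0(2) Hom_minus[OF S(2) h(1) k(1)] this]
    obtain r where r: "r \<in> Hom n Y0 X" "f \<circ>\<^sub>h r = h - k" by (rule bexE)
    have rf: "r i (f0 i x) = (c - d) *\<^sub>C x" if x: "x \<in> vsp X i" for i x
    proof -
      have rx: "r i (f0 i x) \<in> vsp X i" by (rule Hom_in[OF r(1) Hom_in[OF S0(4) x]])
      have "f i (r i (f0 i x)) = h i (f0 i x) - k i (f0 i x)"
        using fun_cong[OF fun_cong[OF r(2)], of i "f0 i x"] by (simp add: hcomp_apply)
      also have "\<dots> = f i ((c - d) *\<^sub>C x)"
        using h(2) k(2) x Hom_diff[OF S(1,4) dmod_scale[OF S(1) x] dmod_scale[OF S(1) x], of c d]
        by (simp add: cvec.scale_left_diff_distrib)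
      finally have eq: "f i (r i (f0 i x)) = f i ((c - d) *\<^sub>C x)" .
      have "f i (r i (f0 i x) - (c - d) *\<^sub>C x) = 0"
        using Hom_diff[OF S(1,4) rx dmod_scale[OF S(1) x]] eq by simp
      then have "r i (f0 i x) - (c - d) *\<^sub>C x = 0" by (rule S(6)[OF dmod_diff[OF S(1) rx dmod_scale[OF S(1) x]]])
      then show ?thesis by simp
    qed
    \<comment> \<open>a retraction of \<open>f0\<close> yields a section of \<open>g0\<close>\<close>
    define r' where "r' = (1 / (c - d)) *\<^sub>C r"
    have r': "r' \<in> Hom n Y0 X" unfolding r'_def by (rule Hom_scaleC[OF S0(1) r(1)])
    have rf': "r' i (f0 i x) = x" if x: "x \<in> vsp X i" for i x
      using rf[OF x] \<open>c \<noteq> d\<close> by (simp add: r'_def scaleC_fun_def scaleC_scaleC scaleC_one)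
    note fr' = Hom_hcomp[OF r' S0(4)]
    note idY = Hom_hid[OF S0(2)]
    have "(hid Y0 - (f0 \<circ>\<^sub>h r')) \<circ>\<^sub>h f0 = 0"
    proof (rule Hom_eqI[OF Hom_hcomp[OF S0(4) Hom_minus[OF S0(2) idY fr']] Hom_zero[OF S0(2)]])
      fix i x assume x: "x \<in> vsp X i"
      show "((hid Y0 - (f0 \<circ>\<^sub>h r')) \<circ>\<^sub>h f0) i x = 0 i x"
        using rf'[OF x] hid_apply[OF Hom_in[OF S0(4) x]] by (simp add: hcomp_apply)
    qed
    from ses_cokernel_factor[OF s0 S0(2) Hom_minus[OF S0(2) idY fr'] this]
    obtain s where s: "s \<in> Hom n Z Y0" "s \<circ>\<^sub>h g0 = hid Y0 - (f0 \<circ>\<^sub>h r')" by (rule bexE)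
    have "g0 \<circ>\<^sub>h s = hid Z"
    proof (rule Hom_eqI[OF Hom_hcomp[OF s(1) S0(5)] Hom_hid[OF S0(3)]])
      fix i z assume z: "z \<in> vsp Z i"
      obtain y where y: "y \<in> vsp Y0 i" "g0 i y = z" using S0(9)[OF z] by (rule bexE)
      have fy: "f0 i (r' i y) \<in> vsp Y0 i" by (rule Hom_in[OF fr' y(1), unfolded hcomp_apply])
      have "s i z = y - f0 i (r' i y)"
        using fun_cong[OF fun_cong[OF s(2)], of i y] y(2) hid_apply[OF y(1)] by (simp add: hcomp_apply)
      then have "g0 i (s i z) = z"
        using Hom_diff[OF S0(2,5) y(1) fy] S0(8)[OF Hom_in[OF r' y(1)]] y(2) by simp
      then show "(g0 \<circ>\<^sub>h s) i z = hid Z i z" by (simp add: hcomp_apply hid_apply[OF z])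
    qed
    with nonsplit[OF s(1)] show False ..
  qed
  have scale: "(Y2, f2, g2) \<in> C (c * d) \<longleftrightarrow> is_scaled n X d (Y1, f1, g1) (Y2, f2, g2)"
    if 1: "(Y1, f1, g1) \<in> C c" and 2: "(Y2, f2, g2) \<in> ?E" for c d Y1 f1 g1 Y2 f2 g2
  proof
    assume c: "(Y2, f2, g2) \<in> C (c * d)"
    show "is_scaled n X d (Y1, f1, g1) (Y2, f2, g2)"
      by (rule is_scaled_cancel[OF s0 CD(3)[OF 1] ses[OF 2] CD(2)[OF 1] CD(2)[OF c]])
  next
    assume "is_scaled n X d (Y1, f1, g1) (Y2, f2, g2)"
    then show "(Y2, f2, g2) \<in> C (c * d)" by (rule CI[OF 2 is_scaled_trans[OF CD(2)[OF 1] _ S0(1)]])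
  qed
  have equiv: "((Y1, f1, g1), (Y2, f2, g2)) \<in> ?R \<longleftrightarrow> (Y2, f2, g2) \<in> C c"
    if 1: "(Y1, f1, g1) \<in> C c" for Y1 f1 g1 c Y2 f2 g2
  proof
    assume "((Y1, f1, g1), (Y2, f2, g2)) \<in> ?R"
    then obtain h where 2: "(Y2, f2, g2) \<in> ?E" and h: "is_iso n Y1 Y2 h" "h \<circ>\<^sub>h f1 = f2" "g2 \<circ>\<^sub>h h = g1"
      unfolding ext_equiv_def by blast
    have "is_scaled n X 1 (Y1, f1, g1) (Y2, f2, g2)"
    proof (rule is_scaledI[OF _ _ h(3)])
      show "h \<in> Hom n Y1 Y2" using h(1) by (simp add: is_iso_def)
      show "h i (f1 i x) = f2 i (1 *\<^sub>C x)" for i x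
        using fun_cong[OF fun_cong[OF h(2)], of i x] by (simp add: hcomp_apply scaleC_one)
    qed
    then show "(Y2, f2, g2) \<in> C c" using scale[OF 1 2, of 1] by simp
  next
    assume 2: "(Y2, f2, g2) \<in> C c"
    have "is_scaled n X 1 (Y1, f1, g1) (Y2, f2, g2)" using scale[OF 1 CD(1)[OF 2], of 1] 2 by simp
    from is_scaled_1_iso[OF CD(3)[OF 1] CD(3)[OF 2] this]
    show "((Y1, f1, g1), (Y2, f2, g2)) \<in> ?R"
      unfolding ext_equiv_def using CD(1)[OF 1] CD(1)[OF 2] by simp
  qed
  have cls: "?R `` {e} = C c" if e: "e \<in> C c" for e c
  proof -
    obtain Y f g where e': "e = (Y, f, g)" by (rule prod_cases3)
    show ?thesis
    proof (rule Set.set_eqI)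
      fix e2 :: "('a, 'b) extn"
      obtain Y2 f2 g2 where e2: "e2 = (Y2, f2, g2)" by (rule prod_cases3)
      show "e2 \<in> ?R `` {e} \<longleftrightarrow> e2 \<in> C c" unfolding e2 e' Image_singleton_iff by (rule equiv[OF e[unfolded e']])
    qed
  qed
  show ?thesis
  proof (rule dim_eq_1_of_coordinate[of _ C])
    have "?E // ?R = range C"
    proof (intro subset_antisym subsetI)
      fix A assume "A \<in> ?E // ?R"
      then obtain e where e: "A = ?R `` {e}" "e \<in> ?E" unfolding quotient_def by blast
      obtain c where "is_scaled n X c ?e0 e" using scaled[OF e(2)] by (rule exE)
      then have "e \<in> C c" using e(2) by (simp add: C_def)
      then show "A \<in> range C" using cls e(1) by (intro rev_image_eqI[of c]) simp_all
    next
      fix A assume "A \<in> range C"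
      then obtain c where c: "A = C c" by (rule imageE)
      obtain Y f g where Y: "(Y, f, g) \<in> C c" using ne[of c] by (elim exE)
      have "?R `` {(Y, f, g)} \<in> ?E // ?R" by (rule quotientI[OF CD(1)[OF Y]])
      then show "A \<in> ?E // ?R" unfolding cls[OF Y] c .
    qed
    then show "carrier (ext1 n Z X) = range C" by (simp add: ext1_def)
    show "inj C"
    proof (rule injI)
      fix c d assume eq: "C c = C d"
      obtain Y f g where Y: "(Y, f, g) \<in> C c" using ne[of c] by (elim exE)
      show "c = d" by (rule unique[OF Y Y[unfolded eq]])
    qed
    have "{e \<in> ?E. splits n Z e} = C 0"
    proof (rule Set.set_eqI)
      fix e :: "('a, 'b) extn"
      obtain Y f g where e: "e = (Y, f, g)" by (rule prod_cases3)
      have "splits n Z (Y, f, g) \<longleftrightarrow> is_scaled n X 0 ?e0 (Y, f, g)" if Y: "(Y, f, g) \<in> ?E"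
      proof
        note S = sesD[OF ses[OF Y]]
        assume "splits n Z (Y, f, g)"
        then obtain s where s: "s \<in> Hom n Z Y" "g \<circ>\<^sub>h s = hid Z" unfolding splits_def prod.case by (rule bexE)
        show "is_scaled n X 0 ?e0 (Y, f, g)"
        proof (rule is_scaledI[OF Hom_hcomp[OF S0(5) s(1)]])
          show "(s \<circ>\<^sub>h g0) i (f0 i x) = f i (0 *\<^sub>C x)" if "x \<in> vsp X i" for i x
            using S0(8)[OF that] by (simp add: hcomp_apply Hom_0[OF s(1)] Hom_0[OF S(4)])
          show "g \<circ>\<^sub>h (s \<circ>\<^sub>h g0) = g0" by (simp only: hcomp_assoc[symmetric] s(2) hcomp_hid_left[OF S0(5)])
        qed
      next
        note S = sesD[OF ses[OF Y]]
        assume "is_scaled n X 0 ?e0 (Y, f, g)"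
        then obtain h where h: "h \<in> Hom n Y0 Y" "\<forall>i. \<forall>x\<in>vsp X i. h i (f0 i x) = f i (0 *\<^sub>C x)" "g \<circ>\<^sub>h h = g0"
          by (rule is_scaledE)
        have "h \<circ>\<^sub>h f0 = 0"
        proof (rule Hom_eqI[OF Hom_hcomp[OF S0(4) h(1)] Hom_zero[OF S(2)]])
          fix i x assume "x \<in> vsp X i"
          then show "(h \<circ>\<^sub>h f0) i x = 0 i x" using h(2) by (simp add: hcomp_apply Hom_0[OF S(4)])
        qed
        from ses_cokernel_factor[OF s0 S(2) h(1) this] obtain s where s: "s \<in> Hom n Z Y" "s \<circ>\<^sub>h g0 = h" by (rule bexE)
        have "g \<circ>\<^sub>h s = hid Z"
        proof (rule Hom_eqI[OF Hom_hcomp[OF s(1) S(5)] Hom_hid[OF S0(3)]])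
          fix i z assume z: "z \<in> vsp Z i"
          obtain y where y: "y \<in> vsp Y0 i" "g0 i y = z" using S0(9)[OF z] by (rule bexE)
          have "g i (s i (g0 i y)) = g0 i y"
            using fun_cong[OF fun_cong[OF s(2)], of i y] fun_cong[OF fun_cong[OF h(3)], of i y] by (simp add: hcomp_apply)
          then show "(g \<circ>\<^sub>h s) i z = hid Z i z" by (simp add: hcomp_apply hid_apply[OF z] y(2))
        qed
        then show "splits n Z (Y, f, g)" unfolding splits_def prod.case using s(1) by (rule bexI)
      qed
      then show "e \<in> {e \<in> ?E. splits n Z e} \<longleftrightarrow> e \<in> C 0" unfolding e C_def by auto
    qed
    then show "\<zero>\<^bsub>ext1 n Z X\<^esub> = C 0" by (simp add: ext1_def)
    show "C c \<oplus>\<^bsub>ext1 n Z X\<^esub> C d = C (c + d)" for c d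
    proof -
      have "{e \<in> ?E. \<exists>e1\<in>C c. \<exists>e2\<in>C d. is_baer_sum n X e1 e2 e} = C (c + d)"
      proof (rule Set.set_eqI)
        fix e :: "('a, 'b) extn"
        obtain Y3 f3 g3 where e: "e = (Y3, f3, g3)" by (rule prod_cases3)
        have *: "is_baer_sum n X e1 e2 e \<longleftrightarrow> is_scaled n X (c + d) ?e0 e" if e3: "e \<in> ?E" and 1: "e1 \<in> C c" and 2: "e2 \<in> C d" for e1 e2
        proof -
          obtain Y1 f1 g1 where e1: "e1 = (Y1, f1, g1)" by (rule prod_cases3)
          obtain Y2 f2 g2 where e2: "e2 = (Y2, f2, g2)" by (rule prod_cases3)
          note 1 = 1[unfolded e1] and 2 = 2[unfolded e2] and e3 = e3[unfolded e]
          show ?thesis unfolding e1 e2 e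
            by (rule baer_sum_of_scaled[OF s0 CD(3)[OF 1] CD(3)[OF 2] ses[OF e3] CD(2)[OF 1] CD(2)[OF 2]])
        qed
        obtain Y1 f1 g1 where 1: "(Y1, f1, g1) \<in> C c" using ne[of c] by (elim exE)
        obtain Y2 f2 g2 where 2: "(Y2, f2, g2) \<in> C d" using ne[of d] by (elim exE)
        show "e \<in> {e \<in> ?E. \<exists>e1\<in>C c. \<exists>e2\<in>C d. is_baer_sum n X e1 e2 e} \<longleftrightarrow> e \<in> C (c + d)"
        proof
          assume a: "e \<in> {e \<in> ?E. \<exists>e1\<in>C c. \<exists>e2\<in>C d. is_baer_sum n X e1 e2 e}"
          then have e3: "e \<in> ?E" and "\<exists>e1\<in>C c. \<exists>e2\<in>C d. is_baer_sum n X e1 e2 e" by simp_all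
          then obtain e1 e2 where "e1 \<in> C c" "e2 \<in> C d" "is_baer_sum n X e1 e2 e" by (elim bexE)
          then show "e \<in> C (c + d)" using * e3 by (simp add: C_def)
        next
          assume a: "e \<in> C (c + d)"
          then have e3: "e \<in> ?E" "is_scaled n X (c + d) ?e0 e" by (simp_all add: C_def)
          then have "is_baer_sum n X (Y1, f1, g1) (Y2, f2, g2) e" using *[OF e3(1) 1 2] by simp
          then have "\<exists>e1\<in>C c. \<exists>e2\<in>C d. is_baer_sum n X e1 e2 e" by (rule bexI[OF bexI[OF _ 2] 1])
          then show "e \<in> {e \<in> ?E. \<exists>e1\<in>C c. \<exists>e2\<in>C d. is_baer_sum n X e1 e2 e}" using e3(1) by simp
        qed
      qed
      then show ?thesis by (simp add: ext1_def)
    qed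
    show "d \<odot>\<^bsub>ext1 n Z X\<^esub> C c = C (d * c)" for d c
    proof -
      have "{e \<in> ?E. \<exists>e1\<in>C c. is_scaled n X d e1 e} = C (d * c)"
      proof (rule Set.set_eqI)
        fix e :: "('a, 'b) extn"
        obtain Y2 f2 g2 where e: "e = (Y2, f2, g2)" by (rule prod_cases3)
        have *: "is_scaled n X d e1 e \<longleftrightarrow> e \<in> C (d * c)" if e2: "e \<in> ?E" and 1: "e1 \<in> C c" for e1
        proof -
          obtain Y1 f1 g1 where e1: "e1 = (Y1, f1, g1)" by (rule prod_cases3)
          show ?thesis unfolding e1 e mult.commute[of d c] using scale[OF 1[unfolded e1] e2[unfolded e], of d] by simp
        qed
        obtain Y1 f1 g1 where 1: "(Y1, f1, g1) \<in> C c" using ne[of c] by (elim exE)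
        show "e \<in> {e \<in> ?E. \<exists>e1\<in>C c. is_scaled n X d e1 e} \<longleftrightarrow> e \<in> C (d * c)"
        proof
          assume a: "e \<in> {e \<in> ?E. \<exists>e1\<in>C c. is_scaled n X d e1 e}"
          then have e2: "e \<in> ?E" and "\<exists>e1\<in>C c. is_scaled n X d e1 e" by simp_all
          then obtain e1 where "e1 \<in> C c" "is_scaled n X d e1 e" by (elim bexE)
          then show "e \<in> C (d * c)" using *[OF e2] by simp
        next
          assume a: "e \<in> C (d * c)"
          then have e2: "e \<in> ?E" by (simp add: C_def)
          then have "is_scaled n X d (Y1, f1, g1) e" using *[OF e2 1] a by simp
          then have "\<exists>e1\<in>C c. is_scaled n X d e1 e" by (rule bexI[OF _ 1])
          then show "e \<in> {e \<in> ?E. \<exists>e1\<in>C c. is_scaled n X d e1 e}" using e2 by simp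
        qed
      qed
      then show ?thesis by (simp add: ext1_def)
    qed
  qed
qed

context exchange_square
begin

text \<open>
  The lift \<open>h\<close> of the square to the given extension restricts to an endomorphism \<open>\<phi>\<close> of \<open>M\<^sub>A\<close>.  Subtracting
  from \<open>h\<close> a map that extends \<open>\<phi> - c\<close>, \<open>c\<close> the constant term, leaves the scalar \<open>c\<close>.
\<close>

lemma extension_from_square:
  assumes sep: "B1 - A = {x1}" "A - B1 = {y1}" "B2 - A = {x2}" "A - B2 = {y2}"
    and e: "E_ses n (MI n A) Y (MI n C) f g"
  shows "\<exists>c. \<exists>h\<in>Hom n E Y. (\<forall>i. \<forall>x\<in>vsp (MI n A) i. h i (inc i x) = f i (c *\<^sub>C x)) \<and> g \<circ>\<^sub>h h = pro"
proof -
  have s: "ses n (MI n A) Y (MI n C) f g" using e by (simp add: E_ses_def)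
  note S = sesD[OF s]
  have c: "card B1 = card C" "card B1 = card A" "card B2 = card C" "card B2 = card A" using cards by simp_all
  obtain h1 where h1: "h1 \<in> Hom n (MI n B1) Y" "g \<circ>\<^sub>h h1 = tmap n B1 \<alpha>2"
    using E_ses_lift_tmap[OF n B1 nonempty(2) C A c(1,2) sep(1,2) le(3) e] by (rule bexE)
  obtain h2 where h2: "h2 \<in> Hom n (MI n B2) Y" "g \<circ>\<^sub>h h2 = tmap n B2 \<alpha>1"
    using E_ses_lift_tmap[OF n B2 nonempty(3) C A c(3,4) sep(3,4) le(4) e] by (rule bexE)
  define h where "h = (h1 \<circ>\<^sub>h pr1) - (h2 \<circ>\<^sub>h pr2)"
  note hc = Hom_hcomp[OF fr(1) h1(1)] Hom_hcomp[OF fr(2) h2(1)]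
  have h: "h \<in> Hom n E Y" unfolding h_def by (rule Hom_minus[OF S(2) hc])
  have gh: "g \<circ>\<^sub>h h = pro"
    unfolding h_def hcomp_minus_right[OF S(2,5) hc] hcomp_assoc[symmetric] h1(2) h2(2) pro_def ..
  note hi = Hom_hcomp[OF Hom_inc h]
  have "pro \<circ>\<^sub>h inc = 0"
  proof (rule Hom_eqI[OF Hom_hcomp[OF Hom_inc Hom_pro] Hom_zero[OF M(4)]])
    show "(pro \<circ>\<^sub>h inc) i x = 0 i x" if "x \<in> vsp (MI n A) i" for i x
      using sesD(8)[OF ses_square that] by (simp add: hcomp_apply)
  qed
  then have "g \<circ>\<^sub>h (h \<circ>\<^sub>h inc) = 0" by (simp only: hcomp_assoc[symmetric] gh)
  from ses_kernel_factor[OF s M(1) hi this]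
  obtain \<phi> where \<phi>: "\<phi> \<in> Hom n (MI n A) (MI n A)" "f \<circ>\<^sub>h \<phi> = h \<circ>\<^sub>h inc" by (rule bexE)
  define c where "c = cst n A \<phi>"
  note idA = Hom_hid[OF M(1)]
  \<comment> \<open>the radical part of \<open>\<phi>\<close>\<close>
  define \<phi>0 where "\<phi>0 = \<phi> + (- c) *\<^sub>C hid (MI n A)"
  have \<phi>0: "\<phi>0 \<in> Hom n (MI n A) (MI n A)" unfolding \<phi>0_def by (rule Hom_plus[OF M(1) \<phi>(1) Hom_scaleC[OF M(1) idA]])
  have "cst n A ((- c) *\<^sub>C hid (MI n A)) = - c * cst n A (hid (MI n A))"
    by (simp add: cst_def scaleC_fun_def scaleC_complex_def)
  then have "cst n A \<phi>0 = 0" unfolding \<phi>0_def cst_add cst_hid[OF n A nonempty(1)] by (simp add: c_def)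
  from radical_factor[OF \<phi>0 this] obtain \<rho> where \<rho>: "\<rho> \<in> Hom n E (MI n A)" "\<rho> \<circ>\<^sub>h inc = \<phi>0" by (rule bexE)
  note fr' = Hom_hcomp[OF \<rho>(1) S(4)]
  define k where "k = h - (f \<circ>\<^sub>h \<rho>)"
  have k: "k \<in> Hom n E Y" unfolding k_def by (rule Hom_minus[OF S(2) h fr'])
  have gf: "g \<circ>\<^sub>h (f \<circ>\<^sub>h \<rho>) = 0"
  proof (rule Hom_eqI[OF Hom_hcomp[OF fr' S(5)] Hom_zero[OF S(3)]])
    show "(g \<circ>\<^sub>h (f \<circ>\<^sub>h \<rho>)) i y = 0 i y" if "y \<in> vsp E i" for i y
      using S(8)[OF Hom_in[OF \<rho>(1) that]] by (simp add: hcomp_apply)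
  qed
  have gk: "g \<circ>\<^sub>h k = pro" unfolding k_def hcomp_minus_right[OF S(2,5) h fr'] gf gh by simp
  have "k i (inc i x) = f i (c *\<^sub>C x)" if x: "x \<in> vsp (MI n A) i" for i x
  proof -
    note \<phi>x = Hom_in[OF \<phi>(1) x] and cx = dmod_scale[OF M(1) x]
    have 1: "h i (inc i x) = f i (\<phi> i x)" using fun_cong[OF fun_cong[OF \<phi>(2)], of i x] by (simp add: hcomp_apply)
    have 2: "\<rho> i (inc i x) = \<phi> i x + (- c) *\<^sub>C x"
      using fun_cong[OF fun_cong[OF \<rho>(2)], of i x] hid_apply[OF x] by (simp add: hcomp_apply \<phi>0_def scaleC_fun_def)
    have "k i (inc i x) = f i (\<phi> i x) - f i (\<phi> i x + (- c) *\<^sub>C x)" by (simp add: k_def hcomp_apply 1 2)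
    also have "\<dots> = f i (c *\<^sub>C x)"
      unfolding Hom_add[OF S(4) \<phi>x cx] Hom_scale[OF S(4) x] by (simp add: cvec.scale_minus_left)
    finally show ?thesis .
  qed
  then show ?thesis using k gk by (intro exI[of _ c] bexI[of _ k]) simp_all
qed

lemma ext1_dim:
  assumes sep: "B1 - A = {x1}" "A - B1 = {y1}" "B2 - A = {x2}" "A - B2 = {y2}"
  shows "vectorspace.dim class_ring (ext1 n (MI n C) (MI n A)) = 1"
proof -
  obtain E' :: "univ rep" and \<phi> where E': "dmod n E'" "is_iso n E E' \<phi>" by (rule univ_copy[OF dE])
  obtain \<psi> where iso: "\<phi> \<in> Hom n E E'" "\<psi> \<in> Hom n E' E" "\<psi> \<circ>\<^sub>h \<phi> = hid E" "\<phi> \<circ>\<^sub>h \<psi> = hid E'"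
    by (rule is_isoE[OF E'(2)])
  define f0 where "f0 = \<phi> \<circ>\<^sub>h inc"
  define g0 where "g0 = pro \<circ>\<^sub>h \<psi>"
  note iA = a_injective_MI[OF n A] and iC = a_injective_MI[OF n C]
  note mid = E_ses_middle_iso[OF n C _ iA good_middle loop_pow_middle E'(1) iso]
  have e0: "E_ses n (MI n A) E' (MI n C) f0 g0" unfolding f0_def g0_def by (rule mid[OF ses_square])
  note S0 = sesD[OF E_sesD(1)[OF n e0]]
  have g\<phi>: "g0 \<circ>\<^sub>h \<phi> = pro" by (simp only: g0_def hcomp_assoc iso(3) hcomp_hid_right[OF Hom_pro])
  have \<psi>f: "\<psi> \<circ>\<^sub>h f0 = inc" by (simp only: f0_def hcomp_assoc[symmetric] iso(3) hcomp_hid_left[OF Hom_inc])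
  show ?thesis
  proof (rule ext1_dim_1[OF n e0])
    fix s assume s: "s \<in> Hom n (MI n C) E'"
    show "g0 \<circ>\<^sub>h s \<noteq> hid (MI n C)" using nonsplit[OF Hom_hcomp[OF s iso(2)]] by (simp only: g0_def hcomp_assoc) simp
  next
    fix e :: "(univ, univ) extn" assume "e \<in> extensions n (MI n C) (MI n A)"
    moreover obtain Y f g where e: "e = (Y, f, g)" by (rule prod_cases3)
    ultimately have "E_ses n (MI n A) Y (MI n C) f g" by (simp add: extensions_def)
    from extension_from_square[OF sep this] obtain c h where h: "h \<in> Hom n E Y"
      "\<forall>i. \<forall>x\<in>vsp (MI n A) i. h i (inc i x) = f i (c *\<^sub>C x)" "g \<circ>\<^sub>h h = pro" by (elim exE bexE conjE)
    have "is_scaled n (MI n A) c (E', f0, g0) (Y, f, g)"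
    proof (rule is_scaledI[OF Hom_hcomp[OF iso(2) h(1)]])
      show "(h \<circ>\<^sub>h \<psi>) i (f0 i x) = f i (c *\<^sub>C x)" if "x \<in> vsp (MI n A) i" for i x
        using h(2) that fun_cong[OF fun_cong[OF \<psi>f], of i x] by (simp add: hcomp_apply)
      show "g \<circ>\<^sub>h (h \<circ>\<^sub>h \<psi>) = g0" by (simp only: hcomp_assoc[symmetric] h(3) g0_def)
    qed
    then show "\<exists>c. is_scaled n (MI n A) c (E', f0, g0) e" unfolding e by (rule exI)
  next
    fix c :: complex
    show "\<exists>e\<in>extensions n (MI n C) (MI n A). is_scaled n (MI n A) c (E', f0, g0) e"
    proof (cases "c = 0")
      case False
      have "E_ses n (MI n A) E' (MI n C) (\<phi> \<circ>\<^sub>h ((1 / c) *\<^sub>C inc)) g0"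
        unfolding g0_def by (rule mid[OF ses_scale[OF ses_square]]) (use False in simp)
      moreover have "\<phi> \<circ>\<^sub>h ((1 / c) *\<^sub>C inc) = (1 / c) *\<^sub>C f0"
        unfolding f0_def by (rule hcomp_scaleC_right[OF iso(1) Hom_inc])
      ultimately have x: "(E', (1 / c) *\<^sub>C f0, g0) \<in> extensions n (MI n C) (MI n A)" by (simp add: extensions_def)
      have "is_scaled n (MI n A) c (E', f0, g0) (E', (1 / c) *\<^sub>C f0, g0)"
      proof (rule is_scaledI[OF Hom_hid[OF E'(1)] _ hcomp_hid_right[OF S0(5)]])
        fix i x assume x: "x \<in> vsp (MI n A) i"
        show "hid E' i (f0 i x) = ((1 / c) *\<^sub>C f0) i (c *\<^sub>C x)"
          using Hom_scale[OF S0(4) x, of c] hid_apply[OF Hom_in[OF S0(4) x]] False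
          by (simp add: scaleC_fun_def scaleC_scaleC scaleC_one)
      qed
      then show ?thesis using x by (rule bexI)
    next
      case True
      let ?W = "MI n A \<oplus>\<^sub>r MI n C"
      note W = dmod_dsum[OF M(1,4)]
      obtain W' :: "univ rep" and \<chi> where W': "dmod n W'" "is_iso n ?W W' \<chi>" by (rule univ_copy[OF W])
      obtain \<xi> where iso': "\<chi> \<in> Hom n ?W W'" "\<xi> \<in> Hom n W' ?W" "\<xi> \<circ>\<^sub>h \<chi> = hid ?W" "\<chi> \<circ>\<^sub>h \<xi> = hid W'"
        by (rule is_isoE[OF W'(2)])
      have "(loop ?W ^^ card C) y = 0" if "y \<in> vsp ?W 0" for y
      proof -
        obtain u v where y: "y = (u, v)" by (rule prod.exhaust)
        have uv: "u \<in> vsp (MI n A) 0" "v \<in> vsp (MI n C) 0" using that y by auto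
        show ?thesis
          using loop_pow_MI_zero[OF n A uv(1)] loop_pow_MI_zero[OF n C uv(2)]
          by (simp add: y loop_dsum_pow cards zero_prod_def)
      qed
      from E_ses_middle_iso[OF n C ses_dsum[OF M(1,4)] iA a_injective_dsum[OF iA iC] this W'(1) iso']
      have x: "(W', \<chi> \<circ>\<^sub>h hinl (MI n A) (MI n C), hsnd (MI n A) (MI n C) \<circ>\<^sub>h \<xi>) \<in> extensions n (MI n C) (MI n A)"
        by (simp add: extensions_def)
      note r = Hom_hinr[OF M(1,4)]
      have "is_scaled n (MI n A) c (E', f0, g0) (W', \<chi> \<circ>\<^sub>h hinl (MI n A) (MI n C), hsnd (MI n A) (MI n C) \<circ>\<^sub>h \<xi>)"
      proof (rule is_scaledI[OF Hom_hcomp[OF Hom_hcomp[OF S0(5) r] iso'(1)]])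
        fix i x assume x: "x \<in> vsp (MI n A) i"
        show "(\<chi> \<circ>\<^sub>h (hinr (MI n A) (MI n C) \<circ>\<^sub>h g0)) i (f0 i x) = (\<chi> \<circ>\<^sub>h hinl (MI n A) (MI n C)) i (c *\<^sub>C x)"
          using S0(8)[OF x] Hom_0[OF r] Hom_0[OF Hom_hinl[OF M(1,4)]] by (simp add: hcomp_apply True)
      next
        have "(hsnd (MI n A) (MI n C) \<circ>\<^sub>h \<xi>) \<circ>\<^sub>h (\<chi> \<circ>\<^sub>h (hinr (MI n A) (MI n C) \<circ>\<^sub>h g0)) =
          hsnd (MI n A) (MI n C) \<circ>\<^sub>h ((\<xi> \<circ>\<^sub>h \<chi>) \<circ>\<^sub>h (hinr (MI n A) (MI n C) \<circ>\<^sub>h g0))" by (simp only: hcomp_assoc)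
        also have "\<dots> = g0"
          unfolding iso'(3) hcomp_hid_left[OF Hom_hcomp[OF S0(5) r]]
          by (simp only: hcomp_assoc[symmetric] hsnd_hinr[OF M(1,4)] hcomp_hid_left[OF S0(5)])
        finally show "(hsnd (MI n A) (MI n C) \<circ>\<^sub>h \<xi>) \<circ>\<^sub>h (\<chi> \<circ>\<^sub>h (hinr (MI n A) (MI n C) \<circ>\<^sub>h g0)) = g0" .
      qed
      then show ?thesis using x by (rule bexI)
    qed
  qed
qed

end

section \<open>Weakly separated sets\<close>

text \<open>
  What weak separation of two sets says about the differences \<open>P\<close> and \<open>Q\<close>: no element of the smaller
  one lies between two elements of the larger one.
\<close>

definition noncrossing :: "nat set \<Rightarrow> nat set \<Rightarrow> bool" where
  "noncrossing P Q \<longleftrightarrow>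
     (card Q \<le> card P \<and> \<not> (\<exists>p\<in>P. \<exists>q\<in>Q. \<exists>p'\<in>P. p < q \<and> q < p')) \<or>
     (card P \<le> card Q \<and> \<not> (\<exists>q\<in>Q. \<exists>p\<in>P. \<exists>q'\<in>Q. q < p \<and> p < q'))"

lemma noncrossing_sym: "noncrossing P Q \<Longrightarrow> noncrossing Q P"
  unfolding noncrossing_def by (erule disjE) simp_all

lemma card_Diff_le_iff:
  assumes "finite I" "finite K"
  shows "card (K - I) \<le> card (I - K) \<longleftrightarrow> card K \<le> card I"
proof -
  have "card K = card (K - I) + card (K \<inter> I)" "card I = card (I - K) + card (K \<inter> I)"
    using card_Int_Diff[OF assms(2), of I] card_Int_Diff[OF assms(1), of K] by (simp_all add: Int_commute)
  then show ?thesis by simp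
qed

lemma weakly_separated_noncrossing:
  assumes "finite I" "finite K" "weakly_separated I K"
  shows "noncrossing (I - K) (K - I)"
proof -
  have no: "\<not> (\<exists>p\<in>P. \<exists>q\<in>Q. \<exists>p'\<in>P. p < q \<and> q < p')"
    if "\<exists>Q' Q''. Q = Q' \<union> Q'' \<and> Q' \<inter> Q'' = {} \<and> set_less Q' P \<and> set_less P Q''" for P Q :: "nat set"
  proof
    have "\<exists>Q' Q''. Q = Q' \<union> Q'' \<and> set_less Q' P \<and> set_less P Q''" using that by blast
    then obtain Q' Q'' where Q: "Q = Q' \<union> Q''" "set_less Q' P" "set_less P Q''" by (elim exE conjE)
    assume "\<exists>p\<in>P. \<exists>q\<in>Q. \<exists>p'\<in>P. p < q \<and> q < p'"
    then obtain p q p' where pq: "p \<in> P" "q \<in> Q" "p' \<in> P" "p < q" "q < p'" by (elim bexE conjE)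
    from pq(2) Q(1) have "q \<in> Q' \<or> q \<in> Q''" by simp
    then show False
    proof
      assume "q \<in> Q'"
      then have "q < p" using Q(2) pq(1) by (simp add: set_less_def)
      then show False using pq(4) by simp
    next
      assume "q \<in> Q''"
      then have "p' < q" using Q(3) pq(3) by (simp add: set_less_def)
      then show False using pq(5) by simp
    qed
  qed
  from assms(3) show ?thesis
    unfolding weakly_separated_def noncrossing_def
    using no[of "K - I" "I - K"] no[of "I - K" "K - I"] card_Diff_le_iff[OF assms(1,2)] card_Diff_le_iff[OF assms(2,1)]
    by (elim disjE conjE) simp_all
qed

text \<open>
  The last element of \<open>P \<union> Q\<close> up to \<open>lo\<close> lies in \<open>P\<close> and the first one after \<open>hi\<close> lies in \<open>Q\<close>.  With
  \<open>q < p\<close> in the middle an element before gives the pattern \<open>P Q P\<close> and one after gives \<open>Q P Q\<close>, so at most one side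
  is occupied and \<open>noncrossing\<close> compares the cardinalities.  Together with the domination on that
  side this yields an element of the other set there, which completes the second pattern.
\<close>

lemma balanced_patterns_confined:
  fixes P Q :: "nat set"
  assumes fin: "finite P" "finite Q" and disj: "P \<inter> Q = {}" and pos: "0 \<notin> P" "0 \<notin> Q"
    and before: "\<And>j. j \<le> lo \<Longrightarrow> card (Q \<inter> {j<..lo}) \<le> card (P \<inter> {j<..lo})"
    and mid: "card (P \<inter> {lo<..hi}) = card (Q \<inter> {lo<..hi})"
    and after: "\<And>j. hi \<le> j \<Longrightarrow> card (P \<inter> {hi<..j}) \<le> card (Q \<inter> {hi<..j})"
    and pq: "q \<in> Q" "p \<in> P" "lo < q" "q < p" "p \<le> hi" and nc: "noncrossing P Q"
  shows "P \<union> Q \<subseteq> {lo<..hi}"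
proof -
  have lohi: "lo \<le> hi" using pq by linarith
  have cut: "card X = card (X \<inter> {0<..lo}) + card (X \<inter> {lo<..hi}) + card (X \<inter> {hi<..})"
    if X: "finite X" "0 \<notin> X" for X :: "nat set"
  proof -
    have "X = ((X \<inter> {0<..lo}) \<union> (X \<inter> {lo<..hi})) \<union> (X \<inter> {hi<..})"
    proof (rule Set.set_eqI)
      fix x show "x \<in> X \<longleftrightarrow> x \<in> ((X \<inter> {0<..lo}) \<union> (X \<inter> {lo<..hi})) \<union> (X \<inter> {hi<..})"
        using X(2) lohi by (cases "x = 0") auto
    qed
    also have "card \<dots> = card ((X \<inter> {0<..lo}) \<union> (X \<inter> {lo<..hi})) + card (X \<inter> {hi<..})"
      using X(1) lohi by (intro card_Un_disjoint) auto
    also have "card ((X \<inter> {0<..lo}) \<union> (X \<inter> {lo<..hi})) = card (X \<inter> {0<..lo}) + card (X \<inter> {lo<..hi})"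
      using X(1) by (intro card_Un_disjoint) auto
    finally show ?thesis .
  qed
  \<comment> \<open>the last element up to \<open>lo\<close> lies in \<open>P\<close>, the first element after \<open>hi\<close> in \<open>Q\<close>\<close>
  have last: "\<exists>p0\<in>P. p0 \<le> lo \<and> (\<forall>q0\<in>Q. q0 \<le> lo \<longrightarrow> q0 < p0)" if ne: "(P \<union> Q) \<inter> {0<..lo} \<noteq> {}"
  proof -
    let ?B = "(P \<union> Q) \<inter> {0<..lo}"
    have finB: "finite ?B" using fin by simp
    define m where "m = Max ?B"
    have m: "m \<in> ?B" unfolding m_def by (rule Max_in[OF finB ne])
    have max: "x \<le> m" if "x \<in> ?B" for x unfolding m_def by (rule Max_ge[OF finB that])
    have "m \<in> P"
    proof (rule ccontr)
      assume "m \<notin> P"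
      then have mQ: "m \<in> Q" using m by simp
      have "P \<inter> {m - 1<..lo} = {}"
      proof (rule ccontr)
        assume "P \<inter> {m - 1<..lo} \<noteq> {}"
        then obtain x where x: "x \<in> P" "m - 1 < x" "x \<le> lo" by auto
        then have "x \<le> m" using pos(1) by (intro max) (auto intro: gr0I)
        then have "x = m" using x(2) by linarith
        with x(1) \<open>m \<notin> P\<close> show False by simp
      qed
      moreover have "0 < card (Q \<inter> {m - 1<..lo})" using mQ m fin by (auto simp: card_gt_0_iff)
      moreover have "m - 1 \<le> lo" using m by auto
      ultimately show False using before[of "m - 1"] by simp
    qed
    moreover have "q0 < m" if q0: "q0 \<in> Q" "q0 \<le> lo" for q0
    proof -
      have "q0 \<le> m" using q0 pos(2) by (intro max) (auto intro: gr0I)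
      moreover have "q0 \<noteq> m" using q0(1) \<open>m \<in> P\<close> disj by auto
      ultimately show ?thesis by simp
    qed
    ultimately show ?thesis using m by (intro bexI[of _ m]) simp_all
  qed
  have first: "\<exists>q1\<in>Q. hi < q1 \<and> (\<forall>p1\<in>P. hi < p1 \<longrightarrow> q1 < p1)" if ne: "(P \<union> Q) \<inter> {hi<..} \<noteq> {}"
  proof -
    let ?B = "(P \<union> Q) \<inter> {hi<..}"
    have finB: "finite ?B" using fin by simp
    define m where "m = Min ?B"
    have m: "m \<in> ?B" unfolding m_def by (rule Min_in[OF finB ne])
    have min: "m \<le> x" if "x \<in> ?B" for x unfolding m_def by (rule Min_le[OF finB that])
    have "m \<in> Q"
    proof (rule ccontr)
      assume "m \<notin> Q"
      then have mP: "m \<in> P" using m by simp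
      have "Q \<inter> {hi<..m} = {}"
      proof (rule ccontr)
        assume "Q \<inter> {hi<..m} \<noteq> {}"
        then obtain x where x: "x \<in> Q" "hi < x" "x \<le> m" by auto
        then have "m \<le> x" by (intro min) simp
        then have "x = m" using x(3) by linarith
        with x(1) \<open>m \<notin> Q\<close> show False by simp
      qed
      moreover have "0 < card (P \<inter> {hi<..m})" using mP m fin by (auto simp: card_gt_0_iff)
      moreover have "hi \<le> m" using m by auto
      ultimately show False using after[of m] by simp
    qed
    moreover have "m < p1" if p1: "p1 \<in> P" "hi < p1" for p1
    proof -
      have "m \<le> p1" using p1 by (intro min) simp
      moreover have "p1 \<noteq> m" using p1(1) \<open>m \<in> Q\<close> disj by auto
      ultimately show ?thesis by simp
    qed
    ultimately show ?thesis using m by (intro bexI[of _ m]) simp_all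
  qed
  have cb: "card (Q \<inter> {0<..lo}) \<le> card (P \<inter> {0<..lo})" by (rule before) simp
  have ca: "card (P \<inter> {hi<..}) \<le> card (Q \<inter> {hi<..})"
  proof -
    define N where "N = Max (insert hi (P \<union> Q))"
    have N: "x \<le> N" if "x \<in> insert hi (P \<union> Q)" for x
      unfolding N_def by (rule Max_ge) (use fin that in simp_all)
    have "P \<inter> {hi<..N} = P \<inter> {hi<..}" "Q \<inter> {hi<..N} = Q \<inter> {hi<..}" using N by auto
    then show ?thesis using after[OF N] by simp
  qed
  have emptyB: "(P \<union> Q) \<inter> {0<..lo} = {}" and emptyA: "(P \<union> Q) \<inter> {hi<..} = {}"
  proof -
    show B: "(P \<union> Q) \<inter> {0<..lo} = {}"
    proof (rule ccontr)
      assume ne: "(P \<union> Q) \<inter> {0<..lo} \<noteq> {}"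
      obtain p0 where p0: "p0 \<in> P" "p0 \<le> lo" "\<forall>q0\<in>Q. q0 \<le> lo \<longrightarrow> q0 < p0"
        using last[OF ne] by (elim bexE conjE)
      have "p0 < q" "q < p" using p0(2) pq by simp_all
      then have "\<exists>p\<in>P. \<exists>q\<in>Q. \<exists>p'\<in>P. p < q \<and> q < p'"
        by (intro bexI[OF _ p0(1)] bexI[OF _ pq(1)] bexI[OF _ pq(2)] conjI)
      then have nc': "card P \<le> card Q" "\<not> (\<exists>q\<in>Q. \<exists>p\<in>P. \<exists>q'\<in>Q. q < p \<and> p < q')"
        using nc by (auto simp: noncrossing_def)
      have "(P \<union> Q) \<inter> {hi<..} = {}"
      proof (rule ccontr)
        assume ne1: "(P \<union> Q) \<inter> {hi<..} \<noteq> {}"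
        obtain q1 where q1: "q1 \<in> Q" "hi < q1" using first[OF ne1] by (elim bexE conjE)
        have "q < p" "p < q1" using pq q1(2) by simp_all
        then have "\<exists>q\<in>Q. \<exists>p\<in>P. \<exists>q'\<in>Q. q < p \<and> p < q'"
          by (intro bexI[OF _ pq(1)] bexI[OF _ pq(2)] bexI[OF _ q1(1)] conjI)
        with nc'(2) show False ..
      qed
      then have "P \<inter> {hi<..} = {}" "Q \<inter> {hi<..} = {}" by auto
      then have "card (P \<inter> {0<..lo}) \<le> card (Q \<inter> {0<..lo})"
        using nc'(1) cut[OF fin(1) pos(1)] cut[OF fin(2) pos(2)] mid by simp
      moreover have "p0 \<noteq> 0" by (rule notI) (use p0(1) pos(1) in simp)
      then have "p0 \<in> P \<inter> {0<..lo}" using p0(1,2) by simp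
      then have "0 < card (P \<inter> {0<..lo})" using fin by (auto simp: card_gt_0_iff)
      ultimately have "Q \<inter> {0<..lo} \<noteq> {}" using card_gt_0_iff[of "Q \<inter> {0<..lo}"] by linarith
      then obtain q0 where q0: "q0 \<in> Q" "q0 \<le> lo" by auto
      then have "q0 < p0" using p0(3) by simp
      then have "\<exists>q\<in>Q. \<exists>p\<in>P. \<exists>q'\<in>Q. q < p \<and> p < q'"
        using \<open>p0 < q\<close> by (intro bexI[OF _ q0(1)] bexI[OF _ p0(1)] bexI[OF _ pq(1)] conjI)
      with nc'(2) show False ..
    qed
    show "(P \<union> Q) \<inter> {hi<..} = {}"
    proof (rule ccontr)
      assume ne: "(P \<union> Q) \<inter> {hi<..} \<noteq> {}"
      obtain q1 where q1: "q1 \<in> Q" "hi < q1" "\<forall>p1\<in>P. hi < p1 \<longrightarrow> q1 < p1" using first[OF ne] by (elim bexE conjE)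
      have "q < p" "p < q1" using pq q1(2) by simp_all
      then have "\<exists>q\<in>Q. \<exists>p\<in>P. \<exists>q'\<in>Q. q < p \<and> p < q'"
        by (intro bexI[OF _ pq(1)] bexI[OF _ pq(2)] bexI[OF _ q1(1)] conjI)
      then have nc': "card Q \<le> card P" "\<not> (\<exists>p\<in>P. \<exists>q\<in>Q. \<exists>p'\<in>P. p < q \<and> q < p')"
        using nc by (auto simp: noncrossing_def)
      have "P \<inter> {0<..lo} = {}" "Q \<inter> {0<..lo} = {}" using B by auto
      then have "card (Q \<inter> {hi<..}) \<le> card (P \<inter> {hi<..})"
        using nc'(1) cut[OF fin(1) pos(1)] cut[OF fin(2) pos(2)] mid by simp
      moreover have "0 < card (Q \<inter> {hi<..})" using q1(1,2) fin by (auto simp: card_gt_0_iff)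
      ultimately have "P \<inter> {hi<..} \<noteq> {}" using card_gt_0_iff[of "P \<inter> {hi<..}"] by linarith
      then obtain p1 where p1: "p1 \<in> P" "hi < p1" by auto
      then have "q1 < p1" using q1(3) by simp
      then have "\<exists>p\<in>P. \<exists>q\<in>Q. \<exists>p'\<in>P. p < q \<and> q < p'"
        using \<open>p < q1\<close> by (intro bexI[OF _ pq(2)] bexI[OF _ q1(1)] bexI[OF _ p1(1)] conjI)
      with nc'(2) show False ..
    qed
  qed
  show ?thesis
  proof
    fix x assume x: "x \<in> P \<union> Q"
    have "x \<noteq> 0" by (rule notI) (use x pos in simp)
    have "x \<notin> {0<..lo}" using x emptyB by blast
    moreover have "x \<notin> {hi<..}" using x emptyA by blast
    ultimately have "\<not> (0 < x \<and> x \<le> lo)" "\<not> hi < x" by simp_all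
    then show "x \<in> {lo<..hi}" using \<open>x \<noteq> 0\<close> by simp
  qed
qed

text \<open>
  Here \<open>lo\<close> and \<open>hi\<close> are positions where \<open>|Q \<inter> {j<..}| - |P \<inter> {j<..}|\<close> is maximal.  If \<open>P \<union> Q\<close> meets the middle, its
  first element there is in \<open>Q\<close> and its last one in \<open>P\<close>; by the previous lemma all of \<open>P \<union> Q\<close> lies in the
  middle, and the outer points \<open>\<alpha>\<close> and \<open>\<delta>\<close> produce both forbidden patterns.  If \<open>P \<union> Q\<close> avoids the middle, the
  inner points \<open>\<beta> < \<gamma>\<close> play the roles of \<open>q < p\<close> in the previous lemma.
\<close>

lemma exchange_obstruction:
  fixes P Q :: "nat set"
  assumes fin: "finite P" "finite Q" and disj: "P \<inter> Q = {}" and pos: "0 \<notin> P" "0 \<notin> Q"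
    and before: "\<And>j. j \<le> lo \<Longrightarrow> card (Q \<inter> {j<..lo}) \<le> card (P \<inter> {j<..lo})"
    and mid: "card (P \<inter> {lo<..hi}) = card (Q \<inter> {lo<..hi})"
    and midj: "\<And>j. lo \<le> j \<Longrightarrow> j \<le> hi \<Longrightarrow> card (P \<inter> {lo<..j}) \<le> card (Q \<inter> {lo<..j})"
    and after: "\<And>j. hi \<le> j \<Longrightarrow> card (P \<inter> {hi<..j}) \<le> card (Q \<inter> {hi<..j})"
    and nc: "noncrossing P Q"
    and in_mid: "lo < \<beta>" "\<beta> < \<gamma>" "\<gamma> \<le> hi"
    and out: "(\<alpha> \<le> lo \<and> hi < \<delta>) \<or> (hi < \<delta> \<and> \<delta> < \<alpha>) \<or> (\<delta> < \<alpha> \<and> \<alpha> \<le> lo)"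
    and nc1: "(P \<union> Q) \<inter> {lo<..hi} = {} \<Longrightarrow> noncrossing (insert \<gamma> P) (insert \<beta> Q)"
    and nc2: "P \<union> Q \<subseteq> {lo<..hi} \<Longrightarrow> noncrossing (insert \<alpha> P) (insert \<delta> Q)"
  shows "P = {} \<and> Q = {}"
proof (cases "(P \<union> Q) \<inter> {lo<..hi} = {}")
  case True
  have off: "\<beta> \<notin> P" "\<beta> \<notin> Q" "\<gamma> \<notin> P" "\<gamma> \<notin> Q" using True in_mid by auto
  have skip: "insert z X \<inter> {u<..v} = X \<inter> {u<..v}" if "z \<notin> {u<..v}" for z X and u v :: nat
    using that by auto
  have "insert \<gamma> P \<union> insert \<beta> Q \<subseteq> {lo<..hi}"
  proof (rule balanced_patterns_confined[of "insert \<gamma> P" "insert \<beta> Q" lo hi \<beta> \<gamma>])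
    show "finite (insert \<gamma> P)" "finite (insert \<beta> Q)" using fin by simp_all
    show "insert \<gamma> P \<inter> insert \<beta> Q = {}" using disj off in_mid by auto
    show "0 \<notin> insert \<gamma> P" "0 \<notin> insert \<beta> Q" using pos in_mid by auto
    show "card (insert \<beta> Q \<inter> {j<..lo}) \<le> card (insert \<gamma> P \<inter> {j<..lo})" if "j \<le> lo" for j
      using before[OF that] in_mid by (simp add: skip)
    show "card (insert \<gamma> P \<inter> {hi<..j}) \<le> card (insert \<beta> Q \<inter> {hi<..j})" if "hi \<le> j" for j
      using after[OF that] in_mid by (simp add: skip)
    have "P \<inter> {lo<..hi} = {}" "Q \<inter> {lo<..hi} = {}" using True by auto
    then have "insert \<gamma> P \<inter> {lo<..hi} = {\<gamma>}" "insert \<beta> Q \<inter> {lo<..hi} = {\<beta>}" using in_mid by auto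
    then show "card (insert \<gamma> P \<inter> {lo<..hi}) = card (insert \<beta> Q \<inter> {lo<..hi})" by simp
    show "noncrossing (insert \<gamma> P) (insert \<beta> Q)" by (rule nc1[OF True])
  qed (use in_mid in simp_all)
  then show ?thesis using True by auto
next
  case False
  let ?B = "(P \<union> Q) \<inter> {lo<..hi}"
  have finB: "finite ?B" using fin by simp
  define q where "q = Min ?B"
  define p where "p = Max ?B"
  have qB: "q \<in> ?B" unfolding q_def by (rule Min_in[OF finB False])
  have pB: "p \<in> ?B" unfolding p_def by (rule Max_in[OF finB False])
  have qmin: "q \<le> x" and pmax: "x \<le> p" if "x \<in> ?B" for x
    unfolding q_def p_def by (rule Min_le[OF finB that], rule Max_ge[OF finB that])
  have q: "q \<in> Q"
  proof (rule ccontr)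
    assume "q \<notin> Q"
    then have qP: "q \<in> P" using qB by simp
    have "Q \<inter> {lo<..q} = {}"
    proof (rule ccontr)
      assume "Q \<inter> {lo<..q} \<noteq> {}"
      then obtain x where x: "x \<in> Q" "lo < x" "x \<le> q" by auto
      then have "q \<le> x" using qB by (intro qmin) auto
      then have "x = q" using x(3) by simp
      with x(1) \<open>q \<notin> Q\<close> show False by simp
    qed
    moreover have "0 < card (P \<inter> {lo<..q})" using qP qB fin by (auto simp: card_gt_0_iff)
    moreover have "lo \<le> q" "q \<le> hi" using qB by auto
    ultimately show False using midj[of q] by simp
  qed
  have p: "p \<in> P"
  proof (rule ccontr)
    assume "p \<notin> P"
    then have pQ: "p \<in> Q" using pB by simp
    have split: "X \<inter> {lo<..hi} = (X \<inter> {lo<..p - 1}) \<union> (X \<inter> {p})" if "X \<subseteq> P \<union> Q" for X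
    proof (rule Set.set_eqI)
      fix x
      show "x \<in> X \<inter> {lo<..hi} \<longleftrightarrow> x \<in> (X \<inter> {lo<..p - 1}) \<union> (X \<inter> {p})"
        using pmax[of x] pB that by auto
    qed
    have "P \<inter> {lo<..hi} = P \<inter> {lo<..p - 1}" using split[of P] \<open>p \<notin> P\<close> by simp
    moreover have "card (Q \<inter> {lo<..hi}) = card (Q \<inter> {lo<..p - 1}) + 1"
    proof -
      have "Q \<inter> {lo<..hi} = insert p (Q \<inter> {lo<..p - 1})" using split[of Q] pQ by auto
      moreover have "p \<notin> Q \<inter> {lo<..p - 1}" using pB by auto
      ultimately show ?thesis using fin(2) by simp
    qed
    moreover have "lo \<le> p - 1" "p - 1 \<le> hi" using pB by auto
    ultimately show False using midj[of "p - 1"] mid by simp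
  qed
  have lq: "lo < q" and ph: "p \<le> hi" using qB pB by auto
  have "q \<noteq> p" using q p disj by auto
  moreover have "q \<le> p" by (rule qmin[OF pB])
  ultimately have qp: "q < p" by simp
  have "P \<union> Q \<subseteq> {lo<..hi}"
    by (rule balanced_patterns_confined[OF fin disj pos before mid after q p lq qp ph nc])
  then have nc': "noncrossing (insert \<alpha> P) (insert \<delta> Q)" by (rule nc2)
  have one: "\<exists>p\<in>insert \<alpha> P. \<exists>q\<in>insert \<delta> Q. \<exists>p'\<in>insert \<alpha> P. p < q \<and> q < p'"
    using out
  proof (elim disjE)
    assume "\<alpha> \<le> lo \<and> hi < \<delta>"
    then show ?thesis using lq qp p q by (intro bexI[of _ \<alpha>] bexI[of _ q] bexI[of _ p] conjI) simp_all
  next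
    assume "hi < \<delta> \<and> \<delta> < \<alpha>"
    then show ?thesis using ph p by (intro bexI[of _ p] bexI[of _ \<delta>] bexI[of _ \<alpha>] conjI) simp_all
  next
    assume "\<delta> < \<alpha> \<and> \<alpha> \<le> lo"
    then show ?thesis using lq qp p q by (intro bexI[of _ \<alpha>] bexI[of _ q] bexI[of _ p] conjI) simp_all
  qed
  have two: "\<exists>q\<in>insert \<delta> Q. \<exists>p\<in>insert \<alpha> P. \<exists>q'\<in>insert \<delta> Q. q < p \<and> p < q'"
    using out
  proof (elim disjE)
    assume "\<alpha> \<le> lo \<and> hi < \<delta>"
    then show ?thesis using qp ph p q by (intro bexI[of _ q] bexI[of _ p] bexI[of _ \<delta>] conjI) simp_all
  next
    assume "hi < \<delta> \<and> \<delta> < \<alpha>"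
    then show ?thesis using qp ph p q by (intro bexI[of _ q] bexI[of _ p] bexI[of _ \<delta>] conjI) simp_all
  next
    assume "\<delta> < \<alpha> \<and> \<alpha> \<le> lo"
    then show ?thesis using lq q by (intro bexI[of _ \<delta>] bexI[of _ \<alpha>] bexI[of _ q] conjI) simp_all
  qed
  from nc' one two show ?thesis unfolding noncrossing_def by (elim disjE conjE) simp_all
qed

lemma tail_count:
  assumes fin: "finite I" "finite K" and "j \<le> l"
  shows "card ((K - I) \<inter> {j<..l}) + tail I j + tail K l = card ((I - K) \<inter> {j<..l}) + tail K j + tail I l"
proof -
  have t: "tail X j = card (X \<inter> {j<..l}) + tail X l" if "finite X" for X
  proof -
    have "{k \<in> X. j < k} = (X \<inter> {j<..l}) \<union> {k \<in> X. l < k}" using \<open>j \<le> l\<close> by auto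
    moreover have "card ((X \<inter> {j<..l}) \<union> {k \<in> X. l < k}) = card (X \<inter> {j<..l}) + card {k \<in> X. l < k}"
      using that by (intro card_Un_disjoint) auto
    ultimately show ?thesis by (simp add: tail_def)
  qed
  have d: "card (X \<inter> {j<..l}) = card ((X - Y) \<inter> {j<..l}) + card (X \<inter> Y \<inter> {j<..l})" if "finite X" for X Y
  proof -
    have "X \<inter> {j<..l} = ((X - Y) \<inter> {j<..l}) \<union> (X \<inter> Y \<inter> {j<..l})" by auto
    also have "card \<dots> = card ((X - Y) \<inter> {j<..l}) + card (X \<inter> Y \<inter> {j<..l})"
      using that by (intro card_Un_disjoint) auto
    finally show ?thesis .
  qed
  have "I \<inter> K = K \<inter> I" by (rule Int_commute)
  then show ?thesis using t[OF fin(1)] t[OF fin(2)] d[OF fin(1), of K] d[OF fin(2), of I] by simp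
qed

lemma tight_positions:
  fixes P Q :: "nat set"
  assumes I: "I \<subseteq> {1..n}" and K: "K \<subseteq> {1..n}" and le: "\<And>j. tail K j \<le> i + tail I j"
    and lohi: "lo < hi" and tight: "tail K lo = i + tail I lo" "tail K hi = i + tail I hi"
    and nc: "noncrossing (I - K) (K - I)"
    and in_mid: "lo < \<beta>" "\<beta> < \<gamma>" "\<gamma> \<le> hi"
    and out: "(\<alpha> \<le> lo \<and> hi < \<delta>) \<or> (hi < \<delta> \<and> \<delta> < \<alpha>) \<or> (\<delta> < \<alpha> \<and> \<alpha> \<le> lo)"
    and nc1: "((I - K) \<union> (K - I)) \<inter> {lo<..hi} = {} \<Longrightarrow> noncrossing (insert \<gamma> (I - K)) (insert \<beta> (K - I))"
    and nc2: "(I - K) \<union> (K - I) \<subseteq> {lo<..hi} \<Longrightarrow> noncrossing (insert \<alpha> (I - K)) (insert \<delta> (K - I))"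
  shows "K = I"
proof -
  have fin: "finite I" "finite K" using I K by (auto intro: finite_subset)
  note count = tail_count[OF fin]
  have "I - K = {} \<and> K - I = {}"
  proof (rule exchange_obstruction[of "I - K" "K - I" lo hi \<beta> \<gamma> \<alpha> \<delta>])
    show "finite (I - K)" "finite (K - I)" using fin by simp_all
    show "(I - K) \<inter> (K - I) = {}" by auto
    show "0 \<notin> I - K" "0 \<notin> K - I" using I K by auto
    show "card ((K - I) \<inter> {j<..lo}) \<le> card ((I - K) \<inter> {j<..lo})" if "j \<le> lo" for j
      using count[OF that] le[of j] tight by linarith
    show "card ((I - K) \<inter> {lo<..hi}) = card ((K - I) \<inter> {lo<..hi})"
      using count[of lo hi] lohi tight by simp
    show "card ((I - K) \<inter> {lo<..j}) \<le> card ((K - I) \<inter> {lo<..j})" if "lo \<le> j" for j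
      using count[OF that] le[of j] tight by linarith
    show "card ((I - K) \<inter> {hi<..j}) \<le> card ((K - I) \<inter> {hi<..j})" if "hi \<le> j" for j
      using count[OF that] le[of j] tight by linarith
  qed (fact nc in_mid out nc1 nc2)+
  then show ?thesis by auto
qed


text \<open>
  The cyclic interval \<open>[a, b)\<close>.  For \<open>a \<noteq> b\<close> it consists of the \<open>j\<close> with
  \<open>of_bool (j < a) < of_bool (j < b) + of_bool (b < a)\<close>, that is, of the vertices where exchanging \<open>b\<close>
  for \<open>a\<close>, together with the factor \<open>t\<close> if \<open>b < a\<close>, loses a dimension.
\<close>

definition arc :: "nat \<Rightarrow> nat \<Rightarrow> nat \<Rightarrow> bool" where
  "arc a b j \<longleftrightarrow> (if a < b then a \<le> j \<and> j < b else a \<le> j \<or> j < b)"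

text \<open>
  Replacing \<open>b\<close> by \<open>a\<close> in the target costs one dimension on the cyclic interval \<open>[a, b)\<close>, which is
  affordable when the inequalities are strict there.  If \<open>b < a\<close>, the interval contains \<open>n\<close>, where both tails vanish,
  and strictness there means \<open>i \<ge> 1\<close>.
\<close>

lemma raise_target:
  assumes L: "L \<subseteq> {1..n}" "a \<notin> L" "b \<notin> L" "e \<notin> L" "a \<noteq> b" "a \<noteq> e" "b \<noteq> e" "{a, b, e} \<subseteq> {1..n}"
    and K: "K \<subseteq> {1..n}" and h: "hle i K (L \<union> {b, e})"
    and slack: "\<And>j. arc a b j \<Longrightarrow> tail K j \<noteq> i + tail (L \<union> {b, e}) j"
  shows "of_bool (b < a) \<le> i \<and> hle (i - of_bool (b < a)) K (L \<union> {a, e})"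
proof -
  note t = tail_insert2[OF L(1,3,4,7)] tail_insert2[OF L(1,2,4,6)]
  have i: "of_bool (b < a) \<le> i"
  proof (cases "b < a")
    case True
    have "arc a b n" using True L(8) by (simp add: arc_def)
    then have "tail K n \<noteq> i + tail (L \<union> {b, e}) n" by (rule slack)
    then show ?thesis using tail_outside[OF K, of n] tail_outside[of "L \<union> {b, e}" n n] L by simp
  qed simp
  have "tail K j \<le> i - of_bool (b < a) + tail (L \<union> {a, e}) j" for j
  proof (cases "arc a b j")
    case True
    then have "tail K j < i + tail (L \<union> {b, e}) j" using slack[OF True] hleD[OF h, of j] by simp
    then have "tail K j < i + (tail L j + of_bool (j < b) + of_bool (j < e))" unfolding t .
    moreover have "of_bool (j < b) + of_bool (b < a) \<le> (of_bool (j < a) + 1 :: nat)"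
      using True L(5) by (auto simp: arc_def of_bool_def split: if_splits)
    ultimately show ?thesis unfolding t using i by linarith
  next
    case False
    have "tail K j \<le> i + (tail L j + of_bool (j < b) + of_bool (j < e))" using hleD[OF h, of j] unfolding t .
    moreover have "of_bool (j < b) + of_bool (b < a) \<le> (of_bool (j < a) :: nat)"
      using False L(5) by (auto simp: arc_def of_bool_def split: if_splits)
    ultimately show ?thesis unfolding t using i by linarith
  qed
  then show ?thesis using i by (simp add: hle_def)
qed

lemma raise_source:
  assumes L: "L \<subseteq> {1..n}" "c \<notin> L" "d \<notin> L" "e \<notin> L" "c \<noteq> d" "c \<noteq> e" "d \<noteq> e" "{c, d, e} \<subseteq> {1..n}"
    and K: "K \<subseteq> {1..n}" and h: "hle i (L \<union> {c, e}) K"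
    and slack: "\<And>j. arc c d j \<Longrightarrow> tail (L \<union> {c, e}) j \<noteq> i + tail K j"
  shows "of_bool (d < c) \<le> i \<and> hle (i - of_bool (d < c)) (L \<union> {d, e}) K"
proof -
  note t = tail_insert2[OF L(1,2,4,6)] tail_insert2[OF L(1,3,4,7)]
  have i: "of_bool (d < c) \<le> i"
  proof (cases "d < c")
    case True
    have "arc c d n" using True L(8) by (simp add: arc_def)
    then have "tail (L \<union> {c, e}) n \<noteq> i + tail K n" by (rule slack)
    then show ?thesis using tail_outside[OF K, of n] tail_outside[of "L \<union> {c, e}" n n] L by simp
  qed simp
  have "tail (L \<union> {d, e}) j \<le> i - of_bool (d < c) + tail K j" for j
  proof (cases "arc c d j")
    case True
    then have "tail (L \<union> {c, e}) j < i + tail K j" using slack[OF True] hleD[OF h, of j] by simp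
    then have "tail L j + of_bool (j < c) + of_bool (j < e) < i + tail K j" unfolding t .
    moreover have "of_bool (j < d) + of_bool (d < c) \<le> (of_bool (j < c) + 1 :: nat)"
      using True L(5) by (auto simp: arc_def of_bool_def split: if_splits)
    ultimately show ?thesis unfolding t using i by linarith
  next
    case False
    have "tail L j + of_bool (j < c) + of_bool (j < e) \<le> i + tail K j" using hleD[OF h, of j] unfolding t .
    moreover have "of_bool (j < d) + of_bool (d < c) \<le> (of_bool (j < c) :: nat)"
      using False L(5) by (auto simp: arc_def of_bool_def split: if_splits)
    ultimately show ?thesis unfolding t using i by linarith
  qed
  then show ?thesis using i by (simp add: hle_def)
qed

context
  fixes n :: nat and L K :: "nat set" and a b c d x y i :: nat
  assumes L: "L \<subseteq> {1..n}" "{a, b, c, d} \<subseteq> {1..n}" "L \<inter> {a, b, c, d} = {}" and dist: "distinct [a, b, c, d]"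
    and K: "K \<subseteq> {1..n}"
    and xy: "x < b" "b < c" "c \<le> y"
    and out: "(a \<le> x \<and> y < d) \<or> (y < d \<and> d < a) \<or> (d < a \<and> a \<le> x)"
    and ws: "weakly_separated (L \<union> {a, b}) K" "weakly_separated (L \<union> {c, d}) K"
begin

text \<open>
  With \<open>x < y\<close> tight, \<open>b\<close> and \<open>c\<close> are the inner points and \<open>a\<close> and \<open>d\<close> the outer ones.  Depending on where \<open>K\<close>
  differs from \<open>L \<union> {b, d}\<close>, the excluded pattern is one between \<open>K\<close> and \<open>L \<union> {c, d}\<close> or \<open>L \<union> {a, b}\<close>.
\<close>

lemma tight_target:
  assumes w: "weakly_separated (L \<union> {b, d}) K" and h: "hle i K (L \<union> {b, d})"
    and tight: "tail K x = i + tail (L \<union> {b, d}) x" "tail K y = i + tail (L \<union> {b, d}) y"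
  shows "K = L \<union> {b, d}"
proof -
  have fin: "finite L" "finite K" using L(1) K by (auto intro: finite_subset)
  have nin: "a \<notin> L" "b \<notin> L" "c \<notin> L" "d \<notin> L" using L(3) by auto
  have neq: "a \<noteq> b" "a \<noteq> c" "a \<noteq> d" "b \<noteq> c" "b \<noteq> d" "c \<noteq> d" using dist by auto
  have nc: "noncrossing (X - K) (K - X)" if "finite X" "weakly_separated X K" for X
    by (rule weakly_separated_noncrossing[OF that(1) fin(2) that(2)])
  let ?I = "L \<union> {b, d}"
  show ?thesis
  proof (rule tight_positions[of ?I n K i x y b c a d])
    show "?I \<subseteq> {1..n}" using L by simp
    show "noncrossing (?I - K) (K - ?I)" by (rule nc[OF _ w]) (use fin in simp)
    show "noncrossing (insert c (?I - K)) (insert b (K - ?I))" if e: "((?I - K) \<union> (K - ?I)) \<inter> {x<..y} = {}"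
    proof -
      have m: "b \<in> {x<..y}" "c \<in> {x<..y}" using xy by auto
      have bK: "b \<in> K" using e m(1) by blast
      have cK: "c \<notin> K" using e m(2) nin neq by blast
      have "insert c (?I - K) = (L \<union> {c, d}) - K" using bK cK by blast
      moreover have "insert b (K - ?I) = K - (L \<union> {c, d})" using bK cK nin neq by blast
      ultimately show ?thesis using nc[OF _ ws(2)] fin by simp
    qed
    show "noncrossing (insert a (?I - K)) (insert d (K - ?I))" if e: "(?I - K) \<union> (K - ?I) \<subseteq> {x<..y}"
    proof -
      have m: "d \<notin> {x<..y}" "a \<notin> {x<..y}" using out xy by auto
      have dK: "d \<in> K" using e m(1) by blast
      have aK: "a \<notin> K" using e m(2) nin neq by blast
      have "insert a (?I - K) = (L \<union> {a, b}) - K" using dK aK by blast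
      moreover have "insert d (K - ?I) = K - (L \<union> {a, b})" using dK aK nin neq by blast
      ultimately show ?thesis using nc[OF _ ws(1)] fin by simp
    qed
    show "tail K j \<le> i + tail ?I j" for j by (rule hleD[OF h])
  qed (use K tight xy out in simp_all)
qed

lemma tight_source:
  assumes w: "weakly_separated (L \<union> {a, c}) K" and h: "hle i (L \<union> {a, c}) K"
    and tight: "tail (L \<union> {a, c}) x = i + tail K x" "tail (L \<union> {a, c}) y = i + tail K y"
  shows "L \<union> {a, c} = K"
proof -
  have fin: "finite L" "finite K" using L(1) K by (auto intro: finite_subset)
  have nin: "a \<notin> L" "b \<notin> L" "c \<notin> L" "d \<notin> L" using L(3) by auto
  have neq: "a \<noteq> b" "a \<noteq> c" "a \<noteq> d" "b \<noteq> c" "b \<noteq> d" "c \<noteq> d" using dist by auto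
  have nc: "noncrossing (K - X) (X - K)" if "finite X" "weakly_separated X K" for X
    by (rule noncrossing_sym[OF weakly_separated_noncrossing[OF that(1) fin(2) that(2)]])
  let ?I = "L \<union> {a, c}"
  show ?thesis
  proof (rule tight_positions[of K n ?I i x y b c a d])
    show "?I \<subseteq> {1..n}" using L by simp
    show "noncrossing (K - ?I) (?I - K)" by (rule nc[OF _ w]) (use fin in simp)
    show "noncrossing (insert c (K - ?I)) (insert b (?I - K))" if e: "((K - ?I) \<union> (?I - K)) \<inter> {x<..y} = {}"
    proof -
      have m: "b \<in> {x<..y}" "c \<in> {x<..y}" using xy by auto
      have cK: "c \<in> K" using e m(2) by blast
      have bK: "b \<notin> K" using e m(1) nin neq by blast
      have "insert c (K - ?I) = K - (L \<union> {a, b})" using bK cK nin neq by blast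
      moreover have "insert b (?I - K) = (L \<union> {a, b}) - K" using bK cK by blast
      ultimately show ?thesis using nc[OF _ ws(1)] fin by simp
    qed
    show "noncrossing (insert a (K - ?I)) (insert d (?I - K))" if e: "(K - ?I) \<union> (?I - K) \<subseteq> {x<..y}"
    proof -
      have m: "d \<notin> {x<..y}" "a \<notin> {x<..y}" using out xy by auto
      have aK: "a \<in> K" using e m(2) by blast
      have dK: "d \<notin> K" using e m(1) nin neq by blast
      have "insert a (K - ?I) = K - (L \<union> {c, d})" using dK aK nin neq by blast
      moreover have "insert d (?I - K) = (L \<union> {c, d}) - K" using dK aK by blast
      ultimately show ?thesis using nc[OF _ ws(2)] fin by simp
    qed
    show "tail ?I j \<le> i + tail K j" for j by (rule hleD[OF h])
  qed (use K tight xy out in simp_all)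
qed

end

lemma arc_positions:
  assumes cyc: "cyclically_ordered a b c d" and x: "arc a b x" and y: "arc c d y"
  shows "x \<noteq> y"
    and "x < y \<Longrightarrow> x < b \<and> b < c \<and> c \<le> y \<and> ((a \<le> x \<and> y < d) \<or> (y < d \<and> d < a) \<or> (d < a \<and> a \<le> x))"
    and "y < x \<Longrightarrow> y < d \<and> d < a \<and> a \<le> x \<and> ((c \<le> y \<and> x < b) \<or> (x < b \<and> b < c) \<or> (b < c \<and> c \<le> y))"
  using assms unfolding cyclically_ordered_def arc_def by (auto split: if_splits)

text \<open>
  Tight positions \<open>x\<close> and \<open>y\<close> in the two cyclic intervals can occur in either order; the order \<open>y < x\<close> is the order
  \<open>x < y\<close> for the rotated quadruple \<open>c, d, a, b\<close>.
\<close>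

lemma Hom_to_target_splits:
  assumes L: "L \<subseteq> {1..n}" "{a, b, c, d} \<subseteq> {1..n}" "L \<inter> {a, b, c, d} = {}"
    and dist: "distinct [a, b, c, d]" and cyc: "cyclically_ordered a b c d"
    and K: "K \<subseteq> {1..n}" "K \<noteq> L \<union> {b, d}"
    and ws: "weakly_separated (L \<union> {b, d}) K" "weakly_separated (L \<union> {a, b}) K" "weakly_separated (L \<union> {c, d}) K"
    and h: "hle i K (L \<union> {b, d})"
  shows "of_bool (b < a) \<le> i \<and> hle (i - of_bool (b < a)) K (L \<union> {a, d}) \<or>
    of_bool (d < c) \<le> i \<and> hle (i - of_bool (d < c)) K (L \<union> {b, c})"
proof (rule ccontr)
  assume neg: "\<not> ?thesis"
  have nin: "a \<notin> L" "b \<notin> L" "c \<notin> L" "d \<notin> L" using L(3) by auto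
  have neq: "a \<noteq> b" "a \<noteq> c" "a \<noteq> d" "b \<noteq> c" "b \<noteq> d" "c \<noteq> d" using dist by auto
  have sub: "{a, b, d} \<subseteq> {1..n}" "{c, d, b} \<subseteq> {1..n}" using L(2) by simp_all
  have "\<exists>x. arc a b x \<and> tail K x = i + tail (L \<union> {b, d}) x"
    using raise_target[OF L(1) nin(1,2,4) neq(1,3,5) sub(1) K(1) h] neg by blast
  then obtain x where x: "arc a b x" "tail K x = i + tail (L \<union> {b, d}) x" by (elim exE conjE)
  have comm: "L \<union> {d, b} = L \<union> {b, d}" "L \<union> {c, b} = L \<union> {b, c}" "L \<union> {d, c} = L \<union> {c, d}" "L \<union> {b, a} = L \<union> {a, b}" by auto
  have "\<exists>y. arc c d y \<and> tail K y = i + tail (L \<union> {b, d}) y"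
    using raise_target[of L n c d b K i, unfolded comm, OF L(1) nin(3,4,2) neq(6) neq(4)[symmetric] neq(5)[symmetric] sub(2) K(1) h] neg by blast
  then obtain y where y: "arc c d y" "tail K y = i + tail (L \<union> {b, d}) y" by (elim exE conjE)
  note pos = arc_positions[OF cyc x(1) y(1)]
  have "K = L \<union> {b, d}"
  proof (cases "x < y")
    case True
    have p: "x < b" "b < c" "c \<le> y" "(a \<le> x \<and> y < d) \<or> (y < d \<and> d < a) \<or> (d < a \<and> a \<le> x)"
      using pos(2)[OF True] by simp_all
    show ?thesis by (rule tight_target[OF L dist K(1) p ws(2,3,1) h x(2) y(2)])
  next
    case False
    then have "y < x" using pos(1) by simp
    note p = pos(3)[OF this]
    have dist': "distinct [c, d, a, b]" and L': "{c, d, a, b} \<subseteq> {1..n}" "L \<inter> {c, d, a, b} = {}"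
      using dist L(2,3) by auto
    have p': "y < d" "d < a" "a \<le> x" "(c \<le> y \<and> x < b) \<or> (x < b \<and> b < c) \<or> (b < c \<and> c \<le> y)"
      using p by simp_all
    show ?thesis
      using tight_target[of L n c d a b K y x i, unfolded comm, OF L(1) L' dist' K(1) p' ws(3,2,1) h y(2) x(2)] .
  qed
  with K(2) show False ..
qed

lemma Hom_from_source_splits:
  assumes L: "L \<subseteq> {1..n}" "{a, b, c, d} \<subseteq> {1..n}" "L \<inter> {a, b, c, d} = {}"
    and dist: "distinct [a, b, c, d]" and cyc: "cyclically_ordered a b c d"
    and K: "K \<subseteq> {1..n}" "K \<noteq> L \<union> {a, c}"
    and ws: "weakly_separated (L \<union> {a, c}) K" "weakly_separated (L \<union> {a, b}) K" "weakly_separated (L \<union> {c, d}) K"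
    and h: "hle i (L \<union> {a, c}) K"
  shows "of_bool (d < c) \<le> i \<and> hle (i - of_bool (d < c)) (L \<union> {a, d}) K \<or>
    of_bool (b < a) \<le> i \<and> hle (i - of_bool (b < a)) (L \<union> {b, c}) K"
proof (rule ccontr)
  assume neg: "\<not> ?thesis"
  have nin: "a \<notin> L" "b \<notin> L" "c \<notin> L" "d \<notin> L" using L(3) by auto
  have neq: "a \<noteq> b" "a \<noteq> c" "a \<noteq> d" "b \<noteq> c" "b \<noteq> d" "c \<noteq> d" using dist by auto
  have sub: "{a, b, c} \<subseteq> {1..n}" "{c, d, a} \<subseteq> {1..n}" using L(2) by simp_all
  have "\<exists>x. arc a b x \<and> tail (L \<union> {a, c}) x = i + tail K x"
    using raise_source[OF L(1) nin(1,2,3) neq(1,2,4) sub(1) K(1) h] neg by blast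
  then obtain x where x: "arc a b x" "tail (L \<union> {a, c}) x = i + tail K x" by (elim exE conjE)
  have comm: "L \<union> {c, a} = L \<union> {a, c}" "L \<union> {d, a} = L \<union> {a, d}" by auto
  have "\<exists>y. arc c d y \<and> tail (L \<union> {a, c}) y = i + tail K y"
    using raise_source[of L n c d a K i, unfolded comm, OF L(1) nin(3,4,1) neq(6) neq(2)[symmetric] neq(3)[symmetric] sub(2) K(1) h] neg by blast
  then obtain y where y: "arc c d y" "tail (L \<union> {a, c}) y = i + tail K y" by (elim exE conjE)
  note pos = arc_positions[OF cyc x(1) y(1)]
  have "L \<union> {a, c} = K"
  proof (cases "x < y")
    case True
    have p: "x < b" "b < c" "c \<le> y" "(a \<le> x \<and> y < d) \<or> (y < d \<and> d < a) \<or> (d < a \<and> a \<le> x)"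
      using pos(2)[OF True] by simp_all
    show ?thesis by (rule tight_source[OF L dist K(1) p ws(2,3,1) h x(2) y(2)])
  next
    case False
    then have yx: "y < x" using pos(1) by simp
    have p: "y < d" "d < a" "a \<le> x" "(c \<le> y \<and> x < b) \<or> (x < b \<and> b < c) \<or> (b < c \<and> c \<le> y)"
      using pos(3)[OF yx] by simp_all
    have dist': "distinct [c, d, a, b]" and L': "{c, d, a, b} \<subseteq> {1..n}" "L \<inter> {c, d, a, b} = {}"
      using dist L(2,3) by auto
    show ?thesis
      using tight_source[of L n c d a b K y x i, unfolded comm, OF L(1) L' dist' K(1) p ws(3,2,1) h y(2) x(2)] .
  qed
  with K(2) show False by simp
qed

section \<open>Mutation sequences\<close>

lemma in_add_decomposition:
  assumes "dmod n R" "in_add n R X"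
  shows "\<exists>(m::nat) \<iota> p. (\<forall>k. k < m \<longrightarrow> \<iota> k \<in> Hom n X R) \<and> (\<forall>k. k < m \<longrightarrow> p k \<in> Hom n R X) \<and> (\<Sum>k<m. p k \<circ>\<^sub>h \<iota> k) = hid X"
proof (rule in_addE[OF assms])
  fix m :: nat and \<iota> p assume a: "\<And>k. k < m \<Longrightarrow> \<iota> k \<in> Hom n X R" "\<And>k. k < m \<Longrightarrow> p k \<in> Hom n R X"
    and id: "(\<Sum>k<m. p k \<circ>\<^sub>h \<iota> k) = hid X"
  show ?thesis by (intro exI[of _ m] exI[of _ \<iota>] exI[of _ p] conjI allI impI a id)
qed

text \<open>
  The maps that lift along \<open>f\<close> are closed under sums and under composition from the right, so it is enough to
  lift maps from the indecomposable summands of \<open>R\<close>.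
\<close>

lemma lift_from_add:
  assumes R: "dmod n R" and E: "dmod n E" and N: "dmod n N" and f: "f \<in> Hom n E N" and K: "finite K" and M: "\<And>k. k \<in> K \<Longrightarrow> dmod n (M k)"
    and iso: "\<phi> \<in> Hom n (big_dsum K M) R" "\<psi> \<in> Hom n R (big_dsum K M)" "\<phi> \<circ>\<^sub>h \<psi> = hid R"
    and lift: "\<And>k h. k \<in> K \<Longrightarrow> h \<in> Hom n (M k) N \<Longrightarrow> \<exists>h'\<in>Hom n (M k) E. f \<circ>\<^sub>h h' = h"
    and X: "in_add n R X" and h: "h \<in> Hom n X N"
  shows "\<exists>h'\<in>Hom n X E. f \<circ>\<^sub>h h' = h"
proof -
  let ?B = "big_dsum K M"
  have B: "dmod n ?B" by (rule dmod_big_dsum[OF K]) (rule M)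
  have hinH: "hin K M k \<in> Hom n (M k) ?B" if "k \<in> K" for k by (rule Hom_hin[OF K _ that]) (rule M)
  have hprH: "hpr K M k \<in> Hom n ?B (M k)" if "k \<in> K" for k by (rule Hom_hpr[OF K _ that]) (rule M)
  have sumB: "(\<Sum>k\<in>K. hin K M k \<circ>\<^sub>h hpr K M k) = hid ?B" by (rule hin_hpr_big_sum[OF K]) (rule M)
  have liftR: "\<exists>r'\<in>Hom n R E. f \<circ>\<^sub>h r' = r" if r: "r \<in> Hom n R N" for r
  proof -
    have "\<exists>u\<in>Hom n (M k) E. f \<circ>\<^sub>h u = (r \<circ>\<^sub>h \<phi>) \<circ>\<^sub>h hin K M k" if "k \<in> K" for k
      by (rule lift[OF that Hom_hcomp[OF hinH[OF that] Hom_hcomp[OF iso(1) r]]])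
    then have "\<forall>k\<in>K. \<exists>u. u \<in> Hom n (M k) E \<and> f \<circ>\<^sub>h u = (r \<circ>\<^sub>h \<phi>) \<circ>\<^sub>h hin K M k" unfolding Bex_def by (intro ballI)
    from bchoice[OF this] obtain u where u: "\<forall>k\<in>K. u k \<in> Hom n (M k) E \<and> f \<circ>\<^sub>h u k = (r \<circ>\<^sub>h \<phi>) \<circ>\<^sub>h hin K M k" ..
    have uH: "u k \<circ>\<^sub>h hpr K M k \<in> Hom n ?B E" if "k \<in> K" for k
      using u that by (intro Hom_hcomp[OF hprH[OF that]]) simp_all
    \<comment> \<open>the lift assembled from the lifts on the summands\<close>
    define s where "s = (\<Sum>k\<in>K. u k \<circ>\<^sub>h hpr K M k)"
    have s: "s \<in> Hom n ?B E" unfolding s_def by (rule Hom_sum[OF E uH])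
    have "f \<circ>\<^sub>h s = (\<Sum>k\<in>K. f \<circ>\<^sub>h (u k \<circ>\<^sub>h hpr K M k))" unfolding s_def by (rule hcomp_sum_right[OF E f uH])
    also have "\<dots> = (\<Sum>k\<in>K. (r \<circ>\<^sub>h \<phi>) \<circ>\<^sub>h (hin K M k \<circ>\<^sub>h hpr K M k))"
      using u by (intro sum.cong refl) (simp add: hcomp_assoc[symmetric])
    also have "\<dots> = (r \<circ>\<^sub>h \<phi>) \<circ>\<^sub>h (\<Sum>k\<in>K. hin K M k \<circ>\<^sub>h hpr K M k)"
      by (rule hcomp_sum_right[OF B Hom_hcomp[OF iso(1) r], symmetric])
        (rule Hom_hcomp[OF hprH hinH], assumption+)
    also have "\<dots> = r \<circ>\<^sub>h \<phi>"
      unfolding sumB by (rule hcomp_hid_right[OF Hom_hcomp[OF iso(1) r]])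
    finally have fs: "f \<circ>\<^sub>h s = r \<circ>\<^sub>h \<phi>" .
    have "f \<circ>\<^sub>h (s \<circ>\<^sub>h \<psi>) = r \<circ>\<^sub>h (\<phi> \<circ>\<^sub>h \<psi>)" by (simp only: hcomp_assoc[symmetric] fs)
    then have "f \<circ>\<^sub>h (s \<circ>\<^sub>h \<psi>) = r" by (simp only: iso(3) hcomp_hid_right[OF r])
    then show ?thesis by (rule bexI[OF _ Hom_hcomp[OF iso(2) s]])
  qed
  obtain m :: nat and \<iota> p where ip: "\<forall>k. k < m \<longrightarrow> \<iota> k \<in> Hom n X R" "\<forall>k. k < m \<longrightarrow> p k \<in> Hom n R X"
    and id: "(\<Sum>k<m. p k \<circ>\<^sub>h \<iota> k) = hid X" using in_add_decomposition[OF R X] by (elim exE conjE)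
  have \<iota>: "\<iota> k \<in> Hom n X R" and p: "p k \<in> Hom n R X" if "k < m" for k using ip that by simp_all
  have dX: "dmod n X" using X unfolding in_add_def by (elim exE) (rule summand_dmod)
  have "\<exists>u\<in>Hom n R E. f \<circ>\<^sub>h u = h \<circ>\<^sub>h p k" if "k < m" for k
    by (rule liftR[OF Hom_hcomp[OF p[OF that] h]])
  then have "\<forall>k\<in>{..<m}. \<exists>u. u \<in> Hom n R E \<and> f \<circ>\<^sub>h u = h \<circ>\<^sub>h p k" unfolding Bex_def by (intro ballI) (simp only: lessThan_iff)
  from bchoice[OF this] obtain u where u: "\<forall>k\<in>{..<m}. u k \<in> Hom n R E \<and> f \<circ>\<^sub>h u k = h \<circ>\<^sub>h p k" ..
  have uH: "u k \<circ>\<^sub>h \<iota> k \<in> Hom n X E" if "k \<in> {..<m}" for k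
    using u that by (intro Hom_hcomp[OF \<iota>]) simp_all
  have "f \<circ>\<^sub>h (\<Sum>k<m. u k \<circ>\<^sub>h \<iota> k) = (\<Sum>k<m. f \<circ>\<^sub>h (u k \<circ>\<^sub>h \<iota> k))" by (rule hcomp_sum_right[OF E f uH])
  also have "\<dots> = (\<Sum>k<m. h \<circ>\<^sub>h (p k \<circ>\<^sub>h \<iota> k))"
    using u by (intro sum.cong refl) (simp add: hcomp_assoc[symmetric])
  also have "\<dots> = h \<circ>\<^sub>h (\<Sum>k<m. p k \<circ>\<^sub>h \<iota> k)"
    by (rule hcomp_sum_right[OF dX h, symmetric]) (rule Hom_hcomp[OF \<iota> p], simp_all)
  also have "\<dots> = h" unfolding id by (rule hcomp_hid_right[OF h])
  finally show ?thesis by (rule bexI[OF _ Hom_sum[OF E uH]])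
qed

lemma extend_to_add:
  assumes R: "dmod n R" and E: "dmod n E" and N: "dmod n N" and f: "f \<in> Hom n N E" and K: "finite K" and M: "\<And>k. k \<in> K \<Longrightarrow> dmod n (M k)"
    and iso: "\<phi> \<in> Hom n (big_dsum K M) R" "\<psi> \<in> Hom n R (big_dsum K M)" "\<phi> \<circ>\<^sub>h \<psi> = hid R"
    and extend: "\<And>k h. k \<in> K \<Longrightarrow> h \<in> Hom n N (M k) \<Longrightarrow> \<exists>h'\<in>Hom n E (M k). h' \<circ>\<^sub>h f = h"
    and X: "in_add n R X" and h: "h \<in> Hom n N X"
  shows "\<exists>h'\<in>Hom n E X. h' \<circ>\<^sub>h f = h"
proof -
  let ?B = "big_dsum K M"
  have B: "dmod n ?B" by (rule dmod_big_dsum[OF K]) (rule M)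
  have hinH: "hin K M k \<in> Hom n (M k) ?B" if "k \<in> K" for k by (rule Hom_hin[OF K _ that]) (rule M)
  have hprH: "hpr K M k \<in> Hom n ?B (M k)" if "k \<in> K" for k by (rule Hom_hpr[OF K _ that]) (rule M)
  have sumB: "(\<Sum>k\<in>K. hin K M k \<circ>\<^sub>h hpr K M k) = hid ?B" by (rule hin_hpr_big_sum[OF K]) (rule M)
  have extR: "\<exists>r'\<in>Hom n E R. r' \<circ>\<^sub>h f = r" if r: "r \<in> Hom n N R" for r
  proof -
    have "\<exists>u\<in>Hom n E (M k). u \<circ>\<^sub>h f = hpr K M k \<circ>\<^sub>h (\<psi> \<circ>\<^sub>h r)" if "k \<in> K" for k
      by (rule extend[OF that Hom_hcomp[OF Hom_hcomp[OF r iso(2)] hprH[OF that]]])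
    then have "\<forall>k\<in>K. \<exists>u. u \<in> Hom n E (M k) \<and> u \<circ>\<^sub>h f = hpr K M k \<circ>\<^sub>h (\<psi> \<circ>\<^sub>h r)" unfolding Bex_def by (intro ballI)
    from bchoice[OF this] obtain u where u: "\<forall>k\<in>K. u k \<in> Hom n E (M k) \<and> u k \<circ>\<^sub>h f = hpr K M k \<circ>\<^sub>h (\<psi> \<circ>\<^sub>h r)" ..
    have uH: "hin K M k \<circ>\<^sub>h u k \<in> Hom n E ?B" if "k \<in> K" for k
      using u that by (intro Hom_hcomp[OF _ hinH[OF that]]) simp_all
    define s where "s = (\<Sum>k\<in>K. hin K M k \<circ>\<^sub>h u k)"
    have s: "s \<in> Hom n E ?B" unfolding s_def by (rule Hom_sum[OF B uH])
    have "s \<circ>\<^sub>h f = (\<Sum>k\<in>K. (hin K M k \<circ>\<^sub>h hpr K M k) \<circ>\<^sub>h (\<psi> \<circ>\<^sub>h r))"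
      unfolding s_def hcomp_sum_left using u by (intro sum.cong refl) (simp add: hcomp_assoc)
    also have "\<dots> = \<psi> \<circ>\<^sub>h r"
      unfolding hcomp_sum_left[symmetric] sumB by (rule hcomp_hid_left[OF Hom_hcomp[OF r iso(2)]])
    finally have sf: "s \<circ>\<^sub>h f = \<psi> \<circ>\<^sub>h r" .
    have "(\<phi> \<circ>\<^sub>h s) \<circ>\<^sub>h f = (\<phi> \<circ>\<^sub>h \<psi>) \<circ>\<^sub>h r" by (simp only: hcomp_assoc sf)
    then have "(\<phi> \<circ>\<^sub>h s) \<circ>\<^sub>h f = r" by (simp only: iso(3) hcomp_hid_left[OF r])
    then show ?thesis by (rule bexI[OF _ Hom_hcomp[OF s iso(1)]])
  qed
  obtain m :: nat and \<iota> p where ip: "\<forall>k. k < m \<longrightarrow> \<iota> k \<in> Hom n X R" "\<forall>k. k < m \<longrightarrow> p k \<in> Hom n R X"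
    and id: "(\<Sum>k<m. p k \<circ>\<^sub>h \<iota> k) = hid X" using in_add_decomposition[OF R X] by (elim exE conjE)
  have \<iota>: "\<iota> k \<in> Hom n X R" and p: "p k \<in> Hom n R X" if "k < m" for k using ip that by simp_all
  have dX: "dmod n X" using X unfolding in_add_def by (elim exE) (rule summand_dmod)
  have "\<exists>u\<in>Hom n E R. u \<circ>\<^sub>h f = \<iota> k \<circ>\<^sub>h h" if "k < m" for k
    by (rule extR[OF Hom_hcomp[OF h \<iota>[OF that]]])
  then have "\<forall>k\<in>{..<m}. \<exists>u. u \<in> Hom n E R \<and> u \<circ>\<^sub>h f = \<iota> k \<circ>\<^sub>h h" unfolding Bex_def by (intro ballI) (simp only: lessThan_iff)
  from bchoice[OF this] obtain u where u: "\<forall>k\<in>{..<m}. u k \<in> Hom n E R \<and> u k \<circ>\<^sub>h f = \<iota> k \<circ>\<^sub>h h" ..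
  have uH: "p k \<circ>\<^sub>h u k \<in> Hom n E X" if "k \<in> {..<m}" for k
    using u that by (intro Hom_hcomp[OF _ p]) simp_all
  have "(\<Sum>k<m. p k \<circ>\<^sub>h u k) \<circ>\<^sub>h f = (\<Sum>k<m. (p k \<circ>\<^sub>h \<iota> k) \<circ>\<^sub>h h)"
    unfolding hcomp_sum_left using u by (intro sum.cong refl) (simp add: hcomp_assoc)
  also have "\<dots> = h" unfolding hcomp_sum_left[symmetric] id by (rule hcomp_hid_left[OF h])
  finally show ?thesis by (rule bexI[OF _ Hom_sum[OF dX uH]])
qed

lemma big_dsum_remove:
  fixes M :: "'k \<Rightarrow> 'v::complex_vector rep"
  assumes K: "finite K" and M: "\<And>k. k \<in> K \<Longrightarrow> dmod n (M k)" and k: "k \<in> K" and R: "dmod n R"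
    and iso: "\<phi> \<in> Hom n (big_dsum (K - {k}) M) R" "\<psi> \<in> Hom n R (big_dsum (K - {k}) M)"
      "\<psi> \<circ>\<^sub>h \<phi> = hid (big_dsum (K - {k}) M)" "\<phi> \<circ>\<^sub>h \<psi> = hid R"
  shows "isomorphic n (big_dsum K M) (M k \<oplus>\<^sub>r R)"
proof -
  let ?B = "big_dsum K M" and ?B' = "big_dsum (K - {k}) M"
  have B: "dmod n ?B" by (rule dmod_big_dsum[OF K]) (rule M)
  have hprH: "hpr K M k \<in> Hom n ?B (M k)" if "k \<in> K" for k by (rule Hom_hpr[OF K _ that]) (rule M)
  have B': "dmod n ?B'" by (rule dmod_big_dsum) (use K M in auto)
  note Mk = M[OF k]
  define \<rho> where "\<rho> = (\<lambda>i f. if f \<in> vsp ?B i then f(k := 0) else 0)"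
  have \<rho>in: "f(k := 0) \<in> vsp ?B' i" if "f \<in> vsp ?B i" for f i using that by (auto simp: big_dsum_simps)
  have \<rho>: "\<rho> \<in> Hom n ?B ?B'"
  proof (rule HomI)
    show "\<rho> i f \<in> vsp ?B' i" if "f \<in> vsp ?B i" for i f using \<rho>in[OF that] that by (simp add: \<rho>_def)
    show "\<rho> i (f + g) = \<rho> i f + \<rho> i g" if "f \<in> vsp ?B i" "g \<in> vsp ?B i" for i f g
      using that dmod_add[OF B that] by (simp add: \<rho>_def fun_eq_iff)
    show "\<rho> i (c *\<^sub>C f) = c *\<^sub>C \<rho> i f" if "f \<in> vsp ?B i" for i c f
      using that dmod_scale[OF B that] by (simp add: \<rho>_def fun_eq_iff scaleC_fun_def)
    show "\<rho> i f = 0" if "f \<notin> vsp ?B i" for i f using that by (simp add: \<rho>_def)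
    show "\<rho> i (bmap ?B i f) = bmap ?B' i (\<rho> (i - 1) f)" if "i \<in> {1..n-1}" "f \<in> vsp ?B (i - 1)" for i f
      using that dmod_bmap_in[OF B that] by (simp add: \<rho>_def fun_eq_iff big_dsum_simps(2))
    show "\<rho> (i - 1) (amap ?B i f) = amap ?B' i (\<rho> i f)" if "i \<in> {1..n-1}" "f \<in> vsp ?B i" for i f
      using that dmod_amap_in[OF B that] by (simp add: \<rho>_def fun_eq_iff big_dsum_simps(3))
  qed
  define \<theta> where "\<theta> = (hinl (M k) R \<circ>\<^sub>h hpr K M k) + (hinr (M k) R \<circ>\<^sub>h (\<phi> \<circ>\<^sub>h \<rho>))"
  note fr = Hom_hinl[OF Mk R] Hom_hinr[OF Mk R]
  have \<theta>: "\<theta> \<in> Hom n ?B (M k \<oplus>\<^sub>r R)"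
    unfolding \<theta>_def
    by (rule Hom_plus[OF dmod_dsum[OF Mk R] Hom_hcomp[OF hprH[OF k] fr(1)] Hom_hcomp[OF Hom_hcomp[OF \<rho> iso(1)] fr(2)]])
  have \<theta>a: "\<theta> i f = (f k, \<phi> i (f(k := 0)))" if f: "f \<in> vsp ?B i" for i f
  proof -
    have "f k \<in> vsp (M k) i" using f k by (simp add: big_dsum_simps)
    moreover have "\<phi> i (f(k := 0)) \<in> vsp R i" by (rule Hom_in[OF iso(1) \<rho>in[OF f]])
    ultimately show ?thesis using f by (simp add: \<theta>_def hcomp_apply hpr_def \<rho>_def hinl_def hinr_def)
  qed
  have \<psi>\<phi>: "\<psi> i (\<phi> i f) = f" if "f \<in> vsp ?B' i" for i f
    using fun_cong[OF fun_cong[OF iso(3)], of i f] hid_apply[OF that] by (simp add: hcomp_apply)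
  have \<phi>\<psi>: "\<phi> i (\<psi> i r) = r" if "r \<in> vsp R i" for i r
    using fun_cong[OF fun_cong[OF iso(4)], of i r] hid_apply[OF that] by (simp add: hcomp_apply)
  have "is_iso n ?B (M k \<oplus>\<^sub>r R) \<theta>"
  proof (rule is_isoI[OF B dmod_dsum[OF Mk R] \<theta>])
    fix i f assume f: "f \<in> vsp ?B i" "\<theta> i f = 0"
    have 0: "f k = 0" "\<phi> i (f(k := 0)) = 0" using f(2) unfolding \<theta>a[OF f(1)] by (simp_all add: zero_prod_def)
    have "f(k := 0) = 0" using \<psi>\<phi>[OF \<rho>in[OF f(1)]] 0(2) Hom_0[OF iso(2)] by simp
    moreover have "f = f(k := 0)" using 0(1) by auto
    ultimately show "f = 0" by simp
  next
    fix i y assume y: "y \<in> vsp (M k \<oplus>\<^sub>r R) i"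
    obtain x r where xr: "y = (x, r)" "x \<in> vsp (M k) i" "r \<in> vsp R i" using y by auto
    have g: "\<psi> i r \<in> vsp ?B' i" by (rule Hom_in[OF iso(2) xr(3)])
    have gk: "\<psi> i r k = 0" using g by (simp add: big_dsum_simps)
    define f where "f = (\<psi> i r)(k := x)"
    have f: "f \<in> vsp ?B i" using g xr(2) k by (auto simp: f_def big_dsum_simps)
    have "f(k := 0) = \<psi> i r" using gk by (auto simp: f_def)
    then have "\<theta> i f = y" unfolding \<theta>a[OF f] xr(1) by (simp add: \<phi>\<psi>[OF xr(3)] f_def)
    then show "\<exists>f\<in>vsp ?B i. \<theta> i f = y" using f by (rule bexI)
  qed
  then show ?thesis unfolding isomorphic_def by (rule exI[of _ \<theta>])
qed

text \<open>
  \<open>\<eta>\<close> is a functor with \<open>\<eta> M\<^sub>K = T\<^bsub>|K|\<^esub>\<close>, so it carries a factorisation of the identity through modules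
  \<open>M\<^sub>K\<close> to one through modules \<open>T\<^sub>j\<close>.
\<close>

lemma in_FJ_of_decomposition:
  fixes X :: "'v::complex_vector rep"
  assumes n: "n > 1" and J: "J \<subseteq> {1..n-1}" and X: "dmod n X" "a_injective n X" and A: "finite A"
    and K: "\<And>k. k \<in> A \<Longrightarrow> K k \<subseteq> {1..n} \<and> card (K k) \<in> J"
    and \<iota>: "\<And>k. k \<in> A \<Longrightarrow> \<iota> k \<in> Hom n X (MI n (K k))" and p: "\<And>k. k \<in> A \<Longrightarrow> p k \<in> Hom n (MI n (K k)) X"
    and id: "(\<Sum>k\<in>A. p k \<circ>\<^sub>h \<iota> k) = hid X"
  shows "in_FJ n J X"
proof -
  have finJ: "finite J" using J by (rule finite_subset) simp
  have T: "dmod n (TT n j)" if "j \<in> J" for j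
  proof -
    have "j \<in> {1..n-1}" using J that by (rule subsetD)
    then have "j \<le> n - 1" by simp
    then have "j \<le> n" by linarith
    then show ?thesis unfolding TT_def by (intro dmod_MI[OF n]) simp
  qed
  let ?R = "big_dsum J (TT n)"
  define \<iota>' where "\<iota>' = (\<lambda>k. hin J (TT n) (card (K k)) \<circ>\<^sub>h hrestrict (eta_sub n X) (\<iota> k))"
  define p' where "p' = (\<lambda>k. hrestrict (eta_sub n (MI n (K k))) (p k) \<circ>\<^sub>h hpr J (TT n) (card (K k)))"
  have H: "hrestrict (eta_sub n X) (\<iota> k) \<in> Hom n (eta n X) (TT n (card (K k)))"
    "hrestrict (eta_sub n (MI n (K k))) (p k) \<in> Hom n (TT n (card (K k))) (eta n X)" if k: "k \<in> A" for k
  proof -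
    have Kk: "K k \<subseteq> {1..n}" using K[OF k] by simp
    note e = eta_MI[OF n Kk] and M = dmod_MI[OF n Kk]
    show "hrestrict (eta_sub n X) (\<iota> k) \<in> Hom n (eta n X) (TT n (card (K k)))"
      using Hom_eta[OF n X(1) M \<iota>[OF k]] unfolding e .
    show "hrestrict (eta_sub n (MI n (K k))) (p k) \<in> Hom n (TT n (card (K k))) (eta n X)"
      using Hom_eta[OF n M X(1) p[OF k]] unfolding e .
  qed
  have cJ: "card (K k) \<in> J" if "k \<in> A" for k using K[OF that] by simp
  have dR: "dmod n ?R" by (rule dmod_big_dsum[OF finJ]) (rule T)
  have hinH: "hin J (TT n) j \<in> Hom n (TT n j) ?R" if "j \<in> J" for j by (rule Hom_hin[OF finJ _ that]) (rule T)
  have hprH: "hpr J (TT n) j \<in> Hom n ?R (TT n j)" if "j \<in> J" for j by (rule Hom_hpr[OF finJ _ that]) (rule T)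
  have hh: "hpr J (TT n) j \<circ>\<^sub>h hin J (TT n) j = hid (TT n j)" if "j \<in> J" for j by (rule hpr_hin[OF finJ _ that]) (rule T)
  have vE: "vsp (eta n X) i = eta_sub n X i" for i by (simp add: eta_def)
  have "in_add n ?R (eta n X)"
  proof (rule in_addI[OF dR dmod_eta[OF n X(1)] A, of \<iota>' p'])
    show \<iota>'H: "\<iota>' k \<in> Hom n (eta n X) ?R" if "k \<in> A" for k
      unfolding \<iota>'_def by (rule Hom_hcomp[OF H(1)[OF that] hinH[OF cJ[OF that]]])
    show p'H: "p' k \<in> Hom n ?R (eta n X)" if "k \<in> A" for k
      unfolding p'_def by (rule Hom_hcomp[OF hprH[OF cJ[OF that]] H(2)[OF that]])
    have c: "(p' k \<circ>\<^sub>h \<iota>' k) i x = p k i (\<iota> k i x)" if k: "k \<in> A" and x: "x \<in> vsp (eta n X) i" for k i x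
    proof -
      have Kk: "K k \<subseteq> {1..n}" using K[OF k] by simp
      have "p' k \<circ>\<^sub>h \<iota>' k = hrestrict (eta_sub n (MI n (K k))) (p k) \<circ>\<^sub>h
          ((hpr J (TT n) (card (K k)) \<circ>\<^sub>h hin J (TT n) (card (K k))) \<circ>\<^sub>h hrestrict (eta_sub n X) (\<iota> k))"
        by (simp only: p'_def \<iota>'_def hcomp_assoc)
      also have "\<dots> = hrestrict (eta_sub n (MI n (K k))) (p k) \<circ>\<^sub>h hrestrict (eta_sub n X) (\<iota> k)"
        unfolding hh[OF cJ[OF k]] hcomp_hid_left[OF H(1)[OF k]] ..
      finally have e: "p' k \<circ>\<^sub>h \<iota>' k = hrestrict (eta_sub n (MI n (K k))) (p k) \<circ>\<^sub>h hrestrict (eta_sub n X) (\<iota> k)" .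
      have "hrestrict (eta_sub n X) (\<iota> k) i x \<in> vsp (eta n (MI n (K k))) i"
        using Hom_in[OF H(1)[OF k] x] unfolding eta_MI[OF n Kk] .
      then have "\<iota> k i x \<in> eta_sub n (MI n (K k)) i" using x by (simp add: eta_def hrestrict_def)
      then show ?thesis unfolding e using x by (simp add: hcomp_apply hrestrict_def vE)
    qed
    show "(\<Sum>k\<in>A. p' k \<circ>\<^sub>h \<iota>' k) = hid (eta n X)"
    proof (rule Hom_eqI[OF Hom_sum[OF dmod_eta[OF n X(1)] Hom_hcomp[OF \<iota>'H p'H]] Hom_hid[OF dmod_eta[OF n X(1)]]])
      fix i x assume x: "x \<in> vsp (eta n X) i"
      have xX: "x \<in> vsp X i" using submoduleD(2)[OF X(1) submodule_eta[OF n X(1)]] x unfolding vE by (rule subsetD)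
      have "(\<Sum>k\<in>A. p' k \<circ>\<^sub>h \<iota>' k) i x = (\<Sum>k\<in>A. (p k \<circ>\<^sub>h \<iota> k) i x)"
        unfolding sum_hom_apply
      proof (rule sum.cong[OF refl])
        fix k assume k: "k \<in> A"
        show "(p' k \<circ>\<^sub>h \<iota>' k) i x = (p k \<circ>\<^sub>h \<iota> k) i x" using c[OF k x] by (simp only: hcomp_apply)
      qed
      also have "\<dots> = hid X i x"
        by (rule trans[OF sum_hom_apply[of "\<lambda>k. p k \<circ>\<^sub>h \<iota> k" A i x, symmetric]]) (simp only: id)
      finally show "(\<Sum>k\<in>A. p' k \<circ>\<^sub>h \<iota>' k) i x = hid (eta n X) i x"
        by (simp only: hid_apply[OF xX] hid_apply[OF x])
    qed
  qed
  then show ?thesis unfolding in_FJ_def using good_iff_a_injective[OF n X(1)] X(2) by simp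
qed

lemma in_FJ_MI:
  assumes n: "n > 1" and J: "J \<subseteq> {1..n-1}" and K: "K \<subseteq> {1..n}" "card K \<in> J"
  shows "in_FJ n J (MI n K)"
proof (rule in_FJ_of_decomposition[OF n J dmod_MI[OF n K(1)] a_injective_MI[OF n K(1)], of "{()}" "\<lambda>_. K"])
  show "hid (MI n K) \<in> Hom n (MI n K) (MI n K)" "hid (MI n K) \<in> Hom n (MI n K) (MI n K)"
    by (rule Hom_hid[OF dmod_MI[OF n K(1)]])+
  show "(\<Sum>k\<in>{()}. hid (MI n K) \<circ>\<^sub>h hid (MI n K)) = hid (MI n K)"
    using hcomp_hid_left[OF Hom_hid[OF dmod_MI[OF n K(1)]]] by simp
qed (use K in simp_all)

context exchange_square
begin

text \<open>
  The sequence of the square lies in the exact category and does not split.  Its middle term is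
  replaced by a copy in \<open>univ\<close>, over which projectivity quantifies.
\<close>

lemma not_projective:
  assumes J: "J \<subseteq> {1..n-1}" "m \<in> J"
  shows "\<not> projective_in_FJ n J (MI n C)"
proof
  assume P: "projective_in_FJ n J (MI n C)"
  obtain E' :: "univ rep" and \<phi> where E': "dmod n E'" "is_iso n E E' \<phi>" by (rule univ_copy[OF dE])
  obtain \<psi> where iso: "\<phi> \<in> Hom n E E'" "\<psi> \<in> Hom n E' E" "\<psi> \<circ>\<^sub>h \<phi> = hid E" "\<phi> \<circ>\<^sub>h \<psi> = hid E'"
    by (rule is_isoE[OF E'(2)])
  note iA = a_injective_MI[OF n A]
  have e: "E_ses n (MI n A) E' (MI n C) (\<phi> \<circ>\<^sub>h inc) (pro \<circ>\<^sub>h \<psi>)"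
    by (rule E_ses_middle_iso[OF n C ses_square iA good_middle loop_pow_middle E'(1) iso])
  have FE: "in_FJ n J E'"
  proof (rule in_FJ_of_decomposition[OF n J(1) E'(1) E_sesD(3)[OF n e], of "UNIV :: bool set" "\<lambda>b. if b then B1 else B2"
        "\<lambda>b. if b then pr1 \<circ>\<^sub>h \<psi> else pr2 \<circ>\<^sub>h \<psi>" "\<lambda>b. if b then \<phi> \<circ>\<^sub>h in1 else \<phi> \<circ>\<^sub>h in2"])
    show "(if b then B1 else B2) \<subseteq> {1..n} \<and> card (if b then B1 else B2) \<in> J" for b
      using B1 B2 cards J(2) by simp
    show "(if b then pr1 \<circ>\<^sub>h \<psi> else pr2 \<circ>\<^sub>h \<psi>) \<in> Hom n E' (MI n (if b then B1 else B2))" for b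
      using Hom_hcomp[OF iso(2) fr(1)] Hom_hcomp[OF iso(2) fr(2)] by simp
    show "(if b then \<phi> \<circ>\<^sub>h in1 else \<phi> \<circ>\<^sub>h in2) \<in> Hom n (MI n (if b then B1 else B2)) E'" for b
      using Hom_hcomp[OF fr(3) iso(1)] Hom_hcomp[OF fr(4) iso(1)] by simp
    have "((\<phi> \<circ>\<^sub>h in1) \<circ>\<^sub>h (pr1 \<circ>\<^sub>h \<psi>)) + ((\<phi> \<circ>\<^sub>h in2) \<circ>\<^sub>h (pr2 \<circ>\<^sub>h \<psi>)) =
      \<phi> \<circ>\<^sub>h (((in1 \<circ>\<^sub>h pr1) + (in2 \<circ>\<^sub>h pr2)) \<circ>\<^sub>h \<psi>)"
      unfolding hcomp_plus_left
        hcomp_plus_right[OF iso(1) Hom_hcomp[OF iso(2) Hom_hcomp[OF fr(1,3)]] Hom_hcomp[OF iso(2) Hom_hcomp[OF fr(2,4)]]]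
      by (simp only: hcomp_assoc)
    also have "\<dots> = hid E'" unfolding hin_hpr_sum[OF M(2,3)] hcomp_hid_left[OF iso(2)] by (rule iso(4))
    finally show "(\<Sum>b\<in>UNIV. (if b then \<phi> \<circ>\<^sub>h in1 else \<phi> \<circ>\<^sub>h in2) \<circ>\<^sub>h (if b then pr1 \<circ>\<^sub>h \<psi> else pr2 \<circ>\<^sub>h \<psi>)) = hid E'"
      by (simp add: UNIV_bool add.commute)
  qed simp
  have F: "in_FJ n J (MI n A)" "in_FJ n J (MI n C)"
    using in_FJ_MI[OF n J(1) A] in_FJ_MI[OF n J(1) C] cards J(2) by simp_all
  from P have "in_FJ n J (MI n A) \<and> in_FJ n J E' \<and> in_FJ n J (MI n C) \<and> E_ses n (MI n A) E' (MI n C) (\<phi> \<circ>\<^sub>h inc) (pro \<circ>\<^sub>h \<psi>) \<longrightarrow>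
        (\<forall>h \<in> Hom n (MI n C) (MI n C). \<exists>h' \<in> Hom n (MI n C) E'. (pro \<circ>\<^sub>h \<psi>) \<circ>\<^sub>h h' = h)"
    unfolding projective_in_FJ_def by (elim conjE allE)
  then have "\<forall>h \<in> Hom n (MI n C) (MI n C). \<exists>h' \<in> Hom n (MI n C) E'. (pro \<circ>\<^sub>h \<psi>) \<circ>\<^sub>h h' = h" using F FE e by simp
  from bspec[OF this Hom_hid[OF M(4)]] obtain s where s: "s \<in> Hom n (MI n C) E'" "(pro \<circ>\<^sub>h \<psi>) \<circ>\<^sub>h s = hid (MI n C)"
    by (rule bexE)
  show False using nonsplit[OF Hom_hcomp[OF s(1) iso(2)]] s(2) by (simp only: hcomp_assoc)
qed

lemma middle_in_add:
  assumes R: "dmod n R" and S: "finite S" "\<And>K. K \<in> S \<Longrightarrow> K \<subseteq> {1..n}" and B: "B1 \<in> S" "B2 \<in> S"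
    and iso: "\<phi> \<in> Hom n (big_dsum S (MI n)) R" "\<psi> \<in> Hom n R (big_dsum S (MI n))" "\<psi> \<circ>\<^sub>h \<phi> = hid (big_dsum S (MI n))"
  shows "in_add n R E"
proof -
  have MS: "dmod n (MI n K)" if "K \<in> S" for K by (rule dmod_MI[OF n S(2)[OF that]])
  have hinH: "hin S (MI n) K \<in> Hom n (MI n K) (big_dsum S (MI n))" if "K \<in> S" for K
    by (rule Hom_hin[OF S(1) _ that]) (rule MS)
  have hprH: "hpr S (MI n) K \<in> Hom n (big_dsum S (MI n)) (MI n K)" if "K \<in> S" for K
    by (rule Hom_hpr[OF S(1) _ that]) (rule MS)
  have hh: "hpr S (MI n) K \<circ>\<^sub>h hin S (MI n) K = hid (MI n K)" if "K \<in> S" for K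
    by (rule hpr_hin[OF S(1) _ that]) (rule MS)
  let ?u = "\<lambda>K. \<phi> \<circ>\<^sub>h hin S (MI n) K" and ?v = "\<lambda>K. hpr S (MI n) K \<circ>\<^sub>h \<psi>"
  have u: "?u K \<in> Hom n (MI n K) R" and v: "?v K \<in> Hom n R (MI n K)" if "K \<in> S" for K
    by (rule Hom_hcomp[OF hinH[OF that] iso(1)]) (rule Hom_hcomp[OF iso(2) hprH[OF that]])
  have vu: "?v K \<circ>\<^sub>h ?u K = hid (MI n K)" if K: "K \<in> S" for K
  proof -
    have "?v K \<circ>\<^sub>h ?u K = hpr S (MI n) K \<circ>\<^sub>h ((\<psi> \<circ>\<^sub>h \<phi>) \<circ>\<^sub>h hin S (MI n) K)" by (simp only: hcomp_assoc)
    also have "\<dots> = hpr S (MI n) K \<circ>\<^sub>h hin S (MI n) K"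
      unfolding iso(3) hcomp_hid_left[OF hinH[OF K]] ..
    also have "\<dots> = hid (MI n K)" by (rule hh[OF K])
    finally show ?thesis .
  qed
  show ?thesis
  proof (rule in_addI[OF R dE, of "UNIV :: bool set" "\<lambda>b. if b then ?u B1 \<circ>\<^sub>h pr1 else ?u B2 \<circ>\<^sub>h pr2"
        "\<lambda>b. if b then in1 \<circ>\<^sub>h ?v B1 else in2 \<circ>\<^sub>h ?v B2"])
    show "(if b then ?u B1 \<circ>\<^sub>h pr1 else ?u B2 \<circ>\<^sub>h pr2) \<in> Hom n E R" for b
      using Hom_hcomp[OF fr(1) u[OF B(1)]] Hom_hcomp[OF fr(2) u[OF B(2)]] by simp
    show "(if b then in1 \<circ>\<^sub>h ?v B1 else in2 \<circ>\<^sub>h ?v B2) \<in> Hom n R E" for b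
      using Hom_hcomp[OF v[OF B(1)] fr(3)] Hom_hcomp[OF v[OF B(2)] fr(4)] by simp
    have "(in1 \<circ>\<^sub>h ?v B1) \<circ>\<^sub>h (?u B1 \<circ>\<^sub>h pr1) = in1 \<circ>\<^sub>h ((?v B1 \<circ>\<^sub>h ?u B1) \<circ>\<^sub>h pr1)" by (simp only: hcomp_assoc)
    then have 1: "(in1 \<circ>\<^sub>h ?v B1) \<circ>\<^sub>h (?u B1 \<circ>\<^sub>h pr1) = in1 \<circ>\<^sub>h pr1" unfolding vu[OF B(1)] hcomp_hid_left[OF fr(1)] .
    have "(in2 \<circ>\<^sub>h ?v B2) \<circ>\<^sub>h (?u B2 \<circ>\<^sub>h pr2) = in2 \<circ>\<^sub>h ((?v B2 \<circ>\<^sub>h ?u B2) \<circ>\<^sub>h pr2)" by (simp only: hcomp_assoc)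
    then have 2: "(in2 \<circ>\<^sub>h ?v B2) \<circ>\<^sub>h (?u B2 \<circ>\<^sub>h pr2) = in2 \<circ>\<^sub>h pr2" unfolding vu[OF B(2)] hcomp_hid_left[OF fr(2)] .
    have "(\<Sum>b\<in>UNIV. (if b then in1 \<circ>\<^sub>h ?v B1 else in2 \<circ>\<^sub>h ?v B2) \<circ>\<^sub>h (if b then ?u B1 \<circ>\<^sub>h pr1 else ?u B2 \<circ>\<^sub>h pr2)) =
      ((in1 \<circ>\<^sub>h ?v B1) \<circ>\<^sub>h (?u B1 \<circ>\<^sub>h pr1)) + ((in2 \<circ>\<^sub>h ?v B2) \<circ>\<^sub>h (?u B2 \<circ>\<^sub>h pr2))"
      by (simp add: UNIV_bool add.commute)
    also have "\<dots> = hid E" unfolding 1 2 by (rule hin_hpr_sum[OF M(2,3)])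
    finally show "(\<Sum>b\<in>UNIV. (if b then in1 \<circ>\<^sub>h ?v B1 else in2 \<circ>\<^sub>h ?v B2) \<circ>\<^sub>h (if b then ?u B1 \<circ>\<^sub>h pr1 else ?u B2 \<circ>\<^sub>h pr2)) = hid E" .
  qed simp
qed

end

lemma mutation_of_exchange_squares:
  assumes sq: "exchange_square n m A B1 B2 C \<alpha>1 \<alpha>2" and sq': "exchange_square n m C D1 D2 A \<beta>1 \<beta>2"
    and J: "J \<subseteq> {1..n-1}" and S: "\<And>K. K \<in> S \<Longrightarrow> K \<subseteq> {1..n} \<and> card K \<in> J"
    and mem: "C \<in> S" "B1 \<in> S" "B2 \<in> S" "D1 \<in> S" "D2 \<in> S"
    and right: "\<And>K i. K \<in> S - {C} \<Longrightarrow> hle i K C \<Longrightarrow>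
        \<alpha>2 \<le> i \<and> hle (i - \<alpha>2) K B1 \<or> \<alpha>1 \<le> i \<and> hle (i - \<alpha>1) K B2"
    and left: "\<And>K i. K \<in> S - {C} \<Longrightarrow> hle i C K \<Longrightarrow>
        \<beta>1 \<le> i \<and> hle (i - \<beta>1) D1 K \<or> \<beta>2 \<le> i \<and> hle (i - \<beta>2) D2 K"
  shows "mutation_sequences n J (TS n S) (MI n C) (MI n A)
    (MI n B1 \<oplus>\<^sub>r MI n B2) (exchange_square.inc n A B1 B2 \<alpha>1 \<alpha>2) (exchange_square.pro n B1 B2 \<alpha>1 \<alpha>2)
    (MI n D1 \<oplus>\<^sub>r MI n D2) (exchange_square.inc n C D1 D2 \<beta>1 \<beta>2) (exchange_square.pro n D1 D2 \<beta>1 \<beta>2)"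
proof -
  interpret q: exchange_square n m A B1 B2 C \<alpha>1 \<alpha>2 by (rule sq)
  interpret q': exchange_square n m C D1 D2 A \<beta>1 \<beta>2 by (rule sq')
  note n = q.n
  have sub: "K \<subseteq> {1..n}" if "K \<in> S" for K using S[OF that] by simp
  have "S \<subseteq> Pow {1..n}" using sub by auto
  then have fin: "finite S" "finite (S - {C})" using finite_subset[of S "Pow {1..n}"] by simp_all
  have mJ: "m \<in> J" using S[OF mem(1)] q.cards by simp
  have MS: "dmod n (MI n K)" if "K \<in> S" for K by (rule dmod_MI[OF n sub[OF that]])
  let ?S = "S - {C}"
  have MS': "dmod n (MI n K)" if "K \<in> ?S" for K using MS that by simp
  have dBS: "dmod n (big_dsum ?S (MI n))" by (rule dmod_big_dsum[OF fin(2)]) (rule MS')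
  obtain R :: "univ rep" and \<phi> where R: "dmod n R" "is_iso n (big_dsum ?S (MI n)) R \<phi>"
    by (rule univ_copy[OF dBS])
  obtain \<psi> where iso: "\<phi> \<in> Hom n (big_dsum ?S (MI n)) R" "\<psi> \<in> Hom n R (big_dsum ?S (MI n))"
    "\<psi> \<circ>\<^sub>h \<phi> = hid (big_dsum ?S (MI n))" "\<phi> \<circ>\<^sub>h \<psi> = hid R" by (rule is_isoE[OF R(2)])
  have memB: "B1 \<in> ?S" "B2 \<in> ?S" using mem q.ne by simp_all
  have memD: "D1 \<in> ?S" "D2 \<in> ?S" using mem q'.ne by simp_all
  have sub': "K \<subseteq> {1..n}" if "K \<in> ?S" for K using sub that by simp
  have iTS: "isomorphic n (TS n S) (MI n C \<oplus>\<^sub>r R)"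
    unfolding TS_def by (rule big_dsum_remove[OF fin(1) MS mem(1) R(1) iso])
  have "minimal_right_approx n R q.E (MI n C) q.pro"
    unfolding minimal_right_approx_def
  proof (intro conjI allI impI ballI)
    show "in_add n R q.E" by (rule q.middle_in_add[OF R(1) fin(2) sub' memB iso(1-3)])
    show "q.pro \<in> Hom n q.E (MI n C)" by (rule q.Hom_pro)
    show "is_iso n q.E q.E \<chi>" if "\<chi> \<in> Hom n q.E q.E" "q.pro \<circ>\<^sub>h \<chi> = q.pro" for \<chi> by (rule q.right_minimal[OF that])
    fix X :: "univ rep" and h assume X: "in_add n R X" "h \<in> Hom n X (MI n C)"
    show "\<exists>h'\<in>Hom n X q.E. q.pro \<circ>\<^sub>h h' = h"
    proof (rule lift_from_add[OF R(1) q.dE q.M(4) q.Hom_pro fin(2) MS' iso(1,2,4) _ X])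
      fix K k assume K: "K \<in> ?S" "k \<in> Hom n (MI n K) (MI n C)"
      show "\<exists>h'\<in>Hom n (MI n K) q.E. q.pro \<circ>\<^sub>h h' = k" by (rule q.lift_to_middle[OF sub'[OF K(1)] K(2) right[OF K(1)]])
    qed
  qed
  moreover have "minimal_left_approx n R (MI n C) q'.E q'.inc"
    unfolding minimal_left_approx_def
  proof (intro conjI allI impI ballI)
    show "in_add n R q'.E" by (rule q'.middle_in_add[OF R(1) fin(2) sub' memD iso(1-3)])
    show "q'.inc \<in> Hom n (MI n C) q'.E" by (rule q'.Hom_inc)
    show "is_iso n q'.E q'.E \<chi>" if "\<chi> \<in> Hom n q'.E q'.E" "\<chi> \<circ>\<^sub>h q'.inc = q'.inc" for \<chi> by (rule q'.left_minimal[OF that])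
    fix X :: "univ rep" and h assume X: "in_add n R X" "h \<in> Hom n (MI n C) X"
    show "\<exists>h'\<in>Hom n q'.E X. h' \<circ>\<^sub>h q'.inc = h"
    proof (rule extend_to_add[OF R(1) q'.dE q'.M(1) q'.Hom_inc fin(2) MS' iso(1,2,4) _ X])
      fix K k assume K: "K \<in> ?S" "k \<in> Hom n (MI n C) (MI n K)"
      show "\<exists>h'\<in>Hom n q'.E (MI n K). h' \<circ>\<^sub>h q'.inc = k" by (rule q'.extend_from_middle[OF sub'[OF K(1)] K(2) left[OF K(1)]])
    qed
  qed
  ultimately show ?thesis
    unfolding mutation_sequences_def
    using indecomposable_MI[OF n q.C q.nonempty(4)] indecomposable_MI[OF n q.A q.nonempty(1)] q.not_projective[OF J mJ]
      in_FJ_MI[OF n J q.A] q.cards mJ q.E_ses_square q'.E_ses_square R(1) iTS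
    by (intro conjI exI[of _ R]) simp_all
qed

theorem proposition12p2:
  fixes n a b c d :: nat and L :: "nat set"
  assumes "n > 1"
    and "L \<subseteq> {1..n}" and "{a, b, c, d} \<subseteq> {1..n}" and "L \<inter> {a, b, c, d} = {}"
    and "distinct [a, b, c, d]" and "cyclically_ordered a b c d"
  shows "vectorspace.dim class_ring (ext1 n (MI n (L \<union> {a, c})) (MI n (L \<union> {b, d}))) = 1 \<and>
    (\<exists>f g f' g'.
      ses n (MI n (L \<union> {a, c})) (MI n (L \<union> {a, d}) \<oplus>\<^sub>r MI n (L \<union> {b, c})) (MI n (L \<union> {b, d})) f g \<and>
      ses n (MI n (L \<union> {b, d})) (MI n (L \<union> {a, b}) \<oplus>\<^sub>r MI n (L \<union> {c, d})) (MI n (L \<union> {a, c})) f' g' \<and>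
      (\<forall>J S.
        J \<subseteq> {1..n-1} \<and> (\<exists>p q. J = {p..q}) \<and>
        maximal_ws_collection n J S \<and> cluster_tilting n J (TS n S) \<and>
        summand n (MI n (L \<union> {a, b})) (TS n S) \<and> summand n (MI n (L \<union> {b, c})) (TS n S) \<and>
        summand n (MI n (L \<union> {c, d})) (TS n S) \<and> summand n (MI n (L \<union> {a, d})) (TS n S) \<longrightarrow>
        (summand n (MI n (L \<union> {b, d})) (TS n S) \<longrightarrow>
           mutation_sequences n J (TS n S) (MI n (L \<union> {b, d})) (MI n (L \<union> {a, c}))
             (MI n (L \<union> {a, d}) \<oplus>\<^sub>r MI n (L \<union> {b, c})) f g
             (MI n (L \<union> {a, b}) \<oplus>\<^sub>r MI n (L \<union> {c, d})) f' g') \<and>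
        (summand n (MI n (L \<union> {a, c})) (TS n S) \<longrightarrow>
           mutation_sequences n J (TS n S) (MI n (L \<union> {a, c})) (MI n (L \<union> {b, d}))
             (MI n (L \<union> {a, b}) \<oplus>\<^sub>r MI n (L \<union> {c, d})) f' g'
             (MI n (L \<union> {a, d}) \<oplus>\<^sub>r MI n (L \<union> {b, c})) f g)))"
proof -
  note n = assms(1) and L = assms(2-4) and dist = assms(5) and cyc = assms(6)
  have L': "{b, c, d, a} \<subseteq> {1..n}" "L \<inter> {b, c, d, a} = {}" and dist': "distinct [b, c, d, a]"
    using L dist by auto
  have cyc': "cyclically_ordered b c d a"
    using cyc unfolding cyclically_ordered_def by (elim disjE) simp_all
  have comm: "L \<union> {b, a} = L \<union> {a, b}" "L \<union> {c, a} = L \<union> {a, c}" "L \<union> {d, a} = L \<union> {a, d}"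
    "L \<union> {d, c} = L \<union> {c, d}" by auto
  have nin: "a \<notin> L" "b \<notin> L" "c \<notin> L" "d \<notin> L" using L(3) by auto
  have neq: "a \<noteq> b" "a \<noteq> c" "a \<noteq> d" "b \<noteq> c" "b \<noteq> d" "c \<noteq> d" using dist by auto
  have sub: "L \<union> {a, b} \<subseteq> {1..n}" "L \<union> {b, c} \<subseteq> {1..n}" "L \<union> {c, d} \<subseteq> {1..n}" "L \<union> {a, d} \<subseteq> {1..n}"
    "L \<union> {b, d} \<subseteq> {1..n}" "L \<union> {a, c} \<subseteq> {1..n}" using L by simp_all
  note sq = exchange_square_cyclic[OF n L dist cyc]
  \<comment> \<open>the second sequence is the first one for the rotated quadruple \<open>b, c, d, a\<close>\<close>
  note sq' = exchange_square_cyclic[OF n L(1) L' dist' cyc', unfolded comm]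
  interpret q: exchange_square n "card L + 2" "L \<union> {a, c}" "L \<union> {a, d}" "L \<union> {b, c}" "L \<union> {b, d}"
    "of_bool (d < c)" "of_bool (b < a)" by (rule sq)
  interpret q': exchange_square n "card L + 2" "L \<union> {b, d}" "L \<union> {a, b}" "L \<union> {c, d}" "L \<union> {a, c}"
    "of_bool (a < d)" "of_bool (c < b)" by (rule sq')
  have "(L \<union> {a, b}) - (L \<union> {b, d}) = {a}" "(L \<union> {b, d}) - (L \<union> {a, b}) = {d}"
    "(L \<union> {c, d}) - (L \<union> {b, d}) = {c}" "(L \<union> {b, d}) - (L \<union> {c, d}) = {b}"
    using nin neq by blast+
  then have dim: "vectorspace.dim class_ring (ext1 n (MI n (L \<union> {a, c})) (MI n (L \<union> {b, d}))) = 1"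
    by (rule q'.ext1_dim)
  have mut: "(summand n (MI n (L \<union> {b, d})) (TS n S) \<longrightarrow>
           mutation_sequences n J (TS n S) (MI n (L \<union> {b, d})) (MI n (L \<union> {a, c})) q.E q.inc q.pro q'.E q'.inc q'.pro) \<and>
        (summand n (MI n (L \<union> {a, c})) (TS n S) \<longrightarrow>
           mutation_sequences n J (TS n S) (MI n (L \<union> {a, c})) (MI n (L \<union> {b, d})) q'.E q'.inc q'.pro q.E q.inc q.pro)"
    if J: "J \<subseteq> {1..n-1}" and max: "maximal_ws_collection n J S"
      and s: "summand n (MI n (L \<union> {a, b})) (TS n S)" "summand n (MI n (L \<union> {b, c})) (TS n S)"
        "summand n (MI n (L \<union> {c, d})) (TS n S)" "summand n (MI n (L \<union> {a, d})) (TS n S)" for J S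
  proof -
    have S: "K \<subseteq> {1..n} \<and> card K \<in> J" if "K \<in> S" for K
      using max that unfolding maximal_ws_collection_def ws_collection_def by simp
    have ws: "weakly_separated I K" if "I \<in> S" "K \<in> S" for I K
      using max that unfolding maximal_ws_collection_def ws_collection_def by simp
    have mem: "I \<in> S" if "summand n (MI n I) (TS n S)" "I \<subseteq> {1..n}" "I \<noteq> {}" for I
      by (rule summand_MI_imp_mem[OF n that(2,3) conjunct1[OF S] that(1)])
    have m: "L \<union> {a, b} \<in> S" "L \<union> {b, c} \<in> S" "L \<union> {c, d} \<in> S" "L \<union> {a, d} \<in> S"
      using mem[OF s(1) sub(1)] mem[OF s(2) sub(2)] mem[OF s(3) sub(3)] mem[OF s(4) sub(4)] by simp_all
    show ?thesis
    proof (intro conjI impI)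
      assume "summand n (MI n (L \<union> {b, d})) (TS n S)"
      then have m': "L \<union> {b, d} \<in> S" using mem[OF _ sub(5)] by simp
      show "mutation_sequences n J (TS n S) (MI n (L \<union> {b, d})) (MI n (L \<union> {a, c})) q.E q.inc q.pro q'.E q'.inc q'.pro"
      proof (rule mutation_of_exchange_squares[OF sq sq' J S m' m(4,2,1,3)])
        fix K i assume K: "K \<in> S - {L \<union> {b, d}}"
        then have K': "K \<subseteq> {1..n}" "K \<noteq> L \<union> {b, d}" "K \<in> S" using S by simp_all
        show "of_bool (b < a) \<le> i \<and> hle (i - of_bool (b < a)) K (L \<union> {a, d}) \<or>
            of_bool (d < c) \<le> i \<and> hle (i - of_bool (d < c)) K (L \<union> {b, c})" if "hle i K (L \<union> {b, d})"
          by (rule Hom_to_target_splits[OF L dist cyc K'(1,2) ws[OF m' K'(3)] ws[OF m(1) K'(3)] ws[OF m(3) K'(3)] that])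
        show "of_bool (a < d) \<le> i \<and> hle (i - of_bool (a < d)) (L \<union> {a, b}) K \<or>
            of_bool (c < b) \<le> i \<and> hle (i - of_bool (c < b)) (L \<union> {c, d}) K" if "hle i (L \<union> {b, d}) K"
          by (rule Hom_from_source_splits[of L n b c d a K i, unfolded comm,
                OF L(1) L' dist' cyc' K'(1,2) ws[OF m' K'(3)] ws[OF m(2) K'(3)] ws[OF m(4) K'(3)] that])
      qed
    next
      assume "summand n (MI n (L \<union> {a, c})) (TS n S)"
      then have m': "L \<union> {a, c} \<in> S" using mem[OF _ sub(6)] by simp
      show "mutation_sequences n J (TS n S) (MI n (L \<union> {a, c})) (MI n (L \<union> {b, d})) q'.E q'.inc q'.pro q.E q.inc q.pro"
      proof (rule mutation_of_exchange_squares[OF sq' sq J S m' m(1,3,4,2)])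
        fix K i assume K: "K \<in> S - {L \<union> {a, c}}"
        then have K': "K \<subseteq> {1..n}" "K \<noteq> L \<union> {a, c}" "K \<in> S" using S by simp_all
        show "of_bool (c < b) \<le> i \<and> hle (i - of_bool (c < b)) K (L \<union> {a, b}) \<or>
            of_bool (a < d) \<le> i \<and> hle (i - of_bool (a < d)) K (L \<union> {c, d})" if "hle i K (L \<union> {a, c})"
          by (rule Hom_to_target_splits[of L n b c d a K i, unfolded comm,
                OF L(1) L' dist' cyc' K'(1,2) ws[OF m' K'(3)] ws[OF m(2) K'(3)] ws[OF m(4) K'(3)] that])
        show "of_bool (d < c) \<le> i \<and> hle (i - of_bool (d < c)) (L \<union> {a, d}) K \<or>
            of_bool (b < a) \<le> i \<and> hle (i - of_bool (b < a)) (L \<union> {b, c}) K" if "hle i (L \<union> {a, c}) K"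
          by (rule Hom_from_source_splits[OF L dist cyc K'(1,2) ws[OF m' K'(3)] ws[OF m(1) K'(3)] ws[OF m(3) K'(3)] that])
      qed
    qed
  qed
  show ?thesis
  proof (rule conjI[OF dim], rule exI[of _ q.inc], rule exI[of _ q.pro], rule exI[of _ q'.inc], rule exI[of _ q'.pro],
      intro conjI allI impI)
    show "ses n (MI n (L \<union> {a, c})) q.E (MI n (L \<union> {b, d})) q.inc q.pro" by (rule q.ses_square)
    show "ses n (MI n (L \<union> {b, d})) q'.E (MI n (L \<union> {a, c})) q'.inc q'.pro" by (rule q'.ses_square)
  qed (elim conjE, rule mut[THEN conjunct1, THEN mp], assumption+, elim conjE, rule mut[THEN conjunct2, THEN mp], assumption+)
qed

end
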